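(* Let $G$ be a second countable compact group and let $B$ be a unital nuclear C$^*$-algebra with a $G$-action $\beta$. Then for any finite subset $F\subset B$ and any $\varepsilon>0$, there exist $n\in\mathbb{N}$, unital completely positive maps $\varphi:B\to\mathbb{M}_n(\mathbb{C})$ and $\varphi':\mathbb{M}_n(\mathbb{C})\to B$, and a unitary representation $u$ of $G$ in $\mathbb{M}_n(\mathbb{C})$ such that for all $g\in G$, $$\varphi\circ\beta_g=\mathrm{Ad}\,u(g)\circ\varphi,\qquad \varphi'\circ\mathrm{Ad}\,u(g)=\beta_g\circ\varphi',$$ and $\|\varphi'\circ\varphi(x)-x\|<\varepsilon$ for all $x\in F$.
   Context: A $G$-action on a C$^*$-algebra $B$ is a homomorphism $\beta:G\to\mathrm{Aut}(B)$ continuous in the point-norm topology. $\mathrm{Ad}\,u(x)=uxu^*$. Unitary representations are continuous. *)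

theory Defs
  imports "HOL-Analysis.Analysis" "Jordan_Normal_Form.Matrix"
begin

text \<open>
  Unital C*-algebras. The superclass \<^class>\<open>real_normed_algebra_1\<close> contains
  \<open>norm 1 = 1\<close>, so the zero algebra is excluded; for a nonzero unital
  C*-algebra this equation is a consequence of the C*-identity.
\<close>

class unital_cstar_algebra = real_normed_algebra_1 + banach +
  fixes scaleC :: "complex \<Rightarrow> 'a \<Rightarrow> 'a"
    and star :: "'a \<Rightarrow> 'a"
  assumes scaleC_of_real: "scaleC (complex_of_real r) x = scaleR r x"
    and scaleC_add_right: "scaleC a (x + y) = scaleC a x + scaleC a y"
    and scaleC_add_left: "scaleC (a + b) x = scaleC a x + scaleC b x"
    and scaleC_scaleC: "scaleC a (scaleC b x) = scaleC (a * b) x"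
    and scaleC_mult_left: "scaleC a x * y = scaleC a (x * y)"
    and scaleC_mult_right: "x * scaleC a y = scaleC a (x * y)"
    and norm_scaleC: "norm (scaleC a x) = cmod a * norm x"
    and star_star: "star (star x) = x"
    and star_add: "star (x + y) = star x + star y"
    and star_scaleC: "star (scaleC a x) = scaleC (cnj a) (star x)"
    and star_mult: "star (x * y) = star y * star x"
    and cstar_identity: "norm (star x * x) = (norm x)\<^sup>2"

instantiation complex :: unital_cstar_algebra
begin

definition scaleC_complex :: "complex \<Rightarrow> complex \<Rightarrow> complex" where
  "scaleC_complex a x = a * x"

definition star_complex :: "complex \<Rightarrow> complex" where
  "star_complex x = cnj x"

instance
  by standard
    (simp_all add: scaleC_complex_def star_complex_def scaleR_conv_of_real algebra_simps
      norm_mult power2_eq_square)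

end

definition star_automorphism :: "('b::unital_cstar_algebra \<Rightarrow> 'b) \<Rightarrow> bool" where
  "star_automorphism f \<longleftrightarrow>
     bij f \<and>
     (\<forall>x y. f (x + y) = f x + f y) \<and>
     (\<forall>a x. f (scaleC a x) = scaleC a (f x)) \<and>
     (\<forall>x y. f (x * y) = f x * f y) \<and>
     (\<forall>x. f (star x) = star (f x))"

text \<open>
  Groups are written additively, as in the class \<^class>\<open>topological_group_add\<close>;
  they are not assumed to be commutative.
\<close>

definition cstar_action ::
    "('g::topological_group_add \<Rightarrow> 'b \<Rightarrow> 'b::unital_cstar_algebra) \<Rightarrow> bool" where
  "cstar_action \<beta> \<longleftrightarrow>
     (\<forall>g. star_automorphism (\<beta> g)) \<and>
     (\<forall>g h. \<beta> (g + h) = \<beta> g \<circ> \<beta> h) \<and>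
     (\<forall>x. continuous_on UNIV (\<lambda>g. \<beta> g x))"

definition mat_star :: "'b::unital_cstar_algebra mat \<Rightarrow> 'b mat" where
  "mat_star A = mat (dim_col A) (dim_row A) (\<lambda>(i, j). star (A $$ (j, i)))"

text \<open>Positivity in the C*-algebra of \<open>k \<times> k\<close> matrices over \<open>'b\<close>: elements of the form \<open>Y* Y\<close>.\<close>

definition mat_positive :: "nat \<Rightarrow> 'b::unital_cstar_algebra mat \<Rightarrow> bool" where
  "mat_positive k X \<longleftrightarrow> (\<exists>Y \<in> carrier_mat k k. X = mat_star Y * Y)"

definition vec_l2_norm :: "complex Matrix.vec \<Rightarrow> real" where
  "vec_l2_norm v = L2_set (\<lambda>i. cmod (vec_index v i)) {..<dim_vec v}"

text \<open>The C*-norm of a complex matrix, as an operator on Euclidean space.\<close>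

definition mat_op_norm :: "complex mat \<Rightarrow> real" where
  "mat_op_norm A =
     Sup {vec_l2_norm (mult_mat_vec A v) | v. v \<in> carrier_vec (dim_col A) \<and> vec_l2_norm v \<le> 1}"

text \<open>
  The algebra \<open>M\<^sub>n(\<complex>)\<close> is \<^term>\<open>carrier_mat n n :: complex mat set\<close>.
  \<open>M\<^sub>k(M\<^sub>n(\<complex>))\<close> is identified with the \<open>kn \<times> kn\<close> complex matrices: entry \<open>(r, s)\<close> of the
  block with index \<open>(i, j)\<close> is the entry with index \<open>(i n + r, j n + s)\<close>. The two functions
  below are the maps obtained by applying \<open>\<phi> : B \<rightarrow> M\<^sub>n(\<complex>)\<close>, respectively
  \<open>\<psi> : M\<^sub>n(\<complex>) \<rightarrow> B\<close>, to the entries of a \<open>k \<times> k\<close> matrix.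
\<close>

definition amplify_to_mat :: "nat \<Rightarrow> nat \<Rightarrow> ('b \<Rightarrow> complex mat) \<Rightarrow> 'b mat \<Rightarrow> complex mat" where
  "amplify_to_mat n k \<phi> X =
     mat (k * n) (k * n) (\<lambda>(i, j). \<phi> (X $$ (i div n, j div n)) $$ (i mod n, j mod n))"

definition amplify_from_mat :: "nat \<Rightarrow> nat \<Rightarrow> (complex mat \<Rightarrow> 'b) \<Rightarrow> complex mat \<Rightarrow> 'b mat" where
  "amplify_from_mat n k \<psi> X =
     mat k k (\<lambda>(i, j). \<psi> (mat n n (\<lambda>(r, s). X $$ (i * n + r, j * n + s))))"

definition cp_to_mat :: "nat \<Rightarrow> ('b::unital_cstar_algebra \<Rightarrow> complex mat) \<Rightarrow> bool" where
  "cp_to_mat n \<phi> \<longleftrightarrow>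
     (\<forall>x. \<phi> x \<in> carrier_mat n n) \<and>
     (\<forall>x y. \<phi> (x + y) = \<phi> x + \<phi> y) \<and>
     (\<forall>a x. \<phi> (scaleC a x) = smult_mat a (\<phi> x)) \<and>
     (\<forall>k. \<forall>X \<in> carrier_mat k k.
        mat_positive k X \<longrightarrow> mat_positive (k * n) (amplify_to_mat n k \<phi> X))"

definition cp_from_mat :: "nat \<Rightarrow> (complex mat \<Rightarrow> 'b::unital_cstar_algebra) \<Rightarrow> bool" where
  "cp_from_mat n \<psi> \<longleftrightarrow>
     (\<forall>A \<in> carrier_mat n n. \<forall>B \<in> carrier_mat n n. \<psi> (A + B) = \<psi> A + \<psi> B) \<and>
     (\<forall>a. \<forall>A \<in> carrier_mat n n. \<psi> (smult_mat a A) = scaleC a (\<psi> A)) \<and>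
     (\<forall>k. \<forall>X \<in> carrier_mat (k * n) (k * n).
        mat_positive (k * n) X \<longrightarrow> mat_positive k (amplify_from_mat n k \<psi> X))"

definition ucp_to_mat :: "nat \<Rightarrow> ('b::unital_cstar_algebra \<Rightarrow> complex mat) \<Rightarrow> bool" where
  "ucp_to_mat n \<phi> \<longleftrightarrow> cp_to_mat n \<phi> \<and> \<phi> 1 = 1\<^sub>m n"

definition ucp_from_mat :: "nat \<Rightarrow> (complex mat \<Rightarrow> 'b::unital_cstar_algebra) \<Rightarrow> bool" where
  "ucp_from_mat n \<psi> \<longleftrightarrow> cp_from_mat n \<psi> \<and> \<psi> (1\<^sub>m n) = 1"

text \<open>
  Nuclearity: the identity is a point-norm limit of contractive completely positive maps
  factoring through matrix algebras (Brown and Ozawa, \<^emph>\<open>C*-algebras and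
  finite-dimensional approximations\<close>). The approximating maps need not be unital.
\<close>

definition nuclear :: "'b::unital_cstar_algebra itself \<Rightarrow> bool" where
  "nuclear _ \<longleftrightarrow>
     (\<forall>F :: 'b set. \<forall>\<epsilon>>0. finite F \<longrightarrow>
        (\<exists>n \<phi> \<psi>.
           cp_to_mat n \<phi> \<and> (\<forall>x. mat_op_norm (\<phi> x) \<le> norm x) \<and>
           cp_from_mat n \<psi> \<and> (\<forall>A \<in> carrier_mat n n. norm (\<psi> A) \<le> mat_op_norm A) \<and>
           (\<forall>x \<in> F. norm (\<psi> (\<phi> x) - x) < \<epsilon>)))"

text \<open>
  Continuity is stated entrywise, which is continuity for the norm topology since
  \<open>M\<^sub>n(\<complex>)\<close> is finite-dimensional.
\<close>

definition unitary_rep_mat :: "nat \<Rightarrow> ('g::topological_group_add \<Rightarrow> complex mat) \<Rightarrow> bool" where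
  "unitary_rep_mat n u \<longleftrightarrow>
     (\<forall>g. u g \<in> carrier_mat n n \<and>
          mat_star (u g) * u g = 1\<^sub>m n \<and> u g * mat_star (u g) = 1\<^sub>m n) \<and>
     (\<forall>g h. u (g + h) = u g * u h) \<and>
     (\<forall>i<n. \<forall>j<n. continuous_on UNIV (\<lambda>g. u g $$ (i, j)))"

definition Ad_mat :: "complex mat \<Rightarrow> complex mat \<Rightarrow> complex mat" where
  "Ad_mat U A = U * A * mat_star U"

end

theory Submission
  imports Defs
begin

text \<open>
  Nuclearity, made unital and uniform on the compact set of all \<open>\<beta> g x\<close> with \<open>x \<in> F\<close>, gives a
  nearly identical composition of unital completely positive maps \<open>\<Phi> : B \<rightarrow> M\<^sub>N\<close> and
  \<open>\<Psi> : M\<^sub>N \<rightarrow> B\<close>. To make them equivariant, tensor \<open>M\<^sub>N\<close> with the matrices on a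
  finite-dimensional invariant space \<open>E\<close> of continuous functions on \<open>G\<close>. With an orthonormal
  basis \<open>e\<close> of \<open>E\<close> the first map has the entries
  \<open>\<integral> cnj (e\<^sub>i h) (e\<^sub>j h) \<Phi>(\<beta> (- h) x) dh\<close>, the compression to \<open>E\<close> of multiplication by
  \<open>h \<mapsto> \<Phi>(\<beta> (- h) x)\<close>. The second is \<open>T \<mapsto> \<integral> \<beta> h (\<Psi> T\<^sub>h) dh\<close>, where \<open>T\<^sub>h\<close> is the slice of \<open>T\<close> at the
  translate by \<open>h\<close> of a unit vector \<open>\<xi> \<in> E\<close>. Translation invariance of the mean gives
  equivariance, and the composition maps \<open>x\<close> to
  \<open>\<integral>\<integral> (\<xi> k)\<^sup>2 \<beta> h (\<Psi> (\<Phi> (\<beta> (- (h + k)) x))) dk dh\<close>, which is close to \<open>x\<close> as soon as \<open>\<xi>\<close> is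
  concentrated near the unit of \<open>G\<close>. Such a \<open>\<xi>\<close> exists because representative functions are
  dense (Peter--Weyl). The invariant mean comes from contracting the oscillation of averages of
  translates, and the representative functions are eigenfunctions of convolution kernels, found by
  power iteration.
\<close>

section \<open>Positive elements of C*-algebras\<close>

text \<open>Positivity in \<open>M_k(B)\<close> is defined by \<open>Y* Y\<close>, but
  \<open>'b mat\<close> contains matrices of all sizes and is no C*-algebra, so the calculus proved
  for \<open>B\<close> does not apply to it. The bridge is the family of values of a matrix as a
  quadratic form on \<open>B^k\<close>: sums, means and compressions of positive matrices are
  immediate for forms, and a binomial series recovers \<open>Y\<close>. On this level complete
  positivity becomes a single condition in either direction: positivity of the Choi matrix for maps
  out of \<open>M_n\<close>, positivity of one functional on \<open>M_n(B)\<close> for maps into it.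
  The space \<open>E\<close> must be finite-dimensional for the target to be a matrix algebra and
  translation invariant for \<open>u\<close> to exist; both maps use the same \<open>E\<close>,
  hence the same \<open>u\<close>. As \<open>G\<close> need not be commutative,
  \<open>\<beta> h\<close> after \<open>\<beta> (- (h + k))\<close> is the action of
  \<open>h - k - h\<close>, a conjugate of \<open>- k\<close>. Concentration of \<open>\<xi>\<close>
  is therefore measured against a weight that averages the displacement over all conjugates.\<close>

lemma scaleC_one [simp]: "scaleC 1 (x::'b::unital_cstar_algebra) = x"
  using scaleC_of_real[of 1 x] by simp

lemma scaleC_zero_left [simp]: "scaleC 0 (x::'b::unital_cstar_algebra) = 0"
  using scaleC_of_real[of 0 x] by simp

lemma scaleC_zero_right [simp]: "scaleC a (0::'b::unital_cstar_algebra) = 0"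
  using scaleC_add_right[of a 0 0] by simp

lemma scaleC_minus_left: "scaleC (- a) (x::'b::unital_cstar_algebra) = - scaleC a x"
  using scaleC_add_left[of a "- a" x] by (simp add: eq_neg_iff_add_eq_0 add.commute)

lemma scaleC_minus_right: "scaleC a (- (x::'b::unital_cstar_algebra)) = - scaleC a x"
  using scaleC_add_right[of a x "- x"] by (simp add: eq_neg_iff_add_eq_0 add.commute)

lemma scaleC_diff_left: "scaleC (a - b) (x::'b::unital_cstar_algebra) = scaleC a x - scaleC b x"
  using scaleC_add_left[of a "- b" x] by (simp add: scaleC_minus_left)

lemma scaleC_diff_right: "scaleC a (x - (y::'b::unital_cstar_algebra)) = scaleC a x - scaleC a y"
  using scaleC_add_right[of a x "- y"] by (simp add: scaleC_minus_right)

lemma scaleC_sum_right: "scaleC a (sum f A) = (\<Sum>i\<in>A. scaleC a (f i :: 'b::unital_cstar_algebra))"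
  by (induction A rule: infinite_finite_induct) (auto simp: scaleC_add_right)

lemma scaleC_sum_left: "scaleC (sum f A) x = (\<Sum>i\<in>A. scaleC (f i) (x :: 'b::unital_cstar_algebra))"
  by (induction A rule: infinite_finite_induct) (auto simp: scaleC_add_left)

lemma bounded_linear_scaleC_right: "bounded_linear (scaleC a :: 'b \<Rightarrow> 'b::unital_cstar_algebra)"
proof (rule bounded_linear_intro[where K = "cmod a"])
  show "scaleC a (r *\<^sub>R x) = r *\<^sub>R scaleC a x" for r and x :: 'b
    by (simp add: scaleC_of_real[symmetric] scaleC_scaleC mult.commute)
qed (auto simp: scaleC_add_right norm_scaleC mult.commute)

lemma bounded_linear_scaleC_left: "bounded_linear (\<lambda>a. scaleC a (x :: 'b::unital_cstar_algebra))"
proof (rule bounded_linear_intro[where K = "norm x"])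
  show "scaleC (r *\<^sub>R a) x = r *\<^sub>R scaleC a x" for r a
    by (simp add: scaleC_of_real[where 'a = 'b, symmetric] scaleC_scaleC scaleR_conv_of_real[where 'a = complex])
qed (auto simp: scaleC_add_left norm_scaleC)

lemma continuous_on_scaleC [continuous_intros]:
  fixes y :: "'a::topological_space \<Rightarrow> 'b::unital_cstar_algebra"
  assumes "continuous_on S a" "continuous_on S y"
  shows "continuous_on S (\<lambda>x. scaleC (a x) (y x))"
proof -
  have "bounded_bilinear (scaleC :: complex \<Rightarrow> 'b \<Rightarrow> 'b)"
    by (rule bounded_bilinear.intro)
       (auto simp: scaleC_add_left scaleC_add_right norm_scaleC
          linear_simps[OF bounded_linear_scaleC_left] linear_simps[OF bounded_linear_scaleC_right]
          intro!: exI[of _ 1])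
  then show ?thesis
    using assms by (rule bounded_bilinear.continuous_on)
qed

lemma star_zero [simp]: "star (0::'b::unital_cstar_algebra) = 0"
  using star_add[of "0::'b" 0] by simp

lemma star_one [simp]: "star (1::'b::unital_cstar_algebra) = 1"
  by (metis mult.right_neutral star_mult star_star mult.left_neutral)

lemma star_minus: "star (- x::'b::unital_cstar_algebra) = - star x"
  using star_add[of x "- x"] by (simp add: eq_neg_iff_add_eq_0 add.commute)

lemma star_diff: "star (x - y::'b::unital_cstar_algebra) = star x - star y"
  using star_add[of x "- y"] by (simp add: star_minus)

lemma star_scaleR: "star (r *\<^sub>R x::'b::unital_cstar_algebra) = r *\<^sub>R star x"
  by (simp add: scaleC_of_real[symmetric] star_scaleC)

lemma star_of_real [simp]: "star (of_real r::'b::unital_cstar_algebra) = of_real r"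
  by (simp add: of_real_def star_scaleR)

lemma star_sum: "star (sum f A) = (\<Sum>i\<in>A. star (f i :: 'b::unital_cstar_algebra))"
  by (induction A rule: infinite_finite_induct) (auto simp: star_add)

lemma star_power: "star (x ^ n::'b::unital_cstar_algebra) = star x ^ n"
  by (induction n) (auto simp: star_mult power_commutes)

lemma norm_star [simp]: "norm (star x::'b::unital_cstar_algebra) = norm x"
proof -
  have le: "norm y \<le> norm (star y)" for y :: 'b
  proof (cases "y = 0")
    case False
    have "norm y * norm y \<le> norm (star y) * norm y"
      using norm_mult_ineq[of "star y" y] by (simp add: cstar_identity power2_eq_square)
    then show ?thesis using False by simp
  qed simp
  show ?thesis using le[of x] le[of "star x"] by (simp add: star_star)
qed

lemma bounded_linear_star: "bounded_linear (star :: 'b \<Rightarrow> 'b::unital_cstar_algebra)"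
  by (rule bounded_linear_intro[where K = 1]) (auto simp: star_add star_scaleR)

lemmas continuous_on_star [continuous_intros] = bounded_linear.continuous_on[OF bounded_linear_star]

lemma norm_mult_self_adjoint:
  "star (a::'b::unital_cstar_algebra) = a \<Longrightarrow> norm (a * a) = (norm a)\<^sup>2"
  using cstar_identity[of a] by simp

lemma norm_mult_self_adjoint_eq_0:
  "star (a::'b::unital_cstar_algebra) = a \<Longrightarrow> a * a = 0 \<Longrightarrow> a = 0"
  using norm_mult_self_adjoint[of a] by simp

section \<open>Invertibility and the norm of self-adjoint elements\<close>

definition invertible_elem :: "'b::ring_1 \<Rightarrow> bool" where
  "invertible_elem a \<longleftrightarrow> (\<exists>b. a * b = 1 \<and> b * a = 1)"

lemma invertible_elemI: "b * a = 1 \<Longrightarrow> a * c = 1 \<Longrightarrow> invertible_elem a"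
  unfolding invertible_elem_def by (metis mult.assoc mult.left_neutral mult.right_neutral)

lemma invertible_elem_mult: "invertible_elem a \<Longrightarrow> invertible_elem b \<Longrightarrow> invertible_elem (a * b)"
  unfolding invertible_elem_def by (metis mult.assoc mult.left_neutral)

lemma invertible_elem_scaleC:
  assumes "z \<noteq> 0" "invertible_elem (a::'b::unital_cstar_algebra)"
  shows "invertible_elem (scaleC z a)"
proof -
  obtain b where "a * b = 1" "b * a = 1" using assms by (auto simp: invertible_elem_def)
  then show ?thesis using assms(1)
    by (intro invertible_elemI[of "scaleC (inverse z) b" _ "scaleC (inverse z) b"])
       (auto simp: scaleC_mult_left scaleC_mult_right scaleC_scaleC)
qed

lemma invertible_elem_uminus: "invertible_elem a \<Longrightarrow> invertible_elem (- a)"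
  unfolding invertible_elem_def by (metis minus_mult_minus)

lemma invertible_elem_one_minus:
  fixes x :: "'b::{real_normed_algebra_1,banach}"
  assumes "norm x < 1"
  shows "invertible_elem (1 - x)"
proof -
  let ?s = "\<Sum>n. x ^ n"
  have s: "summable (\<lambda>n. x ^ n)" by (rule complete_algebra_summable_geometric[OF assms])
  have "x * ?s = (\<Sum>n. x ^ Suc n)" using suminf_mult[OF s, of x] by simp
  moreover have "?s * x = (\<Sum>n. x ^ Suc n)"
    using suminf_mult2[OF s, of x] by (simp add: power_Suc2 del: power_Suc)
  moreover have "?s = 1 + (\<Sum>n. x ^ Suc n)" using suminf_split_head[OF s] by simp
  ultimately show ?thesis
    by (intro invertible_elemI[of ?s _ ?s]) (auto simp: algebra_simps)
qed

definition cscalar :: "complex \<Rightarrow> 'b::unital_cstar_algebra" where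
  "cscalar z = scaleC z 1"

lemma cscalar_mult_left: "cscalar z * x = scaleC z (x::'b::unital_cstar_algebra)"
  and cscalar_mult_right: "x * cscalar z = scaleC z (x::'b::unital_cstar_algebra)"
  by (simp_all add: cscalar_def scaleC_mult_left scaleC_mult_right)

lemma cscalar_of_real: "cscalar (complex_of_real r) = (of_real r :: 'b::unital_cstar_algebra)"
  unfolding cscalar_def scaleC_of_real by (simp add: of_real_def)

lemma invertible_elem_diff_cscalar:
  assumes "norm (x::'b::unital_cstar_algebra) < cmod z"
  shows "invertible_elem (x - cscalar z)"
proof -
  have z: "z \<noteq> 0" using assms by auto
  have "norm (scaleC (inverse z) x) < 1" using assms z
    by (simp add: norm_scaleC norm_inverse pos_divide_less_eq divide_inverse[symmetric] mult.commute[of "inverse _"])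
  then have "invertible_elem (scaleC (- z) (1 - scaleC (inverse z) x))"
    using z by (intro invertible_elem_scaleC invertible_elem_one_minus) auto
  also have "scaleC (- z) (1 - scaleC (inverse z) x) = x - cscalar z" using z
    by (simp add: cscalar_def scaleC_minus_left scaleC_diff_right scaleC_scaleC)
  finally show ?thesis .
qed

lemma invertible_elem_of_real_diff:
  assumes "norm (x::'b::unital_cstar_algebra) < t"
  shows "invertible_elem (of_real t - x)" "invertible_elem (of_real t + x)"
proof -
  have "0 \<le> t" using assms norm_ge_zero[of x] by linarith
  then have t: "cmod (of_real t) = t" by simp
  show "invertible_elem (of_real t - x)"
    using invertible_elem_uminus[OF invertible_elem_diff_cscalar[of x "of_real t"]] assms
    by (simp add: t cscalar_of_real)
  show "invertible_elem (of_real t + x)"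
    using invertible_elem_uminus[OF invertible_elem_diff_cscalar[of "- x" "of_real t"]] assms
    by (simp add: t cscalar_of_real)
qed

text \<open>Arens' device: shifting both \<open>a\<close> and \<open>i q\<close> by
  \<open>i l\<close> leaves their difference unchanged, and for \<open>c = a + i l\<close> the
  C*-identity bounds the square of \<open>norm c\<close> by the sum of the squares of
  \<open>norm a\<close> and \<open>l\<close>. For suitable \<open>l\<close> this is below the square
  of \<open>q + l\<close>, so the Neumann series applies.\<close>

lemma self_adjoint_invertible_diff_imaginary:
  assumes "star (a::'b::unital_cstar_algebra) = a" "q \<noteq> 0"
  shows "invertible_elem (a - cscalar (\<i> * complex_of_real q))"
proof -
  \<comment> \<open>Chosen to make \<open>q * l\<close> the square of \<open>norm a\<close>, so that
    the cross term in the square of \<open>q + l\<close> absorbs that square. Since \<open>q\<close>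
    may be negative, so may \<open>l\<close>.\<close>
  define l where "l = (norm a)\<^sup>2 / q"
  define c where "c = a + cscalar (\<i> * of_real l)"
  define k :: 'b where "k = cscalar (\<i> * of_real l)"
  have "star k = - k"
    unfolding k_def cscalar_def star_scaleC by (simp flip: scaleC_minus_left)
  moreover have "a * k = k * a"
    by (simp add: k_def cscalar_mult_left cscalar_mult_right)
  moreover have "k * k = - of_real (l\<^sup>2)"
  proof -
    have "k * k = cscalar (- complex_of_real (l\<^sup>2))"
      unfolding k_def cscalar_mult_left unfolding cscalar_def scaleC_scaleC
      by (simp add: power2_eq_square algebra_simps)
    then show ?thesis
      by (metis cscalar_def cscalar_of_real scaleC_minus_left)
  qed
  ultimately have "star c * c = a * a + of_real (l\<^sup>2)"
    unfolding c_def k_def[symmetric] by (simp add: star_add assms(1) algebra_simps)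
  then have "(norm c)\<^sup>2 = norm (a * a + of_real (l\<^sup>2))" by (metis cstar_identity)
  also have "\<dots> \<le> (norm a)\<^sup>2 + l\<^sup>2"
  proof -
    have "norm (of_real (l\<^sup>2) :: 'b) = l\<^sup>2" by (simp only: norm_of_real abs_power2)
    moreover have "norm (a * a) \<le> (norm a)\<^sup>2" by (simp add: power2_eq_square norm_mult_ineq)
    ultimately show ?thesis using norm_triangle_ineq[of "a * a" "of_real (l\<^sup>2)"] by linarith
  qed
  also have "\<dots> < (q + l)\<^sup>2"
  proof -
    have "q * l = (norm a)\<^sup>2" using assms(2) by (simp add: l_def)
    moreover have "(q + l)\<^sup>2 = q\<^sup>2 + 2 * (q * l) + l\<^sup>2" by (simp add: power2_sum)
    moreover have "q\<^sup>2 > 0" using assms(2) by simp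
    ultimately show ?thesis using zero_le_power2[of "norm a"] by linarith
  qed
  finally have "norm c < \<bar>q + l\<bar>"
    by (metis abs_ge_zero norm_ge_zero power2_abs power_less_imp_less_base)
  then have "invertible_elem (c - cscalar (\<i> * of_real (q + l)))"
    by (intro invertible_elem_diff_cscalar) (simp add: norm_mult flip: of_real_add)
  also have "c - cscalar (\<i> * of_real (q + l)) = a - cscalar (\<i> * of_real q)"
    by (simp add: c_def cscalar_def algebra_simps scaleC_add_left)
  finally show ?thesis .
qed

lemma self_adjoint_invertible_diff_nonreal:
  assumes "star (a::'b::unital_cstar_algebra) = a" "Im z \<noteq> 0"
  shows "invertible_elem (a - cscalar z)"
proof -
  have "star (a - of_real (Re z)) = a - of_real (Re z)" by (simp add: star_diff assms)
  from self_adjoint_invertible_diff_imaginary[OF this assms(2)]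
  have "invertible_elem (a - of_real (Re z) - cscalar (\<i> * of_real (Im z)))" .
  moreover have "cscalar z = (cscalar (of_real (Re z)) + cscalar (\<i> * of_real (Im z)) :: 'b)"
    unfolding cscalar_def scaleC_add_left[symmetric] complex_eq[symmetric] ..
  ultimately show ?thesis by (simp only: cscalar_of_real diff_diff_add)
qed

text \<open>The resolvent identity \<open>R z - R w = (z - w) R z c R w\<close> gives the estimate
  once \<open>norm (R z)\<close> is under control; close to \<open>w\<close> the same identity
  bounds \<open>norm (R z)\<close> by \<open>2 * norm (R w)\<close>.\<close>

lemma resolvent_continuous:
  fixes c :: "'b::unital_cstar_algebra" and R :: "complex \<Rightarrow> 'b"
  assumes R: "\<And>z. z \<in> S \<Longrightarrow> (1 - scaleC z c) * R z = 1 \<and> R z * (1 - scaleC z c) = 1"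
  shows "continuous_on S R"
proof (rule continuous_onI)
  fix w and e :: real assume w: "w \<in> S" and e: "0 < e"
  define K where "K = norm c * norm (R w)"
  \<comment> \<open>The first bound forces \<open>norm (R z) \<le> 2 * norm (R w)\<close>, the
    second turns the resulting estimate into \<open>e\<close>. The summands \<open>1\<close> keep
    the denominators positive.\<close>
  define d where "d = min (1 / (2 * (K + 1))) (e / (2 * (K + 1) * (norm (R w) + 1)))"
  have K: "K \<ge> 0" by (simp add: K_def)
  have d: "d > 0" using K e by (auto simp: d_def add_nonneg_pos)
  show "\<exists>d>0. \<forall>z\<in>S. dist z w < d \<longrightarrow> dist (R z) (R w) \<le> e"
  proof (intro exI[of _ d] conjI d ballI impI)
    fix z assume z: "z \<in> S" "dist z w < d"
    have "R z - R w = R z * ((1 - scaleC w c) * R w) - (R z * (1 - scaleC z c)) * R w"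
      using R[OF w] R[OF z(1)] by simp
    also have "\<dots> = R z * (scaleC (z - w) c * R w)"
      by (simp add: algebra_simps scaleC_diff_left)
    finally have eq: "R z - R w = R z * (scaleC (z - w) c * R w)" .
    have "norm (scaleC (z - w) c * R w) \<le> dist z w * K"
      using norm_mult_ineq[of "scaleC (z - w) c" "R w"]
      by (simp add: norm_scaleC K_def dist_norm mult.assoc)
    then have "norm (R z * (scaleC (z - w) c * R w)) \<le> norm (R z) * (dist z w * K)"
      by (meson norm_mult_ineq norm_ge_zero mult_left_mono order_trans)
    then have 1: "norm (R z - R w) \<le> norm (R z) * (dist z w * K)" using eq by simp
    have zK: "dist z w * (K + 1) \<le> 1 / 2"
      using z(2) K by (simp add: d_def field_simps)
    have "dist z w * K \<le> dist z w * (K + 1)" by (intro mult_left_mono) auto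
    then have "dist z w * K \<le> 1 / 2" using zK by linarith
    then have "norm (R z) * (dist z w * K) \<le> norm (R z) * (1 / 2)"
      by (intro mult_left_mono) auto
    then have "norm (R z) \<le> 2 * norm (R w)"
      using 1 norm_triangle_ineq2[of "R z" "R w"] by linarith
    then have "norm (R z) * (dist z w * K) \<le> 2 * norm (R w) * (dist z w * K)"
      using K by (intro mult_right_mono) auto
    also have "\<dots> \<le> 2 * (norm (R w) + 1) * (dist z w * (K + 1))"
      using K by (intro mult_mono) auto
    also have "\<dots> \<le> 2 * (norm (R w) + 1) * (d * (K + 1))"
      using K z(2) by (intro mult_left_mono mult_right_mono) auto
    also have "\<dots> \<le> 2 * (norm (R w) + 1) * (e / (2 * (K + 1) * (norm (R w) + 1)) * (K + 1))"
      using K by (intro mult_left_mono mult_right_mono) (auto simp: d_def)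
    also have "\<dots> = e"
    proof -
      have "K + 1 \<noteq> 0" "norm (R w) + 1 \<noteq> 0"
        using K norm_ge_zero[of "R w"] by linarith+
      then show ?thesis by (simp add: divide_simps) (simp add: algebra_simps)
    qed
    finally show "dist (R z) (R w) \<le> e" using 1 by (simp add: dist_norm)
  qed
qed

lemma cis_power: "cis a ^ n = cis (real n * a)"
  by (induction n) (simp_all add: algebra_simps cis_mult)

lemma cis_root_of_unity: "N > 0 \<Longrightarrow> cis (2 * pi / real N) ^ N = 1"
  unfolding cis_power by simp

lemma sum_powers_root_of_unity:
  assumes "0 < j" "j < N"
  shows "(\<Sum>k<N. (cis (2 * pi / real N) ^ k) ^ j) = 0"
proof -
  let ?z = "cis (2 * pi / real N)"
  have N: "N > 0" using assms by simp
  have "?z ^ j \<noteq> 1"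
  proof
    assume "?z ^ j = 1"
    then have "cos (real j * (2 * pi / real N)) = 1"
      unfolding cis_power by (simp add: complex_eq_iff)
    then obtain m :: int where m: "real j * (2 * pi / real N) = of_int m * 2 * pi"
      by (auto simp: cos_one_2pi_int)
    then have "real j = real_of_int m * real N" using N by (simp add: field_simps)
    then have "int j = m * int N" by (metis of_int_of_nat_eq of_int_mult of_int_eq_iff)
    then show False using assms by (metis dvd_triv_right int_dvd_int_iff nat_dvd_not_less)
  qed
  moreover have "(?z ^ j) ^ N = 1"
    using cis_root_of_unity[OF N] by (metis power_mult power_one mult.commute)
  moreover have "(?z ^ k) ^ j = (?z ^ j) ^ k" for k
    by (simp only: power_mult[symmetric] mult.commute)
  ultimately show ?thesis by (simp add: geometric_sum)
qed

lemma sum_powers_mult_one_minus: "(\<Sum>j<N. x ^ j) * (1 - x) = 1 - (x::'a::ring_1) ^ N"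
proof (induction N)
  case (Suc N)
  have "(\<Sum>j<Suc N. x ^ j) * (1 - x) = 1 - x ^ N + x ^ N * (1 - x)"
    by (simp only: sum.lessThan_Suc distrib_right Suc)
  then show ?case by (simp add: right_diff_distrib power_commutes)
qed simp

text \<open>Rickart's argument: averaging the resolvent over the \<open>N\<close>-th roots of unity gives the inverse
  of \<open>1 - (z c)\<^sup>N\<close>, so uniform continuity of the resolvent on the closed disc replaces
  Cauchy's estimates.\<close>

lemma power_tendsto_zero_of_resolvent:
  fixes c :: "'b::unital_cstar_algebra"
  assumes inv: "\<And>z. cmod z \<le> 1 \<Longrightarrow> invertible_elem (1 - scaleC z c)"
    and c1: "norm c \<le> 1" and e: "e > 0"
  shows "\<exists>N0. \<forall>N\<ge>N0. norm (c ^ N) < e"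
proof -
  obtain R where R: "\<And>z. cmod z \<le> 1 \<Longrightarrow> (1 - scaleC z c) * R z = 1 \<and> R z * (1 - scaleC z c) = 1"
    using inv unfolding invertible_elem_def by metis
  have cont: "continuous_on (cball 0 1) R"
    by (rule resolvent_continuous[where c = c]) (simp add: R)
  then have uc: "uniformly_continuous_on (cball 0 1) R"
    by (rule compact_uniformly_continuous) simp
  define \<delta> where "\<delta> = e / 10"
  have \<delta>: "\<delta> > 0" using e by (simp add: \<delta>_def)
  define \<epsilon> where "\<epsilon> = min \<delta> (1 / 10)"
  have \<epsilon>: "\<epsilon> > 0" "\<epsilon> \<le> 1/10" "\<epsilon> \<le> \<delta>" using \<delta> by (auto simp: \<epsilon>_def)
  obtain d where d: "d > 0"
    "\<And>z w. z \<in> cball 0 1 \<Longrightarrow> w \<in> cball 0 1 \<Longrightarrow> dist z w < d \<Longrightarrow> dist (R z) (R w) < \<epsilon>"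
    using uc \<epsilon>(1) unfolding uniformly_continuous_on_def by blast
  \<comment> \<open>Close enough to \<open>1\<close> that moving from the unit circle to the circle
    of radius \<open>r\<close> changes the resolvent by less than \<open>\<epsilon>\<close>, yet
    below \<open>1\<close>, so that \<open>r ^ N\<close> tends to zero.\<close>
  define r where "r = 1 - min (d/2) (1/2)"
  have r: "0 < r" "r < 1" "1 - r < d" using d(1) by (auto simp: r_def)
  obtain K where K: "\<And>z. z \<in> cball 0 1 \<Longrightarrow> norm (R z) \<le> K"
    using compact_imp_bounded[OF compact_continuous_image[OF cont compact_cball]] unfolding bounded_iff by blast
  have K0: "K \<ge> 0" using K[of 0] norm_ge_zero[of "R 0"] by (simp del: norm_ge_zero)
  define \<omega> where "\<omega> N = cis (2 * pi / real N)" for N :: nat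
  define S where "S N t = (1 / real N) *\<^sub>R (\<Sum>k<N. R (of_real t * \<omega> N ^ k))" for N t
  have norm_\<omega>: "cmod (\<omega> N ^ k) = 1" for N k by (simp add: \<omega>_def norm_power)
  have disc: "of_real t * \<omega> N ^ k \<in> cball 0 1" if "0 \<le> t" "t \<le> 1" for t N k
    using that by (simp add: norm_mult norm_\<omega>)
  have S: "(1 - t ^ N *\<^sub>R c ^ N) * S N t = 1" if t: "0 \<le> t" "t \<le> 1" and N: "N > 0" for t N
  proof -
    let ?w = "\<lambda>k. of_real t * \<omega> N ^ k"
    have pw: "scaleC z c ^ j = scaleC (z ^ j) (c ^ j)" for z j
      by (induction j) (auto simp: scaleC_mult_left scaleC_mult_right scaleC_scaleC mult.commute)
    have eq: "(1 - t ^ N *\<^sub>R c ^ N) * R (?w k) = (\<Sum>j<N. scaleC (?w k ^ j) (c ^ j))" for k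
    proof -
      define x where "x = scaleC (?w k) c"
      have "(\<omega> N ^ k) ^ N = (\<omega> N ^ N) ^ k" by (simp only: power_mult[symmetric] mult.commute)
      then have "?w k ^ N = complex_of_real (t ^ N)"
        using cis_root_of_unity[OF N] by (simp add: \<omega>_def power_mult_distrib)
      then have xN: "x ^ N = t ^ N *\<^sub>R c ^ N" by (simp only: x_def pw scaleC_of_real)
      have "(1 - x) * R (?w k) = 1" using R[of "?w k"] disc[OF t, of N k] by (simp add: x_def)
      then have "(1 - x ^ N) * R (?w k) = (\<Sum>j<N. x ^ j)"
        by (simp only: sum_powers_mult_one_minus[symmetric] mult.assoc mult_1_right)
      then show ?thesis by (simp only: xN) (simp only: x_def pw)
    qed
    have "(1 - t ^ N *\<^sub>R c ^ N) * S N t = (1 / real N) *\<^sub>R (\<Sum>k<N. \<Sum>j<N. scaleC (?w k ^ j) (c ^ j))"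
      unfolding S_def mult_scaleR_right sum_distrib_left eq ..
    also have "(\<Sum>k<N. \<Sum>j<N. scaleC (?w k ^ j) (c ^ j)) = (\<Sum>j<N. scaleC (\<Sum>k<N. ?w k ^ j) (c ^ j))"
      by (subst sum.swap) (simp only: scaleC_sum_left)
    \<comment> \<open>Orthogonality of the roots of unity removes every exponent except
      \<open>j = 0\<close>.\<close>
    also have "\<dots> = (\<Sum>j<N. if j = 0 then real N *\<^sub>R 1 else 0)"
    proof (rule sum.cong)
      fix j assume j: "j \<in> {..<N}"
      show "scaleC (\<Sum>k<N. ?w k ^ j) (c ^ j) = (if j = 0 then real N *\<^sub>R 1 else 0)"
      proof (cases "j = 0")
        case True
        have "scaleC (of_nat N) (1::'b) = real N *\<^sub>R 1"
          using scaleC_of_real[of "real N" "1::'b"] by simp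
        then show ?thesis using True by simp
      next
        case False
        have "(\<Sum>k<N. ?w k ^ j) = of_real t ^ j * (\<Sum>k<N. (\<omega> N ^ k) ^ j)"
          by (simp only: power_mult_distrib sum_distrib_left)
        also have "\<dots> = 0"
          using sum_powers_root_of_unity[of j N] j False by (simp add: \<omega>_def)
        finally show ?thesis using False by simp
      qed
    qed simp
    also have "(1 / real N) *\<^sub>R \<dots> = 1" using N by simp
    finally show ?thesis .
  qed
  have SK: "norm (S N t) \<le> K" if t: "0 \<le> t" "t \<le> 1" and N: "N > 0" for N t
  proof -
    have "norm (\<Sum>k<N. R (of_real t * \<omega> N ^ k)) \<le> (\<Sum>k<N. K)"
      by (rule sum_norm_le) (rule K[OF disc[OF t]])
    then show ?thesis using N by (simp add: S_def field_simps)
  qed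
  have Sd: "norm (S N 1 - S N r) \<le> \<epsilon>" if N: "N > 0" for N
  proof -
    have "norm (\<Sum>k<N. R (of_real 1 * \<omega> N ^ k) - R (of_real r * \<omega> N ^ k)) \<le> (\<Sum>k<N. \<epsilon>)"
    proof (rule sum_norm_le)
      fix k
      let ?x = "\<omega> N ^ k"
      have "dist (of_real 1 * ?x) (of_real r * ?x) = cmod (of_real (1 - r) * ?x)"
        by (simp add: dist_norm algebra_simps)
      also have "\<dots> = 1 - r" using r by (simp only: norm_mult norm_of_real norm_\<omega>) simp
      finally have "dist (of_real 1 * ?x) (of_real r * ?x) < d" using r by simp
      then show "norm (R (of_real 1 * ?x) - R (of_real r * ?x)) \<le> \<epsilon>"
        using d(2)[OF disc disc, of 1 r N k N k] r by (simp add: dist_norm less_imp_le)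
    qed
    moreover have "S N 1 - S N r = (1 / real N) *\<^sub>R
        (\<Sum>k<N. R (of_real 1 * \<omega> N ^ k) - R (of_real r * \<omega> N ^ k))"
      by (simp only: S_def scaleR_diff_right sum_subtractf)
    ultimately show ?thesis using N by (simp add: field_simps)
  qed
  have "(\<lambda>N. r ^ N * K) \<longlonglongrightarrow> 0 * K"
    using r by (intro tendsto_mult LIMSEQ_power_zero tendsto_const) auto
  then obtain N0 where N0: "\<And>N. N \<ge> N0 \<Longrightarrow> \<bar>r ^ N * K\<bar> < \<epsilon>"
    unfolding LIMSEQ_iff using \<epsilon>(1) by fastforce
  show ?thesis
  proof (intro exI[of _ "Suc N0"] allI impI)
    fix N assume "Suc N0 \<le> N"
    then have N: "N > 0" "N \<ge> N0" by auto
    have cN: "norm (c ^ N) \<le> 1"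
      using norm_power_ineq[of c N] power_le_one[OF norm_ge_zero c1] by (meson order_trans)
    have "S N r - 1 = r ^ N *\<^sub>R (c ^ N * S N r)"
      using S[of r N] r N by (simp add: algebra_simps)
    then have "norm (S N r - 1) \<le> r ^ N * (norm (c ^ N) * norm (S N r))"
      using r norm_mult_ineq[of "c ^ N" "S N r"] by simp
    also have "\<dots> \<le> r ^ N * (1 * K)"
      using r cN SK[of r N] N by (intro mult_left_mono mult_mono) auto
    also have "\<dots> \<le> \<epsilon>" using N0[OF N(2)] by linarith
    finally have "norm (S N r - 1) \<le> \<epsilon>" .
    then have S1: "norm (S N 1 - 1) \<le> 2 * \<epsilon>"
      using Sd[OF N(1)] norm_triangle_ineq[of "S N 1 - S N r" "S N r - 1"] by simp
    have "c ^ N * S N 1 = S N 1 - 1" using S[of 1 N] N by (simp add: algebra_simps)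
    \<comment> \<open>Both \<open>1\<close> and \<open>1 - c ^ N\<close> are nearly inverse to
      \<open>S N 1\<close>; expressing \<open>c ^ N\<close> through \<open>S N 1 - 1\<close> makes
      this quantitative, and \<open>norm (c ^ N) \<le> 1\<close> takes care of the second
      term.\<close>
    then have "c ^ N = (S N 1 - 1) - c ^ N * (S N 1 - 1)" by (simp add: algebra_simps)
    then have "norm (c ^ N) \<le> norm (S N 1 - 1) + norm (c ^ N * (S N 1 - 1))"
      using norm_triangle_ineq4[of "S N 1 - 1" "c ^ N * (S N 1 - 1)"] by simp
    also have "\<dots> \<le> norm (S N 1 - 1) + norm (c ^ N) * norm (S N 1 - 1)"
      using norm_mult_ineq[of "c ^ N" "S N 1 - 1"] by simp
    also have "\<dots> \<le> 2 * \<epsilon> + 1 * (2 * \<epsilon>)"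
      using S1 cN \<epsilon> by (intro add_mono mult_mono) auto
    also have "\<dots> < e" using \<epsilon> e by (simp add: \<delta>_def)
    finally show "norm (c ^ N) < e" .
  qed
qed

text \<open>If neither \<open>norm b\<close> nor its negative were in the spectrum, the normalised
  element \<open>a\<close> would have its spectrum in the open unit disc, and the powers of
  \<open>a * a\<close> would tend to zero. The C*-identity, however, keeps
  \<open>norm (a ^ (2 ^ k))\<close> equal to \<open>1\<close>.\<close>

lemma self_adjoint_not_both_invertible:
  assumes sa: "star (b::'b::unital_cstar_algebra) = b" and b0: "b \<noteq> 0"
    and inv: "invertible_elem (of_real (norm b) - b)" "invertible_elem (of_real (norm b) + b)"
  shows False
proof -
  define t where "t = norm b"
  define a where "a = (1 / t) *\<^sub>R b"
  have t: "t > 0" using b0 by (simp add: t_def)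
  have saa: "star a = a" by (simp add: a_def star_scaleR sa)
  have na: "norm a = 1" using t by (simp add: a_def t_def)
  have scal: "invertible_elem ((1/t) *\<^sub>R x)" if "invertible_elem x" for x :: 'b
    using invertible_elem_scaleC[of "complex_of_real (1/t)" x] that t unfolding scaleC_of_real by simp
  have "(1/t) *\<^sub>R (of_real (norm b) - b) = 1 - a" "(1/t) *\<^sub>R (of_real (norm b) + b) = 1 + a"
    using t by (auto simp: a_def t_def of_real_def scaleR_right_diff_distrib scaleR_right_distrib)
  then have inva: "invertible_elem (1 - a)" "invertible_elem (1 + a)"
    using scal[OF inv(1)] scal[OF inv(2)] by auto
  have wa: "invertible_elem (a - cscalar w)" if w: "cmod w \<ge> 1" for w
  proof -
    consider "Im w \<noteq> 0" | "cmod w > 1" | "Im w = 0" "cmod w = 1" using w by linarith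
    then show ?thesis
    proof cases
      case 1 then show ?thesis using self_adjoint_invertible_diff_nonreal[OF saa] by blast
    next
      case 2 then show ?thesis using invertible_elem_diff_cscalar[of a w] na by simp
    next
      case 3
      then have "w = 1 \<or> w = -1" by (auto simp: cmod_def complex_eq_iff)
      moreover have "a - 1 = - (1 - a)" by simp
      ultimately show ?thesis
        using inva invertible_elem_uminus[OF inva(1)]
        by (auto simp: cscalar_def scaleC_minus_left add.commute)
    qed
  qed
  have "invertible_elem (1 - scaleC z (a * a))" if z: "cmod z \<le> 1" for z
  proof (cases "z = 0")
    case True then show ?thesis by (auto simp: invertible_elem_def)
  next
    case False
    \<comment> \<open>With this root \<open>1 - z a a\<close> factors as
      \<open>- z (a - w) (a + w)\<close>, and \<open>cmod w \<ge> 1\<close> because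
      \<open>cmod z \<le> 1\<close>.\<close>
    define w where "w = csqrt (1 / z)"
    have ww: "w * w = 1 / z" by (simp add: w_def power2_eq_square[symmetric])
    then have "cmod w * cmod w \<ge> 1" using z False by (simp add: norm_mult[symmetric] norm_divide)
    then have w1: "cmod w \<ge> 1" 
      using mult_strict_mono[of "cmod w" 1 "cmod w" 1] by fastforce
    have "invertible_elem (scaleC (- z) ((a - cscalar w) * (a - cscalar (- w))))"
      using False wa[of w] wa[of "- w"] w1
      by (intro invertible_elem_scaleC invertible_elem_mult) auto
    also have "(a - cscalar w) * (a - cscalar (- w)) = a * a - scaleC (1 / z) 1"
      unfolding ww[symmetric]
      by (simp add: cscalar_def algebra_simps scaleC_minus_left scaleC_diff_right scaleC_mult_left scaleC_mult_right scaleC_scaleC)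
    also have "scaleC (- z) \<dots> = 1 - scaleC z (a * a)"
      using False by (simp add: scaleC_minus_left scaleC_diff_right scaleC_scaleC)
    finally show ?thesis .
  qed
  moreover have "norm (a * a) \<le> 1" using norm_mult_self_adjoint[OF saa] na by simp
  ultimately obtain N0 where N0: "\<And>N. N \<ge> N0 \<Longrightarrow> norm ((a * a) ^ N) < 1"
    using power_tendsto_zero_of_resolvent[of "a * a" 1] by auto
  have "norm (a ^ (2 ^ k)) = 1" for k
  proof (induction k)
    case (Suc k)
    have "a ^ (2 ^ Suc k) = a ^ (2 ^ k) * a ^ (2 ^ k)"
      by (simp add: power_add[symmetric] mult_2)
    moreover have "star (a ^ (2 ^ k)) = a ^ (2 ^ k)" by (simp add: star_power saa)
    ultimately show ?case using norm_mult_self_adjoint[of "a ^ (2 ^ k)"] Suc by simp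
  qed (simp add: na)
  from this[of "Suc N0"] have "norm ((a * a) ^ (2 ^ N0)) = 1"
    by (simp add: power_mult power2_eq_square)
  then show False using N0[of "2 ^ N0"] less_exp[of N0] by simp
qed

section \<open>Elements with nonnegative spectrum\<close>

definition nonneg_spectrum :: "'b::unital_cstar_algebra \<Rightarrow> bool" where
  "nonneg_spectrum a \<longleftrightarrow> star a = a \<and> (\<forall>t>0. invertible_elem (of_real t + a))"

text \<open>Write \<open>t + a = (s + t) - (s - a)\<close> and use the Neumann series. Together with
  the converse \<open>nonneg_spectrum_norm\<close> this replaces a spectral condition by a norm
  inequality, from which sums and limits can be treated.\<close>

lemma nonneg_spectrumI_norm:
  assumes "star (a::'b::unital_cstar_algebra) = a" "norm (of_real s - a) \<le> s"
  shows "nonneg_spectrum a"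
  unfolding nonneg_spectrum_def
proof (intro conjI allI impI)
  fix t :: real assume "t > 0"
  then have "invertible_elem (of_real (s + t) - (of_real s - a))"
    using assms(2) by (intro invertible_elem_of_real_diff) simp
  then show "invertible_elem (of_real t + a)" by (simp add: algebra_simps)
qed fact

text \<open>If the bound failed, \<open>r = norm b\<close> would be admissible in both hypotheses,
  which \<open>self_adjoint_not_both_invertible\<close> excludes. This is the equality of norm and
  spectral radius for self-adjoint elements.\<close>

lemma norm_le_of_invertible:
  assumes sa: "star (b::'b::unital_cstar_algebra) = b" and s: "0 \<le> s"
    and inv: "\<And>r. r > s \<Longrightarrow> invertible_elem (of_real r - b)" "\<And>r. r > s \<Longrightarrow> invertible_elem (of_real r + b)"
  shows "norm b \<le> s"
proof (rule ccontr)
  assume "\<not> norm b \<le> s"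
  then have "norm b > s" by simp
  moreover from this s have "b \<noteq> 0" by auto
  ultimately show False using self_adjoint_not_both_invertible[OF sa] inv by blast
qed

lemma nonneg_spectrum_norm:
  assumes a: "nonneg_spectrum (a::'b::unital_cstar_algebra)" and s: "norm a \<le> s"
  shows "norm (of_real s - a) \<le> s"
proof (rule norm_le_of_invertible)
  show "star (of_real s - a) = of_real s - a"
    using a by (simp add: nonneg_spectrum_def star_diff)
  show "0 \<le> s" using s norm_ge_zero[of a] by linarith
  fix r assume r: "r > s"
  show "invertible_elem (of_real r - (of_real s - a))"
    using a r unfolding nonneg_spectrum_def
    by (metis (no_types, opaque_lifting) add_diff_eq diff_add_eq diff_diff_eq2 diff_gt_0_iff_gt of_real_diff)
  have "invertible_elem (of_real (r + s) - a)"
    using r s norm_ge_zero[of a] by (intro invertible_elem_of_real_diff) linarith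
  then show "invertible_elem (of_real r + (of_real s - a))" by (simp add: algebra_simps)
qed

text \<open>The spectrum of a sum is not directly accessible, but the norm criterion for
  \<open>a + b\<close> is the triangle inequality for \<open>of_real (norm a) - a\<close> and
  \<open>of_real (norm b) - b\<close>.\<close>

lemma nonneg_spectrum_add:
  assumes "nonneg_spectrum (a::'b::unital_cstar_algebra)" "nonneg_spectrum b"
  shows "nonneg_spectrum (a + b)"
proof (rule nonneg_spectrumI_norm[where s = "norm a + norm b"])
  show "star (a + b) = a + b" using assms by (simp add: nonneg_spectrum_def star_add)
  have "of_real (norm a + norm b) - (a + b) = (of_real (norm a) - a) + (of_real (norm b) - b)"
    by (simp add: algebra_simps)
  moreover have "norm ((of_real (norm a) - a) + (of_real (norm b) - b)) \<le> norm a + norm b"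
    using nonneg_spectrum_norm[OF assms(1) order_refl] nonneg_spectrum_norm[OF assms(2) order_refl]
      norm_triangle_ineq[of "of_real (norm a) - a" "of_real (norm b) - b"] by linarith
  ultimately show "norm (of_real (norm a + norm b) - (a + b)) \<le> norm a + norm b" by metis
qed

lemma nonneg_spectrum_scaleR:
  assumes "nonneg_spectrum (a::'b::unital_cstar_algebra)" "r \<ge> 0"
  shows "nonneg_spectrum (r *\<^sub>R a)"
proof (rule nonneg_spectrumI_norm[where s = "r * norm a"])
  show "star (r *\<^sub>R a) = r *\<^sub>R a" using assms by (simp add: nonneg_spectrum_def star_scaleR)
  have "of_real (r * norm a) - r *\<^sub>R a = r *\<^sub>R (of_real (norm a) - a)"
    by (simp add: scaleR_right_diff_distrib of_real_def)
  then show "norm (of_real (r * norm a) - r *\<^sub>R a) \<le> r * norm a"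
    using nonneg_spectrum_norm[OF assms(1) order_refl] assms(2) by (simp add: mult_left_mono)
qed

text \<open>A convergent sequence is bounded, so one \<open>s\<close> serves all its terms and the
  norm criterion passes to the limit.\<close>

lemma closed_nonneg_spectrum: "closed {a::'b::unital_cstar_algebra. nonneg_spectrum a}"
  unfolding closed_sequential_limits
proof (intro allI impI, elim conjE)
  fix x :: "nat \<Rightarrow> 'b" and l
  assume x: "\<forall>n. x n \<in> {a. nonneg_spectrum a}" and l: "x \<longlonglongrightarrow> l"
  have "Bseq x" using l by (rule convergent_imp_Bseq[OF convergentI])
  then obtain s where s: "\<And>n. norm (x n) \<le> s" by (auto simp: Bseq_def)
  have "(\<lambda>n. star (x n)) \<longlonglongrightarrow> star l"
    by (rule bounded_linear.tendsto[OF bounded_linear_star l])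
  moreover have "(\<lambda>n. star (x n)) = x" using x by (auto simp: nonneg_spectrum_def)
  ultimately have "star l = l" using l LIMSEQ_unique by metis
  moreover have "norm (of_real s - l) \<le> s"
    by (rule LIMSEQ_le_const2[OF tendsto_norm[OF tendsto_diff[OF tendsto_const l]]])
       (use nonneg_spectrum_norm[OF _ s] x in auto)
  ultimately show "l \<in> {a. nonneg_spectrum a}" using nonneg_spectrumI_norm by blast
qed

lemma nonneg_spectrum_antisym:
  assumes "nonneg_spectrum (a::'b::unital_cstar_algebra)" "nonneg_spectrum (- a)"
  shows "a = 0"
proof -
  have "norm a \<le> 0"
    using assms by (intro norm_le_of_invertible) (auto simp: nonneg_spectrum_def)
  then show ?thesis by simp
qed

text \<open>The factorisation \<open>t + a a = (a - i sqrt t) (a + i sqrt t)\<close> reduces the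
  claim to differences of \<open>a\<close> with nonzero imaginary numbers.\<close>

lemma nonneg_spectrum_square:
  assumes sa: "star (a::'b::unital_cstar_algebra) = a"
  shows "nonneg_spectrum (a * a)"
  unfolding nonneg_spectrum_def
proof (intro conjI allI impI)
  fix t :: real assume t: "t > 0"
  have "invertible_elem ((a - cscalar (\<i> * of_real (sqrt t))) * (a - cscalar (\<i> * of_real (- sqrt t))))"
    using t by (intro invertible_elem_mult self_adjoint_invertible_diff_imaginary sa) auto
  also have "(a - cscalar (\<i> * of_real (sqrt t))) * (a - cscalar (\<i> * of_real (- sqrt t))) = of_real t + a * a"
  proof -
    define k :: 'b where "k = cscalar (\<i> * of_real (sqrt t))"
    have "cscalar (\<i> * of_real (- sqrt t)) = - k"
      by (simp add: k_def cscalar_def scaleC_minus_left)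
    moreover have "a * k = k * a" by (simp add: k_def cscalar_mult_left cscalar_mult_right)
    moreover have "k * k = - of_real t"
    proof -
      have "k * k = cscalar (- complex_of_real (sqrt t * sqrt t))"
      proof -
        have "(\<i> * z) * (\<i> * z) = - (z * z)" for z by (simp add: algebra_simps)
        then show ?thesis
          unfolding k_def cscalar_mult_left by (simp only: cscalar_def scaleC_scaleC of_real_mult)
      qed
      then have "k * k = cscalar (- complex_of_real t)" using t by simp
      then show ?thesis by (metis cscalar_def cscalar_of_real scaleC_minus_left)
    qed
    ultimately show ?thesis unfolding k_def[symmetric] by (simp add: algebra_simps)
  qed
  finally show "invertible_elem (of_real t + a * a)" .
qed (simp add: star_mult sa)

section \<open>Square roots by the binomial series\<close>

definition sqrt_coeff :: "nat \<Rightarrow> real" where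
  "sqrt_coeff n = (1/2 gchoose n) * (- 1) ^ n"

lemma sqrt_coeff_0 [simp]: "sqrt_coeff 0 = 1"
  by (simp add: sqrt_coeff_def)

text \<open>\<open>sqrt_coeff\<close> lists the Taylor coefficients of \<open>sqrt (1 - x)\<close>
  at zero. After the first one they are nonpositive, because the Pochhammer symbol of
  \<open>-1/2\<close> has exactly one negative factor.\<close>

lemma sqrt_coeff_nonpos: "sqrt_coeff (Suc n) \<le> 0"
proof -
  have "pochhammer (- (1/2)) (Suc n) = - (1/2) * pochhammer (1/2 :: real) n"
    by (simp add: pochhammer_rec)
  moreover have "pochhammer (1/2 :: real) n \<ge> 0" by (rule pochhammer_nonneg) simp
  moreover have "sqrt_coeff (Suc n) = pochhammer (- (1/2)) (Suc n) / fact (Suc n)"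
    by (simp add: sqrt_coeff_def gbinomial_pochhammer power_mult_distrib[symmetric])
  ultimately show ?thesis by (simp add: divide_nonpos_pos)
qed

text \<open>The partial sums are the coefficients of \<open>sqrt (1 - x) / (1 - x)\<close>, that is,
  of the inverse square root of \<open>1 - x\<close>. Combined with the signs of the coefficients
  this gives absolute summability, so the series converges on the closed unit ball including its
  boundary.\<close>

lemma sqrt_coeff_sum_nonneg: "(\<Sum>k\<le>n. sqrt_coeff k) \<ge> 0"
proof -
  have "(\<Sum>k\<le>n. sqrt_coeff k) = (- 1) ^ n * (- (1/2) gchoose n)"
    unfolding sqrt_coeff_def by (subst gbinomial_sum_lower_neg) simp
  also have "\<dots> = pochhammer (1/2) n / fact n"
    by (simp add: gbinomial_pochhammer power_mult_distrib[symmetric])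
  also have "\<dots> \<ge> 0" by (intro divide_nonneg_nonneg pochhammer_nonneg) auto
  finally show ?thesis .
qed

lemma sqrt_coeff_abs_sum: "(\<Sum>k<n. \<bar>sqrt_coeff (Suc k)\<bar>) \<le> 1"
proof -
  have "(\<Sum>k<n. \<bar>sqrt_coeff (Suc k)\<bar>) = - (\<Sum>k<n. sqrt_coeff (Suc k))"
    using sqrt_coeff_nonpos by (simp add: sum_negf[symmetric] abs_of_nonpos)
  moreover have "(\<Sum>k\<le>n. sqrt_coeff k) = 1 + (\<Sum>k<n. sqrt_coeff (Suc k))"
    by (subst sum.atMost_shift) simp
  ultimately show ?thesis using sqrt_coeff_sum_nonneg[of n] by linarith
qed

lemma sqrt_coeff_summable: "summable (\<lambda>n. \<bar>sqrt_coeff n\<bar>)"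
proof -
  have "summable (\<lambda>n. \<bar>sqrt_coeff (Suc n)\<bar>)"
    by (rule summableI_nonneg_bounded[where x = 1]) (auto simp: sqrt_coeff_abs_sum)
  then show ?thesis by (subst (asm) summable_Suc_iff)
qed

lemma sqrt_coeff_suminf_Suc: "(\<Sum>n. \<bar>sqrt_coeff (Suc n)\<bar>) \<le> 1"
  by (rule suminf_le_const)
     (use sqrt_coeff_summable sqrt_coeff_abs_sum in \<open>auto simp: summable_Suc_iff[of "\<lambda>n. \<bar>sqrt_coeff n\<bar>"]\<close>)

text \<open>Vandermonde's identity with both upper indices \<open>1/2\<close>: the Cauchy square of
  the series is \<open>1 - x\<close>.\<close>

lemma sqrt_coeff_convolution:
  "(\<Sum>i\<le>n. sqrt_coeff i * sqrt_coeff (n - i)) = (if n = 0 then 1 else if n = 1 then - 1 else 0)"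
proof -
  have "(\<Sum>i\<le>n. sqrt_coeff i * sqrt_coeff (n - i)) =
      (\<Sum>i\<le>n. ((1/2 gchoose i) * (1/2 gchoose (n - i))) * (- 1) ^ n)"
    by (rule sum.cong) (auto simp: sqrt_coeff_def power_add[symmetric] algebra_simps)
  also have "\<dots> = ((1/2 + 1/2 :: real) gchoose n) * (- 1) ^ n"
    by (simp only: sum_distrib_right[symmetric] gbinomial_Vandermonde atMost_atLeast0)
  also have "\<dots> = (of_nat (1 choose n)) * (- 1) ^ n"
    by (simp add: binomial_gbinomial)
  also have "\<dots> = (if n = 0 then 1 else if n = 1 then - 1 else 0)"
    by (cases n) (auto simp: binomial_eq_0)
  finally show ?thesis .
qed

definition sqrt_series :: "'b::unital_cstar_algebra \<Rightarrow> 'b" where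
  "sqrt_series d = (\<Sum>n. sqrt_coeff n *\<^sub>R d ^ n)"

lemma sqrt_series_summable:
  assumes "norm (d::'b::unital_cstar_algebra) \<le> 1"
  shows "summable (\<lambda>n. norm (sqrt_coeff n *\<^sub>R d ^ n))"
proof (rule summable_comparison_test[OF _ sqrt_coeff_summable], intro exI allI impI)
  fix n
  have "norm (d ^ n) \<le> 1"
    using norm_power_ineq[of d n] power_le_one[OF norm_ge_zero assms, of n] by linarith
  then show "norm (norm (sqrt_coeff n *\<^sub>R d ^ n)) \<le> \<bar>sqrt_coeff n\<bar>"
    by (simp add: mult_left_le)
qed

lemma sqrt_series_square:
  assumes "norm (d::'b::unital_cstar_algebra) \<le> 1"
  shows "sqrt_series d * sqrt_series d = 1 - d"
proof -
  have "sqrt_series d * sqrt_series d =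
      (\<Sum>k. \<Sum>i\<le>k. (sqrt_coeff i *\<^sub>R d ^ i) * (sqrt_coeff (k - i) *\<^sub>R d ^ (k - i)))"
    unfolding sqrt_series_def by (rule Cauchy_product) (rule sqrt_series_summable[OF assms])+
  also have "\<dots> = (\<Sum>k. (if k = 0 then 1 else if k = 1 then - 1 else 0) *\<^sub>R d ^ k)"
  proof (rule suminf_cong)
    fix k
    have "(\<Sum>i\<le>k. (sqrt_coeff i *\<^sub>R d ^ i) * (sqrt_coeff (k - i) *\<^sub>R d ^ (k - i))) =
        (\<Sum>i\<le>k. (sqrt_coeff i * sqrt_coeff (k - i)) *\<^sub>R d ^ k)"
      by (rule sum.cong) (auto simp: power_add[symmetric])
    then show "(\<Sum>i\<le>k. (sqrt_coeff i *\<^sub>R d ^ i) * (sqrt_coeff (k - i) *\<^sub>R d ^ (k - i))) =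
        (if k = 0 then 1 else if k = 1 then - 1 else 0) *\<^sub>R d ^ k"
      by (simp only: scaleR_sum_left[symmetric] sqrt_coeff_convolution)
  qed
  also have "\<dots> = (\<Sum>k\<in>{0,1}. (if k = 0 then 1 else if k = 1 then - 1 else 0) *\<^sub>R d ^ k)"
    by (rule suminf_finite) auto
  also have "\<dots> = 1 - d" by simp
  finally show ?thesis .
qed

lemma sqrt_series_commutes:
  assumes "norm (d::'b::unital_cstar_algebra) \<le> 1" "d * x = x * d"
  shows "sqrt_series d * x = x * sqrt_series d"
proof -
  have s: "summable (\<lambda>n. sqrt_coeff n *\<^sub>R d ^ n)"
    by (rule summable_norm_cancel[OF sqrt_series_summable[OF assms(1)]])
  have "d ^ n * x = x * d ^ n" for n
    using assms(2) by (rule power_commuting_commutes)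
  then show ?thesis
    unfolding sqrt_series_def by (simp add: suminf_mult[OF s, symmetric] suminf_mult2[OF s])
qed

lemma sqrt_series_self_adjoint:
  assumes "norm (d::'b::unital_cstar_algebra) \<le> 1" "star d = d"
  shows "star (sqrt_series d) = sqrt_series d"
  unfolding sqrt_series_def
  by (subst bounded_linear.suminf[OF bounded_linear_star summable_norm_cancel[OF sqrt_series_summable[OF assms(1)]]])
     (simp add: star_scaleR star_power assms(2))

text \<open>The coefficients after the first have absolute sum at most \<open>1\<close>. This is the
  norm criterion with \<open>s = 1\<close>, by which the root itself has nonnegative
  spectrum.\<close>

lemma norm_one_minus_sqrt_series:
  assumes "norm (d::'b::unital_cstar_algebra) \<le> 1"
  shows "norm (1 - sqrt_series d) \<le> 1"
proof -
  let ?f = "\<lambda>n. sqrt_coeff n *\<^sub>R d ^ n"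
  have s: "summable (\<lambda>n. norm (?f n))" by (rule sqrt_series_summable[OF assms])
  have "sqrt_series d = 1 + (\<Sum>n. ?f (Suc n))"
    unfolding sqrt_series_def using suminf_split_head[OF summable_norm_cancel[OF s]] by simp
  then have "norm (1 - sqrt_series d) = norm (\<Sum>n. ?f (Suc n))" by simp
  also have "\<dots> \<le> (\<Sum>n. norm (?f (Suc n)))"
    by (rule summable_norm) (use s in \<open>subst summable_Suc_iff\<close>)
  also have "\<dots> \<le> (\<Sum>n. \<bar>sqrt_coeff (Suc n)\<bar>)"
  proof (rule suminf_le)
    show "norm (?f (Suc n)) \<le> \<bar>sqrt_coeff (Suc n)\<bar>" for n
      using norm_power_ineq[of d "Suc n"] power_le_one[OF norm_ge_zero assms, of "Suc n"]
      by (simp only: norm_scaleR) (rule mult_left_le; linarith)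
    show "summable (\<lambda>n. norm (?f (Suc n)))" using s by (subst summable_Suc_iff)
    show "summable (\<lambda>n. \<bar>sqrt_coeff (Suc n)\<bar>)" using sqrt_coeff_summable by (subst summable_Suc_iff)
  qed
  also have "\<dots> \<le> 1" by (rule sqrt_coeff_suminf_Suc)
  finally show ?thesis .
qed

lemma nonneg_spectrum_sqrt:
  assumes a: "nonneg_spectrum (a::'b::unital_cstar_algebra)"
  obtains s where "nonneg_spectrum s" "s * s = a" "\<And>x. a * x = x * a \<Longrightarrow> s * x = x * s"
proof -
  \<comment> \<open>Rescaling by \<open>t\<close> writes \<open>a\<close> as
    \<open>t (1 - d)\<close> with \<open>norm d \<le> 1\<close>; the summand \<open>1\<close> covers
    \<open>a = 0\<close>.\<close>
  define t where "t = norm a + 1"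
  have t: "t > 0" using norm_ge_zero[of a] unfolding t_def by linarith
  define d where "d = 1 - (1 / t) *\<^sub>R a"
  have "d = (1 / t) *\<^sub>R (of_real t - a)"
    using t by (simp add: d_def scaleR_right_diff_distrib of_real_def)
  moreover have "norm (of_real t - a) \<le> t"
    by (rule nonneg_spectrum_norm[OF a]) (simp add: t_def)
  ultimately have d: "norm d \<le> 1" using t by simp
  have sa: "star a = a" using a by (simp add: nonneg_spectrum_def)
  have sd: "star d = d" by (simp add: d_def star_diff star_scaleR sa)
  show ?thesis
  proof (rule that[of "sqrt t *\<^sub>R sqrt_series d"])
    have "nonneg_spectrum (sqrt_series d)"
      using norm_one_minus_sqrt_series[OF d] sqrt_series_self_adjoint[OF d sd]
      by (intro nonneg_spectrumI_norm[where s = 1]) auto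
    then show "nonneg_spectrum (sqrt t *\<^sub>R sqrt_series d)"
      using t by (intro nonneg_spectrum_scaleR) auto
    show "(sqrt t *\<^sub>R sqrt_series d) * (sqrt t *\<^sub>R sqrt_series d) = a"
    proof -
      have "(sqrt t *\<^sub>R sqrt_series d) * (sqrt t *\<^sub>R sqrt_series d) = t *\<^sub>R (1 - d)"
        using t by (simp add: sqrt_series_square[OF d])
      then show ?thesis using t by (simp add: d_def)
    qed
    show "(sqrt t *\<^sub>R sqrt_series d) * x = x * (sqrt t *\<^sub>R sqrt_series d)" if "a * x = x * a" for x
      using sqrt_series_commutes[OF d, of x] that by (simp add: d_def algebra_simps)
  qed
qed

section \<open>Commuting products and the positivity of \<open>star x * x\<close>\<close>

lemma nonneg_spectrum_mult:
  assumes a: "nonneg_spectrum (a::'b::unital_cstar_algebra)" and b: "nonneg_spectrum b"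
    and ab: "a * b = b * a"
  shows "nonneg_spectrum (a * b)"
proof -
  obtain s where s: "nonneg_spectrum s" "s * s = a" "\<And>x. a * x = x * a \<Longrightarrow> s * x = x * s"
    using nonneg_spectrum_sqrt[OF a] by blast
  obtain r where r: "nonneg_spectrum r" "r * r = b" "\<And>x. b * x = x * b \<Longrightarrow> r * x = x * r"
    using nonneg_spectrum_sqrt[OF b] by blast
  have "r * s = s * r" using s(3)[OF ab] r(3)[of s] by simp
  then have "a * b = (s * r) * (s * r)" "star (s * r) = s * r"
    using s(1,2) r(1,2) by (auto simp: mult.assoc star_mult nonneg_spectrum_def)
      (metis mult.assoc)
  then show ?thesis using nonneg_spectrum_square by metis
qed

text \<open>If \<open>c\<close> inverts \<open>t + x y\<close>, then \<open>(1 - y c x) / t\<close>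
  inverts \<open>t + y x\<close>. Consequently \<open>x y\<close> and \<open>y x\<close> have the
  same negative spectral values.\<close>

lemma invertible_elem_of_real_add_swap:
  assumes t: "t > 0" and inv: "invertible_elem (of_real t + x * (y::'b::unital_cstar_algebra))"
  shows "invertible_elem (of_real t + y * x)"
proof -
  obtain c where c: "(of_real t + x * y) * c = 1" "c * (of_real t + x * y) = 1"
    using inv by (auto simp: invertible_elem_def)
  define b where "b = (1 / t) *\<^sub>R (1 - y * c * x)"
  have ofr: "of_real t * z = t *\<^sub>R z" "z * of_real t = t *\<^sub>R z" for z :: 'b
    by (simp_all add: of_real_def)
  have c': "x * y * c = 1 - t *\<^sub>R c" "c * (x * y) = 1 - t *\<^sub>R c"
    using c by (simp_all add: algebra_simps ofr eq_diff_eq)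
  have "(of_real t + y * x) * (1 - y * c * x) =
      of_real t - t *\<^sub>R (y * c * x) + y * x - y * (x * y * c) * x"
    by (simp add: algebra_simps ofr)
  also have "\<dots> = of_real t" by (simp only: c') (simp add: algebra_simps)
  finally have 1: "(of_real t + y * x) * b = 1" using t by (simp add: b_def) (simp add: of_real_def)
  have "(1 - y * c * x) * (of_real t + y * x) =
      of_real t - t *\<^sub>R (y * c * x) + y * x - y * (c * (x * y)) * x"
    by (simp add: algebra_simps ofr) (simp add: of_real_def)
  also have "\<dots> = of_real t" by (simp only: c') (simp add: algebra_simps)
  finally have 2: "b * (of_real t + y * x) = 1" using t by (simp add: b_def) (simp add: of_real_def)
  show ?thesis using 1 2 by (auto simp: invertible_elem_def)
qed

text \<open>For \<open>y = u + i v\<close> with self-adjoint \<open>u\<close> and \<open>v\<close>,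
  the sum of \<open>y* y\<close> and \<open>y y*\<close> is \<open>2 (u u + v v)\<close>. If
  \<open>- y* y\<close> has nonnegative spectrum, so has \<open>- y y*\<close> by the swap of
  factors; the identity then makes \<open>y* y\<close> nonnegative as well, hence zero.\<close>

lemma star_mult_neg_imp_zero:
  assumes "nonneg_spectrum (- (star y * (y::'b::unital_cstar_algebra)))"
  shows "y = 0"
proof -
  have sa: "star (star y * y) = star y * y" "star (y * star y) = y * star y"
    by (simp_all add: star_mult star_star)
  have "nonneg_spectrum (- (y * star y))"
    unfolding nonneg_spectrum_def
  proof (intro conjI allI impI)
    fix t :: real assume t: "t > 0"
    have "invertible_elem (of_real t + star y * (- y))"
      using assms t by (auto simp: nonneg_spectrum_def)
    from invertible_elem_of_real_add_swap[OF t this]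
    show "invertible_elem (of_real t + - (y * star y))" by simp
  qed (simp add: star_minus sa)
  define u where "u = (1/2) *\<^sub>R (y + star y)"
  define v where "v = cscalar (- \<i> / 2) * (y - star y)"
  have u: "star u = u" by (simp add: u_def star_scaleR star_add star_star add.commute)
  have v: "star v = v"
    by (simp add: v_def cscalar_mult_left star_scaleC star_diff star_star scaleC_minus_left[of "\<i>/2"] scaleC_diff_right)
  have "v * v = scaleC ((- \<i> / 2) * (- \<i> / 2)) ((y - star y) * (y - star y))"
    unfolding v_def cscalar_mult_left by (simp only: scaleC_mult_left scaleC_mult_right scaleC_scaleC)
  also have "(- \<i> / 2) * (- \<i> / 2) = complex_of_real (- 1/4)" by (simp add: complex_eq_iff)
  finally have vv: "v * v = - ((1/4) *\<^sub>R ((y - star y) * (y - star y)))" by (simp only: scaleC_of_real) simp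
  have "u * u = (1/4) *\<^sub>R ((y + star y) * (y + star y))" by (simp add: u_def)
  then have "2 *\<^sub>R (u * u + v * v) = (1/2) *\<^sub>R ((y + star y) * (y + star y) - (y - star y) * (y - star y))"
    by (simp add: vv scaleR_right_diff_distrib)
  also have "(y + star y) * (y + star y) - (y - star y) * (y - star y) = 2 *\<^sub>R (star y * y + y * star y)"
    by (simp add: algebra_simps scaleR_2)
  finally have "star y * y = 2 *\<^sub>R (u * u + v * v) + - (y * star y)" by simp
  moreover have "nonneg_spectrum (2 *\<^sub>R (u * u + v * v) + - (y * star y))"
    using nonneg_spectrum_square[OF u] nonneg_spectrum_square[OF v] \<open>nonneg_spectrum (- (y * star y))\<close>
    by (intro nonneg_spectrum_add nonneg_spectrum_scaleR) auto
  ultimately have "star y * y = 0" using nonneg_spectrum_antisym assms by metis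
  then show ?thesis using cstar_identity[of y] by simp
qed

text \<open>With \<open>a = x\<^sup>* x\<close>, \<open>r = \<bar>a\<bar>\<close> and \<open>p = r - a\<close> (twice the negative part), the element
  \<open>y = x p\<close> satisfies \<open>y\<^sup>* y = - r p\<^sup>2\<close>.\<close>

lemma nonneg_spectrum_star_mult: "nonneg_spectrum (star x * (x::'b::unital_cstar_algebra))"
proof -
  define a where "a = star x * x"
  have sa: "star a = a" by (simp add: a_def star_mult star_star)
  obtain r where r: "nonneg_spectrum r" "r * r = a * a" "\<And>x. a * a * x = x * (a * a) \<Longrightarrow> r * x = x * r"
    using nonneg_spectrum_sqrt[OF nonneg_spectrum_square[OF sa]] by blast
  have ra: "r * a = a * r" by (rule r(3)) (simp add: mult.assoc)
  define p where "p = r - a"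
  have sp: "star p = p" using r(1) sa by (simp add: p_def star_diff nonneg_spectrum_def)
  have rp: "r * p = p * r" using ra by (simp add: p_def algebra_simps)
  have "p * p = r * r - r * a - a * r + a * a" by (simp add: p_def algebra_simps)
  then have pp: "p * p = 2 *\<^sub>R (r * p)" using r(2) ra by (simp add: p_def algebra_simps scaleR_2)
  have "star (x * p) * (x * p) = p * a * p" by (simp add: star_mult sp a_def mult.assoc)
  also have "\<dots> = p * (r - p) * p" by (simp add: p_def)
  also have "\<dots> = r * (p * p) - p * (p * p)" using rp by (simp add: algebra_simps) (metis mult.assoc)
  also have "p * (p * p) = 2 *\<^sub>R (r * (p * p))"
    by (metis pp mult.assoc mult_scaleR_right rp mult_scaleR_left)
  finally have "star (x * p) * (x * p) = - (r * (p * p))" by (simp add: scaleR_2)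
  moreover have "nonneg_spectrum (r * (p * p))"
    by (rule nonneg_spectrum_mult[OF r(1) nonneg_spectrum_square[OF sp]]) (metis rp mult.assoc)
  ultimately have "x * p = 0" by (intro star_mult_neg_imp_zero) simp
  then have "r * (p * p) = 0" using \<open>star (x * p) * (x * p) = - (r * (p * p))\<close> by simp
  then have "p * (p * p) = 0" using \<open>p * (p * p) = 2 *\<^sub>R (r * (p * p))\<close> by simp
  then have "(p * p) * (p * p) = 0" by (simp add: mult.assoc)
  then have "p * p = 0" by (intro norm_mult_self_adjoint_eq_0[of "p * p"]) (auto simp: star_mult sp)
  then have "p = 0" using sp norm_mult_self_adjoint_eq_0 by blast
  then show ?thesis using r(1) by (simp add: p_def a_def)
qed

section \<open>The cone of positive elements\<close>

definition positive_elem :: "'b::unital_cstar_algebra \<Rightarrow> bool" where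
  "positive_elem a \<longleftrightarrow> (\<exists>x. a = star x * x)"

text \<open>The spectral side supplies sums, limits and norm estimates, the factorised side
  conjugation and preservation under homomorphisms.\<close>

lemma positive_elem_iff_nonneg_spectrum: "positive_elem a \<longleftrightarrow> nonneg_spectrum (a::'b::unital_cstar_algebra)"
proof
  assume "nonneg_spectrum a"
  then obtain s where "nonneg_spectrum s" "s * s = a" using nonneg_spectrum_sqrt by blast
  then show "positive_elem a" unfolding positive_elem_def nonneg_spectrum_def by metis
qed (auto simp: positive_elem_def nonneg_spectrum_star_mult)

lemma positive_elem_star_mult [simp]: "positive_elem (star x * (x::'b::unital_cstar_algebra))"
  by (auto simp: positive_elem_def)

lemma positive_elem_zero [simp]: "positive_elem (0::'b::unital_cstar_algebra)"
  using positive_elem_star_mult[of "0::'b"] by simp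

lemma positive_elem_one [simp]: "positive_elem (1::'b::unital_cstar_algebra)"
  using positive_elem_star_mult[of "1::'b"] by simp

lemma positive_elem_add:
  "positive_elem a \<Longrightarrow> positive_elem b \<Longrightarrow> positive_elem (a + b :: 'b::unital_cstar_algebra)"
  by (simp add: positive_elem_iff_nonneg_spectrum nonneg_spectrum_add)

lemma positive_elem_scaleR:
  "positive_elem a \<Longrightarrow> r \<ge> 0 \<Longrightarrow> positive_elem (r *\<^sub>R a :: 'b::unital_cstar_algebra)"
  by (simp add: positive_elem_iff_nonneg_spectrum nonneg_spectrum_scaleR)

lemma positive_elem_sum:
  "(\<And>i. i \<in> A \<Longrightarrow> positive_elem (f i :: 'b::unital_cstar_algebra)) \<Longrightarrow> positive_elem (sum f A)"
  by (induction A rule: infinite_finite_induct) (auto simp: positive_elem_add)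

lemma positive_elem_conj:
  "positive_elem a \<Longrightarrow> positive_elem (star x * a * x :: 'b::unital_cstar_algebra)"
  unfolding positive_elem_def by (metis mult.assoc star_mult)

lemma positive_elem_self_adjoint: "positive_elem a \<Longrightarrow> star a = (a :: 'b::unital_cstar_algebra)"
  by (auto simp: positive_elem_def star_mult star_star)

lemma closed_positive_elem: "closed {a::'b::unital_cstar_algebra. positive_elem a}"
  by (simp add: positive_elem_iff_nonneg_spectrum closed_nonneg_spectrum)

lemma positive_elem_of_real_minus:
  assumes "star a = (a::'b::unital_cstar_algebra)" "norm a \<le> t"
  shows "positive_elem (of_real t - a)" "positive_elem (of_real t + a)"
  using assms
  by (auto simp: positive_elem_iff_nonneg_spectrum star_add star_diff intro!: nonneg_spectrumI_norm[where s = t])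

lemma positive_elem_norm_le:
  assumes "positive_elem a" "positive_elem (of_real t - (a::'b::unital_cstar_algebra))" "t \<ge> 0"
  shows "norm a \<le> t"
proof (rule norm_le_of_invertible)
  fix r assume r: "r > t"
  show "invertible_elem (of_real r + a)"
    using assms(1,3) r by (simp add: positive_elem_iff_nonneg_spectrum nonneg_spectrum_def)
  have "invertible_elem (of_real (r - t) + (of_real t - a))"
    using assms(2) r unfolding positive_elem_iff_nonneg_spectrum nonneg_spectrum_def
    by (metis diff_gt_0_iff_gt)
  then show "invertible_elem (of_real r - a)" by simp
qed (use assms positive_elem_self_adjoint in auto)

section \<open>Matrices over the algebra\<close>

definition inner_seq :: "nat \<Rightarrow> (nat \<Rightarrow> 'b::unital_cstar_algebra) \<Rightarrow> (nat \<Rightarrow> 'b) \<Rightarrow> 'b" where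
  "inner_seq k v w = (\<Sum>i<k. star (v i) * w i)"

definition apply_seq :: "nat \<Rightarrow> (nat \<Rightarrow> nat \<Rightarrow> 'b::unital_cstar_algebra) \<Rightarrow> (nat \<Rightarrow> 'b) \<Rightarrow> nat \<Rightarrow> 'b" where
  "apply_seq k X v i = (\<Sum>j<k. X i j * v j)"

definition qform :: "nat \<Rightarrow> (nat \<Rightarrow> nat \<Rightarrow> 'b::unital_cstar_algebra) \<Rightarrow> (nat \<Rightarrow> 'b) \<Rightarrow> 'b" where
  "qform k X v = (\<Sum>i<k. \<Sum>j<k. star (v i) * X i j * v j)"

text \<open>Positivity of an operator on the Hilbert module \<open>B^k\<close>. Matrices and columns
  are plain functions of which only the indices below \<open>k\<close> count, so that no carrier
  conditions arise.\<close>

definition form_positive :: "nat \<Rightarrow> (nat \<Rightarrow> nat \<Rightarrow> 'b::unital_cstar_algebra) \<Rightarrow> bool" where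
  "form_positive k X \<longleftrightarrow> (\<forall>v. positive_elem (qform k X v))"

definition unit_seq :: "nat \<Rightarrow> nat \<Rightarrow> 'b::unital_cstar_algebra" where
  "unit_seq j i = (if i = j then 1 else 0)"

lemma qform_eq_inner: "qform k X v = inner_seq k v (apply_seq k X v)"
  by (simp add: qform_def inner_seq_def apply_seq_def sum_distrib_left mult.assoc)

lemma inner_seq_diff_right: "inner_seq k v (\<lambda>i. w i - u i) = inner_seq k v w - inner_seq k v u"
  by (simp add: inner_seq_def algebra_simps sum_subtractf)

lemma inner_seq_diff_left: "inner_seq k (\<lambda>i. w i - u i) v = inner_seq k w v - inner_seq k u v"
  by (simp add: inner_seq_def star_diff algebra_simps sum_subtractf)

lemma inner_seq_self_positive: "positive_elem (inner_seq k v v)"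
  unfolding inner_seq_def by (intro positive_elem_sum) simp

lemma apply_seq_diff: "apply_seq k X (\<lambda>i. w i - u i) = (\<lambda>i. apply_seq k X w i - apply_seq k X u i)"
  by (rule ext) (simp add: apply_seq_def algebra_simps sum_subtractf)

lemma inner_apply_hermitian:
  assumes "\<And>i j. i < k \<Longrightarrow> j < k \<Longrightarrow> star (X i j) = X j i"
  shows "inner_seq k (apply_seq k X v) w = inner_seq k v (apply_seq k X w)"
proof -
  have "inner_seq k (apply_seq k X v) w = (\<Sum>i<k. \<Sum>j<k. star (v j) * X j i * w i)"
    unfolding inner_seq_def apply_seq_def
    by (simp add: star_sum star_mult sum_distrib_right assms)
  also have "\<dots> = (\<Sum>j<k. \<Sum>i<k. star (v j) * X j i * w i)" by (rule sum.swap)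
  also have "\<dots> = inner_seq k v (apply_seq k X w)"
    by (simp add: inner_seq_def apply_seq_def sum_distrib_left mult.assoc)
  finally show ?thesis .
qed

lemma qform_two_point:
  assumes "i < k" "j < k"
  shows "qform k X (\<lambda>l. (if l = i then a else 0) + (if l = j then b else 0)) =
    star a * X i i * a + star a * X i j * b + star b * X j i * a + star b * X j j * b"
proof -
  let ?v = "\<lambda>l. (if l = i then a else 0) + (if l = j then b else 0)"
  have m: "x * (if P then y else 0) = (if P then x * y else 0)"
    "(if P then y else 0) * x = (if P then y * x else 0)" for P and x y :: 'a by simp_all
  have 1: "apply_seq k X ?v l = X l i * a + X l j * b" for l
    unfolding apply_seq_def distrib_left sum.distrib m using assms by simp
  have st: "star (if P then x else 0) = (if P then star x else 0)" for P and x :: 'a by simp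
  have "inner_seq k ?v w = star a * w i + star b * w j" for w
    unfolding inner_seq_def star_add st distrib_right sum.distrib m using assms by simp
  then show ?thesis by (simp add: qform_eq_inner 1 distrib_left mult.assoc)
qed

text \<open>Polarization over the columns with \<open>1\<close> in place \<open>i\<close> and
  \<open>z\<close> in place \<open>j\<close>, where \<open>z\<close> runs through the fourth roots
  of unity. For \<open>i = j\<close> the two entries of the column are added, and the formulas
  remain valid.\<close>

lemma polarization_entry:
  fixes k :: nat and X :: "nat \<Rightarrow> nat \<Rightarrow> 'a::unital_cstar_algebra"
  assumes "i < k" "j < k"
  defines "f \<equiv> \<lambda>z. qform k X (\<lambda>l. (if l = i then 1 else 0) + (if l = j then cscalar z else 0))"
  shows "4 *\<^sub>R X i j = f 1 - f (- 1) - scaleC \<i> (f \<i>) + scaleC \<i> (f (- \<i>))"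
    and "4 *\<^sub>R X j i = f 1 - f (- 1) + scaleC \<i> (f \<i>) - scaleC \<i> (f (- \<i>))"
proof -
  have f: "f z = X i i + scaleC z (X i j) + scaleC (cnj z) (X j i) + scaleC (cnj z * z) (X j j)" for z
    unfolding f_def qform_two_point[OF assms(1,2)]
    by (simp add: cscalar_mult_left cscalar_mult_right star_scaleC cscalar_def scaleC_mult_left
        scaleC_mult_right scaleC_scaleC mult.commute)
  have 4: "4 *\<^sub>R (x::'a) = x + x + x + x" for x
  proof -
    have "4 *\<^sub>R x = (1 + 1 + 1 + 1 :: real) *\<^sub>R x" by simp
    then show ?thesis by (simp only: scaleR_left_distrib scaleR_one)
  qed
  show "4 *\<^sub>R X i j = f 1 - f (- 1) - scaleC \<i> (f \<i>) + scaleC \<i> (f (- \<i>))"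
    by (simp add: f 4 scaleC_add_right scaleC_diff_right scaleC_scaleC scaleC_minus_left scaleC_minus_right)
  show "4 *\<^sub>R X j i = f 1 - f (- 1) + scaleC \<i> (f \<i>) - scaleC \<i> (f (- \<i>))"
    by (simp add: f 4 scaleC_add_right scaleC_diff_right scaleC_scaleC scaleC_minus_left scaleC_minus_right)
qed

text \<open>All values of the form are self-adjoint, and taking adjoints in the polarization formula
  for \<open>X i j\<close> yields the one for \<open>X j i\<close>.\<close>

lemma form_positive_hermitian:
  assumes X: "form_positive k X" and ij: "i < k" "j < k"
  shows "star (X i j) = X j i"
proof -
  have s: "star (qform k X v) = qform k X v" for v
    using X by (simp add: form_positive_def positive_elem_self_adjoint)
  have "4 *\<^sub>R star (X i j) = 4 *\<^sub>R X j i"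
    unfolding star_scaleR[symmetric] polarization_entry[OF ij, of X]
    by (simp add: star_add star_diff star_scaleC s scaleC_minus_left)
  then show ?thesis by simp
qed

text \<open>The columns for \<open>z\<close> and \<open>- z\<close> have inner squares adding up to
  \<open>4\<close>, so every form value used in polarization has norm at most \<open>4\<close>. The
  constant does not depend on \<open>X\<close>, which later bounds the entries of all powers of a
  contraction at once.\<close>

lemma form_positive_entry_norm:
  assumes X: "form_positive k X"
    and le: "\<And>v. positive_elem (inner_seq k v v - qform k X v)" and ij: "i < k" "j < k"
  shows "norm (X i j) \<le> 4"
proof -
  define f where "f z = qform k X (\<lambda>l. (if l = i then 1 else 0) + (if l = j then cscalar z else 0))" for z
  have b: "norm (f z) \<le> 4" if "cmod z = 1" for z
  proof (rule positive_elem_norm_le)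
    let ?v = "\<lambda>l. (if l = i then 1 else 0) + (if l = j then cscalar z else 0) :: 'a"
    let ?w = "\<lambda>l. (if l = i then 1 else 0) + (if l = j then cscalar (- z) else 0) :: 'a"
    show "positive_elem (f z)" using X by (simp add: f_def form_positive_def)
    have zz: "cnj z * z = 1" "z * cnj z = 1"
      using that complex_norm_square[of z] by (simp_all add: mult.commute)
    have in2: "inner_seq k v v = qform k unit_seq v" for v :: "nat \<Rightarrow> 'a"
      by (simp add: inner_seq_def qform_def unit_seq_def if_distrib if_distribR cong: if_cong)
    have "inner_seq k ?v ?v + inner_seq k ?w ?w = 4"
      unfolding in2 qform_two_point[OF ij] using zz
      by (simp add: unit_seq_def cscalar_def star_scaleC star_minus scaleC_mult_left scaleC_mult_right
          scaleC_scaleC scaleC_minus_left scaleC_minus_right)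
    moreover have "a + b = 4 \<Longrightarrow> of_real 4 - q = (a - q) + b" for a b q :: 'a
      by (simp add: algebra_simps)
    ultimately have "of_real 4 - f z = (inner_seq k ?v ?v - qform k X ?v) + inner_seq k ?w ?w"
      unfolding f_def by blast
    then show "positive_elem (of_real 4 - f z)"
      using positive_elem_add[OF le[of ?v] inner_seq_self_positive[of k ?w]] by metis
  qed simp
  have "norm (4 *\<^sub>R X i j) \<le> norm (f 1) + norm (f (- 1)) + norm (scaleC \<i> (f \<i>)) + norm (scaleC \<i> (f (- \<i>)))"
    unfolding polarization_entry(1)[OF ij, of X] f_def[symmetric]
    using norm_triangle_ineq[of "f 1 - f (- 1) - scaleC \<i> (f \<i>)" "scaleC \<i> (f (- \<i>))"]
      norm_triangle_ineq4[of "f 1 - f (- 1)" "scaleC \<i> (f \<i>)"]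
      norm_triangle_ineq4[of "f 1" "f (- 1)"] by linarith
  also have "\<dots> \<le> 4 + 4 + 4 + 4"
    unfolding norm_scaleC using b[of 1] b[of "-1"] b[of \<i>] b[of "-\<i>"] by simp
  finally show ?thesis by simp
qed

text \<open>For \<open>s\<close> above the norms of all entries, completing the square gives
  \<open>x* X i j y + y* X j i x \<le> s x* x + s y* y\<close>. Summation over all pairs of indices
  bounds the form by \<open>k s\<close> times the inner square.\<close>

lemma qform_le_scaled:
  assumes X: "form_positive k X"
  obtains t where "t > 0" "\<And>v. positive_elem (t *\<^sub>R inner_seq k v v - qform k X v)"
proof -
  define s where "s = 1 + (\<Sum>i<k. \<Sum>j<k. norm (X i j))"
  have s0: "s > 0" unfolding s_def by (intro add_pos_nonneg sum_nonneg) auto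
  have s: "norm (X i j) \<le> s" if "i < k" "j < k" for i j
  proof -
    have "norm (X i j) \<le> (\<Sum>j<k. norm (X i j))"
      by (rule member_le_sum) (use that in auto)
    also have "\<dots> \<le> (\<Sum>i<k. \<Sum>j<k. norm (X i j))"
      by (rule member_le_sum[where f = "\<lambda>i. \<Sum>j<k. norm (X i j)"]) (use that in \<open>auto intro: sum_nonneg\<close>)
    finally show ?thesis by (simp add: s_def)
  qed
  have herm: "star (X i j) = X j i" if "i < k" "j < k" for i j
    using form_positive_hermitian[OF X that] .
  have 1: "positive_elem (s *\<^sub>R (star x * x) + s *\<^sub>R (star y * y) - star x * X i j * y - star y * X j i * x)"
    if ij: "i < k" "j < k" for i j x y
  proof -
    let ?a = "X i j"
    have "norm (star ?a * ?a) \<le> s\<^sup>2"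
      using s[OF ij] by (simp add: cstar_identity power_mono)
    then have "positive_elem (of_real (s\<^sup>2) - star ?a * ?a)"
      by (intro positive_elem_of_real_minus) (simp_all add: star_mult star_star)
    then have "positive_elem ((1/s) *\<^sub>R (star y * (of_real (s\<^sup>2) - star ?a * ?a) * y))"
      using s0 by (intro positive_elem_scaleR positive_elem_conj) auto
    moreover have "positive_elem ((1/s) *\<^sub>R (star (s *\<^sub>R x - ?a * y) * (s *\<^sub>R x - ?a * y)))"
      using s0 by (intro positive_elem_scaleR) auto
    ultimately have "positive_elem ((1/s) *\<^sub>R (star y * (of_real (s\<^sup>2) - star ?a * ?a) * y) +
        (1/s) *\<^sub>R (star (s *\<^sub>R x - ?a * y) * (s *\<^sub>R x - ?a * y)))" by (rule positive_elem_add)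
    also have "(1/s) *\<^sub>R (star y * (of_real (s\<^sup>2) - star ?a * ?a) * y) +
        (1/s) *\<^sub>R (star (s *\<^sub>R x - ?a * y) * (s *\<^sub>R x - ?a * y)) =
        s *\<^sub>R (star x * x) + s *\<^sub>R (star y * y) - star x * ?a * y - star y * X j i * x"
    proof -
      have e1: "star y * (of_real (s\<^sup>2) - star ?a * ?a) * y = (s * s) *\<^sub>R (star y * y) - star y * star ?a * ?a * y"
        by (simp add: of_real_def power2_eq_square algebra_simps)
      have e2: "star (s *\<^sub>R x - ?a * y) * (s *\<^sub>R x - ?a * y) = (s * s) *\<^sub>R (star x * x)
          - s *\<^sub>R (star x * ?a * y) - s *\<^sub>R (star y * star ?a * x) + star y * star ?a * ?a * y"
        by (simp add: star_diff star_scaleR star_mult algebra_simps)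
      show ?thesis unfolding e1 e2 herm[OF ij, symmetric] using s0
        by (simp add: scaleR_add_right scaleR_diff_right)
    qed
    finally show ?thesis .
  qed
  \<comment> \<open>The summand \<open>1\<close> keeps the factor positive even for
    \<open>k = 0\<close>.\<close>
  have "positive_elem ((real k * s + 1) *\<^sub>R inner_seq k v v - qform k X v)" for v
  proof -
    have "positive_elem (\<Sum>i<k. \<Sum>j<k. s *\<^sub>R (star (v i) * v i) + s *\<^sub>R (star (v j) * v j)
        - star (v i) * X i j * v j - star (v j) * X j i * v i)" (is "positive_elem ?S")
      by (intro positive_elem_sum 1) auto
    then have "positive_elem ((1/2) *\<^sub>R ?S + inner_seq k v v)"
      by (intro positive_elem_add positive_elem_scaleR inner_seq_self_positive) auto
    also have "?S = (real k * s) *\<^sub>R inner_seq k v v + (real k * s) *\<^sub>R inner_seq k v v - qform k X v - qform k X v"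
    proof -
      have a: "(\<Sum>i<k. \<Sum>j<k. s *\<^sub>R (star (v i) * v i)) = (real k * s) *\<^sub>R inner_seq k v v"
        by (simp only: inner_seq_def scaleR_sum_right sum_constant_scaleR card_lessThan scaleR_scaleR)
      have b: "(\<Sum>i<k. \<Sum>j<k. s *\<^sub>R (star (v j) * v j)) = (real k * s) *\<^sub>R inner_seq k v v"
        by (simp only: inner_seq_def scaleR_sum_right sum_constant_scaleR card_lessThan scaleR_scaleR)
      have c: "(\<Sum>i<k. \<Sum>j<k. star (v j) * X j i * v i) = qform k X v"
        unfolding qform_def by (rule sum.swap)
      show ?thesis by (simp only: sum_subtractf sum.distrib a b c) (simp add: qform_def)
    qed
    also have "(1/2) *\<^sub>R \<dots> + inner_seq k v v = (real k * s + 1) *\<^sub>R inner_seq k v v - qform k X v"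
      by (simp add: algebra_simps) (simp add: scaleR_2[symmetric] scaleR_left_distrib[symmetric])
    finally show ?thesis .
  qed
  moreover have "real k * s + 1 > 0" using s0 by (intro add_nonneg_pos) auto
  ultimately show ?thesis using that by blast
qed

section \<open>Powers of a positive contraction and square roots of matrices\<close>

lemma iterate_hermitian:
  assumes "\<And>v w. inner_seq k (T v) w = inner_seq k v (T w)"
  shows "inner_seq k ((T ^^ n) v) w = inner_seq k v ((T ^^ n) w)"
  by (induction n arbitrary: v w) (auto simp: assms funpow_swap1)

text \<open>Even powers are inner squares of \<open>(T ^^ m) v\<close> and odd powers are values of
  the form at \<open>(T ^^ m) v\<close>, which gives positivity. The upper bound holds because the
  powers decrease.\<close>

lemma contraction_powers:
  fixes k :: nat and C :: "nat \<Rightarrow> nat \<Rightarrow> 'b::unital_cstar_algebra"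
  defines "T \<equiv> apply_seq k C"
  assumes C: "form_positive k C" and le: "\<And>v. positive_elem (inner_seq k v v - qform k C v)"
  shows "positive_elem (inner_seq k v ((T ^^ n) v))"
    and "positive_elem (inner_seq k v v - inner_seq k v ((T ^^ n) v))"
proof -
  have h1: "inner_seq k (T v) w = inner_seq k v (T w)" for v w
    unfolding T_def by (rule inner_apply_hermitian) (rule form_positive_hermitian[OF C])
  note h = iterate_hermitian[of k T, OF h1]
  have p: "positive_elem (inner_seq k v (T v))" for v
    using C by (simp add: T_def form_positive_def qform_eq_inner)
  have l: "positive_elem (inner_seq k v v - inner_seq k v (T v))" for v
    using le by (simp add: T_def qform_eq_inner)
  have e: "inner_seq k v ((T ^^ (2 * m)) v) = inner_seq k ((T ^^ m) v) ((T ^^ m) v)"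
    "inner_seq k v ((T ^^ (2 * m + 1)) v) = inner_seq k ((T ^^ m) v) (T ((T ^^ m) v))"
    "inner_seq k v ((T ^^ (2 * m + 2)) v) = inner_seq k (T ((T ^^ m) v)) (T ((T ^^ m) v))" for m v
    using h[of m v] h[of m "T v"] by (simp_all add: mult_2 funpow_add h1 funpow_swap1)
  show "positive_elem (inner_seq k v ((T ^^ n) v))"
  proof (cases "even n")
    case True
    then obtain m where "n = 2 * m" by auto
    then show ?thesis using e(1)[of v m] inner_seq_self_positive by simp
  next
    case False
    then obtain m where "n = 2 * m + 1" using oddE by blast
    then show ?thesis using e(2)[of v m] p by metis
  qed
  have "positive_elem (inner_seq k v ((T ^^ n) v) - inner_seq k v ((T ^^ Suc n) v))" for n
  proof (cases "even n")
    case True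
    then obtain m where "n = 2 * m" by auto
    then show ?thesis using e(1,2)[of v m] l[of "(T ^^ m) v"] by simp
  next
    case False
    then obtain m where n: "n = 2 * m + 1" using oddE by blast
    define w where "w = (T ^^ m) v"
    define y where "y = (\<lambda>i. w i - T w i)"
    have Ty: "T y = (\<lambda>i. T w i - T (T w) i)" unfolding y_def T_def apply_seq_diff ..
    \<comment> \<open>The operator identity
      \<open>T - T T = T (1 - T) T + (1 - T) T (1 - T)\<close>, in which both summands are
      positive.\<close>
    have "inner_seq k w (T w) - inner_seq k (T w) (T w) =
        (inner_seq k (T w) (T w) - inner_seq k (T w) (T (T w))) + inner_seq k y (T y)"
      unfolding Ty inner_seq_diff_right unfolding y_def inner_seq_diff_left
      by (simp add: h1[of w "T w", symmetric] h1[of w "T (T w)", symmetric])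
    moreover have "positive_elem \<dots>" by (intro positive_elem_add l p)
    moreover have "Suc n = 2 * m + 2" using n by simp
    ultimately show ?thesis using e(2,3)[of v m] n by (simp only: w_def)
  qed
  note dec = this
  show "positive_elem (inner_seq k v v - inner_seq k v ((T ^^ n) v))"
  proof (induction n)
    case (Suc n)
    from positive_elem_add[OF Suc dec[of n]] show ?case by simp
  qed simp
qed

text \<open>Here \<open>X / t = 1 - C\<close> with \<open>C\<close> between \<open>0\<close> and
  \<open>1\<close>, so the binomial series in the powers of \<open>C\<close> gives a square root. No
  matrix norm is introduced: the entries of all powers are bounded by \<open>4\<close>, and the
  series converges entrywise to a hermitian matrix.\<close>

lemma form_positive_sqrt:
  fixes X :: "nat \<Rightarrow> nat \<Rightarrow> 'b::unital_cstar_algebra"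
  assumes X: "form_positive k X"
  obtains Y where "\<And>i j. i < k \<Longrightarrow> j < k \<Longrightarrow> X i j = (\<Sum>l<k. star (Y l i) * Y l j)"
proof -
  obtain t where t: "t > 0" "\<And>v. positive_elem (t *\<^sub>R inner_seq k v v - qform k X v)"
    using qform_le_scaled[OF X] by blast
  define C :: "nat \<Rightarrow> nat \<Rightarrow> 'b" where "C i j = unit_seq j i - (1/t) *\<^sub>R X i j" for i j
  have unit: "(\<Sum>j<k. unit_seq j i * v j) = v i" if "i < k" for i and v :: "nat \<Rightarrow> 'b"
    using that by (simp add: unit_seq_def if_distribR if_distrib cong: if_cong)
  have qC: "qform k C v = inner_seq k v v - (1/t) *\<^sub>R qform k X v" for v
  proof -
    have "apply_seq k C v i = v i - (1/t) *\<^sub>R apply_seq k X v i" if "i < k" for i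
      using unit[OF that, of v]
      by (simp add: apply_seq_def C_def left_diff_distrib sum_subtractf scaleR_sum_right)
    then have "qform k C v = inner_seq k v (\<lambda>i. v i - (1/t) *\<^sub>R apply_seq k X v i)"
      by (simp add: qform_eq_inner inner_seq_def)
    then show ?thesis
      by (simp add: inner_seq_diff_right qform_eq_inner) (simp add: inner_seq_def scaleR_sum_right)
  qed
  have C: "form_positive k C" unfolding form_positive_def
  proof
    fix v
    have "qform k C v = (1/t) *\<^sub>R (t *\<^sub>R inner_seq k v v - qform k X v)"
      using t(1) by (simp add: qC scaleR_diff_right)
    then show "positive_elem (qform k C v)"
      using positive_elem_scaleR[OF t(2)[of v], of "1/t"] t(1) by simp
  qed
  have C1: "positive_elem (inner_seq k v v - qform k C v)" for v
    using X t(1) by (simp add: qC form_positive_def positive_elem_scaleR)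
  define T where "T = apply_seq k C"
  \<comment> \<open>The entries of the \<open>n\<close>-th power of \<open>C\<close>: its column
    \<open>j\<close> is the image of the \<open>j\<close>-th unit column.\<close>
  define N where "N n i j = (T ^^ n) (unit_seq j) i" for n i j
  have exp: "(T ^^ n) v i = (\<Sum>j<k. N n i j * v j)" if "i < k" for n v i
    using that
  proof (induction n arbitrary: i)
    case 0 then show ?case using unit[of i v] by (simp add: N_def)
  next
    case (Suc n)
    have "(T ^^ Suc n) v i = (\<Sum>l<k. C i l * (T ^^ n) v l)" by (simp add: T_def apply_seq_def)
    also have "\<dots> = (\<Sum>l<k. \<Sum>j<k. C i l * N n l j * v j)"
      by (intro sum.cong refl) (simp add: Suc.IH sum_distrib_left mult.assoc)
    also have "\<dots> = (\<Sum>j<k. \<Sum>l<k. C i l * N n l j * v j)" by (rule sum.swap)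
    also have "\<dots> = (\<Sum>j<k. N (Suc n) i j * v j)"
      by (simp add: N_def T_def apply_seq_def sum_distrib_right)
    finally show ?case .
  qed
  have qN: "qform k (N n) v = inner_seq k v ((T ^^ n) v)" for n v
    by (simp add: qform_eq_inner inner_seq_def apply_seq_def exp)
  have Npos: "form_positive k (N n)" for n
    unfolding form_positive_def qN T_def using contraction_powers(1)[OF C C1] by blast
  have Nle: "norm (N n i j) \<le> 4" if "i < k" "j < k" for n i j
    by (rule form_positive_entry_norm[OF Npos _ that])
       (unfold qN T_def, rule contraction_powers(2)[OF C C1])
  have summ: "summable (\<lambda>n. norm (sqrt_coeff n *\<^sub>R N n i j))" if "i < k" "j < k" for i j
  proof (rule summable_comparison_test[OF _ summable_mult[OF sqrt_coeff_summable, of 4]], intro exI allI impI)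
    fix n
    show "norm (norm (sqrt_coeff n *\<^sub>R N n i j)) \<le> 4 * \<bar>sqrt_coeff n\<bar>"
      using mult_left_mono[OF Nle[OF that, of n], of "\<bar>sqrt_coeff n\<bar>"] by (simp add: mult.commute)
  qed
  define S where "S i j = (\<Sum>n. sqrt_coeff n *\<^sub>R N n i j)" for i j
  have SS: "(\<Sum>l<k. S i l * S l j) = (1/t) *\<^sub>R X i j" if ij: "i < k" "j < k" for i j
  proof -
    have "(\<lambda>n. \<Sum>l<k. \<Sum>a\<le>n. (sqrt_coeff a *\<^sub>R N a i l) * (sqrt_coeff (n - a) *\<^sub>R N (n - a) l j))
        sums (\<Sum>l<k. S i l * S l j)"
      unfolding S_def by (intro sums_sum Cauchy_product_sums summ ij) auto
    moreover have "(\<Sum>l<k. \<Sum>a\<le>n. (sqrt_coeff a *\<^sub>R N a i l) * (sqrt_coeff (n - a) *\<^sub>R N (n - a) l j)) =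
        (if n = 0 then 1 else if n = 1 then - 1 else 0) *\<^sub>R N n i j" for n
    proof -
      have "(\<Sum>l<k. \<Sum>a\<le>n. (sqrt_coeff a *\<^sub>R N a i l) * (sqrt_coeff (n - a) *\<^sub>R N (n - a) l j)) =
          (\<Sum>a\<le>n. (sqrt_coeff a * sqrt_coeff (n - a)) *\<^sub>R (\<Sum>l<k. N a i l * N (n - a) l j))"
        by (subst sum.swap) (simp add: scaleR_sum_right mult.commute[where 'a = real])
      also have "\<dots> = (\<Sum>a\<le>n. (sqrt_coeff a * sqrt_coeff (n - a)) *\<^sub>R N n i j)"
      proof (rule sum.cong)
        fix a assume a: "a \<in> {..n}"
        have "(\<Sum>l<k. N a i l * N (n - a) l j) = (T ^^ a) ((T ^^ (n - a)) (unit_seq j)) i"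
          using exp[OF ij(1), of a "(T ^^ (n - a)) (unit_seq j)"] by (simp add: N_def)
        also have "\<dots> = N n i j"
          using a by (simp add: N_def flip: funpow_add comp_apply[of "T ^^ a"])
        finally show "(sqrt_coeff a * sqrt_coeff (n - a)) *\<^sub>R (\<Sum>l<k. N a i l * N (n - a) l j) =
          (sqrt_coeff a * sqrt_coeff (n - a)) *\<^sub>R N n i j" by simp
      qed simp
      finally show ?thesis by (simp only: scaleR_sum_left[symmetric] sqrt_coeff_convolution)
    qed
    ultimately have "(\<lambda>n. (if n = 0 then 1 else if n = 1 then - 1 else 0) *\<^sub>R N n i j) sums (\<Sum>l<k. S i l * S l j)"
      by simp
    moreover have "(\<lambda>n. (if n = 0 then 1 else if n = 1 then - 1 else 0) *\<^sub>R N n i j) sums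
        (\<Sum>n\<in>{0,1}. (if n = 0 then 1 else if n = 1 then - 1 else 0) *\<^sub>R N n i j)"
      by (rule sums_finite) auto
    ultimately have "(\<Sum>l<k. S i l * S l j) = (\<Sum>n\<in>{0,1}. (if n = 0 then 1 else if n = 1 then - 1 else 0) *\<^sub>R N n i j)"
      by (rule sums_unique2)
    also have "\<dots> = N 0 i j - N 1 i j" by simp
    also have "N 1 i j = C i j"
      using ij by (simp add: N_def T_def apply_seq_def unit_seq_def if_distrib cong: if_cong)
    also have "N 0 i j - C i j = (1/t) *\<^sub>R X i j" by (simp add: C_def N_def)
    finally show ?thesis .
  qed
  have Sh: "star (S i j) = S j i" if "i < k" "j < k" for i j
    unfolding S_def
    by (subst bounded_linear.suminf[OF bounded_linear_star summable_norm_cancel[OF summ[OF that]]])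
       (simp add: star_scaleR form_positive_hermitian[OF Npos that])
  show ?thesis
  proof (rule that[of "\<lambda>i j. sqrt t *\<^sub>R S i j"])
    fix i j assume ij: "i < k" "j < k"
    have "(\<Sum>l<k. star (sqrt t *\<^sub>R S l i) * (sqrt t *\<^sub>R S l j)) = t *\<^sub>R (\<Sum>l<k. S i l * S l j)"
      using t(1) ij by (simp add: star_scaleR Sh scaleR_sum_right)
    then show "X i j = (\<Sum>l<k. star (sqrt t *\<^sub>R S l i) * (sqrt t *\<^sub>R S l j))"
      using t(1) by (simp add: SS[OF ij])
  qed
qed

lemma qform_gram:
  assumes "\<And>i j. i < k \<Longrightarrow> j < k \<Longrightarrow> X i j = (\<Sum>l<m. star (Y l i) * Y l j)"
  shows "qform k X v = (\<Sum>l<m. star (\<Sum>i<k. Y l i * v i) * (\<Sum>j<k. Y l j * v j))"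
proof -
  have "qform k X v = (\<Sum>i<k. \<Sum>j<k. \<Sum>l<m. (star (v i) * star (Y l i)) * (Y l j * v j))"
    unfolding qform_def by (simp add: assms sum_distrib_left sum_distrib_right mult.assoc)
  also have "\<dots> = (\<Sum>i<k. \<Sum>l<m. \<Sum>j<k. (star (v i) * star (Y l i)) * (Y l j * v j))"
    by (intro sum.cong refl sum.swap)
  also have "\<dots> = (\<Sum>l<m. \<Sum>i<k. \<Sum>j<k. (star (v i) * star (Y l i)) * (Y l j * v j))"
    by (rule sum.swap)
  also have "\<dots> = (\<Sum>l<m. star (\<Sum>i<k. Y l i * v i) * (\<Sum>j<k. Y l j * v j))"
    by (simp add: star_sum star_mult sum_product)
  finally show ?thesis .
qed

text \<open>A Gram matrix has positive form values, and conversely the square root supplies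
  \<open>Y\<close>. This lets positivity of matrices be argued on forms.\<close>

lemma mat_positive_iff:
  fixes A :: "'b::unital_cstar_algebra mat"
  assumes A: "A \<in> carrier_mat k k"
  shows "mat_positive k A \<longleftrightarrow> form_positive k (\<lambda>i j. A $$ (i, j))"
proof
  assume "mat_positive k A"
  then obtain Y where Y: "Y \<in> carrier_mat k k" "A = mat_star Y * Y" by (auto simp: mat_positive_def)
  have "A $$ (i, j) = (\<Sum>l<k. star (Y $$ (l, i)) * Y $$ (l, j))" if "i < k" "j < k" for i j
    using Y that by (auto simp: mat_star_def scalar_prod_def lessThan_atLeast0 intro!: sum.cong)
  then have "qform k (\<lambda>i j. A $$ (i, j)) v =
      (\<Sum>l<k. star (\<Sum>i<k. Y $$ (l, i) * v i) * (\<Sum>j<k. Y $$ (l, j) * v j))" for v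
    by (rule qform_gram)
  then show "form_positive k (\<lambda>i j. A $$ (i, j))"
    unfolding form_positive_def by (auto intro!: positive_elem_sum)
next
  assume "form_positive k (\<lambda>i j. A $$ (i, j))"
  then obtain Y where Y: "\<And>i j. i < k \<Longrightarrow> j < k \<Longrightarrow> A $$ (i, j) = (\<Sum>l<k. star (Y l i) * Y l j)"
    using form_positive_sqrt by blast
  let ?Y = "mat k k (\<lambda>(i, j). Y i j)"
  have "A = mat_star ?Y * ?Y"
    using A by (intro eq_matI) (auto simp: mat_star_def scalar_prod_def lessThan_atLeast0 Y intro!: sum.cong)
  then show "mat_positive k A" unfolding mat_positive_def by (intro bexI[of _ ?Y]) auto
qed

section \<open>Invariant means on compact groups\<close>

definition right_average :: "'g::monoid_add list \<Rightarrow> ('g \<Rightarrow> 'a::real_vector) \<Rightarrow> 'g \<Rightarrow> 'a" where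
  "right_average gs F x = (1 / real (length gs)) *\<^sub>R (\<Sum>g\<leftarrow>gs. F (x + g))"

definition left_average :: "'g::monoid_add list \<Rightarrow> ('g \<Rightarrow> 'a::real_vector) \<Rightarrow> 'g \<Rightarrow> 'a" where
  "left_average gs F x = (1 / real (length gs)) *\<^sub>R (\<Sum>g\<leftarrow>gs. F (g + x))"

text \<open>Von Neumann's mean: the constant that averages of right translates approach uniformly.
  For continuous functions on a compact group with values in a Banach space, existence and
  uniqueness are \<open>group_mean_approx\<close> and \<open>group_mean_unique\<close>.\<close>

definition group_mean :: "('g::group_add \<Rightarrow> 'a::real_normed_vector) \<Rightarrow> 'a" where
  "group_mean F = (THE c. \<forall>e>0. \<exists>gs. gs \<noteq> [] \<and> (\<forall>x. norm (right_average gs F x - c) \<le> e))"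

lemma scaleR_sum_list: "r *\<^sub>R (\<Sum>g\<leftarrow>gs. f g) = (\<Sum>g\<leftarrow>gs. r *\<^sub>R (f g :: 'a::real_vector))"
  by (induction gs) (auto simp: scaleR_add_right)

lemma average_diff_const:
  assumes "gs \<noteq> []"
  shows "(1 / real (length gs)) *\<^sub>R (\<Sum>g\<leftarrow>gs. f g) - (c :: 'a::real_vector) =
    (1 / real (length gs)) *\<^sub>R (\<Sum>g\<leftarrow>gs. f g - c)"
proof -
  have "(\<Sum>g\<leftarrow>gs. f g - c) = (\<Sum>g\<leftarrow>gs. f g) - real (length gs) *\<^sub>R c"
    by (induction gs) (auto simp: algebra_simps)
  then show ?thesis using assms by (simp add: scaleR_diff_right)
qed

lemma norm_average_le:
  assumes "gs \<noteq> []" "\<And>g. g \<in> set gs \<Longrightarrow> norm (f g :: 'a::real_normed_vector) \<le> e"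
  shows "norm ((1 / real (length gs)) *\<^sub>R (\<Sum>g\<leftarrow>gs. f g)) \<le> e"
proof -
  have "norm (\<Sum>g\<leftarrow>gs. f g) \<le> real (length gs) * e"
    using assms(2)
  proof (induction gs)
    case (Cons a gs)
    then have "norm (\<Sum>g\<leftarrow>gs. f g) \<le> real (length gs) * e" "norm (f a) \<le> e" by auto
    then show ?case using norm_triangle_ineq[of "f a" "\<Sum>g\<leftarrow>gs. f g"] by (simp add: algebra_simps)
  qed simp
  then show ?thesis using assms(1) by (simp add: field_simps)
qed

lemma norm_right_average_diff_le:
  assumes "gs \<noteq> []" "\<And>x. norm (F x - c) \<le> e"
  shows "norm (right_average gs F x - c) \<le> e"
  unfolding right_average_def average_diff_const[OF assms(1)]
  by (rule norm_average_le[OF assms(1)]) (rule assms(2))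

lemma norm_left_average_diff_le:
  assumes "gs \<noteq> []" "\<And>x. norm (F x - c) \<le> e"
  shows "norm (left_average gs F x - c) \<le> e"
  unfolding left_average_def average_diff_const[OF assms(1)]
  by (rule norm_average_le[OF assms(1)]) (rule assms(2))

lemma sum_list_map_product:
  "(\<Sum>p\<leftarrow>List.product xs ys. f p) = (\<Sum>x\<leftarrow>xs. \<Sum>y\<leftarrow>ys. f (x, y) :: 'a::comm_monoid_add)"
  by (induction xs) (auto simp: o_def)

lemma right_average_compose:
  "right_average gs (right_average hs F) = right_average (map (\<lambda>(g, h). g + h) (List.product gs hs)) F"
  by (rule ext) (simp add: right_average_def scaleR_sum_list sum_list_map_product o_def case_prod_beta
      add.assoc length_product)

lemma sum_list_swap:
  "(\<Sum>x\<leftarrow>xs. \<Sum>y\<leftarrow>ys. f x y) = (\<Sum>y\<leftarrow>ys. \<Sum>x\<leftarrow>xs. f x y :: 'a::comm_monoid_add)"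
  by (induction xs) (auto simp: sum_list_addf)

lemma left_right_average_commute:
  "left_average hs (right_average gs F) = right_average gs (left_average hs F)"
proof (rule ext)
  fix x
  have "left_average hs (right_average gs F) x =
      (1 / real (length hs) * (1 / real (length gs))) *\<^sub>R (\<Sum>h\<leftarrow>hs. \<Sum>g\<leftarrow>gs. F (h + x + g))"
    by (simp add: left_average_def right_average_def scaleR_sum_list)
  also have "(\<Sum>h\<leftarrow>hs. \<Sum>g\<leftarrow>gs. F (h + x + g)) = (\<Sum>g\<leftarrow>gs. \<Sum>h\<leftarrow>hs. F (h + x + g))"
    by (rule sum_list_swap)
  also have "(1 / real (length hs) * (1 / real (length gs))) *\<^sub>R \<dots> = right_average gs (left_average hs F) x"
    by (simp add: left_average_def right_average_def scaleR_sum_list add.assoc mult.commute[where 'a = real])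
  finally show "left_average hs (right_average gs F) x = right_average gs (left_average hs F) x" .
qed

text \<open>Left and right averages commute, and averaging preserves closeness to a constant; the
  double average is therefore within \<open>e\<close> of \<open>c\<close> and within
  \<open>e'\<close> of \<open>d\<close>. Two right averages are compared below by way of a common
  left average.\<close>

lemma left_right_constants_close:
  assumes "gs \<noteq> []" "\<And>x. norm (right_average gs F x - c) \<le> e"
    and "hs \<noteq> []" "\<And>x. norm (left_average hs F x - d) \<le> e'"
  shows "norm (c - d) \<le> e + e'"
proof -
  let ?m = "left_average hs (right_average gs F) 0"
  have "norm (?m - c) \<le> e" by (rule norm_left_average_diff_le[OF assms(3,2)])
  moreover have "norm (?m - d) \<le> e'"
    unfolding left_right_average_commute by (rule norm_right_average_diff_le[OF assms(1,4)])
  ultimately show ?thesis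
    using norm_triangle_ineq4[of "?m - d" "?m - c"] by (simp add: algebra_simps)
qed

section \<open>Compactness: covers by translates and decreasing oscillation\<close>

locale compact_group =
  fixes G :: "'g::{topological_group_add, t2_space} itself"
  assumes compact_UNIV: "compact (UNIV :: 'g set)"
begin

lemma continuous_translation:
  fixes F :: "'g \<Rightarrow> 'a::topological_space"
  assumes "continuous_on UNIV F"
  shows "continuous_on UNIV (\<lambda>x. F (x + a))" "continuous_on UNIV (\<lambda>x. F (a + x))"
    "continuous_on UNIV (\<lambda>x. F (- x))"
  by (rule continuous_on_compose2[OF assms]; auto intro!: continuous_intros)+

lemma continuous_section:
  fixes F :: "'g \<Rightarrow> 'g \<Rightarrow> 'a::topological_space"
  assumes F: "continuous_on UNIV (\<lambda>(x, y). F x y)"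
  shows "continuous_on UNIV (\<lambda>x. F x y)" "continuous_on UNIV (\<lambda>y. F x y)"
    "continuous_on UNIV (\<lambda>(y, x). F x y)"
proof -
  have c: "continuous_on UNIV (\<lambda>x::'g. (x, y))" "continuous_on UNIV (\<lambda>y::'g. (x, y))"
    "continuous_on UNIV (\<lambda>p::'g \<times> 'g. (snd p, fst p))"
    by (intro continuous_intros)+
  show "continuous_on UNIV (\<lambda>x. F x y)" using continuous_on_compose2[OF F c(1)] by simp
  show "continuous_on UNIV (\<lambda>y. F x y)" using continuous_on_compose2[OF F c(2)] by simp
  show "continuous_on UNIV (\<lambda>(y, x). F x y)"
    using continuous_on_compose2[OF F c(3)] by (simp add: case_prod_beta)
qed

lemma continuous_bounded:
  fixes F :: "'g \<Rightarrow> 'a::real_normed_vector"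
  assumes "continuous_on UNIV F"
  obtains B where "\<And>x. norm (F x) \<le> B" "B \<ge> 0"
proof -
  have "bounded (range F)" by (rule compact_imp_bounded[OF compact_continuous_image[OF assms compact_UNIV]])
  then obtain B where "\<And>x. norm (F x) \<le> B" unfolding bounded_iff by auto
  then show ?thesis using that[of "max B 0"] by (simp add: le_max_iff_disj)
qed

lemma parametric_bounded:
  fixes F :: "'g \<Rightarrow> 'g \<Rightarrow> 'a::real_normed_vector"
  assumes "continuous_on UNIV (\<lambda>(x, y). F x y)"
  obtains B where "\<And>x y. norm (F x y) \<le> B"
proof -
  have "compact (UNIV :: ('g \<times> 'g) set)"
    using compact_Times[OF compact_UNIV compact_UNIV] by simp
  then have "bounded (range (\<lambda>(x, y). F x y))"
    by (intro compact_imp_bounded compact_continuous_image assms)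
  then show ?thesis using that unfolding bounded_iff by auto
qed

text \<open>The tube lemma for \<open>F (v + x) y\<close> as a function of \<open>v\<close> and
  \<open>(x, y)\<close>, at \<open>v = 0\<close>. The parameter \<open>y\<close> is carried along
  because the interchange of two means requires one list of translations for all
  \<open>y\<close>.\<close>

lemma parametric_uniform_continuity:
  fixes F :: "'g \<Rightarrow> 'g \<Rightarrow> 'a::real_normed_vector"
  assumes F: "continuous_on UNIV (\<lambda>(x, y). F x y)" and e: "e > 0"
  obtains V where "open V" "0 \<in> V" "\<And>v x y. v \<in> V \<Longrightarrow> norm (F (v + x) y - F x y) \<le> e"
proof -
  have c: "compact (UNIV :: ('g \<times> 'g) set)"
    using compact_Times[OF compact_UNIV compact_UNIV] by simp
  have "continuous_on UNIV (\<lambda>z::'g \<times> ('g \<times> 'g). (\<lambda>(x, y). F x y) (fst z + fst (snd z), snd (snd z)))"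
    by (rule continuous_on_compose2[OF F]) (auto intro!: continuous_intros)
  then have "continuous_on (UNIV \<times> UNIV) (\<lambda>(v::'g, p). F (v + fst p) (snd p))"
    by (simp add: case_prod_beta)
  then obtain V where "0 \<in> V" "open V"
    "\<forall>v\<in>V \<inter> UNIV. \<forall>p\<in>UNIV. dist ((\<lambda>(v::'g, p). F (v + fst p) (snd p)) (v, p)) ((\<lambda>(v::'g, p). F (v + fst p) (snd p)) (0, p)) \<le> e"
    using continuous_on_prod_compactE[of UNIV UNIV "\<lambda>(v::'g, p). F (v + fst p) (snd p)" 0 e] c e by blast
  then show ?thesis using that[of V] by (simp add: dist_norm)
qed

lemma finite_translate_cover:
  fixes V :: "'g set"
  assumes "open V" "0 \<in> V"
  obtains ys where "ys \<noteq> []" "\<And>x. \<exists>y\<in>set ys. x + y \<in> V"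
proof -
  have "open ((\<lambda>x. x + y) -` V)" for y :: 'g
    by (rule open_vimage[OF assms(1)]) (auto intro!: continuous_intros)
  moreover have "UNIV \<subseteq> (\<Union>y. (\<lambda>x. x + y) -` V)"
  proof
    fix x :: 'g show "x \<in> (\<Union>y. (\<lambda>x. x + y) -` V)" using assms(2) by (auto intro!: exI[of _ "- x"])
  qed
  ultimately obtain Y where Y: "finite Y" "UNIV \<subseteq> (\<Union>y\<in>Y. (\<lambda>x. x + y) -` V)"
    using compactE_image[OF compact_UNIV, of UNIV "\<lambda>y. (\<lambda>x. x + y) -` V"] by auto
  obtain ys where ys: "set ys = Y" using finite_list[OF Y(1)] by blast
  have "\<exists>y\<in>set ys. x + y \<in> V" for x using Y(2) ys by auto
  moreover from this[of 0] have "ys \<noteq> []" by auto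
  ultimately show ?thesis using that by blast
qed

text \<open>Averaging over a cover of \<open>G\<close> by translates of \<open>V\<close> contracts the oscillation by a factor
  \<open>1 - 1/N\<^sup>2\<close>: among the \<open>N\<^sup>2\<close> pairs of terms at \<open>x\<close> and \<open>x'\<close> there is one where both arguments
  fall into \<open>V\<close>.\<close>

lemma oscillation_contraction:
  fixes h :: "'g \<Rightarrow> 'a::real_normed_vector"
  assumes V: "\<And>v. v \<in> V \<Longrightarrow> norm (h v - h 0) \<le> e"
    and ys: "ys \<noteq> []" "\<And>x. \<exists>y\<in>set ys. x + y \<in> V"
    and D: "\<And>x x'. norm (h x - h x') \<le> 2 * e + D"
  defines "N \<equiv> real (length ys)"
  shows "norm (right_average ys h x - right_average ys h x') \<le> 2 * e + (1 - 1 / (N * N)) * D"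
proof -
  have N: "N > 0" using ys(1) by (simp add: N_def)
  let ?d = "\<lambda>p. h (x + fst p) - h (x' + snd p)"
  have 1: "right_average ys h x - right_average ys h x' =
      (1 / (N * N)) *\<^sub>R (\<Sum>p\<leftarrow>List.product ys ys. ?d p)"
  proof -
    have c: "(\<Sum>y\<leftarrow>zs. c) = real (length zs) *\<^sub>R (c::'a)" for c and zs :: "'g list"
      by (induction zs) (auto simp: algebra_simps)
    have "(\<Sum>p\<leftarrow>List.product ys ys. ?d p) = N *\<^sub>R (\<Sum>y\<leftarrow>ys. h (x + y)) - N *\<^sub>R (\<Sum>y\<leftarrow>ys. h (x' + y))"
      by (simp add: sum_list_map_product sum_list_subtractf c scaleR_sum_list N_def)
    then show ?thesis using N by (simp add: right_average_def N_def scaleR_diff_right)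
  qed
  obtain y y' where y: "y \<in> set ys" "x + y \<in> V" "y' \<in> set ys" "x' + y' \<in> V" using ys(2) by metis
  have "(y, y') \<in> set (List.product ys ys)" using y by simp
  then obtain as bs where split: "List.product ys ys = as @ (y, y') # bs" by (meson split_list)
  have len: "real (length as) + real (length bs) + 1 = N * N"
    using arg_cong[OF split, of length] by (simp add: N_def length_product flip: of_nat_mult of_nat_add)
  have le: "norm (\<Sum>p\<leftarrow>ps. ?d p) \<le> real (length ps) * (2 * e + D)" for ps
  proof (induction ps)
    case (Cons p ps)
    then show ?case using D[of "x + fst p" "x' + snd p"] norm_triangle_ineq[of "?d p" "\<Sum>p\<leftarrow>ps. ?d p"]
      by (simp add: algebra_simps)
  qed simp
  have "norm (?d (y, y')) \<le> 2 * e"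
    using norm_triangle_ineq4[of "h (x + y) - h 0" "h (x' + y') - h 0"] V[OF y(2)] V[OF y(4)] by simp
  then have "norm ((\<Sum>p\<leftarrow>as. ?d p) + (?d (y, y') + (\<Sum>p\<leftarrow>bs. ?d p))) \<le>
      real (length as) * (2 * e + D) + (2 * e + real (length bs) * (2 * e + D))"
    using le[of as] le[of bs] by (intro order_trans[OF norm_triangle_ineq] add_mono)
  also have "\<dots> = (N * N) * (2 * e) + (N * N - 1) * D"
    unfolding len[symmetric] by (simp add: algebra_simps)
  finally have "norm (\<Sum>p\<leftarrow>List.product ys ys. ?d p) \<le> (N * N) * (2 * e) + (N * N - 1) * D"
    by (simp only: split map_append sum_list.append list.map sum_list.Cons)
  then have "(1 / (N * N)) * norm (\<Sum>p\<leftarrow>List.product ys ys. ?d p) \<le>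
      (1 / (N * N)) * ((N * N) * (2 * e) + (N * N - 1) * D)"
    using N by (intro mult_left_mono) auto
  also have "\<dots> = 2 * e + (1 - 1 / (N * N)) * D" using N by (simp add: field_simps)
  finally show ?thesis unfolding 1 using N by simp
qed

text \<open>Each further averaging over the cover \<open>ys\<close> multiplies the excess of the
  oscillation over \<open>2 * (e / 4)\<close> by \<open>q\<close>. The neighbourhood
  \<open>V\<close> remains valid throughout, since it moves the argument on the left while the
  averages translate on the right.\<close>

lemma uniform_right_average:
  fixes F :: "'g \<Rightarrow> 'g \<Rightarrow> 'a::real_normed_vector"
  assumes F: "continuous_on UNIV (\<lambda>(x, y). F x y)" and e: "e > 0"
  obtains gs where "gs \<noteq> []"
    "\<And>x x' y. norm (right_average gs (\<lambda>x. F x y) x - right_average gs (\<lambda>x. F x y) x') \<le> e"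
proof -
  have e4: "e / 4 > 0" using e by simp
  obtain V where V: "open V" "0 \<in> V" "\<And>v x y. v \<in> V \<Longrightarrow> norm (F (v + x) y - F x y) \<le> e / 4"
    using parametric_uniform_continuity[OF F e4] by blast
  obtain ys where ys: "ys \<noteq> []" "\<And>x. \<exists>y\<in>set ys. x + y \<in> V"
    using finite_translate_cover[OF V(1,2)] by blast
  obtain B where B: "\<And>x y. norm (F x y) \<le> B" using parametric_bounded[OF F] by blast
  define N where "N = real (length ys)"
  define q where "q = 1 - 1 / (N * N)"
  have "N \<ge> 1" using ys(1) by (cases ys) (auto simp: N_def)
  then have "1 \<le> N * N" using mult_mono[of 1 N 1 N] by simp
  then have q: "0 \<le> q" "q < 1" by (auto simp: q_def)
  have step: "\<exists>gs. gs \<noteq> [] \<and> (\<forall>x x' y. norm (right_average gs (\<lambda>x. F x y) x - right_average gs (\<lambda>x. F x y) x')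
      \<le> 2 * (e / 4) + q ^ n * (2 * B))" for n
  proof (induction n)
    case 0
    have "norm (right_average [0] (\<lambda>x. F x y) x - right_average [0] (\<lambda>x. F x y) x') \<le> 2 * (e / 4) + 2 * B" for x x' y
      using norm_triangle_ineq4[of "F x y" "F x' y"] B[of x y] B[of x' y] e by (simp add: right_average_def)
    then show ?case by (intro exI[of _ "[0]"]) auto
  next
    case (Suc n)
    then obtain gs where gs: "gs \<noteq> []" "\<And>x x' y. norm (right_average gs (\<lambda>x. F x y) x - right_average gs (\<lambda>x. F x y) x')
      \<le> 2 * (e / 4) + q ^ n * (2 * B)" by blast
    have "norm (right_average ys (right_average gs (\<lambda>x. F x y)) x - right_average ys (right_average gs (\<lambda>x. F x y)) x')
      \<le> 2 * (e / 4) + q * (q ^ n * (2 * B))" for x x' y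
      unfolding q_def N_def
    proof (rule oscillation_contraction[OF _ ys])
      show "norm (right_average gs (\<lambda>x. F x y) v - right_average gs (\<lambda>x. F x y) 0) \<le> e / 4" if "v \<in> V" for v
      proof -
        have "right_average gs (\<lambda>x. F x y) v - right_average gs (\<lambda>x. F x y) 0 =
            (1 / real (length gs)) *\<^sub>R (\<Sum>g\<leftarrow>gs. F (v + g) y - F (0 + g) y)"
          by (simp add: right_average_def scaleR_diff_right sum_list_subtractf)
        also have "norm \<dots> \<le> e / 4" by (rule norm_average_le[OF gs(1)]) (use V(3)[OF that] in simp)
        finally show ?thesis .
      qed
    qed (use gs(2) in \<open>simp add: q_def N_def\<close>)
    moreover have "List.product ys gs \<noteq> []" using ys(1) gs(1) by (cases ys; cases gs) auto
    ultimately show ?case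
      by (intro exI[of _ "map (\<lambda>(g, h). g + h) (List.product ys gs)"])
         (simp add: mult.assoc flip: right_average_compose)
  qed
  have "(\<lambda>n. q ^ n * (2 * B)) \<longlonglongrightarrow> 0 * (2 * B)"
    using q by (intro tendsto_mult LIMSEQ_power_zero tendsto_const) auto
  from tendstoD[OF this, of "e / 2"] e obtain n where "\<bar>q ^ n * (2 * B)\<bar> < e / 2"
    by (auto simp: eventually_sequentially dist_real_def)
  then have "2 * (e / 4) + q ^ n * (2 * B) \<le> e" by linarith
  then show ?thesis using step[of n] that by (meson order_trans)
qed

lemma right_average_near_constant:
  fixes F :: "'g \<Rightarrow> 'a::real_normed_vector"
  assumes F: "continuous_on UNIV F" and e: "e > 0"
  obtains gs c where "gs \<noteq> []" "\<And>x. norm (right_average gs F x - c) \<le> e"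
proof -
  have "continuous_on UNIV (\<lambda>(x::'g, y::'g). F x)"
    unfolding case_prod_beta by (rule continuous_on_compose2[OF F]) (auto intro!: continuous_intros)
  from uniform_right_average[OF this e] show ?thesis using that by metis
qed

lemma right_average_minus: "right_average gs (\<lambda>x. F (- x)) x = left_average (map uminus gs) F (- x)"
  for x :: 'g
  by (simp add: right_average_def left_average_def o_def minus_add)

lemma left_average_near_constant:
  fixes F :: "'g \<Rightarrow> 'a::real_normed_vector"
  assumes F: "continuous_on UNIV F" and e: "e > 0"
  obtains gs c where "gs \<noteq> []" "\<And>x. norm (left_average gs F x - c) \<le> e"
proof -
  obtain gs c where gs: "gs \<noteq> []" "\<And>x. norm (right_average gs (\<lambda>x. F (- x)) x - c) \<le> e"
    using right_average_near_constant[OF continuous_translation(3)[OF F] e] by blast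
  have "norm (left_average (map uminus gs) F x - c) \<le> e" for x
    using gs(2)[of "- x"] by (simp add: right_average_minus)
  then show ?thesis using that[of "map uminus gs" c] gs(1) by simp
qed

section \<open>Existence and uniqueness of the mean\<close>

lemma group_mean_unique:
  fixes F :: "'g \<Rightarrow> 'a::real_normed_vector"
  assumes F: "continuous_on UNIV F"
    and c: "\<And>e. e > 0 \<Longrightarrow> \<exists>gs. gs \<noteq> [] \<and> (\<forall>x. norm (right_average gs F x - c) \<le> e)"
  shows "group_mean F = c"
  unfolding group_mean_def
proof (rule the_equality)
  fix c' assume c': "\<forall>e>0. \<exists>gs. gs \<noteq> [] \<and> (\<forall>x. norm (right_average gs F x - c') \<le> e)"
  have "norm (c' - c) \<le> 4 * e" if e: "e > 0" for e
  proof -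
    obtain hs d where hs: "hs \<noteq> []" "\<And>x. norm (left_average hs F x - d) \<le> e"
      using left_average_near_constant[OF F e] by blast
    obtain gs where gs: "gs \<noteq> []" "\<And>x. norm (right_average gs F x - c) \<le> e" using c[OF e] by blast
    obtain gs' where gs': "gs' \<noteq> []" "\<And>x. norm (right_average gs' F x - c') \<le> e" using c' e by blast
    show ?thesis
      using left_right_constants_close[OF gs hs] left_right_constants_close[OF gs' hs]
        norm_triangle_ineq4[of "c' - d" "c - d"] by simp
  qed
  from this[of "norm (c' - c) / 8"] show "c' = c" by (cases "c' = c") auto
qed (use c in blast)

text \<open>Averages of precision \<open>1 / Suc n\<close> come with constants \<open>c n\<close>.
  Comparison through a left average shows that these form a Cauchy sequence, and completeness
  provides the limit.\<close>

lemma group_mean_approx: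
  fixes F :: "'g \<Rightarrow> 'a::banach"
  assumes F: "continuous_on UNIV F" and e: "e > 0"
  obtains gs where "gs \<noteq> []" "\<And>x. norm (right_average gs F x - group_mean F) \<le> e"
proof -
  have "\<exists>gs c. gs \<noteq> [] \<and> (\<forall>x. norm (right_average gs F x - c) \<le> 1 / real (Suc n))" for n
    using right_average_near_constant[OF F, of "1 / real (Suc n)"] by (metis of_nat_0_less_iff zero_less_Suc zero_less_divide_1_iff)
  then obtain gs c where gs: "\<And>n. gs n \<noteq> []" "\<And>n x. norm (right_average (gs n) F x - c n) \<le> 1 / real (Suc n)"
    by metis
  have close: "norm (c m - c n) \<le> 1 / real (Suc m) + 1 / real (Suc n)" for m n
  proof (rule field_le_epsilon)
    fix e :: real assume e: "e > 0"
    obtain hs d where hs: "hs \<noteq> []" "\<And>x. norm (left_average hs F x - d) \<le> e / 2"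
      proof -
        have pos: "e / 2 > 0" using e by simp
        show thesis using left_average_near_constant[OF F pos] that by blast
      qed
    show "norm (c m - c n) \<le> 1 / real (Suc m) + 1 / real (Suc n) + e"
      using left_right_constants_close[OF gs hs, of m] left_right_constants_close[OF gs hs, of n]
        norm_triangle_ineq4[of "c m - d" "c n - d"] by simp
  qed
  have small: "\<exists>M. \<forall>n\<ge>M. 1 / real (Suc n) < e" if e: "e > 0" for e
  proof -
    obtain M where M: "1 / real (Suc M) < e" using nat_approx_posE[OF e] by blast
    have "1 / real (Suc n) \<le> 1 / real (Suc M)" if "n \<ge> M" for n
      using that by (intro divide_left_mono) auto
    then show ?thesis using M by (meson order_le_less_trans)
  qed
  have "Cauchy c"
  proof (rule CauchyI)
    fix e :: real assume "e > 0"
    then obtain M where M: "\<And>n. n \<ge> M \<Longrightarrow> 1 / real (Suc n) < e / 2" using small[of "e / 2"] by auto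
    have "norm (c m - c n) < e" if "m \<ge> M" "n \<ge> M" for m n
      using close[of m n] M[OF that(1)] M[OF that(2)] by linarith
    then show "\<exists>M. \<forall>m\<ge>M. \<forall>n\<ge>M. norm (c m - c n) < e" by blast
  qed
  then obtain l where l: "c \<longlonglongrightarrow> l" using Cauchy_convergent convergent_def by blast
  have ex: "\<exists>gs. gs \<noteq> [] \<and> (\<forall>x. norm (right_average gs F x - l) \<le> e)" if e: "e > 0" for e
  proof -
    obtain M where M: "\<And>n. n \<ge> M \<Longrightarrow> 1 / real (Suc n) < e / 2" using small[of "e / 2"] e by auto
    obtain M' where M': "\<And>n. n \<ge> M' \<Longrightarrow> norm (c n - l) < e / 2"
      using l[unfolded LIMSEQ_iff, rule_format, of "e / 2"] e by auto
    define n where "n = max M M'"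
    have "norm (right_average (gs n) F x - l) \<le> e" for x
      using gs(2)[of n x] M[of n] M'[of n] norm_triangle_ineq[of "right_average (gs n) F x - c n" "c n - l"]
      by (simp add: n_def)
    then show ?thesis using gs(1) by blast
  qed
  have "group_mean F = l" by (rule group_mean_unique[OF F ex])
  then show ?thesis using ex[OF e] that by blast
qed

text \<open>A list of small oscillation for all \<open>y\<close> at once exists by
  \<open>uniform_right_average\<close>. For each single \<open>y\<close>, finer averages show that
  the mean differs from its averages by no more than this oscillation.\<close>

lemma group_mean_uniform_approx:
  fixes F :: "'g \<Rightarrow> 'g \<Rightarrow> 'a::banach"
  assumes F: "continuous_on UNIV (\<lambda>(x, y). F x y)" and e: "e > 0"
  obtains gs where "gs \<noteq> []" "\<And>x y. norm (right_average gs (\<lambda>x. F x y) x - group_mean (\<lambda>x. F x y)) \<le> e"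
proof -
  obtain gs where gs: "gs \<noteq> []"
    "\<And>x x' y. norm (right_average gs (\<lambda>x. F x y) x - right_average gs (\<lambda>x. F x y) x') \<le> e / 2"
    proof -
      have pos: "e / 2 > 0" using e by simp
      show thesis using uniform_right_average[OF F pos] that by blast
    qed
  have "norm (right_average gs (\<lambda>x. F x y) x - group_mean (\<lambda>x. F x y)) \<le> e" for x y
  proof (rule field_le_epsilon)
    fix d :: real assume d: "d > 0"
    have Fy: "continuous_on UNIV (\<lambda>x. F x y)"
      by (rule continuous_section(1)[OF F])
    obtain ks where ks: "ks \<noteq> []" "\<And>x. norm (right_average ks (\<lambda>x. F x y) x - group_mean (\<lambda>x. F x y)) \<le> d / 2"
      proof -
        have pos: "d / 2 > 0" using d by simp
        show thesis using group_mean_approx[OF Fy pos] that by blast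
      qed
    obtain hs c where hs: "hs \<noteq> []" "\<And>x. norm (left_average hs (\<lambda>x. F x y) x - c) \<le> d / 4"
      proof -
        have pos: "d / 4 > 0" using d by simp
        show thesis using left_average_near_constant[OF Fy pos] that by blast
      qed
    have "norm (right_average gs (\<lambda>x. F x y) x' - right_average gs (\<lambda>x. F x y) x) \<le> e / 2" for x' by (rule gs(2))
    from left_right_constants_close[OF gs(1) this hs] left_right_constants_close[OF ks hs]
    show "norm (right_average gs (\<lambda>x. F x y) x - group_mean (\<lambda>x. F x y)) \<le> e + d"
      using norm_triangle_ineq4[of "right_average gs (\<lambda>x. F x y) x - c" "group_mean (\<lambda>x. F x y) - c"] e d
      by simp
  qed
  then show ?thesis using that gs(1) by blast
qed

section \<open>Linearity, invariance and positivity of the mean\<close>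

lemma group_mean_bounded_linear:
  fixes F :: "'g \<Rightarrow> 'a::banach" and T :: "'a \<Rightarrow> 'b::banach"
  assumes T: "bounded_linear T" and F: "continuous_on UNIV F"
  shows "group_mean (\<lambda>x. T (F x)) = T (group_mean F)"
proof (rule group_mean_unique)
  show "continuous_on UNIV (\<lambda>x. T (F x))" by (rule bounded_linear.continuous_on[OF T F])
  fix e :: real assume e: "e > 0"
  obtain K where K: "K > 0" "\<And>x. norm (T x) \<le> norm x * K" using bounded_linear.pos_bounded[OF T] by blast
  obtain gs where gs: "gs \<noteq> []" "\<And>x. norm (right_average gs F x - group_mean F) \<le> e / K"
    proof -
      have pos: "e / K > 0" using e K by simp
      show thesis using group_mean_approx[OF F pos] that by blast
    qed
  interpret T: bounded_linear T by (rule T)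
  have eq: "right_average gs (\<lambda>x. T (F x)) x = T (right_average gs F x)" for x
  proof -
    have "(\<Sum>g\<leftarrow>hs. T (F (x + g))) = T (\<Sum>g\<leftarrow>hs. F (x + g))" for hs
      by (induction hs) (auto simp: T.add T.zero)
    then show ?thesis by (simp add: right_average_def T.scaleR)
  qed
  have "norm (right_average gs (\<lambda>x. T (F x)) x - T (group_mean F)) \<le> e" for x
  proof -
    have "norm (T (right_average gs F x - group_mean F)) \<le> (e / K) * K"
      using K(2)[of "right_average gs F x - group_mean F"] mult_right_mono[OF gs(2)[of x], of K] K(1) by linarith
    then show ?thesis using K(1) by (simp add: T.diff eq)
  qed
  then show "\<exists>gs. gs \<noteq> [] \<and> (\<forall>x. norm (right_average gs (\<lambda>x. T (F x)) x - T (group_mean F)) \<le> e)"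
    using gs(1) by blast
qed

lemma group_mean_const [simp]: "group_mean (\<lambda>x::'g. c :: 'a::real_normed_vector) = c"
proof (rule group_mean_unique)
  show "\<exists>gs::'g list. gs \<noteq> [] \<and> (\<forall>x. norm (right_average gs (\<lambda>x. c) x - c) \<le> e)" if "e > 0" for e
    using that by (intro exI[of _ "[0]"]) (simp add: right_average_def)
qed auto

text \<open>Both functions have to be averaged with one list of translations. Taking the mean of the
  pair in \<open>'a \<times> 'a\<close> and applying linear maps to it arranges this.\<close>

lemma group_mean_add:
  fixes F H :: "'g \<Rightarrow> 'a::banach"
  assumes F: "continuous_on UNIV F" and H: "continuous_on UNIV H"
  shows "group_mean (\<lambda>x. F x + H x) = group_mean F + group_mean H"
proof -
  have c: "continuous_on UNIV (\<lambda>x. (F x, H x))" by (intro continuous_intros F H)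
  have "bounded_linear (\<lambda>p::'a \<times> 'a. fst p + snd p)"
    by (intro bounded_linear_add bounded_linear_fst bounded_linear_snd)
  from group_mean_bounded_linear[OF this c]
  show ?thesis
    using group_mean_bounded_linear[OF bounded_linear_fst c] group_mean_bounded_linear[OF bounded_linear_snd c] by simp
qed

lemma group_mean_scaleR:
  fixes F :: "'g \<Rightarrow> 'a::banach"
  assumes "continuous_on UNIV F"
  shows "group_mean (\<lambda>x. r *\<^sub>R F x) = r *\<^sub>R group_mean F"
  by (rule group_mean_bounded_linear[OF bounded_linear_scaleR_right assms])

lemma group_mean_diff:
  fixes F H :: "'g \<Rightarrow> 'a::banach"
  assumes "continuous_on UNIV F" "continuous_on UNIV H"
  shows "group_mean (\<lambda>x. F x - H x) = group_mean F - group_mean H"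
  using group_mean_add[OF assms(1) continuous_on_minus[OF assms(2)]]
    group_mean_bounded_linear[OF bounded_linear_minus[OF bounded_linear_ident] assms(2)] by simp

lemma group_mean_sum:
  fixes F :: "'i \<Rightarrow> 'g \<Rightarrow> 'a::banach"
  assumes "\<And>i. i \<in> I \<Longrightarrow> continuous_on UNIV (F i)"
  shows "group_mean (\<lambda>x. \<Sum>i\<in>I. F i x) = (\<Sum>i\<in>I. group_mean (F i))"
  using assms
proof (induction I rule: infinite_finite_induct)
  case (insert i I)
  then show ?case by (simp add: group_mean_add continuous_on_sum)
qed auto

lemma group_mean_translate_right:
  fixes F :: "'g \<Rightarrow> 'a::banach"
  assumes F: "continuous_on UNIV F"
  shows "group_mean (\<lambda>x. F (x + a)) = group_mean F"
proof (rule group_mean_unique[OF continuous_translation(1)[OF F]])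
  fix e :: real assume e: "e > 0"
  obtain gs where gs: "gs \<noteq> []" "\<And>x. norm (right_average gs F x - group_mean F) \<le> e"
    using group_mean_approx[OF F e] by blast
  have "right_average (map (\<lambda>g. g - a) gs) (\<lambda>x. F (x + a)) = right_average gs F"
    by (rule ext) (simp add: right_average_def o_def add.assoc)
  then show "\<exists>gs. gs \<noteq> [] \<and> (\<forall>x. norm (right_average gs (\<lambda>x. F (x + a)) x - group_mean F) \<le> e)"
    using gs by (intro exI[of _ "map (\<lambda>g. g - a) gs"]) simp
qed

lemma group_mean_translate_left:
  fixes F :: "'g \<Rightarrow> 'a::banach"
  assumes F: "continuous_on UNIV F"
  shows "group_mean (\<lambda>x. F (a + x)) = group_mean F"
proof (rule group_mean_unique[OF continuous_translation(2)[OF F]])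
  fix e :: real assume e: "e > 0"
  obtain gs where gs: "gs \<noteq> []" "\<And>x. norm (right_average gs F x - group_mean F) \<le> e"
    using group_mean_approx[OF F e] by blast
  have "right_average gs (\<lambda>x. F (a + x)) x = right_average gs F (a + x)" for x
    by (simp add: right_average_def add.assoc)
  then show "\<exists>gs. gs \<noteq> [] \<and> (\<forall>x. norm (right_average gs (\<lambda>x. F (a + x)) x - group_mean F) \<le> e)"
    using gs by auto
qed

text \<open>Right averages of the reflected function are left averages of \<open>F\<close>, and left
  and right averages approach the same constant.\<close>

lemma group_mean_minus_arg:
  fixes F :: "'g \<Rightarrow> 'a::banach"
  assumes F: "continuous_on UNIV F"
  shows "group_mean (\<lambda>x. F (- x)) = group_mean F"
proof -
  have "norm (group_mean F - group_mean (\<lambda>x. F (- x))) \<le> 0"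
  proof (rule field_le_epsilon)
    fix e :: real assume e: "e > 0"
    obtain gs where gs: "gs \<noteq> []" "\<And>x. norm (right_average gs F x - group_mean F) \<le> e / 2"
      proof -
        have pos: "e / 2 > 0" using e by simp
        show thesis using group_mean_approx[OF F pos] that by blast
      qed
    obtain hs where hs: "hs \<noteq> []" "\<And>x. norm (right_average hs (\<lambda>x. F (- x)) x - group_mean (\<lambda>x. F (- x))) \<le> e / 2"
      proof -
        have pos: "e / 2 > 0" using e by simp
        show thesis using group_mean_approx[OF continuous_translation(3)[OF F] pos] that by blast
      qed
    have "norm (left_average (map uminus hs) F x - group_mean (\<lambda>x. F (- x))) \<le> e / 2" for x
      using hs(2)[of "- x"] by (simp add: right_average_minus)
    from left_right_constants_close[OF gs _ this] hs(1)
    show "norm (group_mean F - group_mean (\<lambda>x. F (- x))) \<le> 0 + e" by simp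
  qed
  then show ?thesis by simp
qed

text \<open>Averages are convex combinations of values. Positivity, monotonicity and norm bounds of
  the mean are obtained from this by choosing \<open>S\<close>.\<close>

lemma group_mean_in_closed_convex:
  fixes F :: "'g \<Rightarrow> 'a::banach"
  assumes F: "continuous_on UNIV F" and S: "closed S" "convex S" "\<And>x. F x \<in> S"
  shows "group_mean F \<in> S"
proof -
  have "\<exists>y\<in>S. dist y (group_mean F) < e" if e: "e > 0" for e
  proof -
    obtain gs where gs: "gs \<noteq> []" "\<And>x. norm (right_average gs F x - group_mean F) \<le> e / 2"
      proof -
        have pos: "e / 2 > 0" using e by simp
        show thesis using group_mean_approx[OF F pos] that by blast
      qed
    have "right_average gs F 0 = (\<Sum>i\<in>{0..<length gs}. (1 / real (length gs)) *\<^sub>R F (gs ! i))"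
      by (simp add: right_average_def sum_list_sum_nth scaleR_sum_right)
    also have "\<dots> \<in> S" using gs(1) by (intro convex_sum S) auto
    finally show ?thesis using gs(2)[of 0] e by (intro bexI[of _ "right_average gs F 0"]) (auto simp: dist_norm)
  qed
  then show ?thesis using S(1) by (metis closure_approachable closure_closed)
qed

lemma group_mean_norm_le:
  fixes F :: "'g \<Rightarrow> 'a::banach"
  assumes "continuous_on UNIV F" "\<And>x. norm (F x) \<le> B"
  shows "norm (group_mean F) \<le> B"
  using group_mean_in_closed_convex[OF assms(1), of "cball 0 B"] assms(2) by simp

lemma group_mean_mono:
  fixes F H :: "'g \<Rightarrow> real"
  assumes "continuous_on UNIV F" "continuous_on UNIV H" "\<And>x. F x \<le> H x"
  shows "group_mean F \<le> group_mean H"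
proof -
  have "group_mean (\<lambda>x. H x - F x) \<in> {0..}"
    using assms by (intro group_mean_in_closed_convex continuous_intros) auto
  then show ?thesis using assms by (simp add: group_mean_diff)
qed

lemma group_mean_nonneg:
  fixes F :: "'g \<Rightarrow> real"
  assumes "continuous_on UNIV F" "\<And>x. F x \<ge> 0"
  shows "group_mean F \<ge> 0"
  using group_mean_mono[of "\<lambda>_. 0" F] assms by simp

text \<open>The pairs \<open>(y, s)\<close> with \<open>norm y \<le> s\<close> form a closed convex
  cone, which thus contains the mean of \<open>(F x, H x)\<close>.\<close>

lemma group_mean_norm_le_mean:
  fixes F :: "'g \<Rightarrow> 'a::banach" and H :: "'g \<Rightarrow> real"
  assumes F: "continuous_on UNIV F" and H: "continuous_on UNIV H" and le: "\<And>x. norm (F x) \<le> H x"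
  shows "norm (group_mean F) \<le> group_mean H"
proof -
  have "closed {p::'a \<times> real. norm (fst p) \<le> snd p}"
    by (intro closed_Collect_le continuous_intros)
  moreover have "convex {p::'a \<times> real. norm (fst p) \<le> snd p}"
  proof (rule convexI, clarsimp)
    fix x y :: 'a and a b u v :: real
    assume "norm x \<le> a" "norm y \<le> b" "0 \<le> u" "0 \<le> v" "u + v = 1"
    then show "norm (u *\<^sub>R x + v *\<^sub>R y) \<le> u * a + v * b"
      by (intro order_trans[OF norm_triangle_ineq] add_mono) (auto intro: mult_left_mono)
  qed
  moreover have c: "continuous_on UNIV (\<lambda>x. (F x, H x))" by (intro continuous_intros F H)
  ultimately have "group_mean (\<lambda>x. (F x, H x)) \<in> {p. norm (fst p) \<le> snd p}"
    using le by (intro group_mean_in_closed_convex) auto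
  then show ?thesis
    using group_mean_bounded_linear[OF bounded_linear_fst c] group_mean_bounded_linear[OF bounded_linear_snd c] by simp
qed

text \<open>Near \<open>a\<close> the function exceeds \<open>F a / 2\<close>, and finitely many
  translates of that neighbourhood cover the group. The sum of the corresponding translates of
  \<open>F\<close> is bounded below, while its mean is a multiple of the mean of
  \<open>F\<close>.\<close>

lemma group_mean_strict_pos:
  fixes F :: "'g \<Rightarrow> real"
  assumes F: "continuous_on UNIV F" and nn: "\<And>x. F x \<ge> 0" and pos: "F a > 0"
  shows "group_mean F > 0"
proof -
  define V where "V = (\<lambda>v. F (v + a)) -` {F a / 2 <..}"
  have "open V" unfolding V_def
    by (rule open_vimage[OF _ continuous_translation(1)[OF F]]) auto
  moreover have "0 \<in> V" using pos by (simp add: V_def)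
  ultimately obtain ys where ys: "ys \<noteq> []" "\<And>x. \<exists>y\<in>set ys. x + y \<in> V"
    using finite_translate_cover by blast
  define c where "c = F a / 2"
  have "c \<le> (\<Sum>y\<leftarrow>ys. F (x + y + a))" for x
  proof -
    obtain y where y: "y \<in> set ys" "F (x + y + a) > c" using ys(2)[of x] by (auto simp: V_def c_def)
    have "F (x + y + a) \<le> (\<Sum>y\<leftarrow>ys. F (x + y + a))"
      using y(1) nn by (intro member_le_sum_list) auto
    then show ?thesis using y(2) by simp
  qed
  moreover have cl: "continuous_on UNIV (\<lambda>x. \<Sum>y\<leftarrow>zs. F (x + y + a))" for zs
    by (induction zs) (auto intro!: continuous_intros continuous_translation[OF F] simp: add.assoc)
  moreover have "group_mean (\<lambda>x. \<Sum>y\<leftarrow>zs. F (x + y + a)) = real (length zs) * group_mean F" for zs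
  proof (induction zs)
    case (Cons z zs)
    have "group_mean (\<lambda>x. F (x + z + a)) = group_mean F"
      using group_mean_translate_right[OF F, of "z + a"] by (simp add: add.assoc)
    then show ?case
      using Cons group_mean_add[OF _ cl[of zs], of "\<lambda>x. F (x + z + a)"] continuous_translation(1)[OF F, of "z + a"]
      by (simp add: add.assoc algebra_simps)
  qed simp
  ultimately have "c \<le> real (length ys) * group_mean F"
    using group_mean_mono[of "\<lambda>_. c" "\<lambda>x. \<Sum>y\<leftarrow>ys. F (x + y + a)"] by simp
  moreover have "c > 0" using pos by (simp add: c_def)
  ultimately have "real (length ys) * group_mean F > 0" by linarith
  then show ?thesis by (simp add: zero_less_mult_iff)
qed

section \<open>Means with a parameter and their interchange\<close>

lemma continuous_group_mean:
  fixes F :: "'g \<Rightarrow> 'g \<Rightarrow> 'a::banach"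
  assumes F: "continuous_on UNIV (\<lambda>(x, y). F x y)"
  shows "continuous_on UNIV (\<lambda>x. group_mean (\<lambda>y. F x y))"
  unfolding continuous_on_topological
proof (intro ballI allI impI)
  fix x0 B assume B: "open B" "group_mean (\<lambda>y. F x0 y) \<in> B"
  then obtain e where e: "e > 0" "\<And>z. dist z (group_mean (\<lambda>y. F x0 y)) < e \<Longrightarrow> z \<in> B"
    unfolding open_dist by blast
  have c: "continuous_on (UNIV \<times> UNIV) (\<lambda>(x, y). F x y)" using F by simp
  have e2: "e / 2 > 0" using e(1) by simp
  obtain X0 where X0: "x0 \<in> X0" "open X0"
    "\<forall>x\<in>X0 \<inter> UNIV. \<forall>y\<in>UNIV. dist ((\<lambda>(x, y). F x y) (x, y)) ((\<lambda>(x, y). F x y) (x0, y)) \<le> e / 2"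
    using continuous_on_prod_compactE[OF c compact_UNIV UNIV_I[of x0] e2] by blast
  have "group_mean (\<lambda>y. F x y) \<in> B" if x: "x \<in> X0" for x
  proof (rule e(2))
    have "norm (group_mean (\<lambda>y. F x y - F x0 y)) \<le> e / 2"
      using X0(3) x by (intro group_mean_norm_le continuous_intros continuous_section[OF F]) (auto simp: dist_norm)
    then show "dist (group_mean (\<lambda>y. F x y)) (group_mean (\<lambda>y. F x0 y)) < e"
      using e(1) by (simp add: dist_norm group_mean_diff continuous_section[OF F])
  qed
  then show "\<exists>A. open A \<and> x0 \<in> A \<and> (\<forall>y\<in>UNIV. y \<in> A \<longrightarrow> group_mean (F y) \<in> B)"
    using X0 by blast
qed

text \<open>A finite average over \<open>x\<close> commutes with the mean over \<open>y\<close>, and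
  by \<open>group_mean_uniform_approx\<close> it is close to the mean over \<open>x\<close>
  uniformly in \<open>y\<close>.\<close>

lemma group_mean_swap:
  fixes F :: "'g \<Rightarrow> 'g \<Rightarrow> 'a::banach"
  assumes F: "continuous_on UNIV (\<lambda>(x, y). F x y)"
  shows "group_mean (\<lambda>x. group_mean (\<lambda>y. F x y)) = group_mean (\<lambda>y. group_mean (\<lambda>x. F x y))"
proof (rule group_mean_unique[OF continuous_group_mean[OF F]])
  fix e :: real assume e: "e > 0"
  obtain gs where gs: "gs \<noteq> []" "\<And>x y. norm (right_average gs (\<lambda>x. F x y) x - group_mean (\<lambda>x. F x y)) \<le> e"
    using group_mean_uniform_approx[OF F e] by blast
  have cs: "continuous_on UNIV (\<lambda>y. \<Sum>g\<leftarrow>hs. F (x + g) y)" for x hs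
    by (induction hs) (auto intro!: continuous_intros continuous_section[OF F])
  have "right_average gs (\<lambda>x. group_mean (\<lambda>y. F x y)) x = group_mean (\<lambda>y. right_average gs (\<lambda>x. F x y) x)" for x
  proof -
    have "(\<Sum>g\<leftarrow>hs. group_mean (\<lambda>y. F (x + g) y)) = group_mean (\<lambda>y. \<Sum>g\<leftarrow>hs. F (x + g) y)" for hs
      by (induction hs) (auto simp: group_mean_add cs continuous_section[OF F])
    then show ?thesis by (simp add: right_average_def group_mean_scaleR cs)
  qed
  moreover have "norm (group_mean (\<lambda>y. right_average gs (\<lambda>x. F x y) x) - group_mean (\<lambda>y. group_mean (\<lambda>x. F x y))) \<le> e" for x
  proof -
    have c1: "continuous_on UNIV (\<lambda>y. right_average gs (\<lambda>x. F x y) x)"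
      unfolding right_average_def by (intro continuous_intros cs)
    have c2: "continuous_on UNIV (\<lambda>y. group_mean (\<lambda>x. F x y))"
      by (rule continuous_group_mean[OF continuous_section(3)[OF F]])
    have "norm (group_mean (\<lambda>y. right_average gs (\<lambda>x. F x y) x - group_mean (\<lambda>x. F x y))) \<le> e"
      by (intro group_mean_norm_le continuous_intros c1 c2 gs)
    then show ?thesis by (simp add: group_mean_diff c1 c2)
  qed
  ultimately show "\<exists>gs. gs \<noteq> [] \<and> (\<forall>x. norm (right_average gs (\<lambda>x. group_mean (\<lambda>y. F x y)) x
      - group_mean (\<lambda>y. group_mean (\<lambda>x. F x y))) \<le> e)"
    using gs(1) by (intro exI[of _ gs]) simp
qed

end

section \<open>Representative functions\<close>

context compact_group
begin

section \<open>The inner product of the mean and orthonormal systems\<close>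

definition mean_inner :: "('g \<Rightarrow> complex) \<Rightarrow> ('g \<Rightarrow> complex) \<Rightarrow> complex" where
  "mean_inner f h = group_mean (\<lambda>x. f x * cnj (h x))"

definition mean_square :: "('g \<Rightarrow> complex) \<Rightarrow> real" where
  "mean_square f = group_mean (\<lambda>x. (cmod (f x))\<^sup>2)"

abbreviation cont :: "('g \<Rightarrow> 'a::topological_space) \<Rightarrow> bool" where
  "cont f \<equiv> continuous_on UNIV f"

lemma group_mean_mult_left:
  "cont f \<Longrightarrow> group_mean (\<lambda>x. c * f x) = c * (group_mean f :: complex)"
  by (rule group_mean_bounded_linear[OF bounded_linear_mult_right])

lemma mean_inner_add_left:
  "cont f \<Longrightarrow> cont f' \<Longrightarrow> cont h \<Longrightarrow>
    mean_inner (\<lambda>x. f x + f' x) h = mean_inner f h + mean_inner f' h"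
  unfolding mean_inner_def distrib_right by (intro group_mean_add continuous_intros)

lemma mean_inner_diff_left:
  "cont f \<Longrightarrow> cont f' \<Longrightarrow> cont h \<Longrightarrow>
    mean_inner (\<lambda>x. f x - f' x) h = mean_inner f h - mean_inner f' h"
  unfolding mean_inner_def left_diff_distrib by (intro group_mean_diff continuous_intros)

lemma mean_inner_mult_left:
  "cont f \<Longrightarrow> cont h \<Longrightarrow> mean_inner (\<lambda>x. c * f x) h = c * mean_inner f h"
  unfolding mean_inner_def mult.assoc by (intro group_mean_mult_left continuous_intros)

lemma mean_inner_sum_left:
  "(\<And>i. i \<in> I \<Longrightarrow> cont (f i)) \<Longrightarrow> cont h \<Longrightarrow>
    mean_inner (\<lambda>x. \<Sum>i\<in>I. f i x) h = (\<Sum>i\<in>I. mean_inner (f i) h)"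
  unfolding mean_inner_def sum_distrib_right by (intro group_mean_sum continuous_intros) auto

lemma mean_inner_cnj: "cont f \<Longrightarrow> cont h \<Longrightarrow> cnj (mean_inner f h) = mean_inner h f"
  unfolding mean_inner_def
  by (subst group_mean_bounded_linear[OF bounded_linear_cnj, symmetric])
     (auto intro!: continuous_intros simp: mult.commute)

lemma mean_inner_self: "cont f \<Longrightarrow> mean_inner f f = of_real (mean_square f)"
  unfolding mean_inner_def mean_square_def
  by (subst group_mean_bounded_linear[OF bounded_linear_of_real, symmetric])
     (auto intro!: continuous_intros simp: complex_norm_square simp del: of_real_power)

lemma mean_square_nonneg: "cont f \<Longrightarrow> mean_square f \<ge> 0"
  unfolding mean_square_def by (intro group_mean_nonneg continuous_intros) auto

lemma mean_square_pos: "cont f \<Longrightarrow> f a \<noteq> 0 \<Longrightarrow> mean_square f > 0"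
  unfolding mean_square_def by (rule group_mean_strict_pos[of _ a]) (auto intro!: continuous_intros)

lemma mean_square_mult: "cont f \<Longrightarrow> mean_square (\<lambda>x. c * f x) = (cmod c)\<^sup>2 * mean_square f"
  unfolding mean_square_def norm_mult power_mult_distrib
  using group_mean_scaleR[of "\<lambda>x. (cmod (f x))\<^sup>2" "(cmod c)\<^sup>2"] by (simp add: continuous_intros)

definition orthonormal :: "nat \<Rightarrow> (nat \<Rightarrow> 'g \<Rightarrow> complex) \<Rightarrow> bool" where
  "orthonormal m e \<longleftrightarrow> (\<forall>i<m. cont (e i)) \<and>
     (\<forall>i<m. \<forall>j<m. mean_inner (e i) (e j) = (if i = j then 1 else 0))"

definition mean_proj :: "nat \<Rightarrow> (nat \<Rightarrow> 'g \<Rightarrow> complex) \<Rightarrow> ('g \<Rightarrow> complex) \<Rightarrow> 'g \<Rightarrow> complex" where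
  "mean_proj m e f x = (\<Sum>i<m. mean_inner f (e i) * e i x)"

lemma cont_mean_proj: "orthonormal m e \<Longrightarrow> cont (mean_proj m e f)"
  unfolding mean_proj_def orthonormal_def by (auto intro!: continuous_intros)

lemma mean_inner_combination:
  assumes e: "orthonormal m e" and j: "j < m"
  shows "mean_inner (\<lambda>x. \<Sum>i<m. a i * e i x) (e j) = a j"
proof -
  have c: "cont (e i)" if "i < m" for i using e that by (simp add: orthonormal_def)
  have "mean_inner (\<lambda>x. \<Sum>i<m. a i * e i x) (e j) = (\<Sum>i<m. mean_inner (\<lambda>x. a i * e i x) (e j))"
    using c j by (intro mean_inner_sum_left continuous_intros) auto
  also have "\<dots> = (\<Sum>i<m. if i = j then a i else 0)"
    using e j c by (intro sum.cong refl) (auto simp: mean_inner_mult_left orthonormal_def)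
  finally show ?thesis using j by simp
qed

lemma mean_proj_combination:
  assumes "orthonormal m e" "h = (\<lambda>x. \<Sum>i<m. a i * e i x)"
  shows "mean_proj m e h = h"
  unfolding mean_proj_def assms(2) by (rule ext) (simp add: mean_inner_combination[OF assms(1)])

lemma mean_inner_residual:
  assumes "orthonormal m e" "cont f" "j < m"
  shows "mean_inner (\<lambda>x. f x - mean_proj m e f x) (e j) = 0"
proof -
  have "mean_inner (mean_proj m e f) (e j) = mean_inner f (e j)"
    unfolding mean_proj_def using mean_inner_combination[OF assms(1,3)] .
  then show ?thesis
    using assms by (subst mean_inner_diff_left) (auto simp: cont_mean_proj orthonormal_def)
qed

lemma bessel_identity:
  assumes e: "orthonormal m e" and f: "cont f"
  shows "mean_square f = mean_square (\<lambda>x. f x - mean_proj m e f x) + (\<Sum>i<m. (cmod (mean_inner f (e i)))\<^sup>2)"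
proof -
  define p where "p = mean_proj m e f"
  define r where "r = (\<lambda>x. f x - p x)"
  have c: "cont (e i)" if "i < m" for i using e that by (simp add: orthonormal_def)
  have p: "cont p" unfolding p_def by (rule cont_mean_proj[OF e])
  have r: "cont r" unfolding r_def by (intro continuous_intros f p)
  have ip: "mean_inner p h = (\<Sum>i<m. mean_inner f (e i) * mean_inner (e i) h)" if h: "cont h" for h
    unfolding p_def mean_proj_def using c h
    by (subst mean_inner_sum_left) (auto intro!: continuous_intros sum.cong simp: mean_inner_mult_left)
  have re: "mean_inner r (e j) = 0" if "j < m" for j
    unfolding r_def p_def by (rule mean_inner_residual[OF e f that])
  have er: "mean_inner (e j) r = 0" if "j < m" for j
    using mean_inner_cnj[OF r c[OF that]] re[OF that] by simp
  have pr: "mean_inner p r = 0" by (simp add: ip[OF r] er)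
  then have rp: "mean_inner r p = 0" using mean_inner_cnj[OF p r] by simp
  have pe: "mean_inner p (e j) = mean_inner f (e j)" if "j < m" for j
    unfolding p_def mean_proj_def by (rule mean_inner_combination[OF e that])
  have pp: "mean_inner p p = (\<Sum>i<m. of_real ((cmod (mean_inner f (e i)))\<^sup>2))"
    unfolding ip[OF p]
  proof (rule sum.cong)
    fix i assume "i \<in> {..<m}"
    then have "mean_inner (e i) p = cnj (mean_inner f (e i))"
      using mean_inner_cnj[OF p c, of i] pe[of i] by simp
    then show "mean_inner f (e i) * mean_inner (e i) p = of_real ((cmod (mean_inner f (e i)))\<^sup>2)"
      by (simp only: complex_norm_square)
  qed simp
  have "mean_inner f f = mean_inner (\<lambda>x. r x + p x) f" by (simp add: r_def)
  also have "\<dots> = cnj (mean_inner (\<lambda>x. r x + p x) r + mean_inner (\<lambda>x. r x + p x) p)"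
  proof -
    have fe: "f = (\<lambda>x. r x + p x)" by (simp add: r_def)
    have "mean_inner (\<lambda>x. r x + p x) f = mean_inner r f + mean_inner p f"
      by (rule mean_inner_add_left[OF r p f])
    moreover have "cnj (mean_inner f r) = mean_inner r f" "cnj (mean_inner f p) = mean_inner p f"
      using mean_inner_cnj f r p by auto
    ultimately show ?thesis using fe by simp
  qed
  also have "\<dots> = cnj (mean_inner r r + mean_inner p p)"
    by (simp add: mean_inner_add_left[OF r p r] mean_inner_add_left[OF r p p] pr rp)
  also have "\<dots> = of_real (mean_square r + (\<Sum>i<m. (cmod (mean_inner f (e i)))\<^sup>2))"
    by (simp add: mean_inner_self[OF r] pp)
  finally show ?thesis
    unfolding mean_inner_self[OF f] of_real_eq_iff by (simp add: r_def p_def)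
qed

lemma bessel_inequality:
  assumes "orthonormal m e" "cont f"
  shows "(\<Sum>i<m. (cmod (mean_inner f (e i)))\<^sup>2) \<le> mean_square f"
  using bessel_identity[OF assms] mean_square_nonneg[of "\<lambda>x. f x - mean_proj m e f x"]
    cont_mean_proj[OF assms(1)] assms(2) by (simp add: continuous_intros)

lemma orthonormal_extend:
  assumes e: "orthonormal m e" and f: "cont f" and ne: "f \<noteq> mean_proj m e f"
  obtains c where "orthonormal (Suc m) (e(m := (\<lambda>x. c * (f x - mean_proj m e f x))))" "c \<noteq> 0"
proof -
  define r where "r = (\<lambda>x. f x - mean_proj m e f x)"
  have r: "cont r" unfolding r_def by (intro continuous_intros f cont_mean_proj[OF e])
  obtain a where "r a \<noteq> 0" using ne by (auto simp: r_def fun_eq_iff)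
  then have pos: "mean_square r > 0" using mean_square_pos[OF r] by blast
  define c where "c = complex_of_real (1 / sqrt (mean_square r))"
  have cr: "cont (\<lambda>x. c * r x)" by (intro continuous_intros r)
  have "mean_square (\<lambda>x. c * r x) = 1"
  proof -
    have "(cmod c)\<^sup>2 = 1 / mean_square r"
      using pos by (simp add: c_def norm_divide power_divide)
    then show ?thesis using pos mean_square_mult[OF r, of c] by simp
  qed
  then have self: "mean_inner (\<lambda>x. c * r x) (\<lambda>x. c * r x) = 1" by (simp add: mean_inner_self[OF cr])
  have ec: "cont (e j)" if "j < m" for j using e that by (simp add: orthonormal_def)
  have 1: "mean_inner (\<lambda>x. c * r x) (e j) = 0" if "j < m" for j
  proof -
    have "mean_inner r (e j) = 0" unfolding r_def by (rule mean_inner_residual[OF e f that])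
    then show ?thesis by (simp add: mean_inner_mult_left[OF r ec[OF that]])
  qed
  have 2: "mean_inner (e j) (\<lambda>x. c * r x) = 0" if "j < m" for j
    using mean_inner_cnj[OF cr ec[OF that]] 1[OF that] by simp
  have "orthonormal (Suc m) (e(m := (\<lambda>x. c * r x)))"
    using e cr self 1 2 by (auto simp: orthonormal_def less_Suc_eq)
  moreover have "c \<noteq> 0" using pos by (simp add: c_def)
  ultimately show ?thesis using that unfolding r_def by blast
qed

text \<open>For nonzero \<open>h\<close> this is Bessel's inequality for the system consisting of
  the normalised \<open>h\<close>.\<close>

lemma cauchy_schwarz_mean:
  assumes f: "cont f" and h: "cont h"
  shows "(cmod (mean_inner f h))\<^sup>2 \<le> mean_square f * mean_square h"
proof (cases "\<exists>a. h a \<noteq> 0")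
  case True
  have o0: "orthonormal 0 e" for e by (simp add: orthonormal_def)
  have p0: "mean_proj 0 e h = (\<lambda>x. 0)" for e by (rule ext) (simp add: mean_proj_def)
  have ne: "h \<noteq> mean_proj 0 (\<lambda>_ _. 0) h" using True by (auto simp: p0)
  obtain c where c: "orthonormal (Suc 0) ((\<lambda>_ _. 0)(0 := (\<lambda>x. c * (h x - mean_proj 0 (\<lambda>_ _. 0) h x))))" "c \<noteq> 0"
    using orthonormal_extend[OF o0 h ne] by blast
  have ch: "cont (\<lambda>x. c * h x)" by (intro continuous_intros h)
  have "mean_square (\<lambda>x. c * h x) = 1"
    using c(1) mean_inner_self[OF ch] by (simp add: orthonormal_def p0)
  then have sq: "(cmod c)\<^sup>2 * mean_square h = 1" by (simp add: mean_square_mult[OF h])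
  have "(cmod (mean_inner f (\<lambda>x. c * h x)))\<^sup>2 \<le> mean_square f"
    using bessel_inequality[OF c(1) f] by (simp add: p0)
  moreover have "mean_inner f (\<lambda>x. c * h x) = cnj c * mean_inner f h"
    by (simp add: mean_inner_cnj[OF ch f, symmetric] mean_inner_mult_left[OF h f] mean_inner_cnj[OF h f])
  ultimately have "(cmod c)\<^sup>2 * (cmod (mean_inner f h))\<^sup>2 \<le> mean_square f"
    by (simp add: norm_mult power_mult_distrib)
  then have "(cmod c)\<^sup>2 * (cmod (mean_inner f h))\<^sup>2 * mean_square h \<le> mean_square f * mean_square h"
    by (rule mult_right_mono) (rule mean_square_nonneg[OF h])
  moreover have "(cmod c)\<^sup>2 * (cmod (mean_inner f h))\<^sup>2 * mean_square h = (cmod (mean_inner f h))\<^sup>2"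
    using sq by (simp add: mult.assoc mult.left_commute)
  ultimately show ?thesis by simp
next
  case False
  then have "h = (\<lambda>x. 0)" by auto
  then show ?thesis by (simp add: mean_inner_def mean_square_def)
qed

text \<open>The bound \<open>D\<close> on the length of orthonormal systems in \<open>H\<close>
  expresses finite dimension. A system of maximal length spans \<open>H\<close>, since a nonzero
  residual would extend it.\<close>

lemma orthonormal_basis:
  assumes H: "\<And>f. f \<in> H \<Longrightarrow> cont f" "(\<lambda>_. 0) \<in> H"
    "\<And>f h a. f \<in> H \<Longrightarrow> h \<in> H \<Longrightarrow> (\<lambda>x. f x + a * h x) \<in> H"
    and D: "\<And>m e. orthonormal m e \<Longrightarrow> (\<forall>i<m. e i \<in> H) \<Longrightarrow> m \<le> D"
  obtains m e where "orthonormal m e" "\<And>i. i < m \<Longrightarrow> e i \<in> H" "\<And>f. f \<in> H \<Longrightarrow> mean_proj m e f = f"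
proof -
  define P where "P m \<longleftrightarrow> (\<exists>e. orthonormal m e \<and> (\<forall>i<m. e i \<in> H))" for m
  have P0: "P 0" by (auto simp: P_def orthonormal_def)
  have "\<forall>m. P m \<longrightarrow> m \<le> D" using D by (auto simp: P_def)
  define m where "m = (GREATEST m. P m)"
  have m: "P m" unfolding m_def by (rule GreatestI_nat[where P = P and k = 0 and b = D, OF P0]) (use \<open>\<forall>m. P m \<longrightarrow> m \<le> D\<close> in blast)
  have mx: "\<not> P (Suc m)"
  proof
    assume "P (Suc m)"
    then have "Suc m \<le> m" unfolding m_def
      by (rule Greatest_le_nat[where P = P and b = D]) (use \<open>\<forall>m. P m \<longrightarrow> m \<le> D\<close> in blast)
    then show False by simp
  qed
  obtain e where e: "orthonormal m e" "\<forall>i<m. e i \<in> H" using m by (auto simp: P_def)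
  have comb: "(\<lambda>x. \<Sum>i<l. a i * e i x) \<in> H" if "l \<le> m" for a l
    using that
  proof (induction l)
    case (Suc l)
    then have "(\<lambda>x. (\<Sum>i<l. a i * e i x) + a l * e l x) \<in> H"
      using e(2) by (intro H(3)) auto
    then show ?case by simp
  qed (simp add: H(2))
  have "mean_proj m e f = f" if f: "f \<in> H" for f
  proof (rule ccontr)
    assume "mean_proj m e f \<noteq> f"
    then have ne: "f \<noteq> mean_proj m e f" by (rule not_sym)
    obtain c where c: "orthonormal (Suc m) (e(m := (\<lambda>x. c * (f x - mean_proj m e f x))))"
      using orthonormal_extend[OF e(1) H(1)[OF f] ne] by blast
    have "mean_proj m e f \<in> H" using comb[of m] by (simp add: mean_proj_def[abs_def])
    then have "(\<lambda>x. f x + (- 1) * mean_proj m e f x) \<in> H" using H(3)[OF f] by blast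
    then have "(\<lambda>x. 0 + c * (f x + (- 1) * mean_proj m e f x)) \<in> H" using H(3)[OF H(2)] by blast
    then have "P (Suc m)" unfolding P_def using c e(2) by (intro exI[of _ "e(m := (\<lambda>x. c * (f x - mean_proj m e f x)))"]) (auto simp: less_Suc_eq)
    then show False using mx by simp
  qed
  then show ?thesis using that e by blast
qed

lemma gram_schmidt:
  assumes "finite E" "\<And>h. h \<in> E \<Longrightarrow> cont h"
  shows "\<exists>m e. orthonormal m e \<and> (\<forall>h\<in>E. mean_proj m e h = h)"
  using assms
proof (induction E rule: finite_induct)
  case empty
  show ?case by (intro exI[of _ 0]) (auto simp: orthonormal_def)
next
  case (insert f E)
  then obtain m e where e: "orthonormal m e" "\<forall>h\<in>E. mean_proj m e h = h" by auto
  show ?case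
  proof (cases "f = mean_proj m e f")
    case True
    have "\<forall>h\<in>insert f E. mean_proj m e h = h" using e(2) True[symmetric] by blast
    then show ?thesis using e(1) by blast
  next
    case False
    obtain c where c: "orthonormal (Suc m) (e(m := (\<lambda>x. c * (f x - mean_proj m e f x))))" "c \<noteq> 0"
      using orthonormal_extend[OF e(1) insert.prems[OF insertI1] False] by blast
    let ?e = "e(m := (\<lambda>x. c * (f x - mean_proj m e f x)))"
    have "mean_proj (Suc m) ?e h = h" if "h \<in> E" for h
    proof (rule mean_proj_combination[OF c(1)])
      have "h = mean_proj m e h" using e that by simp
      then show "h = (\<lambda>x. \<Sum>i<Suc m. (if i = m then 0 else mean_inner h (e i)) * ?e i x)"
        by (auto simp: mean_proj_def fun_eq_iff)
    qed
    moreover have "mean_proj (Suc m) ?e f = f"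
    proof (rule mean_proj_combination[OF c(1)])
      show "f = (\<lambda>x. \<Sum>i<Suc m. (if i = m then 1 / c else mean_inner f (e i)) * ?e i x)"
        using c(2) by (auto simp: mean_proj_def fun_eq_iff)
    qed
    ultimately show ?thesis using c(1) by blast
  qed
qed

text \<open>Count the squares of all \<open>mean_inner (e i) (E j)\<close>: over \<open>j\<close>
  they add up to \<open>1\<close> because \<open>e i\<close> lies in the span of \<open>E\<close>,
  over \<open>i\<close> to at most \<open>1\<close> by Bessel's inequality.\<close>

lemma orthonormal_in_span_le:
  assumes E: "orthonormal n E" and e: "orthonormal m e" and sp: "\<And>i. i < m \<Longrightarrow> mean_proj n E (e i) = e i"
  shows "m \<le> n"
proof -
  have Ec: "cont (E j)" if "j < n" for j using E that by (simp add: orthonormal_def)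
  have ec: "cont (e i)" if "i < m" for i using e that by (simp add: orthonormal_def)
  have one: "mean_square (e i) = 1" if "i < m" for i
    using e that mean_inner_self[OF ec[OF that]] by (simp add: orthonormal_def)
  have "1 = (\<Sum>j<n. (cmod (mean_inner (e i) (E j)))\<^sup>2)" if i: "i < m" for i
  proof -
    have "mean_square (\<lambda>x. e i x - mean_proj n E (e i) x) = 0"
      by (simp add: sp[OF i] mean_square_def)
    then show ?thesis using bessel_identity[OF E ec[OF i]] one[OF i] by simp
  qed
  then have "real m = (\<Sum>i<m. \<Sum>j<n. (cmod (mean_inner (e i) (E j)))\<^sup>2)" by simp
  also have "\<dots> = (\<Sum>j<n. \<Sum>i<m. (cmod (mean_inner (E j) (e i)))\<^sup>2)"
  proof (subst sum.swap, intro sum.cong refl)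
    fix i j assume "i \<in> {..<m}" "j \<in> {..<n}"
    then have "mean_inner (e i) (E j) = cnj (mean_inner (E j) (e i))"
      using mean_inner_cnj[OF Ec ec] by simp
    then show "(cmod (mean_inner (e i) (E j)))\<^sup>2 = (cmod (mean_inner (E j) (e i)))\<^sup>2" by simp
  qed
  also have "\<dots> \<le> (\<Sum>j<n. 1)"
  proof (rule sum_mono)
    fix j assume "j \<in> {..<n}"
    then have j: "j < n" by simp
    have "mean_square (E j) = 1"
      using E j mean_inner_self[OF Ec[OF j]] by (simp add: orthonormal_def)
    then show "(\<Sum>i<m. (cmod (mean_inner (E j) (e i)))\<^sup>2) \<le> 1"
      using bessel_inequality[OF e Ec[OF j]] by simp
  qed
  finally show ?thesis by simp
qed

section \<open>Convolution\<close>

definition conv :: "('g \<Rightarrow> complex) \<Rightarrow> ('g \<Rightarrow> complex) \<Rightarrow> 'g \<Rightarrow> complex" where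
  "conv f k x = group_mean (\<lambda>y. f y * k (- y + x))"

lemma cont_compose2:
  assumes "cont f" "continuous_on S p"
  shows "continuous_on S (\<lambda>z. f (p z))"
  by (rule continuous_on_compose2[OF assms]) simp

lemma cont_conv:
  assumes f: "cont f" and k: "cont k"
  shows "cont (conv f k)"
  unfolding conv_def[abs_def] by (rule continuous_group_mean)
    (unfold case_prod_beta, intro continuous_intros cont_compose2[OF f] cont_compose2[OF k])

lemma conv_assoc:
  assumes f: "cont f" and k: "cont k" and l: "cont l"
  shows "conv (conv f k) l = conv f (conv k l)"
proof (rule ext)
  fix x
  have jc: "continuous_on UNIV (\<lambda>(z, y). f y * k (- y + z) * l (- z + x))"
    unfolding case_prod_beta
    by (intro continuous_intros cont_compose2[OF f] cont_compose2[OF k] cont_compose2[OF l])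
  have ck: "cont (\<lambda>y. f y * k (- y + z))" for z
    by (intro continuous_intros cont_compose2[OF k] f)
  have cl: "cont (\<lambda>z. k z * l (- z + y))" for y
    by (intro continuous_intros cont_compose2[OF l] k)
  have "conv (conv f k) l x = group_mean (\<lambda>z. group_mean (\<lambda>y. f y * k (- y + z) * l (- z + x)))"
  proof -
    have "group_mean (\<lambda>y. f y * k (- y + z)) * l (- z + x) = group_mean (\<lambda>y. f y * k (- y + z) * l (- z + x))" for z
      by (rule group_mean_bounded_linear[OF bounded_linear_mult_left ck, symmetric])
    then show ?thesis by (simp add: conv_def)
  qed
  also have "\<dots> = group_mean (\<lambda>y. group_mean (\<lambda>z. f y * k (- y + z) * l (- z + x)))"
    by (rule group_mean_swap[OF jc])
  also have "\<dots> = group_mean (\<lambda>y. f y * conv k l (- y + x))"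
  proof -
    have "group_mean (\<lambda>z. f y * k (- y + z) * l (- z + x)) = f y * conv k l (- y + x)" for y
    proof -
      have c3: "cont (\<lambda>z. f y * k (- y + z) * l (- z + x))"
        by (intro continuous_intros cont_compose2[OF k] cont_compose2[OF l])
      have "group_mean (\<lambda>z. f y * k (- y + z) * l (- z + x)) =
          group_mean (\<lambda>z. f y * k (- y + (y + z)) * l (- (y + z) + x))"
        by (rule group_mean_translate_left[OF c3, symmetric])
      also have "\<dots> = group_mean (\<lambda>z. f y * (k z * l (- z + (- y + x))))"
        by (simp only: add.assoc[symmetric] minus_add left_minus add_0_left mult.assoc)
      also have "\<dots> = f y * conv k l (- y + x)"
        unfolding conv_def by (rule group_mean_mult_left[OF cl])
      finally show ?thesis .
    qed
    then show ?thesis by simp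
  qed
  finally show "conv (conv f k) l x = conv f (conv k l) x" by (simp add: conv_def)
qed

lemma cont_conv_integrand:
  fixes f k :: "'g \<Rightarrow> complex"
  assumes "cont f" "cont k"
  shows "cont (\<lambda>y. f y * k (- y + x))"
  by (intro continuous_intros cont_compose2[OF assms(2)] assms(1))

lemma conv_diff_left:
  "cont f \<Longrightarrow> cont f' \<Longrightarrow> cont k \<Longrightarrow> conv (\<lambda>x. f x - f' x) k x = conv f k x - conv f' k x"
  unfolding conv_def left_diff_distrib by (intro group_mean_diff cont_conv_integrand)

lemma conv_add_left:
  "cont f \<Longrightarrow> cont f' \<Longrightarrow> cont k \<Longrightarrow> conv (\<lambda>x. f x + f' x) k x = conv f k x + conv f' k x"
  unfolding conv_def distrib_right by (intro group_mean_add cont_conv_integrand)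

lemma conv_mult_left:
  "cont f \<Longrightarrow> cont k \<Longrightarrow> conv (\<lambda>x. c * f x) k x = c * conv f k x"
  unfolding conv_def mult.assoc by (intro group_mean_mult_left cont_conv_integrand)

text \<open>Convolution with a kernel on the right commutes with left translations; this makes its
  eigenspaces translation invariant.\<close>

lemma conv_translate:
  assumes f: "cont f" and k: "cont k"
  shows "conv (\<lambda>y. f (a + y)) k x = conv f k (a + x)"
proof -
  have c: "cont (\<lambda>y. f y * k (- y + (a + x)))" by (intro continuous_intros cont_compose2[OF k] f)
  have "conv f k (a + x) = group_mean (\<lambda>y. f (a + y) * k (- (a + y) + (a + x)))"
    unfolding conv_def by (rule group_mean_translate_left[OF c, symmetric])
  also have "\<dots> = conv (\<lambda>y. f (a + y)) k x"
  proof -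
    have "- (a + y) + (a + x) = - y + x" for y by (metis add.assoc minus_add minus_add_cancel)
    then show ?thesis by (simp only: conv_def)
  qed
  finally show ?thesis by simp
qed

lemma mean_square_reflect:
  assumes k: "cont k"
  shows "mean_square (\<lambda>y. cnj (k (- y + x))) = mean_square k"
proof -
  have c: "cont (\<lambda>y. (cmod (k y))\<^sup>2)" by (intro continuous_intros k)
  have "mean_square (\<lambda>y. cnj (k (- y + x))) = group_mean (\<lambda>y. (cmod (k (- y + x)))\<^sup>2)"
    by (simp add: mean_square_def)
  also have "\<dots> = group_mean (\<lambda>y. (cmod (k (y + x)))\<^sup>2)"
    by (rule group_mean_minus_arg[of "\<lambda>y. (cmod (k (y + x)))\<^sup>2"]) (intro continuous_intros cont_compose2[OF k])
  also have "\<dots> = mean_square k" unfolding mean_square_def by (rule group_mean_translate_right[OF c])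
  finally show ?thesis .
qed

lemma conv_eq_inner: "conv f k x = mean_inner f (\<lambda>y. cnj (k (- y + x)))"
  by (simp add: conv_def mean_inner_def)

lemma conv_bound:
  assumes f: "cont f" and k: "cont k"
  shows "(cmod (conv f k x))\<^sup>2 \<le> mean_square f * mean_square k"
  unfolding conv_eq_inner mean_square_reflect[OF k, of x, symmetric]
  by (rule cauchy_schwarz_mean[OF f]) (intro continuous_intros cont_compose2[OF k])

lemma mean_square_le:
  assumes "cont f" "\<And>x. (cmod (f x))\<^sup>2 \<le> B"
  shows "mean_square f \<le> B"
  using group_mean_mono[of "\<lambda>x. (cmod (f x))\<^sup>2" "\<lambda>_. B"] assms
  by (simp add: mean_square_def continuous_intros)

text \<open>At a fixed \<open>x\<close> the values \<open>e i x\<close> are inner products with the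
  single function \<open>y \<mapsto> cnj (K (- y + x))\<close>, so Bessel's inequality bounds the
  sum of their squares by \<open>mean_square K\<close>. The mean over \<open>x\<close> of that sum
  is the number of eigenfunctions.\<close>

lemma eigenspace_orthonormal_bound:
  assumes K: "cont K" and e: "orthonormal m e" "\<And>i. i < m \<Longrightarrow> conv (e i) K = e i"
  shows "real m \<le> mean_square K"
proof -
  have ec: "cont (e i)" if "i < m" for i using e(1) that by (simp add: orthonormal_def)
  have pt: "(\<Sum>i<m. (cmod (e i x))\<^sup>2) \<le> mean_square K" for x
  proof -
    have c: "cont (\<lambda>y. cnj (K (- y + x)))" by (intro continuous_intros cont_compose2[OF K])
    have "cmod (e i x) = cmod (mean_inner (\<lambda>y. cnj (K (- y + x))) (e i))" if i: "i < m" for i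
    proof -
      have "e i x = mean_inner (e i) (\<lambda>y. cnj (K (- y + x)))"
        using e(2)[OF i] by (simp add: conv_eq_inner[symmetric])
      also have "\<dots> = cnj (mean_inner (\<lambda>y. cnj (K (- y + x))) (e i))"
        by (rule mean_inner_cnj[OF c ec[OF i], symmetric])
      finally show ?thesis by simp
    qed
    then have "(\<Sum>i<m. (cmod (e i x))\<^sup>2) = (\<Sum>i<m. (cmod (mean_inner (\<lambda>y. cnj (K (- y + x))) (e i)))\<^sup>2)"
      by simp
    also have "\<dots> \<le> mean_square K"
      using bessel_inequality[OF e(1) c] by (simp only: mean_square_reflect[OF K])
    finally show ?thesis .
  qed
  have "real m = (\<Sum>i<m. mean_square (e i))"
  proof -
    have "mean_square (e i) = 1" if "i < m" for i
      using e(1) that mean_inner_self[OF ec[OF that]] by (simp add: orthonormal_def)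
    then show ?thesis by simp
  qed
  also have "\<dots> = group_mean (\<lambda>x. \<Sum>i<m. (cmod (e i x))\<^sup>2)"
    unfolding mean_square_def by (rule group_mean_sum[symmetric]) (auto intro!: continuous_intros ec)
  also have "\<dots> \<le> group_mean (\<lambda>_::'g. mean_square K)"
    by (rule group_mean_mono) (auto intro!: continuous_intros ec pt)
  finally show ?thesis by simp
qed

section \<open>Powers of a hermitian kernel\<close>

definition hermitian_kernel :: "('g \<Rightarrow> complex) \<Rightarrow> bool" where
  "hermitian_kernel k \<longleftrightarrow> (\<forall>x. k (- x) = cnj (k x))"

text \<open>The index counts convolutions, so \<open>conv_power k n\<close> has \<open>n + 1\<close>
  factors \<open>k\<close>: a unit for convolution is in general not a continuous function. Hence
  the shift by \<open>1\<close> in the index laws.\<close>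

fun conv_power :: "('g \<Rightarrow> complex) \<Rightarrow> nat \<Rightarrow> 'g \<Rightarrow> complex" where
  "conv_power k 0 = k"
| "conv_power k (Suc n) = conv (conv_power k n) k"

lemma cont_conv_power: "cont k \<Longrightarrow> cont (conv_power k n)"
  by (induction n) (auto intro: cont_conv)

lemma conv_power_add:
  assumes k: "cont k"
  shows "conv (conv_power k m) (conv_power k n) = conv_power k (m + n + 1)"
  by (induction n) (simp_all add: conv_assoc[symmetric] cont_conv_power k)

lemma conv_reflect:
  assumes f: "cont f" and h: "cont h"
  shows "cnj (conv f h (- x)) = conv (\<lambda>y. cnj (h (- y))) (\<lambda>y. cnj (f (- y))) x"
proof -
  have c: "cont (\<lambda>y. f y * h (- y + - x))" by (intro continuous_intros cont_compose2[OF h] f)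
  have c': "cont (\<lambda>y. cnj (f y * h (- y + - x)))" by (intro continuous_intros c)
  have "cnj (conv f h (- x)) = group_mean (\<lambda>y. cnj (f y * h (- y + - x)))"
    unfolding conv_def by (rule group_mean_bounded_linear[OF bounded_linear_cnj c, symmetric])
  also have "\<dots> = group_mean (\<lambda>y. cnj (f (- x + y) * h (- (- x + y) + - x)))"
    by (rule group_mean_translate_left[OF c', symmetric])
  also have "\<dots> = conv (\<lambda>y. cnj (h (- y))) (\<lambda>y. cnj (f (- y))) x"
    by (simp add: conv_def minus_add add.assoc mult.commute)
  finally show ?thesis .
qed

lemma hermitian_conv_power:
  assumes k: "cont k" "hermitian_kernel k"
  shows "hermitian_kernel (conv_power k n)"
proof (induction n)
  case (Suc n)
  have r: "(\<lambda>y. cnj (k (- y))) = k" "(\<lambda>y. cnj (conv_power k n (- y))) = conv_power k n"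
    using k(2) Suc by (auto simp: hermitian_kernel_def)
  have "cnj (conv_power k (Suc n) (- x)) = conv k (conv_power k n) x" for x
    using conv_reflect[OF cont_conv_power[OF k(1)] k(1), of n x] by (simp add: r)
  moreover have "conv k (conv_power k n) = conv_power k (Suc n)"
    using conv_power_add[OF k(1), of 0 n] by simp
  ultimately have "cnj (conv_power k (Suc n) (- x)) = conv_power k (Suc n) x" for x by simp
  then have "cnj (cnj (conv_power k (Suc n) (- x))) = cnj (conv_power k (Suc n) x)" for x by (rule arg_cong)
  then show ?case unfolding hermitian_kernel_def complex_cnj_cnj by blast
qed (use k in simp)

text \<open>Inner products become values at the unit of the group, so that inner products of powers
  of \<open>k\<close> depend only on the total number of factors.\<close>

lemma conv_at_zero: "hermitian_kernel h \<Longrightarrow> conv f h 0 = mean_inner f h"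
  by (simp add: conv_def mean_inner_def hermitian_kernel_def)

lemma conv_power_inner:
  assumes k: "cont k" "hermitian_kernel k"
  shows "mean_inner (conv_power k m) (conv_power k n) = conv_power k (m + n + 1) 0"
  using conv_at_zero[OF hermitian_conv_power[OF k]] conv_power_add[OF k(1)] by metis

lemma conv_power_mean_square:
  assumes k: "cont k" "hermitian_kernel k"
  shows "of_real (mean_square (conv_power k n)) = conv_power k (2 * n + 1) 0"
  using conv_power_inner[OF k, of n n] mean_inner_self[OF cont_conv_power[OF k(1)], of n]
  by (simp add: mult_2)

lemma conv_power_log_convex:
  assumes k: "cont k" "hermitian_kernel k"
  shows "(mean_square (conv_power k (Suc n)))\<^sup>2 \<le>
    mean_square (conv_power k n) * mean_square (conv_power k (Suc (Suc n)))"
proof -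
  have "mean_inner (conv_power k n) (conv_power k (Suc (Suc n))) = of_real (mean_square (conv_power k (Suc n)))"
    using conv_power_inner[OF k, of n "Suc (Suc n)"] conv_power_mean_square[OF k, of "Suc n"]
    by (simp add: mult_2)
  then show ?thesis
    using cauchy_schwarz_mean[OF cont_conv_power[OF k(1), of n] cont_conv_power[OF k(1), of "Suc (Suc n)"]]
    by simp
qed

lemma conv_power_submult:
  assumes k: "cont k"
  shows "mean_square (conv_power k (m + n + 1)) \<le> mean_square (conv_power k m) * mean_square (conv_power k n)"
  unfolding conv_power_add[OF k, symmetric]
  by (intro mean_square_le cont_conv conv_bound cont_conv_power k)

lemma conv_power_scale:
  assumes k: "cont k"
  shows "conv_power (\<lambda>x. c * k x) n = (\<lambda>x. c ^ Suc n * conv_power k n x)"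
proof (induction n)
  case (Suc n)
  have "conv (\<lambda>x. c ^ Suc n * conv_power k n x) (\<lambda>x. c * k x) x = c ^ Suc (Suc n) * conv (conv_power k n) k x" for x
  proof -
    have "conv (\<lambda>x. c ^ Suc n * conv_power k n x) (\<lambda>x. c * k x) x =
        group_mean (\<lambda>y. c ^ Suc (Suc n) * (conv_power k n y * k (- y + x)))"
      by (simp add: conv_def mult_ac)
    also have "\<dots> = c ^ Suc (Suc n) * conv (conv_power k n) k x"
      unfolding conv_def
      by (intro group_mean_mult_left continuous_intros cont_conv_power[OF k] cont_compose2[OF k])
    finally show ?thesis .
  qed
  then show ?case by (intro ext) (simp only: conv_power.simps Suc)
qed simp

text \<open>Let \<open>b n\<close> be the mean square of \<open>conv_power k n\<close>. By
  log-convexity the ratios \<open>b (Suc n) / b n\<close> increase, by submultiplicativity they stay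
  below \<open>b 0\<close>; their limit \<open>L\<close> is the square of the spectral radius of
  convolution with \<open>k\<close>. Division of \<open>k\<close> by \<open>sqrt L\<close> brings
  all ratios to at most \<open>1\<close>, while \<open>L ^ Suc m \<le> b m\<close> keeps the mean
  squares at or above \<open>1\<close>.\<close>

lemma normalise_kernel:
  assumes k: "cont k" "hermitian_kernel k" and ne: "k a \<noteq> 0"
  shows "\<exists>c::real. \<forall>n. mean_square (conv_power (\<lambda>x. of_real c * k x) n) \<ge> 1 \<and>
    mean_square (conv_power (\<lambda>x. of_real c * k x) (Suc n)) \<le> mean_square (conv_power (\<lambda>x. of_real c * k x) n)"
proof -
  define b where "b n = mean_square (conv_power k n)" for n
  have lc: "(b (Suc n))\<^sup>2 \<le> b n * b (Suc (Suc n))" for n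
    unfolding b_def by (rule conv_power_log_convex[OF k])
  have sm: "b (m + n + 1) \<le> b m * b n" for m n unfolding b_def by (rule conv_power_submult[OF k(1)])
  have b0: "b 0 > 0" unfolding b_def using mean_square_pos[OF k(1) ne] by simp
  \<comment> \<open>The mean square of \<open>k\<close> is the value of
    \<open>conv_power k 1\<close> at the unit. So \<open>b 0\<close> and \<open>b 1\<close> are
    positive, and log-convexity propagates positivity from two consecutive terms.\<close>
  have "conv_power k 1 0 \<noteq> 0" using conv_power_mean_square[OF k, of 0] b0 by (auto simp: b_def)
  then have b1: "b 1 > 0" unfolding b_def by (rule mean_square_pos[OF cont_conv_power[OF k(1)]])
  have pos: "b n > 0 \<and> b (Suc n) > 0" for n
  proof (induction n)
    case (Suc n)
    then have "0 < (b (Suc n))\<^sup>2" by simp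
    then have "0 < b n * b (Suc (Suc n))" using lc[of n] by linarith
    then show ?case using Suc by (simp add: zero_less_mult_iff)
  qed (use b0 b1 in simp)
  define r where "r n = b (Suc n) / b n" for n
  have inc: "incseq r"
  proof (rule incseq_SucI)
    fix n
    show "r n \<le> r (Suc n)"
      using lc[of n] pos[of n] pos[of "Suc n"] by (simp add: r_def field_simps power2_eq_square)
  qed
  have bd: "\<forall>n. r n \<le> b 0"
    using sm[of _ 0] pos by (simp add: r_def field_simps)
  obtain L where L: "r \<longlonglongrightarrow> L" "\<And>n. r n \<le> L"
    using incseq_convergent[OF inc bd] by blast
  have rpos: "r n > 0" for n using pos[of n] by (simp add: r_def)
  have Lpos: "L > 0" using rpos[of 0] L(2)[of 0] by linarith
  have lim: "(\<lambda>n. b (n + m) / b n) \<longlonglongrightarrow> L ^ m" for m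
  proof (induction m)
    case 0
    have "b n / b n = 1" for n using pos[of n] by simp
    then show ?case by simp
  next
    case (Suc m)
    have "(\<lambda>n. r (n + m)) \<longlonglongrightarrow> L" using L(1) by (rule LIMSEQ_ignore_initial_segment)
    then have "(\<lambda>n. r (n + m) * (b (n + m) / b n)) \<longlonglongrightarrow> L * L ^ m" using Suc by (rule tendsto_mult)
    moreover have "r (n + m) * (b (n + m) / b n) = b (n + Suc m) / b n" for n
      using pos[of "n + m"] by (simp add: r_def)
    ultimately show ?case by (simp only: power_Suc)
  qed
  have low: "L ^ Suc m \<le> b m" for m
  proof (rule LIMSEQ_le_const2[OF lim[of "Suc m"]], intro exI allI impI)
    fix n
    show "b (n + Suc m) / b n \<le> b m"
      using sm[of n m] pos[of n] by (simp add: field_simps)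
  qed
  define c where "c = 1 / sqrt L"
  have c: "c > 0" using Lpos by (simp add: c_def)
  have cc: "(c ^ m)\<^sup>2 = 1 / L ^ m" for m
  proof -
    have "(c ^ m)\<^sup>2 = (c\<^sup>2) ^ m" by (simp add: power_mult[symmetric] mult.commute)
    also have "c\<^sup>2 = 1 / L" using Lpos by (simp add: c_def power_divide)
    finally show ?thesis by (simp add: power_one_over)
  qed
  have ms: "mean_square (conv_power (\<lambda>x. complex_of_real c * k x) n) = b n / L ^ Suc n" for n
  proof -
    have "(cmod (complex_of_real c ^ Suc n))\<^sup>2 = (c ^ Suc n)\<^sup>2"
      using c by (simp only: norm_power norm_of_real abs_of_pos)
    then show ?thesis
      unfolding conv_power_scale[OF k(1)] mean_square_mult[OF cont_conv_power[OF k(1)]] cc b_def by simp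
  qed
  show ?thesis
  proof (intro exI[of _ c] allI conjI)
    fix n
    show "1 \<le> mean_square (conv_power (\<lambda>x. complex_of_real c * k x) n)"
      unfolding ms using low[of n] Lpos by (simp add: pos_le_divide_eq del: power_Suc)
    have "b (Suc n) \<le> L * b n" using L(2)[of n] pos[of n] by (simp add: r_def field_simps)
    then show "mean_square (conv_power (\<lambda>x. complex_of_real c * k x) (Suc n)) \<le>
        mean_square (conv_power (\<lambda>x. complex_of_real c * k x) n)"
      unfolding ms using Lpos by (simp add: field_simps)
  qed
qed

text \<open>Power iteration: for a normalised kernel \<open>k\<close> the even convolution powers converge uniformly to
  a nonzero function fixed by convolution with \<open>k * k\<close>.\<close>

lemma normalised_kernel_eigenfunction:
  assumes k: "cont k" "hermitian_kernel k"
    and ge1: "\<And>n. mean_square (conv_power k n) \<ge> 1"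
    and dec: "\<And>n. mean_square (conv_power k (Suc n)) \<le> mean_square (conv_power k n)"
  obtains p where "cont p" "p 0 \<noteq> 0" "conv p (conv k k) = p"
proof -
  define b where "b n = mean_square (conv_power k n)" for n
  define K where "K = conv k k"
  have K: "cont K" unfolding K_def by (intro cont_conv k)
  \<comment> \<open>These have \<open>2 * j + 2\<close> factors. Only even powers are taken, since
    an eigenvalue \<open>-1\<close> of convolution with \<open>k\<close> would make consecutive
    powers oscillate.\<close>
  define P where "P j = conv_power k (2 * j + 1)" for j
  have P: "cont (P j)" for j unfolding P_def by (rule cont_conv_power[OF k(1)])
  have PK: "conv (P j) K = P (Suc j)" for j
    using conv_power_add[OF k(1), of "2 * j + 1" 1] by (simp add: P_def K_def numeral_eq_Suc)
  have Pi: "mean_inner (P i) (P j) = of_real (b (i + j + 1))" for i j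
    using conv_power_inner[OF k, of "2 * i + 1" "2 * j + 1"] conv_power_mean_square[OF k, of "i + j + 1"]
    by (simp add: P_def b_def algebra_simps)
  \<comment> \<open>Every inner product of the \<open>P j\<close> is a term of the convergent
    sequence \<open>b\<close>, so the \<open>P j\<close> are Cauchy in mean square.\<close>
  have Pd: "mean_square (\<lambda>x. P i x - P j x) = b (2 * i + 1) + b (2 * j + 1) - 2 * b (i + j + 1)" for i j
  proof -
    have c: "cont (\<lambda>x. P i x - P j x)" by (intro continuous_intros P)
    have "mean_inner (\<lambda>x. P i x - P j x) (P l) = of_real (b (i + l + 1) - b (j + l + 1))" for l
      by (simp add: mean_inner_diff_left[OF P P P] Pi)
    then have e: "mean_inner (P l) (\<lambda>x. P i x - P j x) = of_real (b (i + l + 1) - b (j + l + 1))" for l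
      by (simp only: mean_inner_cnj[OF c P, symmetric] complex_cnj_complex_of_real)
    have "complex_of_real (mean_square (\<lambda>x. P i x - P j x)) =
        of_real ((b (i + i + 1) - b (j + i + 1)) - (b (i + j + 1) - b (j + j + 1)))"
      unfolding mean_inner_self[OF c, symmetric] mean_inner_diff_left[OF P P c] e by simp
    then have "mean_square (\<lambda>x. P i x - P j x) =
        (b (i + i + 1) - b (j + i + 1)) - (b (i + j + 1) - b (j + j + 1))"
      by (simp only: of_real_eq_iff)
    moreover have a: "i + i + 1 = 2 * i + 1" "j + j + 1 = 2 * j + 1" "j + i + 1 = i + j + 1" by simp_all
    ultimately show ?thesis unfolding a by linarith
  qed
  have db: "decseq b" unfolding b_def by (rule decseq_SucI) (rule dec)
  have lb: "\<forall>n. 1 \<le> b n" using ge1 by (simp add: b_def)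
  obtain \<beta> where \<beta>: "b \<longlonglongrightarrow> \<beta>"
    using decseq_convergent[OF db lb] by blast
  have \<beta>1: "\<beta> \<ge> 1" by (rule LIMSEQ_le_const[OF \<beta>]) (use ge1 in \<open>auto simp: b_def\<close>)
  define B where "B = mean_square K"
 have cancel: "z \<noteq> 0 \<Longrightarrow> a / z * z = a" for a z :: real by simp
  have B0: "B \<ge> 0" unfolding B_def by (rule mean_square_nonneg[OF K])
  \<comment> \<open>One more convolution with \<open>K\<close> turns mean-square distance into
    uniform distance.\<close>
  have sup: "(cmod (P (Suc i) x - P (Suc j) x))\<^sup>2 \<le> mean_square (\<lambda>x. P i x - P j x) * B" for i j x
    using conv_bound[OF _ K, of "\<lambda>x. P i x - P j x" x] conv_diff_left[OF P P K, of i j x]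
    by (simp add: PK B_def continuous_intros P)
  have "uniformly_Cauchy_on UNIV (\<lambda>j. P (Suc j))"
    unfolding uniformly_Cauchy_on_def
  proof (intro allI impI)
    fix e :: real assume e: "e > 0"
    define d where "d = e\<^sup>2 / (4 * (B + 1))"
    have d: "d > 0" using e B0 by (simp add: d_def)
    obtain M where M: "\<And>n. n \<ge> M \<Longrightarrow> \<bar>b n - \<beta>\<bar> < d"
      using \<beta>[unfolded LIMSEQ_iff, rule_format, OF d] by auto
    have "dist (P (Suc i) x) (P (Suc j) x) < e" if "i \<ge> M" "j \<ge> M" for i j x
    proof -
      have "mean_square (\<lambda>x. P i x - P j x) < 4 * d"
        unfolding Pd using M[of "2 * i + 1"] M[of "2 * j + 1"] M[of "i + j + 1"] that by linarith
      then have "mean_square (\<lambda>x. P i x - P j x) * B \<le> 4 * d * B"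
        using B0 by (intro mult_right_mono) auto
      also have "\<dots> < 4 * d * (B + 1)" using d by simp
      also have "\<dots> = e\<^sup>2"
      proof -
        have "B + 1 > 0" using B0 by linarith
        then have "d * (4 * (B + 1)) = e\<^sup>2" unfolding d_def using cancel[of "4 * (B + 1)"] by simp
        moreover have "4 * d * (B + 1) = d * (4 * (B + 1))" by (simp only: mult.left_commute mult.assoc)
        ultimately show ?thesis by (simp only:)
      qed
      finally have "(cmod (P (Suc i) x - P (Suc j) x))\<^sup>2 < e\<^sup>2" using sup[of i x j] by linarith
      then show ?thesis using e by (simp add: dist_norm power_less_imp_less_base)
    qed
    then show "\<exists>M. \<forall>x\<in>UNIV. \<forall>m\<ge>M. \<forall>n\<ge>M. dist (P (Suc m) x) (P (Suc n) x) < e" by blast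
  qed
  then have "uniformly_convergent_on UNIV (\<lambda>j. P (Suc j))" by (rule Cauchy_uniformly_convergent)
  then obtain p where p: "uniform_limit UNIV (\<lambda>j. P (Suc j)) p sequentially"
    by (auto simp: uniformly_convergent_on_def)
  have cp: "cont p"
    by (rule uniform_limit_theorem[OF _ p]) (simp_all add: P)
  have plim: "(\<lambda>j. P (Suc j) x) \<longlonglongrightarrow> p x" for x using tendsto_uniform_limitI[OF p] by simp
  \<comment> \<open>The value at the unit is a mean square and hence at least \<open>1\<close>; this
    keeps the limit from vanishing.\<close>
  have "P j 0 = of_real (b j)" for j
    using conv_power_mean_square[OF k, of j] by (simp add: P_def b_def)
  then have "(\<lambda>j. complex_of_real (b (Suc j))) \<longlonglongrightarrow> p 0" using plim[of 0] by simp
  moreover have "(\<lambda>j. complex_of_real (b (Suc j))) \<longlonglongrightarrow> of_real \<beta>"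
    using LIMSEQ_Suc[OF \<beta>] by (rule tendsto_of_real)
  ultimately have "p 0 = of_real \<beta>" by (rule LIMSEQ_unique)
  then have p0: "p 0 \<noteq> 0" using \<beta>1 by auto
  have "conv p K x = p x" for x
  proof (rule LIMSEQ_unique)
    show "(\<lambda>j. P (Suc (Suc j)) x) \<longlonglongrightarrow> p x" using LIMSEQ_Suc[OF plim[of x]] .
    show "(\<lambda>j. P (Suc (Suc j)) x) \<longlonglongrightarrow> conv p K x"
    proof (rule LIMSEQ_I)
      fix e :: real assume e: "e > 0"
      define d where "d = (e / 2) / (B + 1)"
      have d: "d > 0" using e B0 by (simp add: d_def)
      obtain M where M: "\<And>n y. n \<ge> M \<Longrightarrow> dist (P (Suc n) y) (p y) < d"
        using p[unfolded uniform_limit_iff, rule_format, OF d] unfolding eventually_sequentially by auto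
      have "norm (P (Suc (Suc n)) x - conv p K x) < e" if n: "n \<ge> M" for n
      proof -
        have c: "cont (\<lambda>y. P (Suc n) y - p y)" by (intro continuous_intros P cp)
        have "mean_square (\<lambda>y. P (Suc n) y - p y) \<le> d\<^sup>2"
          using M[OF n] by (intro mean_square_le c power_mono) (auto simp: dist_norm less_imp_le)
        then have "mean_square (\<lambda>y. P (Suc n) y - p y) * B \<le> d\<^sup>2 * (B + 1)"
          using B0 by (intro mult_mono) auto
        also have "\<dots> \<le> d\<^sup>2 * (B + 1)\<^sup>2"
          using B0 by (intro mult_left_mono self_le_power) auto
        also have "\<dots> = (e / 2)\<^sup>2"
        proof -
          have "B + 1 \<noteq> 0" using B0 by auto
          then have "d * (B + 1) = e / 2" unfolding d_def by (rule cancel)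
          then show ?thesis by (simp only: power_mult_distrib[symmetric])
        qed
        finally have le: "mean_square (\<lambda>y. P (Suc n) y - p y) * B \<le> (e / 2)\<^sup>2" .
        have "conv (\<lambda>y. P (Suc n) y - p y) K x = P (Suc (Suc n)) x - conv p K x"
          by (simp add: conv_diff_left[OF P cp K] PK)
        then have "(cmod (P (Suc (Suc n)) x - conv p K x))\<^sup>2 \<le> (e / 2)\<^sup>2"
          using conv_bound[OF c K, of x] le unfolding B_def by simp
        then have "cmod (P (Suc (Suc n)) x - conv p K x) \<le> e / 2"
          by (rule power2_le_imp_le) (use e in simp)
        then show ?thesis using e by simp
      qed
      then show "\<exists>no. \<forall>n\<ge>no. norm (P (Suc (Suc n)) x - conv p K x) < e" by blast
    qed
  qed
  then have "conv p (conv k k) = p" unfolding K_def by auto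
  then show ?thesis using that[OF cp p0] by blast
qed

section \<open>Linear spans and representative functions\<close>

inductive_set cspan :: "('g \<Rightarrow> complex) set \<Rightarrow> ('g \<Rightarrow> complex) set" for E where
  zero: "(\<lambda>_. 0) \<in> cspan E"
| step: "f \<in> cspan E \<Longrightarrow> h \<in> E \<Longrightarrow> (\<lambda>x. f x + a * h x) \<in> cspan E"

lemma cspan_add: "h \<in> cspan E \<Longrightarrow> f \<in> cspan E \<Longrightarrow> (\<lambda>x. f x + h x) \<in> cspan E"
proof (induction rule: cspan.induct)
  case (step h e a)
  from cspan.step[OF step.IH[OF step.prems] step.hyps(2), of a] show ?case by (simp add: add.assoc)
qed simp

lemma cspan_scale: "f \<in> cspan E \<Longrightarrow> (\<lambda>x. c * f x) \<in> cspan E"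
proof (induction rule: cspan.induct)
  case (step f e a)
  from cspan.step[OF step.IH step.hyps(2), of "c * a"] show ?case by (simp add: algebra_simps)
qed (simp add: cspan.zero)

lemma cspan_mono: "f \<in> cspan E \<Longrightarrow> E \<subseteq> E' \<Longrightarrow> f \<in> cspan E'"
  by (induction rule: cspan.induct) (auto intro: cspan.intros)

lemma cspan_base: "e \<in> E \<Longrightarrow> e \<in> cspan E"
  using cspan.step[OF cspan.zero, of e E 1] by simp

lemma cspan_mult_base:
  "h \<in> cspan E' \<Longrightarrow> e \<in> E \<Longrightarrow> (\<lambda>x. e x * h x) \<in> cspan ((\<lambda>(e, e') x. e x * e' x) ` (E \<times> E'))"
proof (induction rule: cspan.induct)
  case (step h e' a)
  have "(\<lambda>x. e x * e' x) \<in> (\<lambda>(e, e') x. e x * e' x) ` (E \<times> E')" using step.prems step.hyps(2) by force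
  from cspan.step[OF step.IH[OF step.prems] this, of a] show ?case by (simp add: algebra_simps)
qed (simp add: cspan.zero)

lemma cspan_mult:
  "f \<in> cspan E \<Longrightarrow> h \<in> cspan E' \<Longrightarrow> (\<lambda>x. f x * h x) \<in> cspan ((\<lambda>(e, e') x. e x * e' x) ` (E \<times> E'))"
proof (induction rule: cspan.induct)
  case (step f e a)
  from cspan_add[OF cspan_scale[OF cspan_mult_base[OF step.prems step.hyps(2)], of a] step.IH[OF step.prems]]
  show ?case by (simp add: algebra_simps)
qed (simp add: cspan.zero)

lemma cspan_cnj: "f \<in> cspan E \<Longrightarrow> (\<lambda>x. cnj (f x)) \<in> cspan ((\<lambda>e x. cnj (e x)) ` E)"
proof (induction rule: cspan.induct)
  case (step f e a)
  from cspan.step[OF step.IH imageI[OF step.hyps(2)], of "cnj a"] show ?case by simp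
qed (simp add: cspan.zero)

lemma cspan_sum:
  fixes m :: nat
  shows "(\<And>i. i < m \<Longrightarrow> e i \<in> E) \<Longrightarrow> (\<lambda>x. \<Sum>i<m. c i * e i x) \<in> cspan E"
proof (induction m)
  case (Suc m)
  have "(\<lambda>x. (\<Sum>i<m. c i * e i x) + c m * e m x) \<in> cspan E"
    using Suc by (intro cspan.step) auto
  then show ?case by simp
qed (simp add: cspan.zero)

lemma mean_proj_fixed_add:
  assumes e: "orthonormal m e" and f: "mean_proj m e f = f" and h: "mean_proj m e h = h"
  shows "mean_proj m e (\<lambda>x. f x + a * h x) = (\<lambda>x. f x + a * h x)"
proof (rule mean_proj_combination[OF e])
  have "f x + a * h x = (\<Sum>i<m. (mean_inner f (e i) + a * mean_inner h (e i)) * e i x)" for x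
  proof -
    have "(\<Sum>i<m. (mean_inner f (e i) + a * mean_inner h (e i)) * e i x) = mean_proj m e f x + a * mean_proj m e h x"
      by (simp add: mean_proj_def distrib_right sum.distrib sum_distrib_left mult.assoc)
    then show ?thesis by (simp add: f h)
  qed
  then show "(\<lambda>x. f x + a * h x) = (\<lambda>x. \<Sum>i<m. (mean_inner f (e i) + a * mean_inner h (e i)) * e i x)" by auto
qed

lemma mean_proj_fixed_zero: "orthonormal m e \<Longrightarrow> mean_proj m e (\<lambda>_. 0) = (\<lambda>_. 0)"
  by (rule mean_proj_combination[where a = "\<lambda>_. 0"]) auto

lemma mean_proj_cspan:
  assumes e: "orthonormal m e" and E: "\<forall>h\<in>E. mean_proj m e h = h"
  shows "f \<in> cspan E \<Longrightarrow> mean_proj m e f = f"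
  by (induction rule: cspan.induct) (use E in \<open>auto simp: mean_proj_fixed_zero[OF e] mean_proj_fixed_add[OF e]\<close>)

text \<open>Finite dimension of the space of left translates, witnessed by a finite set of
  continuous functions whose span contains all of them. That span need not itself be translation
  invariant.\<close>

definition representative :: "('g \<Rightarrow> complex) \<Rightarrow> bool" where
  "representative f \<longleftrightarrow> cont f \<and>
     (\<exists>E. finite E \<and> (\<forall>h\<in>E. cont h) \<and> (\<forall>g. (\<lambda>x. f (g + x)) \<in> cspan E))"

lemma representative_const: "representative (\<lambda>_. c)"
proof -
  have "(\<lambda>_. c) \<in> cspan {\<lambda>_. 1}" using cspan_scale[OF cspan_base[of "\<lambda>_. 1" "{\<lambda>_. 1}"], of c] by simp
  then show ?thesis unfolding representative_def by (intro conjI exI[of _ "{\<lambda>_. 1}"]) auto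
qed

lemma representative_add:
  assumes "representative f" "representative h"
  shows "representative (\<lambda>x. f x + h x)"
proof -
  obtain E E' where E: "finite E" "\<forall>e\<in>E. cont e" "\<forall>g. (\<lambda>x. f (g + x)) \<in> cspan E"
    and E': "finite E'" "\<forall>e\<in>E'. cont e" "\<forall>g. (\<lambda>x. h (g + x)) \<in> cspan E'"
    using assms unfolding representative_def by blast
  have "(\<lambda>x. f (g + x) + h (g + x)) \<in> cspan (E \<union> E')" for g
    using E(3) E'(3) by (intro cspan_add) (auto intro: cspan_mono)
  then show ?thesis unfolding representative_def using assms E(1,2) E'(1,2)
    by (intro conjI exI[of _ "E \<union> E'"]) (auto simp: representative_def intro!: continuous_intros)
qed

lemma representative_mult:
  assumes "representative f" "representative h"
  shows "representative (\<lambda>x. f x * h x)"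
proof -
  obtain E E' where E: "finite E" "\<forall>e\<in>E. cont e" "\<forall>g. (\<lambda>x. f (g + x)) \<in> cspan E"
    and E': "finite E'" "\<forall>e\<in>E'. cont e" "\<forall>g. (\<lambda>x. h (g + x)) \<in> cspan E'"
    using assms unfolding representative_def by blast
  let ?E = "(\<lambda>(e, e') x. e x * e' x) ` (E \<times> E')"
  have "(\<lambda>x. f (g + x) * h (g + x)) \<in> cspan ?E" for g
    using E(3) E'(3) by (intro cspan_mult) auto
  moreover have "finite ?E" using E(1) E'(1) by blast
  moreover have "\<forall>e\<in>?E. cont e" using E(2) E'(2) by (auto intro!: continuous_intros)
  moreover have "cont (\<lambda>x. f x * h x)" using assms by (auto simp: representative_def intro!: continuous_intros)
  ultimately show ?thesis unfolding representative_def by blast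
qed

lemma representative_cnj:
  assumes "representative f"
  shows "representative (\<lambda>x. cnj (f x))"
proof -
  obtain E where E: "finite E" "\<forall>e\<in>E. cont e" "\<forall>g. (\<lambda>x. f (g + x)) \<in> cspan E"
    using assms unfolding representative_def by blast
  let ?E = "(\<lambda>e x. cnj (e x)) ` E"
  have "(\<lambda>x. cnj (f (g + x))) \<in> cspan ?E" for g
    using E(3) by (intro cspan_cnj) auto
  moreover have "finite ?E" using E(1) by blast
  moreover have "\<forall>e\<in>?E. cont e" using E(2) by (auto intro!: continuous_intros)
  moreover have "cont (\<lambda>x. cnj (f x))" using assms by (auto simp: representative_def intro!: continuous_intros)
  ultimately show ?thesis unfolding representative_def by blast
qed

lemma representative_translate:
  assumes "representative f"
  shows "representative (\<lambda>x. f (a + x))"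
proof -
  obtain E where E: "finite E" "\<forall>e\<in>E. cont e" "\<forall>g. (\<lambda>x. f (g + x)) \<in> cspan E"
    using assms unfolding representative_def by blast
  have "(\<lambda>x. f (a + (g + x))) \<in> cspan E" for g using E(3)[rule_format, of "a + g"] by (simp add: add.assoc)
  moreover have "cont (\<lambda>x. f (a + x))"
    using assms continuous_translation(2)[of f a] by (simp add: representative_def)
  ultimately show ?thesis unfolding representative_def using E(1,2) by blast
qed

text \<open>The functions fixed by convolution with \<open>K\<close> form a translation invariant
  space in which orthonormal systems have bounded length. An orthonormal basis of it spans all
  translates of \<open>p\<close>.\<close>

lemma eigenfunction_representative:
  assumes K: "cont K" and p: "cont p" "conv p K = p"
  shows "representative p"
proof -
  define H where "H = {f. cont f \<and> conv f K = f}"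
  have Hc: "cont f" if "f \<in> H" for f using that by (simp add: H_def)
  have H0: "(\<lambda>_. 0) \<in> H" by (auto simp: H_def conv_def)
  have Ha: "(\<lambda>x. f x + a * h x) \<in> H" if f: "f \<in> H" and h: "h \<in> H" for f h a
  proof -
    have c: "cont f" "cont h" "conv f K = f" "conv h K = h" using f h by (auto simp: H_def)
    have ca: "cont (\<lambda>x. a * h x)" by (intro continuous_intros c)
    have "conv (\<lambda>x. f x + a * h x) K x = f x + a * h x" for x
      by (simp add: conv_add_left[OF c(1) ca K] conv_mult_left[OF c(2) K] c)
    moreover have "cont (\<lambda>x. f x + a * h x)" by (intro continuous_intros c)
    ultimately show ?thesis by (auto simp: H_def)
  qed
  have bound: "m \<le> nat \<lceil>mean_square K\<rceil>" if "orthonormal m e" "\<forall>i<m. e i \<in> H" for m e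
  proof -
    have "real m \<le> mean_square K"
      using that by (intro eigenspace_orthonormal_bound[OF K that(1)]) (auto simp: H_def)
    then show ?thesis by linarith
  qed
  obtain m e where e: "orthonormal m e" "\<And>i. i < m \<Longrightarrow> e i \<in> H" "\<And>f. f \<in> H \<Longrightarrow> mean_proj m e f = f"
    by (rule orthonormal_basis[of H "nat \<lceil>mean_square K\<rceil>"])
       (erule Hc, rule H0, erule (1) Ha, erule (1) bound, blast)
  have tr: "(\<lambda>x. p (g + x)) \<in> H" for g
  proof -
    have "conv (\<lambda>x. p (g + x)) K x = p (g + x)" for x
      by (simp add: conv_translate[OF p(1) K] p(2))
    then show ?thesis using continuous_translation(2)[OF p(1), of g] by (auto simp: H_def)
  qed
  have "(\<lambda>x. p (g + x)) \<in> cspan (e ` {..<m})" for g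
  proof -
    have "(\<lambda>x. \<Sum>i<m. mean_inner (\<lambda>x. p (g + x)) (e i) * e i x) \<in> cspan (e ` {..<m})"
      by (rule cspan_sum) auto
    moreover have "(\<lambda>x. \<Sum>i<m. mean_inner (\<lambda>x. p (g + x)) (e i) * e i x) = (\<lambda>x. p (g + x))"
      using e(3)[OF tr[of g]] by (simp add: mean_proj_def[abs_def])
    ultimately show ?thesis by simp
  qed
  then show ?thesis unfolding representative_def using p(1) e(2) Hc
    by (intro conjI exI[of _ "e ` {..<m}"]) auto
qed

section \<open>Density of representative functions\<close>

lemma continuous_separation:
  assumes "a \<noteq> (b :: 'g)"
  obtains u :: "'g \<Rightarrow> real" where "cont u" "u a = 1" "u b = 0"
proof -
  have "compact_space (euclidean :: 'g topology)"
    using compact_UNIV by (simp add: compact_space_def compactin_euclidean_iff)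
  moreover have "Hausdorff_space (euclidean :: 'g topology)"
    unfolding Hausdorff_space_def
  proof clarsimp
    fix x y :: 'g assume "x \<noteq> y"
    from hausdorff[OF this] show "\<exists>U. open U \<and> (\<exists>V. open V \<and> x \<in> U \<and> y \<in> V \<and> disjnt U V)"
      unfolding disjnt_def by blast
  qed
  ultimately have n: "normal_space (euclidean :: 'g topology)"
    using compact_Hausdorff_or_regular_imp_normal_space by blast
  obtain f where "continuous_map euclidean euclideanreal f" "f ` {a} \<subseteq> {1::real}" "f ` {b} \<subseteq> {0}"
    using Urysohn_lemma_alt[OF n, of "{a}" "{b}" 1 0] assms by (auto simp: disjnt_def)
  then show ?thesis using that[of f] by auto
qed

lemma conv_mult_right:
  assumes "cont f" "cont k"
  shows "conv f (\<lambda>x. c * k x) = (\<lambda>x. c * conv f k x)"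
proof (rule ext)
  fix x
  have "conv f (\<lambda>x. c * k x) x = group_mean (\<lambda>y. c * (f y * k (- y + x)))"
    by (simp add: conv_def mult_ac)
  then show "conv f (\<lambda>x. c * k x) x = c * conv f k x"
    unfolding conv_def by (simp add: group_mean_mult_left cont_conv_integrand[OF assms])
qed

text \<open>If all representative functions were invariant under right translation by \<open>g\<close>, then convolving
  them with \<open>u - u(-g + \<cdot>)\<close> would give zero, contradicting the eigenfunction of the kernel built
  from this difference.\<close>

lemma representative_separates:
  assumes xy: "x \<noteq> (y :: 'g)"
  obtains f where "representative f" "f x \<noteq> f y"
proof (rule ccontr)
  assume "\<not> thesis"
  then have eq: "f x = f y" if "representative f" for f using that \<open>\<And>f. representative f \<Longrightarrow> f x \<noteq> f y \<Longrightarrow> thesis\<close> by blast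
  define g where "g = - x + y"
  have "g \<noteq> 0"
  proof
    assume "g = 0"
    then have "x + (- x + y) = x + 0" by (simp only: g_def)
    then show False using xy by simp
  qed
  then have g: "0 \<noteq> - g" by simp
  obtain u :: "'g \<Rightarrow> real" where u: "cont u" "u 0 = 1" "u (- g) = 0" using continuous_separation[OF g] .
  define U where "U w = complex_of_real (u w)" for w
  have U: "cont U" unfolding U_def by (intro continuous_intros u)
  define q where "q w = U w - U (- g + w)" for w
  have q: "cont q" unfolding q_def by (intro continuous_intros U cont_compose2[OF U])
  define qs where "qs w = cnj (q (- w))" for w
  have qs: "cont qs" unfolding qs_def by (intro continuous_intros cont_compose2[OF q])
  \<comment> \<open>The product of \<open>q\<close> with its adjoint is a hermitian kernel, and its
    value at the unit is the mean square of \<open>q\<close>, hence nonzero.\<close>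
  define k where "k = conv q qs"
  have k: "cont k" unfolding k_def by (rule cont_conv[OF q qs])
  have herm: "hermitian_kernel k"
    unfolding hermitian_kernel_def
  proof
    fix w
    have "cnj (k (- w)) = k w"
    proof -
      have "(\<lambda>y. cnj (qs (- y))) = q" "(\<lambda>y. cnj (q (- y))) = qs" by (auto simp: qs_def)
      then show ?thesis using conv_reflect[OF q qs, of w] by (simp only: k_def)
    qed
    then show "k (- w) = cnj (k w)" by (metis complex_cnj_cnj)
  qed
  have "k 0 = mean_inner q q" by (simp add: k_def conv_def mean_inner_def qs_def)
  moreover have "q 0 \<noteq> 0" using u by (simp add: q_def U_def)
  ultimately have k0: "k 0 \<noteq> 0" using mean_square_pos[OF q] mean_inner_self[OF q] by fastforce
  obtain c :: real where c: "\<forall>n. mean_square (conv_power (\<lambda>x. of_real c * k x) n) \<ge> 1 \<and>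
      mean_square (conv_power (\<lambda>x. of_real c * k x) (Suc n)) \<le> mean_square (conv_power (\<lambda>x. of_real c * k x) n)"
    using normalise_kernel[OF k herm k0] ..
  define l where "l = (\<lambda>x. complex_of_real c * k x)"
  have l: "cont l" unfolding l_def by (intro continuous_intros k)
  have lh: "hermitian_kernel l" using herm by (simp add: hermitian_kernel_def l_def)
  have c': "mean_square (conv_power l n) \<ge> 1"
    "mean_square (conv_power l (Suc n)) \<le> mean_square (conv_power l n)" for n
    using c unfolding l_def by blast+
  obtain p where p: "cont p" "p 0 \<noteq> 0" "conv p (conv l l) = p"
    by (rule normalised_kernel_eigenfunction[OF l lh c'])
  have rep: "representative p" by (rule eigenfunction_representative[OF cont_conv[OF l l] p(1,3)])
  \<comment> \<open>Applied to the translate of \<open>p\<close> by \<open>z - x\<close>, equality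
    at \<open>x\<close> and \<open>y\<close> becomes invariance under right translation by
    \<open>g = - x + y\<close>.\<close>
  have inv: "p (z + g) = p z" for z
    using eq[OF representative_translate[OF rep, of "z - x"]] by (simp add: g_def add.assoc[symmetric])
  have "conv p q w = 0" for w
  proof -
    have c1: "cont (\<lambda>y. p y * U (- y + w))" by (rule cont_conv_integrand[OF p(1) U])
    have c2: "cont (\<lambda>y. p y * U (- g + (- y + w)))" by (intro continuous_intros p cont_compose2[OF U])
    have "conv p q w = group_mean (\<lambda>y. p y * U (- y + w)) - group_mean (\<lambda>y. p y * U (- g + (- y + w)))"
      unfolding conv_def q_def right_diff_distrib by (rule group_mean_diff[OF c1 c2])
    also have "group_mean (\<lambda>y. p y * U (- g + (- y + w))) = group_mean (\<lambda>y. p (y + g) * U (- (y + g) + w))"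
      by (simp only: inv minus_add add.assoc)
    also have "\<dots> = group_mean (\<lambda>y. p y * U (- y + w))"
      by (rule group_mean_translate_right[OF c1])
    finally show ?thesis by simp
  qed
  then have "conv p q = (\<lambda>_. 0)" by auto
  then have "conv p k = (\<lambda>_. 0)"
    unfolding k_def conv_assoc[OF p(1) q qs, symmetric] by (simp add: conv_def[abs_def])
  then have "conv p l = (\<lambda>_. 0)" unfolding l_def conv_mult_right[OF p(1) k] by simp
  then have "conv p (conv l l) = (\<lambda>_. 0)"
    unfolding conv_assoc[OF p(1) l l, symmetric] by (simp add: conv_def[abs_def])
  then have "p = (\<lambda>_. 0)" unfolding p(3) .
  then show False using p(2) by simp
qed

text \<open>Stone--Weierstrass for the real functions that are representative as complex ones. They
  separate points because representative functions are closed under conjugation, so real and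
  imaginary parts of a separating function are available.\<close>

lemma representative_dense:
  fixes b :: "'g \<Rightarrow> real"
  assumes b: "cont b" and e: "e > 0"
  obtains \<xi> :: "'g \<Rightarrow> real" where "representative (\<lambda>x. of_real (\<xi> x))" "\<And>x. \<bar>b x - \<xi> x\<bar> < e"
proof -
  let ?P = "\<lambda>\<xi>::'g \<Rightarrow> real. representative (\<lambda>x. of_real (\<xi> x))"
  have re: "?P (\<lambda>x. Re (f x))" if "representative f" for f
  proof -
    have "representative (\<lambda>x. (1/2) * (f x + cnj (f x)))"
      by (intro representative_mult representative_const representative_add representative_cnj that)
    moreover have "(1/2) * (f x + cnj (f x)) = of_real (Re (f x))" for x by (simp add: complex_add_cnj)
    ultimately show ?thesis by simp
  qed
  have "\<exists>\<xi>. ?P \<xi> \<and> (\<forall>x\<in>UNIV. \<bar>b x - \<xi> x\<bar> < e)"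
  proof (rule Stone_Weierstrass_HOL[OF compact_UNIV])
    show "?P (\<lambda>x. c)" for c by (rule representative_const)
    show "cont f" if "?P f" for f
      using that continuous_on_Re[of UNIV "\<lambda>x. complex_of_real (f x)"] by (simp add: representative_def)
    show "?P (\<lambda>x. f x + h x)" if "?P f \<and> ?P h" for f h using representative_add[of "\<lambda>x. of_real (f x)" "\<lambda>x. of_real (h x)"] that by simp
    show "?P (\<lambda>x. f x * h x)" if "?P f \<and> ?P h" for f h using representative_mult[of "\<lambda>x. of_real (f x)" "\<lambda>x. of_real (h x)"] that by simp
    show "\<exists>f. ?P f \<and> f x \<noteq> f y" if "x \<in> UNIV \<and> y \<in> UNIV \<and> x \<noteq> y" for x y
    proof -
      have "x \<noteq> y" using that by simp
      then obtain f where f: "representative f" "f x \<noteq> f y" by (rule representative_separates)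
      show ?thesis
      proof (cases "Re (f x) = Re (f y)")
        case False
        then show ?thesis using re[OF f(1)] by (intro exI[of _ "\<lambda>x. Re (f x)"] conjI)
      next
        case True
        have "representative (\<lambda>x. - \<i> * f x)" by (intro representative_mult representative_const f)
        from re[OF this] have "?P (\<lambda>x. Im (f x))" by simp
        moreover have "Im (f x) \<noteq> Im (f y)" using f(2) True complex_eqI by blast
        ultimately show ?thesis by (intro exI[of _ "\<lambda>x. Im (f x)"] conjI)
      qed
    qed
  qed (use b e in auto)
  then show ?thesis using that by auto
qed

text \<open>The span witnessing that \<open>f\<close> is representative may fail to be invariant.
  The functions all of whose translates lie in that span form an invariant subspace
  \<open>H\<close>, which is finite-dimensional and contains \<open>f\<close>.\<close>

lemma representative_invariant_basis:
  assumes f: "representative f"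
  obtains m e where "orthonormal m e" "mean_proj m e f = f"
    "\<And>g j. j < m \<Longrightarrow> mean_proj m e (\<lambda>x. e j (g + x)) = (\<lambda>x. e j (g + x))"
proof -
  obtain E where E: "finite E" "\<forall>h\<in>E. cont h" "\<forall>g. (\<lambda>x. f (g + x)) \<in> cspan E" and fc: "cont f"
    using f unfolding representative_def by blast
  obtain n v where v: "orthonormal n v" "\<forall>h\<in>E. mean_proj n v h = h"
    using gram_schmidt[of E] E by blast
  define H where "H = {h. cont h \<and> (\<forall>g. mean_proj n v (\<lambda>x. h (g + x)) = (\<lambda>x. h (g + x)))}"
  have Hc: "cont h" if "h \<in> H" for h using that by (simp add: H_def)
  have H0: "(\<lambda>_. 0) \<in> H" by (simp add: H_def mean_proj_fixed_zero[OF v(1)])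
  have Ha: "(\<lambda>x. h x + a * h' x) \<in> H" if "h \<in> H" "h' \<in> H" for h h' a
    using that by (auto simp: H_def intro!: continuous_intros mean_proj_fixed_add[OF v(1)])
  have "mean_proj n v h = h" if "h \<in> H" for h
    using that unfolding H_def by (auto dest: spec[of _ 0])
  then have bound: "m \<le> n" if "orthonormal m e" "\<forall>i<m. e i \<in> H" for m e
    using orthonormal_in_span_le[OF v(1) that(1)] that(2) by blast
  obtain m e where e: "orthonormal m e" "\<And>i. i < m \<Longrightarrow> e i \<in> H" "\<And>h. h \<in> H \<Longrightarrow> mean_proj m e h = h"
    by (rule orthonormal_basis[of H n]) (erule Hc, rule H0, erule (1) Ha, erule (1) bound, blast)
  have "f \<in> H" using fc E(3) mean_proj_cspan[OF v] by (simp add: H_def)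
  then have "mean_proj m e f = f" by (rule e(3))
  moreover have "mean_proj m e (\<lambda>x. e j (g + x)) = (\<lambda>x. e j (g + x))" if "j < m" for g j
  proof (rule e(3))
    have "cont (\<lambda>x. e j (g + x))" by (rule continuous_translation(2)[OF Hc[OF e(2)[OF that]]])
    moreover have "mean_proj n v (\<lambda>x. e j (g + (g' + x))) = (\<lambda>x. e j (g + (g' + x)))" for g'
      using e(2)[OF that] unfolding H_def by (auto dest: spec[of _ "g + g'"] simp: add.assoc)
    ultimately show "(\<lambda>x. e j (g + x)) \<in> H" by (simp add: H_def)
  qed
  ultimately show ?thesis using that e(1) by blast
qed

end

section \<open>Nuclearity\<close>

lemma sum_mult_split: "(\<Sum>a<k * n. f a) = (\<Sum>s<k. \<Sum>p<n. f (s * n + p) :: 'a::comm_monoid_add)" for n :: nat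
proof -
  have "(\<Sum>s<k. \<Sum>p<n. f (s * n + p)) = (\<Sum>(s, p)\<in>{..<k} \<times> {..<n}. f (s * n + p))"
    by (rule sum.cartesian_product)
  also have "\<dots> = (\<Sum>a<k * n. f a)"
  proof (rule sum.reindex_bij_witness[of _ "\<lambda>a. (a div n, a mod n)" "\<lambda>(s, p). s * n + p"])
    fix sp assume sp: "sp \<in> {..<k} \<times> {..<n}"
    obtain s p where [simp]: "sp = (s, p)" and s: "s < k" and p: "p < n" using sp by auto
    show "((case sp of (s, p) \<Rightarrow> s * n + p) div n, (case sp of (s, p) \<Rightarrow> s * n + p) mod n) = sp"
      using p by simp
    have "s * n + p < Suc s * n" using p by simp
    also have "\<dots> \<le> k * n" using s by (intro mult_le_mono1) simp
    finally show "(case sp of (s, p) \<Rightarrow> s * n + p) \<in> {..<k * n}" by simp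
  next
    fix a assume a: "a \<in> {..<k * n}"
    then have "n > 0" by (cases n) auto
    then show "(a div n, a mod n) \<in> {..<k} \<times> {..<n}" using a by (auto simp: less_mult_imp_div_less)
  qed auto
  finally show ?thesis by simp
qed

lemma index_less: "s < k \<Longrightarrow> p < n \<Longrightarrow> s * n + p < k * (n::nat)"
proof -
  assume s: "s < k" and p: "p < n"
  have "s * n + p < Suc s * n" using p by simp
  also have "\<dots> \<le> k * n" using s by (intro mult_le_mono1) simp
  finally show ?thesis .
qed

lemma qform_cong: "(\<And>i j. i < k \<Longrightarrow> j < k \<Longrightarrow> X i j = X' i j) \<Longrightarrow> qform k X v = qform k X' v"
  unfolding qform_def by (intro sum.cong refl) auto

lemma form_positive_cong:
  "(\<And>i j. i < k \<Longrightarrow> j < k \<Longrightarrow> X i j = X' i j) \<Longrightarrow> form_positive k X \<longleftrightarrow> form_positive k X'"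
  unfolding form_positive_def using qform_cong[of k X X'] by simp

lemma mat_positive_mat_iff: "mat_positive k (mat k k (\<lambda>(i, j). X i j)) \<longleftrightarrow> form_positive k X"
  using mat_positive_iff[of "mat k k (\<lambda>(i, j). X i j)" k]
    form_positive_cong[of k "\<lambda>i j. mat k k (\<lambda>(i, j). X i j) $$ (i, j)" X] by simp

lemma form_positive_gram:
  fixes m :: nat
  assumes "\<And>i j. i < k \<Longrightarrow> j < k \<Longrightarrow> X i j = (\<Sum>l<m. star (Y l i) * Y l j)"
  shows "form_positive k X"
  unfolding form_positive_def
proof
  fix v
  have "qform k X v = (\<Sum>l<m. star (\<Sum>i<k. Y l i * v i) * (\<Sum>j<k. Y l j * v j))"
    by (rule qform_gram) (rule assms)
  then show "positive_elem (qform k X v)" by (simp add: positive_elem_sum)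
qed

lemma form_positive_add:
  assumes "form_positive k X" "form_positive k Y"
  shows "form_positive k (\<lambda>i j. X i j + Y i j)"
proof -
  have "qform k (\<lambda>i j. X i j + Y i j) v = qform k X v + qform k Y v" for v
    by (simp add: qform_def distrib_left distrib_right sum.distrib)
  then show ?thesis using assms by (simp add: form_positive_def positive_elem_add)
qed

lemma form_positive_rank_one:
  assumes "positive_elem a"
  shows "form_positive k (\<lambda>i j. star (y i) * a * y j)"
proof -
  obtain b where b: "a = star b * b" using assms by (auto simp: positive_elem_def)
  show ?thesis
    by (rule form_positive_gram[where m = 1 and Y = "\<lambda>_ i. b * y i"]) (simp add: b star_mult mult.assoc)
qed

text \<open>Factor \<open>X\<close> as \<open>Z* Z\<close> over the complex numbers. The sum is then
  a value of the form of the same scalar matrix over \<open>B\<close>, which is again a Gram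
  matrix.\<close>

lemma scalar_form_positive:
  fixes X :: "nat \<Rightarrow> nat \<Rightarrow> complex" and y :: "nat \<Rightarrow> 'b::unital_cstar_algebra"
  assumes "form_positive k X"
  shows "positive_elem (\<Sum>i<k. \<Sum>j<k. scaleC (X i j) (star (y i) * y j))"
proof -
  obtain Z where Z: "\<And>i j. i < k \<Longrightarrow> j < k \<Longrightarrow> X i j = (\<Sum>l<k. star (Z l i) * Z l j)"
    using form_positive_sqrt[OF assms] by blast
  have "(\<Sum>i<k. \<Sum>j<k. scaleC (X i j) (star (y i) * y j)) =
      (\<Sum>i<k. \<Sum>j<k. star (y i) * cscalar (X i j) * y j)"
    by (simp add: cscalar_mult_right scaleC_mult_left)
  also have "\<dots> = qform k (\<lambda>i j. cscalar (X i j)) y" by (simp add: qform_def)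
  finally have eq: "(\<Sum>i<k. \<Sum>j<k. scaleC (X i j) (star (y i) * y j)) = qform k (\<lambda>i j. cscalar (X i j)) y" .
  have "form_positive k (\<lambda>i j. cscalar (X i j) :: 'b)"
    by (rule form_positive_gram[where m = k and Y = "\<lambda>l i. cscalar (Z l i)"])
       (simp add: Z cscalar_def star_scaleC scaleC_sum_left scaleC_mult_left scaleC_mult_right scaleC_scaleC
         star_complex_def mult.commute)
  then show ?thesis unfolding eq form_positive_def by blast
qed

lemma scaled_form_positive:
  fixes X :: "nat \<Rightarrow> nat \<Rightarrow> complex" and a :: "'b::unital_cstar_algebra"
  assumes "form_positive k X" "positive_elem a"
  shows "form_positive k (\<lambda>i j. scaleC (X i j) a)"
proof -
  obtain b where b: "a = star b * b" using assms(2) by (auto simp: positive_elem_def)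
  have "qform k (\<lambda>i j. scaleC (X i j) a) v = (\<Sum>i<k. \<Sum>j<k. scaleC (X i j) (star (b * v i) * (b * v j)))" for v
    by (simp add: qform_def b star_mult mult.assoc scaleC_mult_left scaleC_mult_right)
  then show ?thesis unfolding form_positive_def
    using scalar_form_positive[OF assms(1), of "\<lambda>i. b * _ i"] by simp
qed

text \<open>A linear map \<open>\<Phi> : B \<rightarrow> M_n\<close> corresponds to the functional
  on \<open>M_n(B)\<close> that sends \<open>X\<close> to the sum of all
  \<open>\<Phi> (X p q) p q\<close>, and \<open>\<Phi>\<close> is completely positive exactly if
  this functional is positive. One condition at size \<open>n\<close> replaces all
  amplifications.\<close>

definition cp_pairing :: "nat \<Rightarrow> ('b::unital_cstar_algebra \<Rightarrow> nat \<Rightarrow> nat \<Rightarrow> complex) \<Rightarrow> bool" where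
  "cp_pairing n \<Phi> \<longleftrightarrow>
     (\<forall>x y p q. \<Phi> (x + y) p q = \<Phi> x p q + \<Phi> y p q) \<and>
     (\<forall>a x p q. \<Phi> (scaleC a x) p q = a * \<Phi> x p q) \<and>
     (\<forall>X. form_positive n X \<longrightarrow> positive_elem (\<Sum>p<n. \<Sum>q<n. \<Phi> (X p q) p q))"

lemma cp_pairing_zero: "cp_pairing n \<Phi> \<Longrightarrow> \<Phi> 0 p q = 0"
proof -
  assume "cp_pairing n \<Phi>"
  then have "\<Phi> (0 + 0) p q = \<Phi> 0 p q + \<Phi> 0 p q" unfolding cp_pairing_def by blast
  then show ?thesis by simp
qed

lemma cp_pairing_sum: "cp_pairing n \<Phi> \<Longrightarrow> \<Phi> (\<Sum>i\<in>I. f i) p q = (\<Sum>i\<in>I. \<Phi> (f i) p q)"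
proof (induction I rule: infinite_finite_induct)
  case (insert i I)
  then show ?case by (simp add: cp_pairing_def)
qed (simp_all add: cp_pairing_zero)

text \<open>Compression \<open>V* X V\<close> by a scalar \<open>k \<times> n\<close> matrix: its
  form at \<open>y\<close> is the form of \<open>X\<close> at \<open>V y\<close>.\<close>

lemma conj_scalar_form_positive:
  fixes X :: "nat \<Rightarrow> nat \<Rightarrow> 'b::unital_cstar_algebra"
  assumes "form_positive k X"
  shows "form_positive n (\<lambda>p q. \<Sum>s<k. \<Sum>t<k. scaleC (cnj (v s p) * v t q) (X s t))"
proof -
  have "qform n (\<lambda>p q. \<Sum>s<k. \<Sum>t<k. scaleC (cnj (v s p) * v t q) (X s t)) y =
      qform k X (\<lambda>s. \<Sum>p<n. scaleC (v s p) (y p))" for y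
  proof -
    have "qform n (\<lambda>p q. \<Sum>s<k. \<Sum>t<k. scaleC (cnj (v s p) * v t q) (X s t)) y =
        (\<Sum>p<n. \<Sum>q<n. \<Sum>s<k. \<Sum>t<k. scaleC (cnj (v s p) * v t q) (star (y p) * X s t * y q))"
      by (simp add: qform_def sum_distrib_left sum_distrib_right scaleC_mult_left scaleC_mult_right)
    also have "\<dots> = (\<Sum>p<n. \<Sum>s<k. \<Sum>q<n. \<Sum>t<k. scaleC (cnj (v s p) * v t q) (star (y p) * X s t * y q))"
      by (intro sum.cong refl sum.swap)
    also have "\<dots> = (\<Sum>s<k. \<Sum>p<n. \<Sum>q<n. \<Sum>t<k. scaleC (cnj (v s p) * v t q) (star (y p) * X s t * y q))"
      by (rule sum.swap)
    also have "\<dots> = (\<Sum>s<k. \<Sum>p<n. \<Sum>t<k. \<Sum>q<n. scaleC (cnj (v s p) * v t q) (star (y p) * X s t * y q))"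
      by (intro sum.cong refl sum.swap)
    also have "\<dots> = (\<Sum>s<k. \<Sum>t<k. \<Sum>p<n. \<Sum>q<n. scaleC (cnj (v s p) * v t q) (star (y p) * X s t * y q))"
      by (intro sum.cong refl sum.swap)
    also have "\<dots> = qform k X (\<lambda>s. \<Sum>p<n. scaleC (v s p) (y p))"
    proof -
      have "star (\<Sum>p<n. scaleC (v s p) (y p)) * X s t * (\<Sum>q<n. scaleC (v t q) (y q)) =
          (\<Sum>p<n. \<Sum>q<n. star (scaleC (v s p) (y p)) * X s t * scaleC (v t q) (y q))" for s t
        by (simp only: star_sum sum_distrib_right[where r = "X s t"] sum_product)
      then show ?thesis
        by (simp add: qform_def star_scaleC scaleC_mult_left scaleC_mult_right scaleC_scaleC mult.commute)
    qed
    finally show ?thesis .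
  qed
  then show ?thesis using assms by (simp add: form_positive_def)
qed

lemma cp_to_mat_imp_pairing:
  assumes cp: "cp_to_mat n \<phi>"
  shows "cp_pairing n (\<lambda>x p q. if p < n \<and> q < n then \<phi> x $$ (p, q) else 0)"
  unfolding cp_pairing_def
proof (intro conjI allI impI)
  have car: "\<phi> x \<in> carrier_mat n n" for x using cp by (simp add: cp_to_mat_def)
  then have dim: "dim_row (\<phi> x) = n" "dim_col (\<phi> x) = n" for x by auto
  fix x y :: 'a and a p q
  have "\<phi> (x + y) = \<phi> x + \<phi> y" "\<phi> (scaleC a x) = smult_mat a (\<phi> x)" using cp by (simp_all add: cp_to_mat_def)
  then show "(if p < n \<and> q < n then \<phi> (x + y) $$ (p, q) else 0) =
      (if p < n \<and> q < n then \<phi> x $$ (p, q) else 0) + (if p < n \<and> q < n then \<phi> y $$ (p, q) else 0)"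
    "(if p < n \<and> q < n then \<phi> (scaleC a x) $$ (p, q) else 0) = a * (if p < n \<and> q < n then \<phi> x $$ (p, q) else 0)"
    by (auto simp: dim)
next
  fix X :: "nat \<Rightarrow> nat \<Rightarrow> 'a" assume X: "form_positive n X"
  let ?X = "mat n n (\<lambda>(i, j). X i j)"
  have "mat_positive (n * n) (amplify_to_mat n n \<phi> ?X)"
    using cp X by (simp add: cp_to_mat_def mat_positive_mat_iff)
  then have pos: "form_positive (n * n) (\<lambda>a b. \<phi> (?X $$ (a div n, b div n)) $$ (a mod n, b mod n))"
    unfolding amplify_to_mat_def by (simp add: mat_positive_mat_iff)
  \<comment> \<open>The sum of all \<open>e_s \<otimes> e_s\<close>. The form of the amplified
    matrix at this vector is the functional attached to \<open>\<phi>\<close>.\<close>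
  define v :: "nat \<Rightarrow> complex" where "v a = (if a div n = a mod n then 1 else 0)" for a
  have "qform (n * n) (\<lambda>a b. \<phi> (?X $$ (a div n, b div n)) $$ (a mod n, b mod n)) v =
      (\<Sum>s<n. \<Sum>p<n. \<Sum>t<n. \<Sum>q<n. (if s = p then 1 else 0) * \<phi> (X s t) $$ (p, q) * (if t = q then 1 else 0))"
    unfolding qform_def sum_mult_split
    by (intro sum.cong refl) (auto simp: v_def star_complex_def)
  also have "\<dots> = (\<Sum>p<n. \<Sum>q<n. \<phi> (X p q) $$ (p, q))"
  proof -
    have "(\<Sum>t<n. \<Sum>q<n. (if s = p then 1 else 0) * \<phi> (X s t) $$ (p, q) * (if t = q then 1 else 0)) =
        (if s = p then \<Sum>t<n. \<phi> (X s t) $$ (p, t) else 0)" for s p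
      by (simp add: if_distrib[of "\<lambda>x. _ * x"] cong: if_cong)
    then show ?thesis by simp
  qed
  also have "\<dots> = (\<Sum>p<n. \<Sum>q<n. if p < n \<and> q < n then \<phi> (X p q) $$ (p, q) else 0)"
    by (intro sum.cong refl) auto
  finally have eq: "qform (n * n) (\<lambda>a b. \<phi> (?X $$ (a div n, b div n)) $$ (a mod n, b mod n)) v =
      (\<Sum>p<n. \<Sum>q<n. if p < n \<and> q < n then \<phi> (X p q) $$ (p, q) else 0)" .
  show "positive_elem (\<Sum>p<n. \<Sum>q<n. if p < n \<and> q < n then \<phi> (X p q) $$ (p, q) else 0)"
    using pos unfolding form_positive_def eq[symmetric] by blast
qed

text \<open>The form of the amplification at a scalar vector, read as a \<open>k \<times> n\<close>
  matrix \<open>V\<close>, is the functional applied to the compression \<open>V* X V\<close>, which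
  has size \<open>n\<close> whatever \<open>k\<close> is.\<close>

lemma pairing_imp_cp_to_mat:
  assumes cp: "cp_pairing n \<Phi>"
  shows "cp_to_mat n (\<lambda>x. mat n n (\<lambda>(p, q). \<Phi> x p q))"
  unfolding cp_to_mat_def
proof (intro conjI allI ballI impI)
  fix k and X :: "'a mat" assume X: "X \<in> carrier_mat k k" and pos: "mat_positive k X"
  have fp: "form_positive k (\<lambda>i j. X $$ (i, j))" using pos mat_positive_iff[OF X] by simp
  have "form_positive (k * n) (\<lambda>a b. mat n n (\<lambda>(p, q). \<Phi> (X $$ (a div n, b div n)) p q) $$ (a mod n, b mod n))"
    unfolding form_positive_def
  proof
    fix v :: "nat \<Rightarrow> complex"
    define V where "V s p = v (s * n + p)" for s p
    have "qform (k * n) (\<lambda>a b. mat n n (\<lambda>(p, q). \<Phi> (X $$ (a div n, b div n)) p q) $$ (a mod n, b mod n)) v =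
        (\<Sum>s<k. \<Sum>p<n. \<Sum>t<k. \<Sum>q<n. cnj (V s p) * \<Phi> (X $$ (s, t)) p q * V t q)"
      unfolding qform_def sum_mult_split by (intro sum.cong refl) (auto simp: V_def star_complex_def)
    also have "\<dots> = (\<Sum>p<n. \<Sum>s<k. \<Sum>t<k. \<Sum>q<n. cnj (V s p) * \<Phi> (X $$ (s, t)) p q * V t q)"
      by (rule sum.swap)
    also have "\<dots> = (\<Sum>p<n. \<Sum>s<k. \<Sum>q<n. \<Sum>t<k. cnj (V s p) * \<Phi> (X $$ (s, t)) p q * V t q)"
      by (intro sum.cong refl sum.swap)
    also have "\<dots> = (\<Sum>p<n. \<Sum>q<n. \<Sum>s<k. \<Sum>t<k. cnj (V s p) * \<Phi> (X $$ (s, t)) p q * V t q)"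
      by (intro sum.cong refl sum.swap)
    also have "\<dots> = (\<Sum>p<n. \<Sum>q<n. \<Phi> (\<Sum>s<k. \<Sum>t<k. scaleC (cnj (V s p) * V t q) (X $$ (s, t))) p q)"
      using cp unfolding cp_pairing_sum[OF cp] cp_pairing_def by (simp add: mult_ac)
    also have "positive_elem \<dots>"
      using cp conj_scalar_form_positive[OF fp, of n V] unfolding cp_pairing_def by blast
    finally show "positive_elem (qform (k * n) (\<lambda>a b. mat n n (\<lambda>(p, q). \<Phi> (X $$ (a div n, b div n)) p q) $$ (a mod n, b mod n)) v)" .
  qed
  then show "mat_positive (k * n) (amplify_to_mat n k (\<lambda>x. mat n n (\<lambda>(p, q). \<Phi> x p q)) X)"
    unfolding amplify_to_mat_def by (simp add: mat_positive_mat_iff)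
qed (use cp in \<open>auto simp: cp_pairing_def intro!: eq_matI\<close>)

definition mat_unit :: "nat \<Rightarrow> nat \<Rightarrow> nat \<Rightarrow> complex mat" where
  "mat_unit n p q = mat n n (\<lambda>(i, j). if i = p \<and> j = q then 1 else 0)"

text \<open>The Choi matrix is the amplification of \<open>\<psi>\<close> applied to the positive
  rank-one matrix of the vector summing all \<open>e_s \<otimes> e_s\<close>, whose blocks are the
  matrix units.\<close>

lemma cp_from_mat_choi:
  assumes cp: "cp_from_mat n \<psi>"
  shows "form_positive n (\<lambda>p q. \<psi> (mat_unit n p q))"
    and "A \<in> carrier_mat n n \<Longrightarrow> \<psi> A = (\<Sum>p<n. \<Sum>q<n. scaleC (A $$ (p, q)) (\<psi> (mat_unit n p q)))"
proof -
  let ?X = "mat (n * n) (n * n) (\<lambda>(a, b). if a div n = a mod n \<and> b div n = b mod n then 1 else (0::complex))"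
  have "form_positive (n * n) (\<lambda>a b. if a div n = a mod n \<and> b div n = b mod n then 1 else (0::complex))"
    by (rule form_positive_gram[where m = 1 and Y = "\<lambda>_ a. if a div n = a mod n then 1 else 0"]) (auto simp: star_complex_def)
  then have "mat_positive n (amplify_from_mat n n \<psi> ?X)"
    using cp by (simp add: cp_from_mat_def mat_positive_mat_iff)
  then have "form_positive n (\<lambda>i j. \<psi> (mat n n (\<lambda>(r, s). ?X $$ (i * n + r, j * n + s))))"
    unfolding amplify_from_mat_def by (simp only: mat_positive_mat_iff)
  moreover have "mat n n (\<lambda>(r, s). ?X $$ (i * n + r, j * n + s)) = mat_unit n i j" if "i < n" "j < n" for i j
    unfolding mat_unit_def using that by (intro eq_matI) (auto simp: index_less)
  ultimately show "form_positive n (\<lambda>p q. \<psi> (mat_unit n p q))"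
    using form_positive_cong[of n "\<lambda>i j. \<psi> (mat n n (\<lambda>(r, s). ?X $$ (i * n + r, j * n + s)))"] by simp
next
  assume A: "A \<in> carrier_mat n n"
  have u: "mat_unit n p q \<in> carrier_mat n n" for p q by (simp add: mat_unit_def)
  have add: "\<psi> (A + B) = \<psi> A + \<psi> B" if "A \<in> carrier_mat n n" "B \<in> carrier_mat n n" for A B
    using cp that by (simp add: cp_from_mat_def)
  have sm: "\<psi> (smult_mat a A) = scaleC a (\<psi> A)" if "A \<in> carrier_mat n n" for a A
    using cp that by (simp add: cp_from_mat_def)
  have "\<psi> (0\<^sub>m n n) = 0"
    using add[of "0\<^sub>m n n" "0\<^sub>m n n"] by simp
  then have zero: "\<psi> (mat n n (\<lambda>_. 0)) = 0" by (simp add: zero_mat_def)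
  define R where "R S = mat n n (\<lambda>(i, j). if (i, j) \<in> S then A $$ (i, j) else 0)" for S
  have R: "R S \<in> carrier_mat n n" for S by (simp add: R_def)
  have "\<psi> (R S) = (\<Sum>(p, q)\<in>S. scaleC (A $$ (p, q)) (\<psi> (mat_unit n p q)))" if "finite S" "S \<subseteq> {..<n} \<times> {..<n}" for S
    using that
  proof (induction S rule: finite_induct)
    case empty
    have "R {} = mat n n (\<lambda>_. 0)" by (auto simp: R_def intro!: eq_matI)
    then show ?case using zero by simp
  next
    case (insert pq S)
    obtain p q where [simp]: "pq = (p, q)" by force
    have "R (insert pq S) = smult_mat (A $$ (p, q)) (mat_unit n p q) + R S"
      using insert.hyps insert.prems by (auto simp: R_def mat_unit_def intro!: eq_matI)
    then show ?case using insert R u by (simp add: add sm smult_carrier_mat)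
  qed
  from this[of "{..<n} \<times> {..<n}"] have "\<psi> (R ({..<n} \<times> {..<n})) = (\<Sum>p<n. \<Sum>q<n. scaleC (A $$ (p, q)) (\<psi> (mat_unit n p q)))"
    by (simp add: sum.cartesian_product)
  moreover have "R ({..<n} \<times> {..<n}) = A" using A by (auto simp: R_def intro!: eq_matI)
  ultimately show "\<psi> A = (\<Sum>p<n. \<Sum>q<n. scaleC (A $$ (p, q)) (\<psi> (mat_unit n p q)))" by simp
qed

text \<open>With the Choi matrix factored as \<open>Y* Y\<close>, the form of the amplified matrix
  splits over the rows of \<open>Y\<close> into terms that pair the scalar matrix \<open>X\<close>
  with a Gram matrix over \<open>B\<close>.\<close>

lemma choi_imp_cp_from_mat:
  assumes P: "form_positive n P"
  shows "cp_from_mat n (\<lambda>A. \<Sum>p<n. \<Sum>q<n. scaleC (A $$ (p, q)) (P p q :: 'b::unital_cstar_algebra))"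
  unfolding cp_from_mat_def
proof (intro conjI allI ballI impI)
  fix A B :: "complex mat" and a assume A: "A \<in> carrier_mat n n" and B: "B \<in> carrier_mat n n"
  have "scaleC ((A + B) $$ (p, q)) (P p q) = scaleC (A $$ (p, q)) (P p q) + scaleC (B $$ (p, q)) (P p q)"
    if "p < n" "q < n" for p q using that A B by (simp add: scaleC_add_left)
  then show "(\<Sum>p<n. \<Sum>q<n. scaleC ((A + B) $$ (p, q)) (P p q)) =
      (\<Sum>p<n. \<Sum>q<n. scaleC (A $$ (p, q)) (P p q)) + (\<Sum>p<n. \<Sum>q<n. scaleC (B $$ (p, q)) (P p q))"
    by (simp add: sum.distrib)
next
  fix a and A :: "complex mat" assume A: "A \<in> carrier_mat n n"
  have "scaleC (smult_mat a A $$ (p, q)) (P p q) = scaleC a (scaleC (A $$ (p, q)) (P p q))"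
    if "p < n" "q < n" for p q using that A by (simp add: scaleC_scaleC)
  then show "(\<Sum>p<n. \<Sum>q<n. scaleC (smult_mat a A $$ (p, q)) (P p q)) =
      scaleC a (\<Sum>p<n. \<Sum>q<n. scaleC (A $$ (p, q)) (P p q))"
    by (simp add: scaleC_sum_right)
next
  fix k and X :: "complex mat" assume X: "X \<in> carrier_mat (k * n) (k * n)" and pos: "mat_positive (k * n) X"
  have fp: "form_positive (k * n) (\<lambda>i j. X $$ (i, j))" using pos mat_positive_iff[OF X] by simp
  obtain Y where Y: "\<And>i j. i < n \<Longrightarrow> j < n \<Longrightarrow> P i j = (\<Sum>l<n. star (Y l i) * Y l j)"
    using form_positive_sqrt[OF P] by blast
  let ?e = "\<lambda>s t. \<Sum>p<n. \<Sum>q<n. scaleC (mat n n (\<lambda>(r, r'). X $$ (s * n + r, t * n + r')) $$ (p, q)) (P p q)"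
  have "form_positive k ?e"
    unfolding form_positive_def
  proof
    fix b :: "nat \<Rightarrow> 'b"
    define y where "y l a = Y l (a mod n) * b (a div n)" for l a
    have "qform k ?e b = (\<Sum>s<k. \<Sum>t<k. \<Sum>p<n. \<Sum>q<n. \<Sum>l<n. scaleC (X $$ (s * n + p, t * n + q)) (star (Y l p * b s) * (Y l q * b t)))"
      unfolding qform_def
      by (intro sum.cong refl) (simp add: Y sum_distrib_left sum_distrib_right scaleC_sum_right
          scaleC_mult_left scaleC_mult_right star_mult mult.assoc)
    also have "\<dots> = (\<Sum>s<k. \<Sum>p<n. \<Sum>t<k. \<Sum>q<n. \<Sum>l<n. scaleC (X $$ (s * n + p, t * n + q)) (star (Y l p * b s) * (Y l q * b t)))"
      by (intro sum.cong refl sum.swap)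
    also have "\<dots> = (\<Sum>c<k * n. \<Sum>d<k * n. \<Sum>l<n. scaleC (X $$ (c, d)) (star (y l c) * y l d))"
      unfolding sum_mult_split by (intro sum.cong refl) (auto simp: y_def)
    also have "\<dots> = (\<Sum>c<k * n. \<Sum>l<n. \<Sum>d<k * n. scaleC (X $$ (c, d)) (star (y l c) * y l d))"
      by (intro sum.cong refl sum.swap)
    also have "\<dots> = (\<Sum>l<n. \<Sum>c<k * n. \<Sum>d<k * n. scaleC (X $$ (c, d)) (star (y l c) * y l d))"
      by (rule sum.swap)
    also have "positive_elem \<dots>" by (intro positive_elem_sum scalar_form_positive fp)
    finally show "positive_elem (qform k ?e b)" .
  qed
  then show "mat_positive k (amplify_from_mat n k (\<lambda>A. \<Sum>p<n. \<Sum>q<n. scaleC (A $$ (p, q)) (P p q)) X)"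
    unfolding amplify_from_mat_def by (simp only: mat_positive_mat_iff)
qed

section \<open>States and the operator norm\<close>

lemma positive_complex_iff: "positive_elem (z::complex) \<longleftrightarrow> Im z = 0 \<and> Re z \<ge> 0"
proof
  assume "positive_elem z"
  then obtain x where "z = cnj x * x" by (auto simp: positive_elem_def star_complex_def)
  then show "Im z = 0 \<and> Re z \<ge> 0" by (simp add: algebra_simps)
next
  assume z: "Im z = 0 \<and> Re z \<ge> 0"
  then have "z = star (complex_of_real (sqrt (Re z))) * complex_of_real (sqrt (Re z))"
    by (simp add: star_complex_def complex_eq_iff)
  then show "positive_elem z" unfolding positive_elem_def by blast
qed

text \<open>Self-adjoint elements satisfy the bound with constant \<open>1\<close>; the splitting
  into real and imaginary parts doubles it.\<close>

lemma positive_unital_functional_bound: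
  fixes \<omega> :: "'b::unital_cstar_algebra \<Rightarrow> complex"
  assumes add: "\<And>x y. \<omega> (x + y) = \<omega> x + \<omega> y" and sc: "\<And>a x. \<omega> (scaleC a x) = a * \<omega> x"
    and pos: "\<And>x. positive_elem x \<Longrightarrow> positive_elem (\<omega> x)" and one: "\<omega> 1 = 1"
  shows "cmod (\<omega> x) \<le> 2 * norm x"
proof -
  have ofr: "\<omega> (of_real r) = of_real r" for r
    using sc[of "complex_of_real r" 1] one unfolding scaleC_of_real by (simp add: of_real_def[where 'a = 'b])
  have sa: "cmod (\<omega> u) \<le> norm u" if u: "star u = u" for u
  proof -
    have "positive_elem (\<omega> (of_real (norm u) + u))" "positive_elem (\<omega> (of_real (norm u) - u))"
      using positive_elem_of_real_minus[OF u order_refl] pos by auto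
    moreover have "\<omega> (of_real (norm u) - u) = of_real (norm u) - \<omega> u"
      using add[of "of_real (norm u) - u" u] by (simp add: ofr)
    ultimately have "Im (\<omega> u) = 0" "\<bar>Re (\<omega> u)\<bar> \<le> norm u"
      by (auto simp: add ofr positive_complex_iff)
    then show ?thesis by (simp add: cmod_def)
  qed
  define u where "u = (1/2) *\<^sub>R (x + star x)"
  define v where "v = scaleC (- \<i> / 2) (x - star x)"
  have u: "star u = u" by (simp add: u_def star_scaleR star_add star_star add.commute)
  have v: "star v = v"
    by (simp add: v_def star_scaleC star_diff star_star scaleC_minus_left[of "\<i>/2"] scaleC_diff_right)
  have "scaleC \<i> v = scaleC (complex_of_real (1/2)) (x - star x)" by (simp add: v_def scaleC_scaleC)
  then have "scaleC \<i> v = (1/2) *\<^sub>R (x - star x)" unfolding scaleC_of_real .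
  then have "u + scaleC \<i> v = (1/2) *\<^sub>R (x + x)" by (simp only: u_def scaleR_right_distrib[symmetric]) simp
  then have "u + scaleC \<i> v = x" by (simp add: scaleR_2[symmetric])
  then have "\<omega> x = \<omega> u + \<i> * \<omega> v" using add[of u "scaleC \<i> v"] sc[of \<i> v] by simp
  then have "cmod (\<omega> x) \<le> cmod (\<omega> u) + cmod (\<omega> v)"
    using norm_triangle_ineq[of "\<omega> u" "\<i> * \<omega> v"] by (simp add: norm_mult)
  also have "\<dots> \<le> norm u + norm v" using sa[OF u] sa[OF v] by linarith
  also have "norm u \<le> norm x" using norm_triangle_ineq[of x "star x"] by (simp add: u_def)
  also have "norm v \<le> norm x" using norm_triangle_ineq4[of x "star x"] by (simp add: v_def norm_scaleC norm_divide)
  finally show ?thesis by simp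
qed

lemma vec_l2_norm_vec: "vec_l2_norm (Matrix.vec n f) = L2_set (\<lambda>i. cmod (f i)) {..<n}"
  unfolding vec_l2_norm_def by (intro L2_set_cong) auto

text \<open>\<open>Sup\<close> on the reals is informative only for bounded sets; the sum of the
  absolute values of all entries is a bound.\<close>

lemma mat_op_norm_bdd:
  "bdd_above {vec_l2_norm (mult_mat_vec A v) | v. v \<in> carrier_vec (dim_col A) \<and> vec_l2_norm v \<le> 1}"
proof (rule bdd_aboveI)
  fix r assume "r \<in> {vec_l2_norm (mult_mat_vec A v) | v. v \<in> carrier_vec (dim_col A) \<and> vec_l2_norm v \<le> 1}"
  then obtain v where v: "r = vec_l2_norm (mult_mat_vec A v)" "v \<in> carrier_vec (dim_col A)" "vec_l2_norm v \<le> 1"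
    by blast
  have v1: "cmod (vec_index v j) \<le> 1" if "j < dim_col A" for j
    using member_le_L2_set[of "{..<dim_vec v}" j "\<lambda>i. cmod (vec_index v i)"] v(2,3) that
    by (auto simp: vec_l2_norm_def)
  have "r \<le> (\<Sum>i<dim_row A. cmod (vec_index (mult_mat_vec A v) i))"
    using L2_set_le_sum[of "{..<dim_row A}" "\<lambda>i. cmod (vec_index (mult_mat_vec A v) i)"]
    unfolding v(1) vec_l2_norm_def by (simp del: index_mult_mat_vec)
  also have "\<dots> \<le> (\<Sum>i<dim_row A. \<Sum>j<dim_col A. cmod (A $$ (i, j)))"
  proof (rule sum_mono)
    fix i assume i: "i \<in> {..<dim_row A}"
    have "vec_index (mult_mat_vec A v) i = (\<Sum>j<dim_col A. A $$ (i, j) * vec_index v j)"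
      using i v(2) by (auto simp: scalar_prod_def lessThan_atLeast0 intro!: sum.cong)
    then have "cmod (vec_index (mult_mat_vec A v) i) \<le> (\<Sum>j<dim_col A. cmod (A $$ (i, j) * vec_index v j))"
      by (simp add: norm_sum)
    also have "\<dots> \<le> (\<Sum>j<dim_col A. cmod (A $$ (i, j)))"
      by (intro sum_mono) (use v1 in \<open>auto simp: norm_mult mult_left_le\<close>)
    finally show "cmod (vec_index (mult_mat_vec A v) i) \<le> (\<Sum>j<dim_col A. cmod (A $$ (i, j)))" .
  qed
  finally show "r \<le> (\<Sum>i<dim_row A. \<Sum>j<dim_col A. cmod (A $$ (i, j)))" .
qed

lemma mat_op_norm_upper:
  "v \<in> carrier_vec (dim_col A) \<Longrightarrow> vec_l2_norm v \<le> 1 \<Longrightarrow> vec_l2_norm (mult_mat_vec A v) \<le> mat_op_norm A"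
  unfolding mat_op_norm_def by (rule cSup_upper[OF _ mat_op_norm_bdd]) blast

lemma mat_op_norm_one: "mat_op_norm (1\<^sub>m n) \<le> 1"
  unfolding mat_op_norm_def
proof (rule cSup_least)
  have "vec_l2_norm (Matrix.vec n (\<lambda>_. 0)) \<le> 1" by (simp add: vec_l2_norm_vec L2_set_def)
  then show "{vec_l2_norm (mult_mat_vec (1\<^sub>m n) v) | v. v \<in> carrier_vec (dim_col (1\<^sub>m n)) \<and> vec_l2_norm v \<le> 1} \<noteq> {}"
    by (auto intro!: exI[of _ "Matrix.vec n (\<lambda>_. 0)"])
qed auto

text \<open>Cauchy--Schwarz after scaling \<open>v\<close> to norm \<open>1\<close>. It serves to
  show \<open>h \<le> 1\<close> for the positive contraction \<open>h = \<phi> 1\<close>.\<close>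

lemma mat_op_norm_form_bound:
  assumes A: "A \<in> carrier_mat n n" and le: "mat_op_norm A \<le> 1"
  shows "cmod (\<Sum>p<n. \<Sum>q<n. cnj (v p) * A $$ (p, q) * v q) \<le> (\<Sum>p<n. (cmod (v p))\<^sup>2)"
proof -
  define r where "r = L2_set (\<lambda>p. cmod (v p)) {..<n}"
  have r2: "(\<Sum>p<n. (cmod (v p))\<^sup>2) = r\<^sup>2"
    unfolding r_def L2_set_def by (simp add: sum_nonneg)
  have r0: "r \<ge> 0" by (simp add: r_def L2_set_nonneg)
  show ?thesis
  proof (cases "r = 0")
    case True
    then have "v p = 0" if "p < n" for p
      using that L2_set_eq_0_iff[of "{..<n}" "\<lambda>p. cmod (v p)"] by (simp add: r_def)
    then show ?thesis by (simp add: sum_nonneg)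
  next
    case False
    then have rp: "r > 0" using r0 by simp
    define w where "w p = v p / of_real r" for p
    have "L2_set (\<lambda>p. cmod (w p)) {..<n} = r / r"
    proof -
      have "L2_set (\<lambda>p. cmod (w p)) {..<n} = L2_set (\<lambda>p. (1 / r) * cmod (v p)) {..<n}"
        using rp by (intro L2_set_cong) (auto simp: w_def norm_divide)
      also have "\<dots> = (1 / r) * r" unfolding r_def by (subst L2_set_right_distrib) (use rp in \<open>auto simp: r_def[symmetric]\<close>)
      finally show ?thesis by simp
    qed
    then have w1: "L2_set (\<lambda>p. cmod (w p)) {..<n} = 1" using rp by simp
    let ?w = "Matrix.vec n w"
    define Aw where "Aw p = (\<Sum>q<n. A $$ (p, q) * w q)" for p
    have Aw: "mult_mat_vec A ?w = Matrix.vec n Aw"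
      using A by (intro eq_vecI) (auto simp: Aw_def scalar_prod_def lessThan_atLeast0 intro!: sum.cong)
    have "vec_l2_norm (mult_mat_vec A ?w) \<le> mat_op_norm A"
      using A w1 by (intro mat_op_norm_upper) (auto simp: vec_l2_norm_vec)
    then have Aw1: "L2_set (\<lambda>p. cmod (Aw p)) {..<n} \<le> 1" using le by (simp add: Aw vec_l2_norm_vec)
    have vw: "v p = of_real r * w p" for p using rp by (simp add: w_def)
    have "(\<Sum>p<n. \<Sum>q<n. cnj (v p) * A $$ (p, q) * v q) = of_real (r\<^sup>2) * (\<Sum>p<n. cnj (w p) * Aw p)"
      unfolding vw Aw_def by (simp add: sum_distrib_left power2_eq_square mult_ac)
    then have "cmod (\<Sum>p<n. \<Sum>q<n. cnj (v p) * A $$ (p, q) * v q) = r\<^sup>2 * cmod (\<Sum>p<n. cnj (w p) * Aw p)"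
      by (simp only: norm_mult norm_of_real abs_power2)
    also have "cmod (\<Sum>p<n. cnj (w p) * Aw p) \<le> (\<Sum>p<n. \<bar>cmod (w p)\<bar> * \<bar>cmod (Aw p)\<bar>)"
      by (rule order_trans[OF norm_sum]) (simp add: norm_mult)
    also have "\<dots> \<le> L2_set (\<lambda>p. cmod (w p)) {..<n} * L2_set (\<lambda>p. cmod (Aw p)) {..<n}"
      by (rule L2_set_mult_ineq)
    also have "\<dots> \<le> 1" using w1 Aw1 by simp
    finally have "cmod (\<Sum>p<n. \<Sum>q<n. cnj (v p) * A $$ (p, q) * v q) \<le> r\<^sup>2 * 1"
      by (simp add: mult_left_mono)
    then show ?thesis by (simp add: r2)
  qed
qed

lemma mat_op_norm_entry:
  assumes A: "A \<in> carrier_mat n n" and pq: "p < n" "q < n"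
  shows "cmod (A $$ (p, q)) \<le> mat_op_norm A"
proof -
  let ?e = "Matrix.vec n (\<lambda>i. if i = q then 1 else (0::complex))"
  have "L2_set (\<lambda>i. cmod (if i = q then 1 else 0)) {..<n} = 1"
  proof -
    have "(\<Sum>i<n. (cmod (if i = q then 1 else 0))\<^sup>2) = (\<Sum>i<n. if i = q then 1 else 0)" by (intro sum.cong) auto
    then show ?thesis using pq by (simp add: L2_set_def)
  qed
  then have e: "vec_l2_norm ?e \<le> 1" by (simp add: vec_l2_norm_vec)
  have "mult_mat_vec A ?e = Matrix.vec n (\<lambda>i. A $$ (i, q))"
    using A pq by (intro eq_vecI) (auto simp: scalar_prod_def if_distrib cong: if_cong)
  then have "L2_set (\<lambda>i. cmod (A $$ (i, q))) {..<n} \<le> mat_op_norm A"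
    using mat_op_norm_upper[of ?e A] e A by (simp add: vec_l2_norm_vec)
  then show ?thesis using member_le_L2_set[of "{..<n}" p "\<lambda>i. cmod (A $$ (i, q))"] pq by simp
qed

section \<open>Approximation on compact sets by unital maps\<close>

lemma nuclear_approx_compact:
  assumes nuc: "nuclear TYPE('b::unital_cstar_algebra)" and K: "compact (K :: 'b set)" and e: "e > 0"
  obtains n \<phi> \<psi> where "cp_to_mat n \<phi>" "\<And>x. mat_op_norm (\<phi> x) \<le> norm (x :: 'b)" "cp_from_mat n \<psi>"
    "\<And>A. A \<in> carrier_mat n n \<Longrightarrow> norm (\<psi> A) \<le> mat_op_norm A"
    "\<And>x. x \<in> K \<Longrightarrow> norm (\<psi> (\<phi> x) - x) < e"
proof -
  have e3: "e / 3 > 0" using e by simp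
  have cov: "K \<subseteq> (\<Union>y\<in>K. ball y (e / 3))" using e3 by auto
  \<comment> \<open>A finite \<open>e / 3\<close>-net: as the composition is contractive,
    approximation on the net extends to \<open>K\<close>.\<close>
  obtain F where F: "finite F" "K \<subseteq> (\<Union>y\<in>F. ball y (e / 3))"
    by (rule compactE_image[OF K _ cov]) auto
  obtain n \<phi> \<psi> where *: "cp_to_mat n \<phi>" "\<forall>x. mat_op_norm (\<phi> x) \<le> norm (x :: 'b)" "cp_from_mat n \<psi>"
    "\<forall>A \<in> carrier_mat n n. norm (\<psi> A) \<le> mat_op_norm A" "\<forall>x \<in> F. norm (\<psi> (\<phi> x) - x) < e / 3"
    using nuc[unfolded nuclear_def, rule_format, OF e3 F(1)] by blast
  have car: "\<phi> x \<in> carrier_mat n n" for x using *(1) by (simp add: cp_to_mat_def)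
  have contr: "norm (\<psi> (\<phi> x)) \<le> norm x" for x
    using *(2,4) car order_trans by blast
  have diff: "\<psi> (\<phi> x) = \<psi> (\<phi> (x - y)) + \<psi> (\<phi> y)" for x y
  proof -
    have "\<phi> ((x - y) + y) = \<phi> (x - y) + \<phi> y" using *(1) unfolding cp_to_mat_def by blast
    moreover have "\<psi> (\<phi> (x - y) + \<phi> y) = \<psi> (\<phi> (x - y)) + \<psi> (\<phi> y)"
      using *(3) car unfolding cp_from_mat_def by blast
    ultimately show ?thesis by simp
  qed
  have "norm (\<psi> (\<phi> x) - x) < e" if x: "x \<in> K" for x
  proof -
    obtain y where y: "y \<in> F" "dist y x < e / 3" using F(2) x by auto
    have "\<psi> (\<phi> x) - x = \<psi> (\<phi> (x - y)) + ((\<psi> (\<phi> y) - y) + (y - x))" by (subst diff[of x y]) simp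
    also have "norm \<dots> \<le> norm (\<psi> (\<phi> (x - y))) + (norm (\<psi> (\<phi> y) - y) + norm (y - x))"
      by (meson norm_triangle_ineq order_trans add_left_mono)
    also have "norm (\<psi> (\<phi> (x - y))) \<le> norm (x - y)" by (rule contr)
    finally show ?thesis using y *(5) by (auto simp: dist_norm norm_minus_commute)
  qed
  then show ?thesis using that[of n \<phi> \<psi>] * by blast
qed

lemma positive_elem_le_norm:
  fixes a b :: "'b::unital_cstar_algebra"
  assumes a: "positive_elem a" and ab: "positive_elem (b - a)"
  shows "norm a \<le> norm b"
proof (rule positive_elem_norm_le[OF a])
  have "positive_elem b" using positive_elem_add[OF ab a] by simp
  then have "positive_elem (of_real (norm b) - b)"
    by (intro positive_elem_of_real_minus positive_elem_self_adjoint) auto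
  from positive_elem_add[OF this ab] show "positive_elem (of_real (norm b) - a)" by simp
qed simp

lemma positive_elem_one_minus:
  fixes a :: "'b::unital_cstar_algebra"
  assumes "star a = a" "norm a \<le> 1"
  shows "positive_elem (1 - a)"
  using positive_elem_of_real_minus(1)[OF assms] by simp

text \<open>The map \<open>M_n \<rightarrow> B\<close> with Choi matrix \<open>P\<close>, on
  matrices given as functions.\<close>

definition choi_map :: "nat \<Rightarrow> (nat \<Rightarrow> nat \<Rightarrow> 'b::unital_cstar_algebra) \<Rightarrow> (nat \<Rightarrow> nat \<Rightarrow> complex) \<Rightarrow> 'b" where
  "choi_map n P A = (\<Sum>p<n. \<Sum>q<n. scaleC (A p q) (P p q))"

lemma choi_map_add: "choi_map n P (\<lambda>p q. A p q + B p q) = choi_map n P A + choi_map n P B"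
  by (simp add: choi_map_def scaleC_add_left sum.distrib)

lemma choi_map_scale: "choi_map n P (\<lambda>p q. a * A p q) = scaleC a (choi_map n P A)"
  by (simp add: choi_map_def scaleC_sum_right scaleC_scaleC)

lemma choi_map_positive:
  assumes P: "form_positive n P" and A: "form_positive n A"
  shows "positive_elem (choi_map n P A)"
proof -
  obtain Y where Y: "\<And>i j. i < n \<Longrightarrow> j < n \<Longrightarrow> P i j = (\<Sum>l<n. star (Y l i) * Y l j)"
    using form_positive_sqrt[OF P] by blast
  have "choi_map n P A = (\<Sum>p<n. \<Sum>q<n. \<Sum>l<n. scaleC (A p q) (star (Y l p) * Y l q))"
    unfolding choi_map_def by (intro sum.cong refl) (simp add: Y scaleC_sum_right)
  also have "\<dots> = (\<Sum>p<n. \<Sum>l<n. \<Sum>q<n. scaleC (A p q) (star (Y l p) * Y l q))"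
    by (intro sum.cong refl sum.swap)
  also have "\<dots> = (\<Sum>l<n. \<Sum>p<n. \<Sum>q<n. scaleC (A p q) (star (Y l p) * Y l q))"
    by (rule sum.swap)
  also have "positive_elem \<dots>" by (intro positive_elem_sum scalar_form_positive A)
  finally show ?thesis .
qed

lemma cp_pairing_form:
  assumes cp: "cp_pairing n \<Phi>" and a: "positive_elem (a::'b::unital_cstar_algebra)"
  shows "form_positive n (\<Phi> a)"
  unfolding form_positive_def
proof
  fix v :: "nat \<Rightarrow> complex"
  have "qform n (\<Phi> a) v = (\<Sum>p<n. \<Sum>q<n. \<Phi> (scaleC (cnj (v p) * v q) a) p q)"
    using cp by (simp add: qform_def star_complex_def cp_pairing_def mult_ac)
  moreover have fp: "form_positive n (\<lambda>p q. scaleC (cnj (v p) * v q) a)"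
    by (rule scaled_form_positive[OF form_positive_gram[where m = 1 and Y = "\<lambda>_. v"] a])
       (simp add: star_complex_def)
  moreover have "positive_elem (\<Sum>p<n. \<Sum>q<n. \<Phi> (scaleC (cnj (v p) * v q) a) p q)"
    by (rule cp[unfolded cp_pairing_def, THEN conjunct2, THEN conjunct2, rule_format, OF fp])
  ultimately show "positive_elem (qform n (\<Phi> a) v)" by (simp only:)
qed

lemma form_positive_uminus_one:
  fixes h :: "nat \<Rightarrow> nat \<Rightarrow> complex"
  assumes h: "form_positive n h"
    and le: "\<And>v. cmod (\<Sum>p<n. \<Sum>q<n. cnj (v p) * h p q * v q) \<le> (\<Sum>p<n. (cmod (v p))\<^sup>2)"
  shows "form_positive n (\<lambda>p q. (if p = q then 1 else 0) - h p q)"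
  unfolding form_positive_def
proof
  fix v
  let ?s = "\<Sum>p<n. \<Sum>q<n. cnj (v p) * h p q * v q"
  have s: "qform n h v = ?s" by (simp add: qform_def star_complex_def)
  then have "positive_elem ?s" using h unfolding form_positive_def by metis
  then have s0: "Im ?s = 0" "Re ?s \<ge> 0" by (simp_all only: positive_complex_iff)
  have "(\<Sum>p<n. \<Sum>q<n. cnj (v p) * (if p = q then 1 else 0) * v q) = of_real (\<Sum>p<n. (cmod (v p))\<^sup>2)"
    by (simp add: if_distrib if_distribR complex_norm_square mult.commute cong: if_cong del: of_real_power)
  then have "qform n (\<lambda>p q. (if p = q then 1 else 0) - h p q) v = of_real (\<Sum>p<n. (cmod (v p))\<^sup>2) - ?s"
    by (simp add: qform_def star_complex_def right_diff_distrib left_diff_distrib sum_subtractf del: of_real_sum)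
  moreover have "Re ?s \<le> (\<Sum>p<n. (cmod (v p))\<^sup>2)" using le[of v] complex_Re_le_cmod[of ?s] by linarith
  ultimately show "positive_elem (qform n (\<lambda>p q. (if p = q then 1 else 0) - h p q) v)"
    using s0 by (simp add: positive_complex_iff)
qed

text \<open>Non-unital approximating maps are made unital by adding the defects
  \<open>1 - \<phi>(1)\<close> and \<open>1 - \<psi>(1)\<close>, multiplied by states. This avoids the customary conjugation by
  inverse square roots.\<close>

lemma nuclear_unital_approx:
  assumes nuc: "nuclear TYPE('b::unital_cstar_algebra)" and K: "compact (K :: 'b set)" and e: "e > 0"
  obtains n \<Phi> P C where "cp_pairing n \<Phi>" "\<And>p q. p < n \<Longrightarrow> q < n \<Longrightarrow> \<Phi> (1::'b) p q = (if p = q then 1 else 0)"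
    "form_positive n P" "(\<Sum>p<n. P p p) = 1"
    "\<And>x p q. p < n \<Longrightarrow> q < n \<Longrightarrow> cmod (\<Phi> x p q) \<le> C * norm x"
    "\<And>x. x \<in> K \<Longrightarrow> norm (choi_map n P (\<Phi> x) - x) < e"
proof -
  have "bounded K" by (rule compact_imp_bounded[OF K])
  then obtain R where R: "\<And>x. x \<in> K \<Longrightarrow> norm x \<le> R" "R > 0" by (auto simp: bounded_pos)
  \<comment> \<open>The total error will be below \<open>d + 4 * R * d\<close>, which
    \<open>d * (1 + 6 * R)\<close> dominates. The bound \<open>1/2\<close> keeps
    \<open>\<psi> (\<phi> 1)\<close> away from zero.\<close>
  define d where "d = min (1/2) (e / (2 * (1 + 6 * R)))"
  have d: "d > 0" using e R(2) by (simp add: d_def)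
  have d1: "d < 1" by (simp add: d_def)
  have dR: "d * (1 + 6 * R) < e"
  proof -
    have "d * (1 + 6 * R) \<le> e / (2 * (1 + 6 * R)) * (1 + 6 * R)"
      using R(2) by (intro mult_right_mono) (auto simp: d_def)
    also have "\<dots> = e / 2" using R(2) by (simp add: field_simps)
    finally show ?thesis using e by simp
  qed
  \<comment> \<open>The unit is included so that \<open>\<psi> (\<phi> 1)\<close> is close to
    \<open>1\<close>; this makes the corrections by both defects small.\<close>
  have cK: "compact (insert 1 K)" by (rule compact_insert[OF K])
  obtain n \<phi> \<psi> where cp: "cp_to_mat n \<phi>" and \<phi>le: "\<And>x. mat_op_norm (\<phi> x) \<le> norm (x :: 'b)"
    and cp': "cp_from_mat n \<psi>" and \<psi>le: "\<And>A. A \<in> carrier_mat n n \<Longrightarrow> norm (\<psi> A) \<le> mat_op_norm A"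
    and app: "\<And>x. x \<in> insert 1 K \<Longrightarrow> norm (\<psi> (\<phi> x) - x) < d"
    using nuclear_approx_compact[OF nuc cK d] by blast
  have car: "\<phi> x \<in> carrier_mat n n" for x using cp by (simp add: cp_to_mat_def)
  define \<Phi>\<^sub>0 where "\<Phi>\<^sub>0 x p q = (if p < n \<and> q < n then \<phi> x $$ (p, q) else 0)" for x p q
  have cp0: "cp_pairing n \<Phi>\<^sub>0" unfolding \<Phi>\<^sub>0_def[abs_def] by (rule cp_to_mat_imp_pairing[OF cp])
  define P\<^sub>0 where "P\<^sub>0 p q = \<psi> (mat_unit n p q)" for p q
  have P0: "form_positive n P\<^sub>0" unfolding P\<^sub>0_def by (rule cp_from_mat_choi(1)[OF cp'])
  have \<psi>: "\<psi> A = choi_map n P\<^sub>0 (\<lambda>p q. A $$ (p, q))" if "A \<in> carrier_mat n n" for A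
    unfolding choi_map_def P\<^sub>0_def by (rule cp_from_mat_choi(2)[OF cp' that])
  have \<psi>\<phi>: "\<psi> (\<phi> x) = choi_map n P\<^sub>0 (\<Phi>\<^sub>0 x)" for x
    unfolding \<psi>[OF car] choi_map_def by (intro sum.cong refl) (simp add: \<Phi>\<^sub>0_def)
  define h where "h = \<Phi>\<^sub>0 1"
  have h: "form_positive n h" unfolding h_def by (rule cp_pairing_form[OF cp0 positive_elem_one])
  have hle: "cmod (\<Sum>p<n. \<Sum>q<n. cnj (v p) * h p q * v q) \<le> (\<Sum>p<n. (cmod (v p))\<^sup>2)" for v
  proof -
    have "(\<Sum>p<n. \<Sum>q<n. cnj (v p) * h p q * v q) = (\<Sum>p<n. \<Sum>q<n. cnj (v p) * \<phi> 1 $$ (p, q) * v q)"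
      by (intro sum.cong refl) (simp add: h_def \<Phi>\<^sub>0_def)
    then show ?thesis using mat_op_norm_form_bound[OF car, of 1 v] \<phi>le[of 1] by simp
  qed
  define k where "k p q = (if p = q then 1 else 0) - h p q" for p q
  have k: "form_positive n k" unfolding k_def[abs_def] by (rule form_positive_uminus_one[OF h hle])
  \<comment> \<open>If the matrix \<open>\<phi> 1\<close> were zero, the composition would vanish at
    the unit. A vector \<open>v\<close> with nonzero form value yields a state on \<open>B\<close>
    directly from \<open>\<phi>\<close>, by normalising the vector functional.\<close>
  have "\<exists>v. qform n h v \<noteq> 0"
  proof (rule ccontr)
    assume "\<not> ?thesis"
    then have z: "qform n h v = 0" for v by blast
    have "h p q = 0" if "p < n" "q < n" for p q
      using polarization_entry(1)[OF that, of h] by (simp add: z)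
    then have "choi_map n P\<^sub>0 h = 0" by (simp add: choi_map_def)
    then have "\<psi> (\<phi> 1) = 0" by (simp add: \<psi>\<phi> h_def)
    then show False using app[of 1] d1 by simp
  qed
  then obtain v where v: "qform n h v \<noteq> 0" by blast
  define \<omega> where "\<omega> x = qform n (\<Phi>\<^sub>0 x) v / qform n h v" for x
  have hv: "Im (qform n h v) = 0" "Re (qform n h v) > 0"
    using h v positive_complex_iff[of "qform n h v"] by (auto simp: form_positive_def complex_eq_iff)
  have \<omega>add: "\<omega> (x + y) = \<omega> x + \<omega> y" for x y
    using cp0 by (simp add: \<omega>_def qform_def cp_pairing_def distrib_left distrib_right sum.distrib add_divide_distrib)
  have \<omega>sc: "\<omega> (scaleC a x) = a * \<omega> x" for a x
    using cp0 by (simp add: \<omega>_def qform_def cp_pairing_def sum_distrib_left mult_ac)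
  have \<omega>pos: "positive_elem (\<omega> x)" if "positive_elem x" for x
  proof -
    have "positive_elem (qform n (\<Phi>\<^sub>0 x) v)"
      using cp_pairing_form[OF cp0 that] by (simp add: form_positive_def)
    then show ?thesis using hv by (simp add: \<omega>_def positive_complex_iff Re_divide Im_divide)
  qed
  have \<omega>1: "\<omega> 1 = 1" using v by (simp add: \<omega>_def h_def)
  have \<omega>le: "cmod (\<omega> x) \<le> 2 * norm x" for x
    by (rule positive_unital_functional_bound[OF \<omega>add \<omega>sc \<omega>pos \<omega>1])
  define \<Phi> where "\<Phi> x p q = \<Phi>\<^sub>0 x p q + \<omega> x * k p q" for x p q
  have \<omega>sum: "\<omega> (sum f I) = (\<Sum>i\<in>I. \<omega> (f i))" for f :: "nat \<Rightarrow> 'b" and I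
  proof (induction I rule: infinite_finite_induct)
    case empty
    show ?case using \<omega>sc[of 0 0] by simp
  next
    case (infinite A)
    then show ?case using \<omega>sc[of 0 0] by simp
  qed (simp add: \<omega>add)
  have cp1: "cp_pairing n \<Phi>"
    unfolding cp_pairing_def
  proof (intro conjI allI impI)
    show "\<Phi> (x + y) p q = \<Phi> x p q + \<Phi> y p q" for x y p q
      using cp0 by (simp add: \<Phi>_def \<omega>add cp_pairing_def algebra_simps)
    show "\<Phi> (scaleC a x) p q = a * \<Phi> x p q" for a x p q
      using cp0 by (simp add: \<Phi>_def \<omega>sc cp_pairing_def algebra_simps)
    fix X :: "nat \<Rightarrow> nat \<Rightarrow> 'b" assume X: "form_positive n X"
    \<comment> \<open>Here \<open>X\<close> takes the role of a Choi matrix, evaluated at the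
      positive matrix \<open>k\<close>.\<close>
    have "(\<Sum>p<n. \<Sum>q<n. \<omega> (X p q) * k p q) = \<omega> (choi_map n X k)"
      by (simp add: choi_map_def \<omega>sum \<omega>sc mult.commute)
    moreover have "positive_elem (\<omega> (choi_map n X k))" by (intro \<omega>pos choi_map_positive X k)
    moreover have "positive_elem (\<Sum>p<n. \<Sum>q<n. \<Phi>\<^sub>0 (X p q) p q)" using cp0 X by (simp add: cp_pairing_def)
    ultimately show "positive_elem (\<Sum>p<n. \<Sum>q<n. \<Phi> (X p q) p q)"
      by (simp add: \<Phi>_def sum.distrib positive_elem_add)
  qed
  have one: "\<Phi> 1 p q = (if p = q then 1 else 0)" for p q
    by (simp add: \<Phi>_def \<omega>1 k_def h_def)
  have n0: "n > 0" using v by (cases n) (auto simp: qform_def)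
  define b where "b = \<psi> (1\<^sub>m n)"
  have b_choi: "b = choi_map n P\<^sub>0 (\<lambda>p q. if p = q then 1 else 0)"
    unfolding b_def \<psi>[OF one_carrier_mat] choi_map_def by (intro sum.cong refl) simp
  have bk: "b = choi_map n P\<^sub>0 h + choi_map n P\<^sub>0 k"
    unfolding b_choi choi_map_add[symmetric] by (simp add: k_def)
  have bpos: "positive_elem b"
    unfolding bk by (intro positive_elem_add choi_map_positive P0 h k)
  have b1: "positive_elem (1 - b)"
    using \<psi>le[of "1\<^sub>m n"] mat_op_norm_one[of n]
    by (intro positive_elem_one_minus positive_elem_self_adjoint bpos) (simp add: b_def)
  have hd: "norm (1 - choi_map n P\<^sub>0 h) < d"
    using app[of 1] by (simp add: \<psi>\<phi> h_def norm_minus_commute)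
  \<comment> \<open>Since \<open>b\<close>, the sum of the images of \<open>h\<close> and
    \<open>k\<close>, is at most \<open>1\<close>, the image of \<open>k\<close> is dominated by
    \<open>1\<close> minus the image of \<open>h\<close>, whose norm is below
    \<open>d\<close>.\<close>
  have kd: "norm (choi_map n P\<^sub>0 k) \<le> d"
  proof -
    have "positive_elem ((1 - choi_map n P\<^sub>0 h) - choi_map n P\<^sub>0 k)" using b1 by (simp add: bk algebra_simps)
    from positive_elem_le_norm[OF choi_map_positive[OF P0 k] this] show ?thesis using hd by simp
  qed
  have bd: "norm (1 - b) \<le> d"
  proof -
    have "positive_elem ((1 - choi_map n P\<^sub>0 h) - (1 - b))"
      using choi_map_positive[OF P0 k] by (simp add: bk)
    from positive_elem_le_norm[OF b1 this] show ?thesis using hd by simp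
  qed
  \<comment> \<open>Adds the defect \<open>1 - b\<close> times the state of \<open>M_n\<close> given
    by the entry at \<open>(0, 0)\<close>.\<close>
  define P where "P p q = P\<^sub>0 p q + (if p = 0 \<and> q = 0 then 1 - b else 0)" for p q
  have P: "form_positive n P"
  proof -
    have "form_positive n (\<lambda>p q. star (if p = 0 then 1 else 0) * (1 - b) * (if q = 0 then 1 else 0))"
      by (rule form_positive_rank_one[OF b1])
    moreover have "(\<lambda>(p::nat) (q::nat). star (if p = 0 then 1 else 0) * (1 - b) * (if q = 0 then 1 else 0)) =
        (\<lambda>p q. if p = 0 \<and> q = (0::nat) then 1 - b else 0)" by (auto simp: fun_eq_iff)
    ultimately have "form_positive n (\<lambda>p q. if p = 0 \<and> q = (0::nat) then 1 - b else 0)" by simp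
    from form_positive_add[OF P0 this] show ?thesis by (simp add: P_def[abs_def])
  qed
  have choi: "choi_map n P A = choi_map n P\<^sub>0 A + scaleC (A 0 0) (1 - b)" for A
  proof -
    have m: "scaleC a (if Q then c else 0) = (if Q then scaleC a c else 0)" for a Q and c :: 'b by simp
    have "(\<Sum>q<n. if p = 0 \<and> q = 0 then f q else 0) = (if p = 0 then f 0 else 0)" for p :: nat and f :: "nat \<Rightarrow> 'b"
      using n0 by (cases "p = 0") simp_all
    then have "(\<Sum>p<n. \<Sum>q<n. scaleC (A p q) (if p = 0 \<and> q = 0 then 1 - b else 0)) = scaleC (A 0 0) (1 - b)"
      using n0 by (simp add: m)
    then show ?thesis by (simp add: choi_map_def P_def scaleC_add_right sum.distrib)
  qed
  have Ptr: "(\<Sum>p<n. P p p) = 1"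
  proof -
    have "(\<Sum>p<n. P p p) = choi_map n P (\<lambda>p q. if p = q then 1 else 0)"
      unfolding choi_map_def by (intro sum.cong refl) (simp add: if_distrib[of "\<lambda>x. scaleC x _"] cong: if_cong)
    also have "\<dots> = 1" unfolding choi b_choi[symmetric] by simp
    finally show ?thesis .
  qed
  have bdd: "cmod (\<Phi> x p q) \<le> (1 + 2 * (\<Sum>p<n. \<Sum>q<n. cmod (k p q))) * norm x" if pq: "p < n" "q < n" for x p q
  proof -
    have "cmod (k p q) \<le> (\<Sum>q<n. cmod (k p q))" by (rule member_le_sum) (use pq in auto)
    also have "\<dots> \<le> (\<Sum>p<n. \<Sum>q<n. cmod (k p q))"
      by (rule member_le_sum[where f = "\<lambda>p. \<Sum>q<n. cmod (k p q)"]) (use pq in \<open>auto intro: sum_nonneg\<close>)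
    finally have "cmod (\<omega> x) * cmod (k p q) \<le> (2 * norm x) * (\<Sum>p<n. \<Sum>q<n. cmod (k p q))"
      by (intro mult_mono \<omega>le) auto
    moreover have "cmod (\<Phi>\<^sub>0 x p q) \<le> norm x"
      using mat_op_norm_entry[OF car pq, of x] \<phi>le[of x] pq by (simp add: \<Phi>\<^sub>0_def)
    moreover have "cmod (\<Phi> x p q) \<le> cmod (\<Phi>\<^sub>0 x p q) + cmod (\<omega> x) * cmod (k p q)"
      unfolding \<Phi>_def by (metis norm_mult norm_triangle_ineq)
    ultimately show ?thesis by (simp add: algebra_simps)
  qed
  have "norm (choi_map n P (\<Phi> x) - x) < e" if x: "x \<in> K" for x
  proof -
    have "cmod (\<Phi> x 0 0) \<le> 2 * norm x"
    proof (rule positive_unital_functional_bound[where \<omega> = "\<lambda>x. \<Phi> x 0 0"])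
      show "positive_elem (\<Phi> y 0 0)" if "positive_elem y" for y
      proof -
        have "positive_elem (qform n (\<Phi> y) (\<lambda>i. (if i = 0 then 1 else 0) + (if i = 0 then 0 else 0)))"
          using cp_pairing_form[OF cp1 that] unfolding form_positive_def by blast
        then show ?thesis unfolding qform_two_point[OF n0 n0] by simp
      qed
    qed (use cp1 one in \<open>auto simp: cp_pairing_def\<close>)
    then have 1: "norm (scaleC (\<Phi> x 0 0) (1 - b)) \<le> (2 * R) * d"
      unfolding norm_scaleC using R(1)[OF x] R(2) bd by (intro mult_mono) auto
    have 2: "norm (scaleC (\<omega> x) (choi_map n P\<^sub>0 k)) \<le> (2 * R) * d"
      unfolding norm_scaleC using R(1)[OF x] \<omega>le[of x] kd R(2) by (intro mult_mono) auto
    have 3: "norm (choi_map n P\<^sub>0 (\<Phi>\<^sub>0 x) - x) < d" using app[of x] x by (simp add: \<psi>\<phi>)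
    have "choi_map n P (\<Phi> x) - x = (choi_map n P\<^sub>0 (\<Phi>\<^sub>0 x) - x) + (scaleC (\<omega> x) (choi_map n P\<^sub>0 k) + scaleC (\<Phi> x 0 0) (1 - b))"
      unfolding choi by (simp add: \<Phi>_def[abs_def] choi_map_add choi_map_scale)
    also have "norm \<dots> \<le> norm (choi_map n P\<^sub>0 (\<Phi>\<^sub>0 x) - x) + (norm (scaleC (\<omega> x) (choi_map n P\<^sub>0 k)) + norm (scaleC (\<Phi> x 0 0) (1 - b)))"
      by (meson norm_triangle_ineq order_trans add_left_mono)
    also have "\<dots> < d + ((2 * R) * d + (2 * R) * d)" using 1 2 3 by linarith
    also have "\<dots> \<le> d * (1 + 6 * R)" using d R(2) by (simp add: algebra_simps)
    also have "\<dots> < e" by (rule dR)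
    finally show ?thesis .
  qed
  then show ?thesis using that[OF cp1 one P Ptr bdd] by blast
qed

section \<open>Equivariant approximation\<close>

lemma convex_positive_elem: "convex {a::'b::unital_cstar_algebra. positive_elem a}"
  by (rule convexI) (simp add: positive_elem_add positive_elem_scaleR)

context compact_group
begin

lemma group_mean_positive:
  fixes f :: "'g \<Rightarrow> 'b::unital_cstar_algebra"
  assumes "cont f" "\<And>x. positive_elem (f x)"
  shows "positive_elem (group_mean f)"
  using group_mean_in_closed_convex[OF assms(1) closed_positive_elem convex_positive_elem] assms(2) by simp

lemma group_mean_scaleC_left:
  fixes y :: "'b::unital_cstar_algebra"
  shows "cont f \<Longrightarrow> group_mean (\<lambda>x. scaleC (f x) y) = scaleC (group_mean f) y"
  by (rule group_mean_bounded_linear[OF bounded_linear_scaleC_left])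

lemma group_mean_scaleC_right:
  fixes f :: "'g \<Rightarrow> 'b::unital_cstar_algebra"
  shows "cont f \<Longrightarrow> group_mean (\<lambda>x. scaleC z (f x)) = scaleC z (group_mean f)"
  by (rule group_mean_bounded_linear[OF bounded_linear_scaleC_right])

lemma form_positive_group_mean:
  fixes R :: "'g \<Rightarrow> nat \<Rightarrow> nat \<Rightarrow> 'b::unital_cstar_algebra"
  assumes c: "\<And>i j. i < k \<Longrightarrow> j < k \<Longrightarrow> cont (\<lambda>h. R h i j)"
    and pos: "\<And>h. form_positive k (R h)"
  shows "form_positive k (\<lambda>i j. group_mean (\<lambda>h. R h i j))"
  unfolding form_positive_def
proof
  fix v
  have ct: "cont (\<lambda>h. star (v i) * R h i j * v j)" if "i < k" "j < k" for i j
    by (intro continuous_intros c that)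
  have "star (v i) * group_mean (\<lambda>h. R h i j) * v j = group_mean (\<lambda>h. star (v i) * R h i j * v j)"
    if "i < k" "j < k" for i j
  proof -
    have "bounded_linear (\<lambda>x. star (v i) * x * v j)"
      by (intro bounded_linear_mult_const bounded_linear_const_mult bounded_linear_ident)
    from group_mean_bounded_linear[OF this c[OF that]] show ?thesis by simp
  qed
  then have "qform k (\<lambda>i j. group_mean (\<lambda>h. R h i j)) v = (\<Sum>i<k. \<Sum>j<k. group_mean (\<lambda>h. star (v i) * R h i j * v j))"
    unfolding qform_def by (intro sum.cong refl) simp
  also have "\<dots> = (\<Sum>i<k. group_mean (\<lambda>h. \<Sum>j<k. star (v i) * R h i j * v j))"
    by (intro sum.cong refl group_mean_sum[symmetric] ct) auto
  also have "\<dots> = group_mean (\<lambda>h. \<Sum>i<k. \<Sum>j<k. star (v i) * R h i j * v j)"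
    by (intro group_mean_sum[symmetric] continuous_on_sum ct) auto
  also have "positive_elem \<dots>"
  proof (rule group_mean_positive)
    show "cont (\<lambda>h. \<Sum>i<k. \<Sum>j<k. star (v i) * R h i j * v j)"
      by (intro continuous_on_sum ct) auto
    show "positive_elem (\<Sum>i<k. \<Sum>j<k. star (v i) * R h i j * v j)" for h
      using pos[of h] by (simp add: form_positive_def qform_def)
  qed
  finally show "positive_elem (qform k (\<lambda>i j. group_mean (\<lambda>h. R h i j)) v)" .
qed

text \<open>The bump \<open>b = max 0 (d - w)\<close> lives where \<open>w < d\<close>, so weighting
  its square with \<open>w\<close> multiplies the mean by at most \<open>d\<close>. A representative
  function uniformly close to \<open>b\<close> inherits this after normalisation, with
  \<open>2 * d = \<delta>\<close> in place of \<open>d\<close>.\<close>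

lemma concentrated_representative:
  fixes w :: "'g \<Rightarrow> real"
  assumes w: "cont w" "\<And>x. w x \<ge> 0" "w 0 = 0" and \<delta>: "\<delta> > 0"
  obtains \<xi> :: "'g \<Rightarrow> real" where "representative (\<lambda>x. of_real (\<xi> x))"
    "group_mean (\<lambda>x. (\<xi> x)\<^sup>2) = 1" "group_mean (\<lambda>x. (\<xi> x)\<^sup>2 * w x) \<le> \<delta>"
proof -
  define d where "d = \<delta> / 2"
  have d: "d > 0" using \<delta> by (simp add: d_def)
  define b where "b x = max 0 (d - w x)" for x
  have b: "cont b" unfolding b_def by (intro continuous_intros w)
  have bd: "0 \<le> b x" "b x \<le> d" for x using w(2)[of x] d by (auto simp: b_def)
  have bw: "(b x)\<^sup>2 * w x \<le> d * (b x)\<^sup>2" for x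
  proof (cases "w x \<le> d")
    case True then show ?thesis using mult_right_mono[OF True, of "(b x)\<^sup>2"] by (simp add: mult.commute)
  next
    case False then show ?thesis by (simp add: b_def)
  qed
  define B where "B = group_mean (\<lambda>x. (b x)\<^sup>2)"
  have b2: "cont (\<lambda>x. (b x)\<^sup>2)" by (intro continuous_intros b)
  have B: "B > 0" unfolding B_def
    by (rule group_mean_strict_pos[OF b2, of 0]) (use d w(3) in \<open>auto simp: b_def\<close>)
  obtain W where W: "\<And>x. norm (w x) \<le> W" "W \<ge> 0" using continuous_bounded[OF w(1)] by blast
  define c where "c = 2 * d + 1"
  have c: "c > 0" using d by (simp add: c_def)
  \<comment> \<open>\<open>c\<close> bounds the absolute value of \<open>\<xi>\<^sub>0 + b\<close>,
    so \<open>\<eta> * c\<close> bounds the error of the squares, and \<open>W\<close> bounds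
    \<open>w\<close>. The choice gives \<open>\<eta> * c * (W + 2 * d + 1) \<le> d * B\<close>,
    which covers the losses in the weighted mean and in the normalisation.\<close>
  define \<eta> where "\<eta> = min 1 (d * B / (c * (W + 2 * d + 1)))"
  have den: "c * (W + 2 * d + 1) > 0" using c W(2) d by simp
  have \<eta>: "\<eta> > 0" "\<eta> \<le> 1" using d B den by (auto simp: \<eta>_def)
  have "\<eta> * (c * (W + 2 * d + 1)) \<le> d * B / (c * (W + 2 * d + 1)) * (c * (W + 2 * d + 1))"
    using den by (intro mult_right_mono) (auto simp: \<eta>_def)
  also have "\<dots> = d * B"
    by (rule nonzero_divide_eq_eq[THEN iffD1, OF less_imp_neq[OF den, symmetric] refl, symmetric])
  finally have \<eta>c: "(\<eta> * c) * (W + 2 * d + 1) \<le> d * B" by (simp only: mult.assoc)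
  obtain \<xi>\<^sub>0 :: "'g \<Rightarrow> real" where \<xi>0: "representative (\<lambda>x. of_real (\<xi>\<^sub>0 x))" "\<And>x. \<bar>b x - \<xi>\<^sub>0 x\<bar> < \<eta>"
    using representative_dense[OF b \<eta>(1)] by blast
  have "cont (\<lambda>x. Re (of_real (\<xi>\<^sub>0 x)))"
    using \<xi>0(1) unfolding representative_def by (intro continuous_on_Re) blast
  then have c0: "cont \<xi>\<^sub>0" by simp
  have c02: "cont (\<lambda>x. (\<xi>\<^sub>0 x)\<^sup>2)" by (intro continuous_intros c0)
  have near: "\<bar>(\<xi>\<^sub>0 x)\<^sup>2 - (b x)\<^sup>2\<bar> \<le> \<eta> * c" for x
  proof -
    have "(\<xi>\<^sub>0 x)\<^sup>2 - (b x)\<^sup>2 = (\<xi>\<^sub>0 x - b x) * (\<xi>\<^sub>0 x + b x)" by (simp add: power2_eq_square algebra_simps)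
    then have "\<bar>(\<xi>\<^sub>0 x)\<^sup>2 - (b x)\<^sup>2\<bar> = \<bar>\<xi>\<^sub>0 x - b x\<bar> * \<bar>\<xi>\<^sub>0 x + b x\<bar>" by (simp add: abs_mult)
    also have "\<dots> \<le> \<eta> * c"
      using \<xi>0(2)[of x] bd[of x] \<eta> by (intro mult_mono) (auto simp: c_def)
    finally show ?thesis .
  qed
  define M where "M = group_mean (\<lambda>x. (\<xi>\<^sub>0 x)\<^sup>2)"
  have Mge: "M \<ge> B - \<eta> * c"
  proof -
    have "group_mean (\<lambda>x. (b x)\<^sup>2 - \<eta> * c) \<le> M" unfolding M_def
    proof (rule group_mean_mono)
      show "(b x)\<^sup>2 - \<eta> * c \<le> (\<xi>\<^sub>0 x)\<^sup>2" for x using near[of x] by linarith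
    qed (intro continuous_intros b2 c02)+
    then show ?thesis using group_mean_diff[OF b2 continuous_on_const, of "\<eta> * c"] by (simp add: B_def)
  qed
  have Mw: "group_mean (\<lambda>x. (\<xi>\<^sub>0 x)\<^sup>2 * w x) \<le> d * B + \<eta> * c * W"
  proof -
    have "group_mean (\<lambda>x. (\<xi>\<^sub>0 x)\<^sup>2 * w x) \<le> group_mean (\<lambda>x. d * (b x)\<^sup>2 + \<eta> * c * W)"
    proof (rule group_mean_mono)
      fix x
      have "(\<xi>\<^sub>0 x)\<^sup>2 * w x \<le> ((b x)\<^sup>2 + \<eta> * c) * w x"
        using near[of x] w(2)[of x] by (intro mult_right_mono) linarith+
      also have "\<dots> \<le> d * (b x)\<^sup>2 + \<eta> * c * W"
      proof -
        have "\<eta> * c * w x \<le> \<eta> * c * W"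
          using W(1)[of x] w(2)[of x] \<eta> c by (intro mult_left_mono) auto
        then show ?thesis using bw[of x] by (simp add: distrib_right)
      qed
      finally show "(\<xi>\<^sub>0 x)\<^sup>2 * w x \<le> d * (b x)\<^sup>2 + \<eta> * c * W" .
    qed (intro continuous_intros b c0 w)+
    also have "\<dots> = d * B + \<eta> * c * W"
    proof -
      have "cont (\<lambda>x. d * (b x)\<^sup>2)" by (intro continuous_intros b)
      then show ?thesis using group_mean_scaleR[OF b2, of d] by (simp add: group_mean_add B_def)
    qed
    finally show ?thesis .
  qed
  have "\<eta> * c * W + 2 * d * (\<eta> * c) + \<eta> * c \<le> d * B" using \<eta>c by (simp add: algebra_simps)
  moreover have "\<eta> * c > 0" using \<eta> c by simp
  moreover have "\<eta> * c * W \<ge> 0" using \<eta> c W(2) by simp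
  ultimately have 1: "d * B + \<eta> * c * W \<le> 2 * d * (B - \<eta> * c)" and 2: "2 * d * (\<eta> * c) < d * B"
    by (simp_all add: algebra_simps)
  have M0: "M > 0"
  proof -
    have "d * (2 * (\<eta> * c)) < d * B" using 2 by (simp add: mult_ac)
    then have "2 * (\<eta> * c) < B" using d by simp
    then show ?thesis using Mge \<open>\<eta> * c > 0\<close> by linarith
  qed
  have MM: "group_mean (\<lambda>x. (\<xi>\<^sub>0 x)\<^sup>2 * w x) \<le> \<delta> * M"
  proof -
    have "2 * d * (B - \<eta> * c) \<le> 2 * d * M" using Mge d by (intro mult_left_mono) auto
    then show ?thesis using Mw 1 by (simp add: d_def)
  qed
  define \<xi> where "\<xi> x = \<xi>\<^sub>0 x / sqrt M" for x
  have sq: "(\<xi> x)\<^sup>2 = (1 / M) * (\<xi>\<^sub>0 x)\<^sup>2" for x using M0 by (simp add: \<xi>_def power_divide)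
  have "representative (\<lambda>x. of_real (1 / sqrt M) * of_real (\<xi>\<^sub>0 x))"
    by (intro representative_mult representative_const \<xi>0)
  then have "representative (\<lambda>x. of_real (\<xi> x))" by (simp add: \<xi>_def)
  moreover have "group_mean (\<lambda>x. (\<xi> x)\<^sup>2) = 1"
    unfolding sq using group_mean_scaleR[OF c02, of "1 / M"] M0 by (simp add: M_def[symmetric])
  moreover have "group_mean (\<lambda>x. (\<xi> x)\<^sup>2 * w x) \<le> \<delta>"
  proof -
    have "cont (\<lambda>x. (\<xi>\<^sub>0 x)\<^sup>2 * w x)" by (intro continuous_intros c0 w)
    then have "group_mean (\<lambda>x. (\<xi> x)\<^sup>2 * w x) = (1 / M) * group_mean (\<lambda>x. (\<xi>\<^sub>0 x)\<^sup>2 * w x)"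
      unfolding sq using group_mean_scaleR[of "\<lambda>x. (\<xi>\<^sub>0 x)\<^sup>2 * w x" "1 / M"] by (simp add: mult.assoc)
    also have "\<dots> \<le> (1 / M) * (\<delta> * M)" using MM M0 by (intro mult_left_mono) auto
    finally show ?thesis using M0 by simp
  qed
  ultimately show ?thesis using that by blast
qed

section \<open>Translation in an invariant orthonormal basis\<close>

definition basis_matrix :: "(nat \<Rightarrow> 'g \<Rightarrow> complex) \<Rightarrow> 'g \<Rightarrow> nat \<Rightarrow> nat \<Rightarrow> complex" where
  "basis_matrix e g i j = mean_inner (\<lambda>x. e j (- g + x)) (e i)"

text \<open>\<open>basis_matrix e g\<close> represents left translation by \<open>g\<close> on the
  span of \<open>e\<close>. Invariance of the span gives the expansion and the product rule,
  invariance of the mean the relation to the adjoint.\<close>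

lemma invariant_basis_matrix:
  assumes e: "orthonormal m e"
    and inv: "\<forall>g. \<forall>j<m. mean_proj m e (\<lambda>x. e j (g + x)) = (\<lambda>x. e j (g + x))"
  shows "j < m \<Longrightarrow> e j (- g + x) = (\<Sum>i<m. basis_matrix e g i j * e i x)"
    and "i < m \<Longrightarrow> j < m \<Longrightarrow> basis_matrix e (g + h) i j = (\<Sum>l<m. basis_matrix e g i l * basis_matrix e h l j)"
    and "i < m \<Longrightarrow> j < m \<Longrightarrow> basis_matrix e (- g) i j = cnj (basis_matrix e g j i)"
    and "i < m \<Longrightarrow> j < m \<Longrightarrow> basis_matrix e 0 i j = (if i = j then 1 else 0)"
    and "i < m \<Longrightarrow> j < m \<Longrightarrow> cont (\<lambda>g. basis_matrix e g i j)"
proof -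
  have ec: "cont (e i)" if "i < m" for i using e that by (simp add: orthonormal_def)
  have et: "cont (\<lambda>x. e i (a + x))" if "i < m" for i a by (rule continuous_translation(2)[OF ec[OF that]])
  show exp: "e j (- g + x) = (\<Sum>i<m. basis_matrix e g i j * e i x)" if "j < m" for j g x
    using fun_cong[OF inv[rule_format, OF that, of "- g"], of x] by (simp add: mean_proj_def basis_matrix_def)
  show "basis_matrix e (g + h) i j = (\<Sum>l<m. basis_matrix e g i l * basis_matrix e h l j)" if ij: "i < m" "j < m" for i j g h
  proof -
    have "e j (- (g + h) + x) = (\<Sum>l<m. basis_matrix e h l j * e l (- g + x))" for x
      using exp[OF ij(2), of h "- g + x"] by (simp only: minus_add add.assoc)
    then have "basis_matrix e (g + h) i j = mean_inner (\<lambda>x. \<Sum>l<m. basis_matrix e h l j * e l (- g + x)) (e i)" by (simp add: basis_matrix_def)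
    also have "\<dots> = (\<Sum>l<m. mean_inner (\<lambda>x. basis_matrix e h l j * e l (- g + x)) (e i))"
      by (rule mean_inner_sum_left) (auto intro!: continuous_on_mult_left et ec ij)
    also have "\<dots> = (\<Sum>l<m. basis_matrix e g i l * basis_matrix e h l j)"
    proof (intro sum.cong refl)
      fix l assume "l \<in> {..<m}"
      then have "mean_inner (\<lambda>x. basis_matrix e h l j * e l (- g + x)) (e i) = basis_matrix e h l j * mean_inner (\<lambda>x. e l (- g + x)) (e i)"
        by (intro mean_inner_mult_left et ec ij) simp
      then show "mean_inner (\<lambda>x. basis_matrix e h l j * e l (- g + x)) (e i) = basis_matrix e g i l * basis_matrix e h l j" by (simp add: basis_matrix_def)
    qed
    finally show ?thesis .
  qed
  show "basis_matrix e (- g) i j = cnj (basis_matrix e g j i)" if ij: "i < m" "j < m" for i j g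
  proof -
    have c: "cont (\<lambda>x. e j (g + x) * cnj (e i x))" by (intro continuous_intros et ec ij)
    have "basis_matrix e (- g) i j = group_mean (\<lambda>x. e j (g + x) * cnj (e i x))" by (simp add: basis_matrix_def mean_inner_def)
    also have "\<dots> = group_mean (\<lambda>x. e j (g + (- g + x)) * cnj (e i (- g + x)))"
      by (rule group_mean_translate_left[OF c, symmetric])
    also have "\<dots> = mean_inner (e j) (\<lambda>x. e i (- g + x))" by (simp add: mean_inner_def)
    also have "\<dots> = cnj (basis_matrix e g j i)" unfolding basis_matrix_def by (rule mean_inner_cnj[OF et[OF ij(1)] ec[OF ij(2)], symmetric])
    finally show ?thesis .
  qed
  show "basis_matrix e 0 i j = (if i = j then 1 else 0)" if "i < m" "j < m" for i j
    using e that by (auto simp: basis_matrix_def orthonormal_def)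
  show "cont (\<lambda>g. basis_matrix e g i j)" if ij: "i < m" "j < m" for i j
    unfolding basis_matrix_def mean_inner_def
    by (rule continuous_group_mean)
       (unfold case_prod_beta, intro continuous_intros cont_compose2[OF ec[OF ij(1)]] cont_compose2[OF ec[OF ij(2)]])
qed

text \<open>Collects what the construction requires of \<open>E\<close>. The \<open>c i h\<close>
  are the coordinates of the translate of \<open>\<xi>\<close> by \<open>h\<close>; they transform
  by \<open>U\<close>, and their square sum is \<open>1\<close> because translation preserves the
  mean square. The rule for \<open>e j (g + x)\<close> is the expansion for \<open>- g\<close>,
  rewritten by \<open>U (- g) i j = cnj (U g j i)\<close>.\<close>

lemma concentrated_coefficients:
  fixes w :: "'g \<Rightarrow> real"
  assumes w: "cont w" "\<And>x. w x \<ge> 0" "w 0 = 0" and \<delta>: "\<delta> > 0"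
  obtains m e U c and \<xi> :: "'g \<Rightarrow> real" where
    "orthonormal m e"
    "\<forall>j<m. \<forall>g x. e j (g + x) = (\<Sum>i<m. cnj (U g j i) * e i x)"
    "\<forall>i<m. \<forall>j<m. \<forall>g h. U (g + h) i j = (\<Sum>l<m. U g i l * U h l j)"
    "\<forall>i<m. \<forall>j<m. \<forall>g. U (- g) i j = cnj (U g j i)"
    "\<forall>i<m. \<forall>j<m. U 0 i j = (if i = j then 1 else 0)"
    "\<forall>i<m. \<forall>j<m. cont (\<lambda>g. U g i j)"
    "\<forall>i<m. cont (c i)"
    "\<forall>i<m. \<forall>g h. c i (g + h) = (\<Sum>j<m. U g i j * c j h)"
    "\<forall>h. (\<Sum>i<m. cnj (c i h) * c i h) = 1"
    "\<forall>h x. (\<Sum>i<m. c i h * e i x) = complex_of_real (\<xi> (- h + x))"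
    "cont \<xi>" "group_mean (\<lambda>x. (\<xi> x)\<^sup>2) = 1" "group_mean (\<lambda>x. (\<xi> x)\<^sup>2 * w x) \<le> \<delta>"
proof -
  obtain \<xi> :: "'g \<Rightarrow> real" where \<xi>: "representative (\<lambda>x. of_real (\<xi> x))"
    "group_mean (\<lambda>x. (\<xi> x)\<^sup>2) = 1" "group_mean (\<lambda>x. (\<xi> x)\<^sup>2 * w x) \<le> \<delta>"
    using concentrated_representative[OF w \<delta>] by blast
  define X where "X x = complex_of_real (\<xi> x)" for x
  have Xc: "cont X" using \<xi>(1) unfolding representative_def X_def by blast
  have "cont (\<lambda>x. Re (X x))" by (intro continuous_on_Re Xc)
  then have \<xi>c: "cont \<xi>" by (simp add: X_def)
  have Xr: "representative X" using \<xi>(1) by (simp add: X_def[abs_def])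
  obtain m e where e: "orthonormal m e" "mean_proj m e X = X"
    and inv: "\<forall>g. \<forall>j<m. mean_proj m e (\<lambda>x. e j (g + x)) = (\<lambda>x. e j (g + x))"
    using representative_invariant_basis[OF Xr] by blast
  define U where "U = basis_matrix e"
  note U = invariant_basis_matrix[OF e(1) inv, folded U_def]
  define a where "a j = mean_inner X (e j)" for j
  define c where "c i h = (\<Sum>j<m. U h i j * a j)" for i h
  have ec: "cont (e i)" if "i < m" for i using e(1) that by (simp add: orthonormal_def)
  have ce: "(\<Sum>i<m. c i h * e i x) = X (- h + x)" for h x
  proof -
    have "X (- h + x) = (\<Sum>j<m. a j * e j (- h + x))"
      using fun_cong[OF e(2), of "- h + x"] by (simp add: mean_proj_def a_def)
    also have "\<dots> = (\<Sum>j<m. \<Sum>i<m. a j * (U h i j * e i x))"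
      by (intro sum.cong refl) (simp add: U(1) sum_distrib_left)
    also have "\<dots> = (\<Sum>i<m. \<Sum>j<m. a j * (U h i j * e i x))" by (rule sum.swap)
    also have "\<dots> = (\<Sum>i<m. c i h * e i x)"
      by (simp add: c_def sum_distrib_left sum_distrib_right mult_ac)
    finally show ?thesis by simp
  qed
  have inv': "\<forall>j<m. \<forall>g x. e j (g + x) = (\<Sum>i<m. cnj (U g j i) * e i x)"
  proof (intro allI impI)
    fix j g x assume j: "j < m"
    have "e j (g + x) = (\<Sum>i<m. U (- g) i j * e i x)" using U(1)[OF j, of "- g" x] by simp
    then show "e j (g + x) = (\<Sum>i<m. cnj (U g j i) * e i x)" using U(3) j by simp
  qed
  have cc: "\<forall>i<m. cont (c i)"
    unfolding c_def by (intro allI impI continuous_on_sum continuous_on_mult continuous_on_const U(5)) auto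
  have cU: "\<forall>i<m. \<forall>g h. c i (g + h) = (\<Sum>j<m. U g i j * c j h)"
  proof (intro allI impI)
    fix i g h assume i: "i < m"
    have "c i (g + h) = (\<Sum>l<m. \<Sum>j<m. U g i j * U h j l * a l)"
      unfolding c_def using i by (intro sum.cong refl) (simp add: U(2) sum_distrib_right)
    also have "\<dots> = (\<Sum>j<m. \<Sum>l<m. U g i j * U h j l * a l)" by (rule sum.swap)
    also have "\<dots> = (\<Sum>j<m. U g i j * c j h)" by (simp add: c_def sum_distrib_left mult.assoc)
    finally show "c i (g + h) = (\<Sum>j<m. U g i j * c j h)" .
  qed
  have c1: "\<forall>h. (\<Sum>i<m. cnj (c i h) * c i h) = 1"
  proof
    fix h
    define f where "f = (\<lambda>x. X (- h + x))"
    have f: "cont f" unfolding f_def by (rule continuous_translation(2)[OF Xc])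
    have fe: "f = (\<lambda>x. \<Sum>i<m. c i h * e i x)" by (simp add: f_def ce)
    have ci: "mean_inner f (e i) = c i h" if "i < m" for i
      unfolding fe by (rule mean_inner_combination[OF e(1) that])
    have "mean_proj m e f = f" by (rule mean_proj_combination[OF e(1) fe])
    then have "mean_square f = (\<Sum>i<m. (cmod (c i h))\<^sup>2)"
      using bessel_identity[OF e(1) f] ci by (simp add: mean_square_def)
    moreover have "mean_square f = 1"
    proof -
      have "cont (\<lambda>x. (\<xi> x)\<^sup>2)" by (intro continuous_intros \<xi>c)
      from group_mean_translate_left[OF this, of "- h"] show ?thesis
        using \<xi>(2) by (simp add: mean_square_def f_def X_def)
    qed
    ultimately have "of_real (\<Sum>i<m. (cmod (c i h))\<^sup>2) = (1::complex)" by simp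
    then show "(\<Sum>i<m. cnj (c i h) * c i h) = 1"
      by (simp add: complex_norm_square mult.commute del: of_real_power)
  qed
  have ce': "\<forall>h x. (\<Sum>i<m. c i h * e i x) = complex_of_real (\<xi> (- h + x))"
    unfolding ce by (simp add: X_def)
  have U': "\<forall>i<m. \<forall>j<m. \<forall>g h. U (g + h) i j = (\<Sum>l<m. U g i l * U h l j)"
    "\<forall>i<m. \<forall>j<m. \<forall>g. U (- g) i j = cnj (U g j i)"
    "\<forall>i<m. \<forall>j<m. U 0 i j = (if i = j then 1 else 0)"
    "\<forall>i<m. \<forall>j<m. cont (\<lambda>g. U g i j)"
    using U(2-5) by blast+
  show ?thesis by (rule that[OF e(1) inv' U' cc cU c1 ce' \<xi>c \<xi>(2,3)])
qed

end

text \<open>Contractivity is the only assertion with content: the square of \<open>norm x\<close>,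
  minus \<open>x* x\<close>, has the form \<open>y* y\<close>, and its image under \<open>f\<close>
  has the same form.\<close>

lemma star_automorphism_facts:
  fixes f :: "'b::unital_cstar_algebra \<Rightarrow> 'b"
  assumes f: "star_automorphism f"
  shows "f (x + y) = f x + f y" "f (scaleC a x) = scaleC a (f x)" "f (x * y) = f x * f y"
    "f (star x) = star (f x)" "f 1 = 1" "norm (f x) \<le> norm x" "bounded_linear f"
proof -
  show add: "f (x + y) = f x + f y" and sc: "f (scaleC a x) = scaleC a (f x)" and mult: "f (x * y) = f x * f y"
    and st: "f (star x) = star (f x)" for x y a
    using f by (simp_all add: star_automorphism_def)
  obtain z where z: "f z = 1" using f unfolding star_automorphism_def by (metis bij_pointE)
  show one: "f 1 = 1" using mult[of 1 z] z by simp
  have scR: "f (r *\<^sub>R x) = r *\<^sub>R f x" for r x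
    using sc[of "complex_of_real r" x] unfolding scaleC_of_real .
  have minus: "f (x - y) = f x - f y" for x y using add[of "x - y" y] by simp
  have norm: "norm (f x) \<le> norm x" for x
  proof -
    have "positive_elem (of_real ((norm x)\<^sup>2) - star x * x)"
      by (intro positive_elem_of_real_minus) (simp_all add: star_mult star_star cstar_identity)
    then obtain y where y: "of_real ((norm x)\<^sup>2) - star x * x = star y * y" by (auto simp: positive_elem_def)
    have "of_real ((norm x)\<^sup>2) - star (f x) * f x = star (f y) * f y"
    proof -
      have "f (of_real ((norm x)\<^sup>2)) = of_real ((norm x)\<^sup>2)"
        using scR[of "(norm x)\<^sup>2" 1] one unfolding of_real_def by simp
      then show ?thesis using arg_cong[OF y, of f] by (simp only: minus mult st)
    qed
    then have "norm (star (f x) * f x) \<le> (norm x)\<^sup>2"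
      by (intro positive_elem_norm_le) simp_all
    then have "(norm (f x))\<^sup>2 \<le> (norm x)\<^sup>2" by (simp only: cstar_identity)
    then show ?thesis by (rule power2_le_imp_le) simp
  qed
  then show "norm (f x) \<le> norm x" for x .
  show "bounded_linear f"
    by (rule bounded_linear_intro[where K = 1]) (use add scR norm in auto)
qed

section \<open>Matrices indexed by pairs\<close>

lemma mult_mat_entry:
  assumes "A \<in> carrier_mat n k" "B \<in> carrier_mat k m" "i < n" "j < m"
  shows "(A * B) $$ (i, j) = (\<Sum>l<k. A $$ (i, l) * B $$ (l, j))"
  using assms by (auto simp: scalar_prod_def lessThan_atLeast0 intro!: sum.cong)

lemma Ad_mat_entry:
  assumes U: "U \<in> carrier_mat n n" and A: "A \<in> carrier_mat n n" and ij: "i < n" "j < n"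
  shows "Ad_mat U A $$ (i, j) = (\<Sum>k<n. \<Sum>l<n. U $$ (i, k) * cnj (U $$ (j, l)) * A $$ (k, l))"
proof -
  have S: "mat_star U \<in> carrier_mat n n" using U by (simp add: mat_star_def)
  have UA: "U * A \<in> carrier_mat n n" using U A by simp
  have "Ad_mat U A $$ (i, j) = (\<Sum>l<n. (U * A) $$ (i, l) * mat_star U $$ (l, j))"
    unfolding Ad_mat_def by (rule mult_mat_entry[OF UA S ij])
  also have "\<dots> = (\<Sum>l<n. \<Sum>k<n. U $$ (i, k) * cnj (U $$ (j, l)) * A $$ (k, l))"
  proof (intro sum.cong refl)
    fix l assume "l \<in> {..<n}"
    then have l: "l < n" by simp
    have "(U * A) $$ (i, l) = (\<Sum>k<n. U $$ (i, k) * A $$ (k, l))"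
      by (rule mult_mat_entry[OF U A ij(1) l])
    moreover have "mat_star U $$ (l, j) = cnj (U $$ (j, l))"
      using U ij l by (auto simp: mat_star_def star_complex_def)
    ultimately show "(U * A) $$ (i, l) * mat_star U $$ (l, j) = (\<Sum>k<n. U $$ (i, k) * cnj (U $$ (j, l)) * A $$ (k, l))"
      by (simp add: sum_distrib_left sum_distrib_right mult_ac)
  qed
  also have "\<dots> = (\<Sum>k<n. \<Sum>l<n. U $$ (i, k) * cnj (U $$ (j, l)) * A $$ (k, l))" by (rule sum.swap)
  finally show ?thesis .
qed

text \<open>The matrix \<open>V \<otimes> 1\<close>, with the index pair \<open>(i, p)\<close> encoded as \<open>i N + p\<close>.\<close>

definition ampliation :: "nat \<Rightarrow> nat \<Rightarrow> (nat \<Rightarrow> nat \<Rightarrow> complex) \<Rightarrow> complex mat" where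
  "ampliation m N V = mat (m * N) (m * N)
     (\<lambda>(a, b). if a mod N = b mod N then V (a div N) (b div N) else 0)"

lemma ampliation_carrier [simp]: "ampliation m N V \<in> carrier_mat (m * N) (m * N)"
  by (simp add: ampliation_def)

lemma ampliation_entry:
  "i < m \<Longrightarrow> p < N \<Longrightarrow> j < m \<Longrightarrow> q < N \<Longrightarrow>
    ampliation m N V $$ (i * N + p, j * N + q) = (if p = q then V i j else 0)"
  by (simp add: ampliation_def index_less)

lemma mat_eq_block:
  assumes "A \<in> carrier_mat (m * N) (m * N)" "B \<in> carrier_mat (m * N) (m * N)"
    and eq: "\<And>i p j q. i < m \<Longrightarrow> p < N \<Longrightarrow> j < m \<Longrightarrow> q < N \<Longrightarrow>
      A $$ (i * N + p, j * N + q) = B $$ (i * N + p, j * N + q)"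
  shows "A = B"
proof (rule eq_matI)
  fix a b assume "a < dim_row B" "b < dim_col B"
  then have ab: "a < m * N" "b < m * N" using assms by auto
  then have N: "N > 0" by (cases N) auto
  have "a div N < m" "b div N < m" using ab by (auto simp: less_mult_imp_div_less)
  then show "A $$ (a, b) = B $$ (a, b)"
    using eq[of "a div N" "a mod N" "b div N" "b mod N"] N by simp
qed (use assms in auto)

lemma ampliation_mult:
  "ampliation m N V * ampliation m N W = ampliation m N (\<lambda>i j. \<Sum>k<m. V i k * W k j)"
proof (rule mat_eq_block)
  fix i p j q assume ip: "i < m" "p < N" "j < m" "q < N"
  have "(ampliation m N V * ampliation m N W) $$ (i * N + p, j * N + q) =
      (\<Sum>a<m * N. ampliation m N V $$ (i * N + p, a) * ampliation m N W $$ (a, j * N + q))"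
    using ip by (intro mult_mat_entry[OF ampliation_carrier ampliation_carrier] index_less)
  also have "\<dots> = (\<Sum>k<m. \<Sum>r<N. (if p = r then V i k else 0) * (if r = q then W k j else 0))"
    unfolding sum_mult_split using ip by (intro sum.cong refl) (simp add: ampliation_entry)
  also have "\<dots> = (\<Sum>k<m. if p = q then V i k * W k j else 0)"
  proof (intro sum.cong refl)
    fix k
    have "(\<Sum>r<N. (if p = r then V i k else 0) * (if r = q then W k j else 0)) =
        (\<Sum>r<N. if p = r then (if p = q then V i k * W k j else 0) else 0)"
      by (intro sum.cong refl) auto
    then show "(\<Sum>r<N. (if p = r then V i k else 0) * (if r = q then W k j else 0)) =
        (if p = q then V i k * W k j else 0)" using ip by simp
  qed
  also have "\<dots> = ampliation m N (\<lambda>i j. \<Sum>k<m. V i k * W k j) $$ (i * N + p, j * N + q)"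
    using ip by (simp add: ampliation_entry)
  finally show "(ampliation m N V * ampliation m N W) $$ (i * N + p, j * N + q) =
      ampliation m N (\<lambda>i j. \<Sum>k<m. V i k * W k j) $$ (i * N + p, j * N + q)" .
qed (rule mult_carrier_mat[OF ampliation_carrier ampliation_carrier], rule ampliation_carrier)

lemma ampliation_star: "mat_star (ampliation m N V) = ampliation m N (\<lambda>i j. cnj (V j i))"
  by (rule eq_matI) (auto simp: mat_star_def ampliation_def star_complex_def)

lemma ampliation_cong:
  "(\<And>i j. i < m \<Longrightarrow> j < m \<Longrightarrow> V i j = W i j) \<Longrightarrow> ampliation m N V = ampliation m N W"
  by (rule mat_eq_block[where m = m and N = N]) (auto simp: ampliation_entry)

lemma ampliation_one: "ampliation m N (\<lambda>i j. if i = j then 1 else 0) = 1\<^sub>m (m * N)"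
proof (rule mat_eq_block)
  fix i p j q assume ip: "i < m" "p < N" "j < m" "q < N"
  have "i * N + p = j * N + q \<longleftrightarrow> i = j \<and> p = q"
  proof
    assume eq: "i * N + p = j * N + q"
    have "(i * N + p) div N = i" "(j * N + q) div N = j" "(i * N + p) mod N = p" "(j * N + q) mod N = q"
      using ip by auto
    then show "i = j \<and> p = q" using eq by metis
  qed auto
  then show "ampliation m N (\<lambda>i j. if i = j then 1 else 0) $$ (i * N + p, j * N + q) = 1\<^sub>m (m * N) $$ (i * N + p, j * N + q)"
    using ip by (auto simp: ampliation_entry index_less)
qed auto

lemma Ad_ampliation_entry:
  assumes A: "A \<in> carrier_mat (m * N) (m * N)" and ip: "i < m" "p < N" "j < m" "q < N"
  shows "Ad_mat (ampliation m N V) A $$ (i * N + p, j * N + q) =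
    (\<Sum>k<m. \<Sum>l<m. V i k * cnj (V j l) * A $$ (k * N + p, l * N + q))"
proof -
  have "Ad_mat (ampliation m N V) A $$ (i * N + p, j * N + q) =
      (\<Sum>a<m * N. \<Sum>b<m * N. ampliation m N V $$ (i * N + p, a) * cnj (ampliation m N V $$ (j * N + q, b)) * A $$ (a, b))"
    by (rule Ad_mat_entry[OF ampliation_carrier A]) (use ip in \<open>auto intro: index_less\<close>)
  also have "\<dots> = (\<Sum>k<m. \<Sum>r<N. \<Sum>l<m. \<Sum>s<N.
      if p = r then if q = s then V i k * cnj (V j l) * A $$ (k * N + r, l * N + s) else 0 else 0)"
    unfolding sum_mult_split using ip by (intro sum.cong refl) (simp add: ampliation_entry)
  also have "\<dots> = (\<Sum>k<m. \<Sum>r<N. if p = r then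
      (\<Sum>l<m. V i k * cnj (V j l) * A $$ (k * N + p, l * N + q)) else 0)"
    using ip by (intro sum.cong refl) auto
  also have "\<dots> = (\<Sum>k<m. \<Sum>l<m. V i k * cnj (V j l) * A $$ (k * N + p, l * N + q))"
    using ip by simp
  finally show ?thesis .
qed

section \<open>The action and its continuity\<close>

locale compact_group_action = compact_group G for G :: "'g::{topological_group_add, t2_space} itself" +
  fixes \<beta> :: "'g \<Rightarrow> 'b \<Rightarrow> 'b::unital_cstar_algebra"
  assumes action: "cstar_action \<beta>"
begin

lemma automorphism: "star_automorphism (\<beta> g)"
  using action by (simp add: cstar_action_def)

lemmas action_simps = star_automorphism_facts(1-5)[OF automorphism]
lemmas action_norm_le = star_automorphism_facts(6)[OF automorphism]
lemmas action_bounded_linear = star_automorphism_facts(7)[OF automorphism]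

lemma action_add: "\<beta> (g + h) x = \<beta> g (\<beta> h x)"
  using action by (simp add: cstar_action_def)

lemma action_zero: "\<beta> 0 x = x"
proof -
  have "\<beta> 0 (\<beta> 0 x) = \<beta> 0 x" using action_add[of 0 0 x] by simp
  moreover have "inj (\<beta> 0)" using automorphism[of 0] by (simp add: star_automorphism_def bij_is_inj)
  ultimately show ?thesis by (simp add: inj_eq)
qed

lemma action_sum: "\<beta> g (sum f I) = (\<Sum>i\<in>I. \<beta> g (f i))"
  using linear_sum[OF bounded_linear.linear[OF action_bounded_linear]] .

lemma action_diff: "\<beta> g (x - y) = \<beta> g x - \<beta> g y"
  using linear_diff[OF bounded_linear.linear[OF action_bounded_linear]] .

text \<open>Point-norm continuity gives the limit at the fixed vector \<open>y t0\<close>, and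
  contractivity of all \<open>\<beta> g\<close> controls the replacement of \<open>y t\<close> by
  \<open>y t0\<close>.\<close>

lemma continuous_action:
  fixes p :: "'t::topological_space \<Rightarrow> 'g" and y :: "'t \<Rightarrow> 'b"
  assumes p: "continuous_on UNIV p" and y: "continuous_on UNIV y"
  shows "continuous_on UNIV (\<lambda>t. \<beta> (p t) (y t))"
  unfolding continuous_on_def
proof
  fix t0
  have c: "continuous_on UNIV (\<lambda>g. \<beta> g (y t0))" using action by (simp add: cstar_action_def)
  have "continuous_on UNIV (\<lambda>t. \<beta> (p t) (y t0))" by (rule continuous_on_compose2[OF c p]) simp
  then have 1: "((\<lambda>t. \<beta> (p t) (y t0)) \<longlongrightarrow> \<beta> (p t0) (y t0)) (at t0)"
    by (simp add: continuous_on_def)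
  have 2: "((\<lambda>t. norm (y t - y t0)) \<longlongrightarrow> 0) (at t0)"
    using y by (simp add: continuous_on_def LIM_zero tendsto_norm_zero)
  have "((\<lambda>t. \<beta> (p t) (y t) - \<beta> (p t) (y t0)) \<longlongrightarrow> 0) (at t0)"
    by (rule Lim_null_comparison[OF _ 2]) (simp add: action_diff[symmetric] action_norm_le)
  from tendsto_add[OF this 1] show "((\<lambda>t. \<beta> (p t) (y t)) \<longlongrightarrow> \<beta> (p t0) (y t0)) (at t0 within UNIV)" by simp
qed

lemma compact_orbits:
  assumes "finite F"
  shows "compact (\<Union>x\<in>F. range (\<lambda>g. \<beta> g x))"
proof (rule compact_UN[OF assms])
  fix x assume "x \<in> F"
  have "continuous_on UNIV (\<lambda>g. \<beta> g x)" using action by (simp add: cstar_action_def)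
  then show "compact (range (\<lambda>g. \<beta> g x))" by (rule compact_continuous_image[OF _ compact_UNIV])
qed

section \<open>The equivariant unital completely positive maps\<close>

lemma equivariant_approximation:
  assumes nuc: "nuclear TYPE('b)" and F: "finite F" and \<epsilon>: "\<epsilon> > 0"
  shows "\<exists>n \<phi> \<psi> u. ucp_to_mat n \<phi> \<and> ucp_from_mat n \<psi> \<and> unitary_rep_mat n u \<and>
    (\<forall>g. (\<forall>x. \<phi> (\<beta> g x) = Ad_mat (u g) (\<phi> x)) \<and>
         (\<forall>A \<in> carrier_mat n n. \<psi> (Ad_mat (u g) A) = \<beta> g (\<psi> A))) \<and>
    (\<forall>x \<in> F. norm (\<psi> (\<phi> x) - x) < \<epsilon>)"
proof -
  define K where "K = (\<Union>x\<in>F. range (\<lambda>g. \<beta> g x))"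
  have cK: "compact K" unfolding K_def by (rule compact_orbits[OF F])
  have e2: "\<epsilon> / 2 > 0" and e4: "\<epsilon> / 4 > 0" using \<epsilon> by simp_all
  obtain N \<Phi> P C where cp: "cp_pairing N \<Phi>" and \<Phi>1: "\<And>p q. p < N \<Longrightarrow> q < N \<Longrightarrow> \<Phi> (1::'b) p q = (if p = q then 1 else 0)"
    and P: "form_positive N P" and Ptr: "(\<Sum>p<N. P p p) = 1"
    and \<Phi>b: "\<And>x p q. p < N \<Longrightarrow> q < N \<Longrightarrow> cmod (\<Phi> x p q) \<le> C * norm x"
    and app: "\<And>x. x \<in> K \<Longrightarrow> norm (choi_map N P (\<Phi> x) - x) < \<epsilon> / 2"
    using nuclear_unital_approx[OF nuc cK e2] by blast
  have N: "N > 0" using Ptr by (cases N) auto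
  have bl\<Phi>: "bounded_linear (\<lambda>x. \<Phi> x p q)" if "p < N" "q < N" for p q
  proof (rule bounded_linear_intro[where K = C])
    show "\<Phi> (x + y) p q = \<Phi> x p q + \<Phi> y p q" for x y using cp by (simp add: cp_pairing_def)
    have "\<Phi> (scaleC (of_real r) x) p q = of_real r * \<Phi> x p q" for r x using cp by (simp add: cp_pairing_def)
    then show "\<Phi> (r *\<^sub>R x) p q = r *\<^sub>R \<Phi> x p q" for r x unfolding scaleC_of_real scaleR_conv_of_real .
    show "norm (\<Phi> x p q) \<le> norm x * C" for x using \<Phi>b[OF that, of x] by (simp add: mult.commute)
  qed
  define S where "S x = choi_map N P (\<Phi> x)" for x
  \<comment> \<open>Mean displacement of \<open>x\<close> by the conjugates of \<open>- k\<close>.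
    It is continuous in \<open>k\<close> and vanishes at \<open>k = 0\<close>, so it can serve as a
    weight for the concentration of \<open>\<xi>\<close>.\<close>
  define v where "v x k = group_mean (\<lambda>h. norm (\<beta> (h + - k + - h) x - x))" for x k
  define w where "w k = (\<Sum>x\<in>F. v x k)" for k
  have vj: "continuous_on UNIV (\<lambda>(k, h). norm (\<beta> (h + - k + - h) x - x))" for x
    unfolding case_prod_beta by (intro continuous_intros continuous_action)
  have vc: "cont (v x)" for x unfolding v_def by (rule continuous_group_mean[OF vj])
  have v0: "v x k \<ge> 0" for x k
    unfolding v_def by (intro group_mean_nonneg continuous_section(2)[OF vj]) simp
  have w: "cont w" "\<And>k. w k \<ge> 0" "w 0 = 0"
  proof -
    show "cont w" unfolding w_def by (intro continuous_on_sum vc)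
    show "w k \<ge> 0" for k unfolding w_def by (intro sum_nonneg v0)
    show "w 0 = 0" by (simp add: w_def v_def action_zero)
  qed
  obtain m e U c and \<xi> :: "'g \<Rightarrow> real" where
    e: "orthonormal m e"
    and eU: "\<forall>j<m. \<forall>g x. e j (g + x) = (\<Sum>i<m. cnj (U g j i) * e i x)"
    and U2: "\<forall>i<m. \<forall>j<m. \<forall>g h. U (g + h) i j = (\<Sum>l<m. U g i l * U h l j)"
    and U3: "\<forall>i<m. \<forall>j<m. \<forall>g. U (- g) i j = cnj (U g j i)"
    and U0: "\<forall>i<m. \<forall>j<m. U 0 i j = (if i = j then 1 else 0)"
    and Uc: "\<forall>i<m. \<forall>j<m. cont (\<lambda>g. U g i j)"
    and cc: "\<forall>i<m. cont (c i)"
    and cU: "\<forall>i<m. \<forall>g h. c i (g + h) = (\<Sum>j<m. U g i j * c j h)"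
    and c1: "\<forall>h. (\<Sum>i<m. cnj (c i h) * c i h) = 1"
    and ce: "\<forall>h x. (\<Sum>i<m. c i h * e i x) = complex_of_real (\<xi> (- h + x))"
    and \<xi>: "cont \<xi>" "group_mean (\<lambda>x. (\<xi> x)\<^sup>2) = 1" "group_mean (\<lambda>x. (\<xi> x)\<^sup>2 * w x) \<le> \<epsilon> / 4"
    by (rule concentrated_coefficients[OF w e4])
  have ec: "cont (e i)" if "i < m" for i using e that by (simp add: orthonormal_def)
  \<comment> \<open>An index \<open>a\<close> below \<open>n\<close> stands for the pair of
    \<open>a div N\<close>, the number of a basis function of \<open>E\<close>, and
    \<open>a mod N\<close>, an index of \<open>M_N\<close>.\<close>
  define n where "n = m * N"
  have ix: "i * N + p < n" if "i < m" "p < N" for i p unfolding n_def by (rule index_less[OF that])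
  have dm: "a div N < m" "a mod N < N" if "a < n" for a
    using that N by (auto simp: n_def less_mult_imp_div_less)
  define u where "u g = ampliation m N (U g)" for g
  define f where "f x a b h = cnj (e (a div N) h) * e (b div N) h * \<Phi> (\<beta> (- h) x) (a mod N) (b mod N)" for x a b h
  have fc: "cont (f x a b)" if "a < n" "b < n" for x a b
    unfolding f_def
    by (intro continuous_intros ec dm that bounded_linear.continuous_on[OF bl\<Phi>] continuous_action)
  define \<Theta> where "\<Theta> x a b = (if a < n \<and> b < n then group_mean (f x a b) else 0)" for x a b
  \<comment> \<open>Choi coefficients of the integrand of the second map: the slice at the unit
    vector with coordinates \<open>c i h\<close> weights the block \<open>(i, j)\<close> with
    \<open>cnj (c i h) * c j h\<close>.\<close>
  define r where "r h a b = scaleC (cnj (c (a div N) h) * c (b div N) h) (\<beta> h (P (a mod N) (b mod N)))" for h a b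
  have rc: "cont (\<lambda>h. r h a b)" if "a < n" "b < n" for a b
    unfolding r_def using cc dm[OF that(1)] dm[OF that(2)]
    by (intro continuous_intros continuous_action) auto
  define Q where "Q a b = group_mean (\<lambda>h. r h a b)" for a b

  have cp\<Theta>: "cp_pairing n \<Theta>"
  proof -
    have add: "\<Theta> (x + y) a b = \<Theta> x a b + \<Theta> y a b" for x y a b
    proof (cases "a < n \<and> b < n")
      case True
      have "f (x + y) a b h = f x a b h + f y a b h" for h
        using cp by (simp add: f_def action_simps cp_pairing_def distrib_left)
      then have "group_mean (f (x + y) a b) = group_mean (\<lambda>h. f x a b h + f y a b h)" by presburger
      also have "\<dots> = group_mean (f x a b) + group_mean (f y a b)" using True by (intro group_mean_add fc) auto
      finally show ?thesis using True by (simp add: \<Theta>_def)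
    next
      case False then show ?thesis by (auto simp: \<Theta>_def)
    qed
    have sc: "\<Theta> (scaleC z x) a b = z * \<Theta> x a b" for z x a b
    proof (cases "a < n \<and> b < n")
      case True
      have "f (scaleC z x) a b h = z * f x a b h" for h
        using cp by (simp add: f_def action_simps cp_pairing_def mult_ac)
      then have "group_mean (f (scaleC z x) a b) = group_mean (\<lambda>h. z * f x a b h)" by presburger
      also have "\<dots> = z * group_mean (f x a b)" using True by (intro group_mean_mult_left fc) auto
      finally show ?thesis using True by (simp add: \<Theta>_def)
    next
      case False then show ?thesis by (auto simp: \<Theta>_def)
    qed
    have pos: "positive_elem (\<Sum>a<n. \<Sum>b<n. \<Theta> (X a b) a b)"
      if X: "form_positive n X" for X :: "nat \<Rightarrow> nat \<Rightarrow> 'b"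
    proof -
    have "(\<Sum>a<n. \<Sum>b<n. \<Theta> (X a b) a b) = (\<Sum>a<n. \<Sum>b<n. group_mean (f (X a b) a b))"
      by (intro sum.cong refl) (simp add: \<Theta>_def)
    also have "\<dots> = (\<Sum>a<n. group_mean (\<lambda>h. \<Sum>b<n. f (X a b) a b h))"
      by (intro sum.cong refl group_mean_sum[symmetric] fc) auto
    also have "\<dots> = group_mean (\<lambda>h. \<Sum>a<n. \<Sum>b<n. f (X a b) a b h)"
      by (intro group_mean_sum[symmetric] continuous_on_sum fc) auto
    also have "positive_elem \<dots>"
    proof (rule group_mean_positive)
      show "cont (\<lambda>h. \<Sum>a<n. \<Sum>b<n. f (X a b) a b h)" by (intro continuous_on_sum fc) auto
      fix h
      obtain Z where Z: "\<And>a b. a < n \<Longrightarrow> b < n \<Longrightarrow> X a b = (\<Sum>l<n. star (Z l a) * Z l b)"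
        using form_positive_sqrt[OF X] by blast
      \<comment> \<open>Compression of the transported matrix by the scalars \<open>e i h\<close>.
        For fixed \<open>h\<close>, the integrand of the functional attached to
        \<open>\<Theta>\<close> is the functional attached to \<open>\<Phi>\<close>, evaluated at
        \<open>Y\<close>.\<close>
      define Y where "Y p q = (\<Sum>i<m. \<Sum>j<m. scaleC (cnj (e i h) * e j h) (\<beta> (- h) (X (i * N + p) (j * N + q))))" for p q
      have "form_positive N Y"
      proof (rule form_positive_gram[where m = n and Y = "\<lambda>l p. \<Sum>i<m. scaleC (e i h) (\<beta> (- h) (Z l (i * N + p)))"])
        fix p q assume pq: "p < N" "q < N"
        have "Y p q = (\<Sum>i<m. \<Sum>j<m. \<Sum>l<n. star (scaleC (e i h) (\<beta> (- h) (Z l (i * N + p)))) * scaleC (e j h) (\<beta> (- h) (Z l (j * N + q))))"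
          unfolding Y_def using pq
          by (intro sum.cong refl) (simp add: Z ix action_sum action_simps scaleC_sum_right star_scaleC
              scaleC_mult_left scaleC_mult_right scaleC_scaleC mult.commute)
        also have "\<dots> = (\<Sum>i<m. \<Sum>l<n. \<Sum>j<m. star (scaleC (e i h) (\<beta> (- h) (Z l (i * N + p)))) * scaleC (e j h) (\<beta> (- h) (Z l (j * N + q))))"
          by (intro sum.cong refl sum.swap)
        also have "\<dots> = (\<Sum>l<n. \<Sum>i<m. \<Sum>j<m. star (scaleC (e i h) (\<beta> (- h) (Z l (i * N + p)))) * scaleC (e j h) (\<beta> (- h) (Z l (j * N + q))))"
          by (rule sum.swap)
        finally show "Y p q = (\<Sum>l<n. star (\<Sum>i<m. scaleC (e i h) (\<beta> (- h) (Z l (i * N + p)))) * (\<Sum>i<m. scaleC (e i h) (\<beta> (- h) (Z l (i * N + q)))))"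
          by (simp only: star_sum sum_product)
      qed
      then have pos: "positive_elem (\<Sum>p<N. \<Sum>q<N. \<Phi> (Y p q) p q)"
        using cp unfolding cp_pairing_def by blast
      have "(\<Sum>a<n. \<Sum>b<n. f (X a b) a b h) = (\<Sum>i<m. \<Sum>p<N. \<Sum>j<m. \<Sum>q<N. cnj (e i h) * e j h * \<Phi> (\<beta> (- h) (X (i * N + p) (j * N + q))) p q)"
        unfolding n_def sum_mult_split by (intro sum.cong refl) (simp add: f_def)
      also have "\<dots> = (\<Sum>p<N. \<Sum>i<m. \<Sum>j<m. \<Sum>q<N. cnj (e i h) * e j h * \<Phi> (\<beta> (- h) (X (i * N + p) (j * N + q))) p q)"
        by (rule sum.swap)
      also have "\<dots> = (\<Sum>p<N. \<Sum>i<m. \<Sum>q<N. \<Sum>j<m. cnj (e i h) * e j h * \<Phi> (\<beta> (- h) (X (i * N + p) (j * N + q))) p q)"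
        by (intro sum.cong refl sum.swap)
      also have "\<dots> = (\<Sum>p<N. \<Sum>q<N. \<Sum>i<m. \<Sum>j<m. cnj (e i h) * e j h * \<Phi> (\<beta> (- h) (X (i * N + p) (j * N + q))) p q)"
        by (intro sum.cong refl sum.swap)
      also have "\<dots> = (\<Sum>p<N. \<Sum>q<N. \<Phi> (Y p q) p q)"
        using cp unfolding Y_def cp_pairing_sum[OF cp] cp_pairing_def by simp
      finally show "positive_elem (\<Sum>a<n. \<Sum>b<n. f (X a b) a b h)" using pos by (simp only:)
    qed
    finally show ?thesis .
    qed
    show ?thesis unfolding cp_pairing_def using add sc pos by blast
  qed

  have Q: "form_positive n Q"
    unfolding Q_def
  proof (rule form_positive_group_mean)
    show "cont (\<lambda>h. r h a b)" if "a < n" "b < n" for a b by (rule rc[OF that])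
    fix h
    obtain Z where Z: "\<And>p q. p < N \<Longrightarrow> q < N \<Longrightarrow> P p q = (\<Sum>l<N. star (Z l p) * Z l q)"
      using form_positive_sqrt[OF P] by blast
    show "form_positive n (r h)"
    proof (rule form_positive_gram[where m = N and Y = "\<lambda>l a. scaleC (c (a div N) h) (\<beta> h (Z l (a mod N)))"])
      fix a b assume "a < n" "b < n"
      then show "r h a b = (\<Sum>l<N. star (scaleC (c (a div N) h) (\<beta> h (Z l (a mod N)))) * scaleC (c (b div N) h) (\<beta> h (Z l (b mod N))))"
        using dm by (simp add: r_def Z action_sum action_simps scaleC_sum_right star_scaleC
            scaleC_mult_left scaleC_mult_right scaleC_scaleC mult.commute)
    qed
  qed

  define \<phi> where "\<phi> x = mat n n (\<lambda>(a, b). \<Theta> x a b)" for x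
  define \<psi> where "\<psi> A = (\<Sum>a<n. \<Sum>b<n. scaleC (A $$ (a, b)) (Q a b))" for A :: "complex mat"
  have \<phi>c: "\<phi> x \<in> carrier_mat n n" for x by (simp add: \<phi>_def)
  have \<phi>e: "\<phi> x $$ (i * N + p, j * N + q) = group_mean (\<lambda>h. cnj (e i h) * e j h * \<Phi> (\<beta> (- h) x) p q)"
    if "i < m" "p < N" "j < m" "q < N" for x i p j q
    using that by (simp add: \<phi>_def \<Theta>_def ix f_def[abs_def])
  have Qe: "Q (i * N + p) (j * N + q) = group_mean (\<lambda>h. scaleC (cnj (c i h) * c j h) (\<beta> h (P p q)))"
    if "p < N" "q < N" for i p j q
    using that by (simp add: Q_def r_def)
  have uc: "u g \<in> carrier_mat n n" for g by (simp add: u_def n_def)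

  have ucp1: "ucp_to_mat n \<phi>"
    unfolding ucp_to_mat_def
  proof
    show "cp_to_mat n \<phi>" unfolding \<phi>_def[abs_def] by (rule pairing_imp_cp_to_mat[OF cp\<Theta>])
    show "\<phi> 1 = 1\<^sub>m n"
      unfolding n_def ampliation_one[symmetric]
    proof (rule mat_eq_block)
      fix i p j q assume ip: "i < m" "p < N" "j < m" "q < N"
      have "\<phi> 1 $$ (i * N + p, j * N + q) = group_mean (\<lambda>h. e j h * cnj (e i h) * (if p = q then 1 else 0))"
        by (subst \<phi>e[OF ip]) (simp add: action_simps \<Phi>1[OF ip(2,4)] mult.commute[of "cnj _"])
      also have "\<dots> = (if p = q then mean_inner (e j) (e i) else 0)" by (simp add: mean_inner_def)
      also have "\<dots> = ampliation m N (\<lambda>i j. if i = j then 1 else 0) $$ (i * N + p, j * N + q)"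
        using e ip by (auto simp: ampliation_entry orthonormal_def)
      finally show "\<phi> 1 $$ (i * N + p, j * N + q) = ampliation m N (\<lambda>i j. if i = j then 1 else 0) $$ (i * N + p, j * N + q)" .
    qed (use \<phi>c in \<open>auto simp: n_def\<close>)
  qed

  have ucp2: "ucp_from_mat n \<psi>"
    unfolding ucp_from_mat_def
  proof
    show "cp_from_mat n \<psi>" unfolding \<psi>_def[abs_def] by (rule choi_imp_cp_from_mat[OF Q])
    have "\<psi> (1\<^sub>m n) = (\<Sum>a<n. \<Sum>b<n. if b = a then Q a b else 0)"
      unfolding \<psi>_def by (intro sum.cong refl) auto
    also have "\<dots> = (\<Sum>a<n. Q a a)" by simp
    also have "\<dots> = group_mean (\<lambda>h. \<Sum>a<n. r h a a)"
      unfolding Q_def by (rule group_mean_sum[symmetric]) (auto intro: rc)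
    also have "(\<lambda>h. \<Sum>a<n. r h a a) = (\<lambda>h. 1)"
    proof
      fix h
      have "(\<Sum>a<n. r h a a) = (\<Sum>i<m. \<Sum>p<N. scaleC (cnj (c i h) * c i h) (\<beta> h (P p p)))"
        unfolding n_def sum_mult_split by (intro sum.cong refl) (simp add: r_def)
      also have "\<dots> = scaleC (\<Sum>i<m. cnj (c i h) * c i h) (\<beta> h (\<Sum>p<N. P p p))"
        unfolding action_sum scaleC_sum_left scaleC_sum_right by (rule sum.swap)
      finally show "(\<Sum>a<n. r h a a) = 1" using c1 by (simp add: Ptr action_simps)
    qed
    finally show "\<psi> (1\<^sub>m n) = 1" by simp
  qed

  have rep: "unitary_rep_mat n u"
    unfolding unitary_rep_mat_def
  proof (intro conjI allI impI)
    fix g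
    have UU: "(\<Sum>k<m. cnj (U g k i) * U g k j) = (if i = j then 1 else 0)"
      "(\<Sum>k<m. U g i k * cnj (U g j k)) = (if i = j then 1 else 0)" if "i < m" "j < m" for i j
    proof -
      have "(\<Sum>k<m. cnj (U g k i) * U g k j) = (\<Sum>k<m. U (- g) i k * U g k j)" using U3 that by simp
      also have "\<dots> = U (- g + g) i j" by (simp only: U2[rule_format, OF that])
      finally show "(\<Sum>k<m. cnj (U g k i) * U g k j) = (if i = j then 1 else 0)" using U0 that by simp
      have "(\<Sum>k<m. U g i k * cnj (U g j k)) = (\<Sum>k<m. U g i k * U (- g) k j)" using U3 that by simp
      also have "\<dots> = U (g + - g) i j" by (simp only: U2[rule_format, OF that])
      finally show "(\<Sum>k<m. U g i k * cnj (U g j k)) = (if i = j then 1 else 0)" using U0 that by simp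
    qed
    show "u g \<in> carrier_mat n n" by (rule uc)
    show "mat_star (u g) * u g = 1\<^sub>m n"
      unfolding u_def ampliation_star ampliation_mult n_def ampliation_one[symmetric]
      by (rule ampliation_cong) (rule UU(1))
    show "u g * mat_star (u g) = 1\<^sub>m n"
      unfolding u_def ampliation_star ampliation_mult n_def ampliation_one[symmetric]
      by (rule ampliation_cong) (rule UU(2))
    show "u (g + h) = u g * u h" for h
      unfolding u_def ampliation_mult by (rule ampliation_cong) (use U2 in blast)
    show "continuous_on UNIV (\<lambda>g. u g $$ (a, b))" if "a < n" "b < n" for a b
    proof (cases "a mod N = b mod N")
      case True
      have "cont (\<lambda>g. U g (a div N) (b div N))" using Uc dm that by blast
      then show ?thesis using that True by (simp add: u_def ampliation_def n_def)
    next
      case False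
      then show ?thesis using that by (simp add: u_def ampliation_def n_def)
    qed
  qed

  have eq1: "\<phi> (\<beta> g x) = Ad_mat (u g) (\<phi> x)" for g x
  proof (rule mat_eq_block)
    fix i p j q assume ip: "i < m" "p < N" "j < m" "q < N"
    let ?F = "\<lambda>i j h. cnj (e i h) * e j h * \<Phi> (\<beta> (- h) x) p q"
    have Fc: "cont (?F i j)" if "i < m" "j < m" for i j
      by (intro continuous_intros ec that bounded_linear.continuous_on[OF bl\<Phi>] continuous_action ip)
    have Gc: "cont (\<lambda>h. cnj (e i h) * e j h * \<Phi> (\<beta> (- h) (\<beta> g x)) p q)"
      by (intro continuous_intros ec bounded_linear.continuous_on[OF bl\<Phi>] continuous_action ip)
    have "\<phi> (\<beta> g x) $$ (i * N + p, j * N + q) = group_mean (\<lambda>h. cnj (e i h) * e j h * \<Phi> (\<beta> (- h) (\<beta> g x)) p q)"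
      by (rule \<phi>e[OF ip])
    \<comment> \<open>Substituting \<open>g + h\<close> for \<open>h\<close> moves the action of
      \<open>g\<close> from \<open>x\<close> to the basis functions.\<close>
    also have "\<dots> = group_mean (\<lambda>h. cnj (e i (g + h)) * e j (g + h) * \<Phi> (\<beta> (- (g + h)) (\<beta> g x)) p q)"
      by (rule group_mean_translate_left[OF Gc, symmetric])
    also have "\<dots> = group_mean (\<lambda>h. \<Sum>k<m. \<Sum>l<m. U g i k * cnj (U g j l) * ?F k l h)"
    proof -
      have "\<beta> (- (g + h)) (\<beta> g x) = \<beta> (- h) x" for h
      proof -
        have "- (g + h) + g = - h" by (metis add.assoc add.right_neutral left_minus minus_add)
        then show ?thesis by (simp only: action_add[symmetric])
      qed
      moreover have "cnj (e i (g + h)) * e j (g + h) = (\<Sum>k<m. \<Sum>l<m. U g i k * cnj (U g j l) * (cnj (e k h) * e l h))" for h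
      proof -
        have 1: "e j (g + h) = (\<Sum>l<m. cnj (U g j l) * e l h)" using eU ip by blast
        have 2: "e i (g + h) = (\<Sum>k<m. cnj (U g i k) * e k h)" using eU ip by blast
        show ?thesis unfolding 1 2 cnj_sum sum_product by (intro sum.cong refl) (simp add: mult_ac)
      qed
      ultimately show ?thesis by (simp add: sum_distrib_right mult.assoc)
    qed
    also have "\<dots> = (\<Sum>k<m. group_mean (\<lambda>h. \<Sum>l<m. U g i k * cnj (U g j l) * ?F k l h))"
      by (intro group_mean_sum continuous_on_sum continuous_on_mult_left Fc) auto
    also have "\<dots> = (\<Sum>k<m. \<Sum>l<m. group_mean (\<lambda>h. U g i k * cnj (U g j l) * ?F k l h))"
      by (intro sum.cong refl group_mean_sum continuous_on_mult_left Fc) auto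
    also have "\<dots> = (\<Sum>k<m. \<Sum>l<m. U g i k * cnj (U g j l) * \<phi> x $$ (k * N + p, l * N + q))"
    proof (intro sum.cong refl)
      fix k l assume kl: "k \<in> {..<m}" "l \<in> {..<m}"
      then have "group_mean (\<lambda>h. U g i k * cnj (U g j l) * ?F k l h) = U g i k * cnj (U g j l) * group_mean (?F k l)"
        by (intro group_mean_mult_left Fc) auto
      then show "group_mean (\<lambda>h. U g i k * cnj (U g j l) * ?F k l h) = U g i k * cnj (U g j l) * \<phi> x $$ (k * N + p, l * N + q)"
        using kl ip by (simp add: \<phi>e)
    qed
    also have "\<dots> = Ad_mat (u g) (\<phi> x) $$ (i * N + p, j * N + q)"
      unfolding u_def using \<phi>c by (intro Ad_ampliation_entry[symmetric] ip) (simp add: n_def)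
    finally show "\<phi> (\<beta> g x) $$ (i * N + p, j * N + q) = Ad_mat (u g) (\<phi> x) $$ (i * N + p, j * N + q)" .
  next
    show "\<phi> (\<beta> g x) \<in> carrier_mat (m * N) (m * N)" using \<phi>c by (simp add: n_def)
    have "dim_row (u g) = m * N" using uc[of g] by (simp add: n_def)
    then show "Ad_mat (u g) (\<phi> x) \<in> carrier_mat (m * N) (m * N)"
      by (auto simp: Ad_mat_def mat_star_def)
  qed

  \<comment> \<open>Equivariance on the level of Choi matrices: conjugation by \<open>u g\<close>
    translates the coordinates \<open>c\<close> by \<open>- g\<close>, and substituting
    \<open>g + h\<close> for \<open>h\<close> turns this into \<open>\<beta> g\<close>.\<close>
  have eqQ: "(\<Sum>i<m. \<Sum>j<m. scaleC (U g i k * cnj (U g j l)) (Q (i * N + p) (j * N + q))) = \<beta> g (Q (k * N + p) (l * N + q))"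
    if kl: "k < m" "l < m" "p < N" "q < N" for g k l p q
  proof -
    let ?R = "\<lambda>i j h. scaleC (cnj (c i h) * c j h) (\<beta> h (P p q))"
    have Rc: "cont (?R i j)" if "i < m" "j < m" for i j
      using cc that by (intro continuous_intros continuous_action) auto
    have ck: "c k (- g + h) = (\<Sum>i<m. cnj (U g i k) * c i h)" if "k < m" for k h
      using cU U3 that by simp
    have "(\<Sum>i<m. \<Sum>j<m. scaleC (U g i k * cnj (U g j l)) (Q (i * N + p) (j * N + q))) =
        (\<Sum>i<m. \<Sum>j<m. group_mean (\<lambda>h. scaleC (U g i k * cnj (U g j l)) (?R i j h)))"
      by (intro sum.cong refl) (simp add: Qe kl group_mean_scaleC_right Rc)
    also have "\<dots> = (\<Sum>i<m. group_mean (\<lambda>h. \<Sum>j<m. scaleC (U g i k * cnj (U g j l)) (?R i j h)))"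
      by (intro sum.cong refl group_mean_sum[symmetric] continuous_on_scaleC continuous_on_const Rc) auto
    also have "\<dots> = group_mean (\<lambda>h. \<Sum>i<m. \<Sum>j<m. scaleC (U g i k * cnj (U g j l)) (?R i j h))"
      by (intro group_mean_sum[symmetric] continuous_on_sum continuous_on_scaleC continuous_on_const Rc) auto
    also have "(\<lambda>h. \<Sum>i<m. \<Sum>j<m. scaleC (U g i k * cnj (U g j l)) (?R i j h)) =
        (\<lambda>h. scaleC (cnj (c k (- g + h)) * c l (- g + h)) (\<beta> h (P p q)))"
    proof
      fix h
      have "cnj (c k (- g + h)) * c l (- g + h) = (\<Sum>i<m. \<Sum>j<m. (U g i k * cnj (U g j l)) * (cnj (c i h) * c j h))"
        unfolding ck[OF kl(1)] ck[OF kl(2)] cnj_sum sum_product by (intro sum.cong refl) (simp add: mult_ac)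
      then show "(\<Sum>i<m. \<Sum>j<m. scaleC (U g i k * cnj (U g j l)) (?R i j h)) =
          scaleC (cnj (c k (- g + h)) * c l (- g + h)) (\<beta> h (P p q))"
        by (simp add: scaleC_sum_left scaleC_scaleC)
    qed
    also have "group_mean \<dots> = group_mean (\<lambda>h. scaleC (cnj (c k (- g + (g + h))) * c l (- g + (g + h))) (\<beta> (g + h) (P p q)))"
    proof (rule group_mean_translate_left[symmetric])
      have "cont (\<lambda>h. c k (- g + h))" "cont (\<lambda>h. c l (- g + h))"
        using cc kl by (auto intro: continuous_translation(2))
      then show "cont (\<lambda>h. scaleC (cnj (c k (- g + h)) * c l (- g + h)) (\<beta> h (P p q)))"
        by (intro continuous_intros continuous_action)
    qed
    also have "\<dots> = group_mean (\<lambda>h. \<beta> g (?R k l h))"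
      by (simp add: action_add action_simps)
    also have "\<dots> = \<beta> g (Q (k * N + p) (l * N + q))"
      unfolding Qe[OF kl(3,4)] by (rule group_mean_bounded_linear[OF action_bounded_linear Rc[OF kl(1,2)]])
    finally show ?thesis .
  qed

  have eq2: "\<psi> (Ad_mat (u g) A) = \<beta> g (\<psi> A)" if A: "A \<in> carrier_mat n n" for g A
  proof -
    let ?t = "\<lambda>i j k l p q. scaleC (A $$ (k * N + p, l * N + q)) (scaleC (U g i k * cnj (U g j l)) (Q (i * N + p) (j * N + q)))"
    have "\<psi> (Ad_mat (u g) A) = (\<Sum>i<m. \<Sum>p<N. \<Sum>j<m. \<Sum>q<N. scaleC (Ad_mat (u g) A $$ (i * N + p, j * N + q)) (Q (i * N + p) (j * N + q)))"
      by (simp only: \<psi>_def n_def sum_mult_split)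
    also have "\<dots> = (\<Sum>i<m. \<Sum>p<N. \<Sum>j<m. \<Sum>q<N. \<Sum>k<m. \<Sum>l<m. ?t i j k l p q)"
      using A by (intro sum.cong refl) (simp add: u_def n_def Ad_ampliation_entry scaleC_sum_left scaleC_scaleC mult_ac)
    \<comment> \<open>The sums over \<open>i\<close> and \<open>j\<close> are moved innermost, where
      \<open>eqQ\<close> evaluates them for fixed \<open>k\<close>, \<open>l\<close>,
      \<open>p\<close>, \<open>q\<close>.\<close>
    also have "\<dots> = (\<Sum>p<N. \<Sum>i<m. \<Sum>j<m. \<Sum>q<N. \<Sum>k<m. \<Sum>l<m. ?t i j k l p q)" by (rule sum.swap)
    also have "\<dots> = (\<Sum>p<N. \<Sum>i<m. \<Sum>q<N. \<Sum>j<m. \<Sum>k<m. \<Sum>l<m. ?t i j k l p q)" by (intro sum.cong refl sum.swap)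
    also have "\<dots> = (\<Sum>p<N. \<Sum>q<N. \<Sum>i<m. \<Sum>j<m. \<Sum>k<m. \<Sum>l<m. ?t i j k l p q)" by (intro sum.cong refl sum.swap)
    also have "\<dots> = (\<Sum>p<N. \<Sum>q<N. \<Sum>i<m. \<Sum>k<m. \<Sum>j<m. \<Sum>l<m. ?t i j k l p q)" by (intro sum.cong refl sum.swap)
    also have "\<dots> = (\<Sum>p<N. \<Sum>q<N. \<Sum>k<m. \<Sum>i<m. \<Sum>j<m. \<Sum>l<m. ?t i j k l p q)" by (intro sum.cong refl sum.swap)
    also have "\<dots> = (\<Sum>p<N. \<Sum>q<N. \<Sum>k<m. \<Sum>i<m. \<Sum>l<m. \<Sum>j<m. ?t i j k l p q)" by (intro sum.cong refl sum.swap)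
    also have "\<dots> = (\<Sum>p<N. \<Sum>q<N. \<Sum>k<m. \<Sum>l<m. \<Sum>i<m. \<Sum>j<m. ?t i j k l p q)" by (intro sum.cong refl sum.swap)
    also have "\<dots> = (\<Sum>p<N. \<Sum>q<N. \<Sum>k<m. \<Sum>l<m. scaleC (A $$ (k * N + p, l * N + q)) (\<beta> g (Q (k * N + p) (l * N + q))))"
      by (intro sum.cong refl) (simp add: scaleC_sum_right[symmetric] eqQ)
    also have "\<dots> = (\<Sum>p<N. \<Sum>k<m. \<Sum>q<N. \<Sum>l<m. scaleC (A $$ (k * N + p, l * N + q)) (\<beta> g (Q (k * N + p) (l * N + q))))"
      by (intro sum.cong refl sum.swap)
    also have "\<dots> = (\<Sum>k<m. \<Sum>p<N. \<Sum>q<N. \<Sum>l<m. scaleC (A $$ (k * N + p, l * N + q)) (\<beta> g (Q (k * N + p) (l * N + q))))"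
      by (rule sum.swap)
    also have "\<dots> = (\<Sum>k<m. \<Sum>p<N. \<Sum>l<m. \<Sum>q<N. scaleC (A $$ (k * N + p, l * N + q)) (\<beta> g (Q (k * N + p) (l * N + q))))"
      by (intro sum.cong refl sum.swap)
    also have "\<dots> = \<beta> g (\<psi> A)"
      by (simp only: \<psi>_def n_def sum_mult_split action_sum action_simps)
    finally show ?thesis .
  qed

  have Sc: "bounded_linear S"
    unfolding S_def choi_map_def
    by (intro bounded_linear_sum bounded_linear_compose[OF bounded_linear_scaleC_left bl\<Phi>]) auto
  \<comment> \<open>The coordinates \<open>c i h\<close> and the values \<open>e i k\<close> pair to
    \<open>\<xi> (- h + k)\<close> by \<open>ce\<close>, whose square is the weight in the double
    mean. Substituting \<open>h + k\<close> for \<open>k\<close> frees the weight from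
    \<open>h\<close>.\<close>
  have comp: "\<psi> (\<phi> x) = group_mean (\<lambda>h. group_mean (\<lambda>k. (\<xi> k)\<^sup>2 *\<^sub>R \<beta> h (S (\<beta> (- (h + k)) x))))" for x
  proof -
    let ?G = "\<lambda>a b k h. scaleC (f x a b k) (r h a b)"
    have Gc: "continuous_on UNIV (\<lambda>(k, h). ?G a b k h)" if "a < n" "b < n" for a b
      unfolding case_prod_beta
      by (intro continuous_on_scaleC cont_compose2[OF fc[OF that]] cont_compose2[OF rc[OF that]] continuous_intros)
    have "\<psi> (\<phi> x) = (\<Sum>a<n. \<Sum>b<n. scaleC (group_mean (f x a b)) (Q a b))"
      unfolding \<psi>_def by (intro sum.cong refl) (simp add: \<phi>_def \<Theta>_def)
    also have "\<dots> = (\<Sum>a<n. \<Sum>b<n. group_mean (\<lambda>k. group_mean (\<lambda>h. ?G a b k h)))"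
    proof (intro sum.cong refl)
      fix a b assume "a \<in> {..<n}" "b \<in> {..<n}"
      then have ab: "a < n" "b < n" by auto
      have "scaleC (group_mean (f x a b)) (Q a b) = group_mean (\<lambda>k. scaleC (f x a b k) (Q a b))"
        by (rule group_mean_scaleC_left[OF fc[OF ab], symmetric])
      also have "\<dots> = group_mean (\<lambda>k. group_mean (\<lambda>h. ?G a b k h))"
        unfolding Q_def by (simp add: group_mean_scaleC_right[OF rc[OF ab]])
      finally show "scaleC (group_mean (f x a b)) (Q a b) = group_mean (\<lambda>k. group_mean (\<lambda>h. ?G a b k h))" .
    qed
    also have "\<dots> = (\<Sum>a<n. group_mean (\<lambda>k. \<Sum>b<n. group_mean (\<lambda>h. ?G a b k h)))"
      by (intro sum.cong refl group_mean_sum[symmetric] continuous_group_mean Gc) auto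
    also have "\<dots> = group_mean (\<lambda>k. \<Sum>a<n. \<Sum>b<n. group_mean (\<lambda>h. ?G a b k h))"
      by (intro group_mean_sum[symmetric] continuous_on_sum continuous_group_mean Gc) auto
    also have "\<dots> = group_mean (\<lambda>k. group_mean (\<lambda>h. \<Sum>a<n. \<Sum>b<n. ?G a b k h))"
    proof -
      have s: "cont (\<lambda>h. ?G a b k h)" if "a < n" "b < n" for a b k
        by (rule continuous_section(2)[OF Gc[OF that]])
      have "(\<Sum>a<n. \<Sum>b<n. group_mean (\<lambda>h. ?G a b k h)) = (\<Sum>a<n. group_mean (\<lambda>h. \<Sum>b<n. ?G a b k h))" for k
        by (intro sum.cong refl group_mean_sum[symmetric] s) auto
      moreover have "(\<Sum>a<n. group_mean (\<lambda>h. \<Sum>b<n. ?G a b k h)) = group_mean (\<lambda>h. \<Sum>a<n. \<Sum>b<n. ?G a b k h)" for k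
        by (intro group_mean_sum[symmetric] continuous_on_sum s) auto
      ultimately show ?thesis by simp
    qed
    also have "(\<lambda>k. group_mean (\<lambda>h. \<Sum>a<n. \<Sum>b<n. ?G a b k h)) = (\<lambda>k. group_mean (\<lambda>h. (\<xi> (- h + k))\<^sup>2 *\<^sub>R \<beta> h (S (\<beta> (- k) x))))"
    proof -
      have "(\<Sum>a<n. \<Sum>b<n. ?G a b k h) = (\<xi> (- h + k))\<^sup>2 *\<^sub>R \<beta> h (S (\<beta> (- k) x))" for k h
      proof -
        have "(\<Sum>a<n. \<Sum>b<n. ?G a b k h) = (\<Sum>i<m. \<Sum>p<N. \<Sum>j<m. \<Sum>q<N.
            scaleC (cnj (c i h * e i k) * (c j h * e j k)) (scaleC (\<Phi> (\<beta> (- k) x) p q) (\<beta> h (P p q))))"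
          unfolding n_def sum_mult_split by (intro sum.cong refl) (simp add: f_def r_def scaleC_scaleC mult_ac)
        also have "\<dots> = (\<Sum>i<m. \<Sum>j<m. \<Sum>p<N. \<Sum>q<N.
            scaleC (cnj (c i h * e i k) * (c j h * e j k)) (scaleC (\<Phi> (\<beta> (- k) x) p q) (\<beta> h (P p q))))"
          by (intro sum.cong refl sum.swap)
        also have "\<dots> = (\<Sum>i<m. \<Sum>j<m. scaleC (cnj (c i h * e i k) * (c j h * e j k)) (\<beta> h (S (\<beta> (- k) x))))"
          by (simp only: S_def choi_map_def action_sum action_simps scaleC_sum_right)
        also have "\<dots> = scaleC (cnj (\<Sum>i<m. c i h * e i k) * (\<Sum>j<m. c j h * e j k)) (\<beta> h (S (\<beta> (- k) x)))"
          by (simp only: cnj_sum sum_product scaleC_sum_left)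
        also have "cnj (\<Sum>i<m. c i h * e i k) * (\<Sum>j<m. c j h * e j k) = complex_of_real ((\<xi> (- h + k))\<^sup>2)"
          using ce by (simp add: power2_eq_square)
        finally show ?thesis unfolding scaleC_of_real .
      qed
      then show ?thesis by simp
    qed
    also have "group_mean \<dots> = group_mean (\<lambda>h. group_mean (\<lambda>k. (\<xi> (- h + k))\<^sup>2 *\<^sub>R \<beta> h (S (\<beta> (- k) x))))"
    proof (rule group_mean_swap)
      show "continuous_on UNIV (\<lambda>(k, h). (\<xi> (- h + k))\<^sup>2 *\<^sub>R \<beta> h (S (\<beta> (- k) x)))"
        unfolding case_prod_beta
        by (intro continuous_intros cont_compose2[OF \<xi>(1)] continuous_action bounded_linear.continuous_on[OF Sc])
    qed
    also have "\<dots> = group_mean (\<lambda>h. group_mean (\<lambda>k. (\<xi> k)\<^sup>2 *\<^sub>R \<beta> h (S (\<beta> (- (h + k)) x))))"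
    proof -
      have "group_mean (\<lambda>k. (\<xi> (- h + k))\<^sup>2 *\<^sub>R \<beta> h (S (\<beta> (- k) x))) =
          group_mean (\<lambda>k. (\<xi> (- h + (h + k)))\<^sup>2 *\<^sub>R \<beta> h (S (\<beta> (- (h + k)) x)))" for h
        by (rule group_mean_translate_left[symmetric])
          (intro continuous_intros cont_compose2[OF \<xi>(1)] continuous_action bounded_linear.continuous_on[OF Sc])
      then show ?thesis by simp
    qed
    finally show ?thesis .
  qed

  have "norm (\<psi> (\<phi> x) - x) < \<epsilon>" if x: "x \<in> F" for x
  proof -
    let ?T = "\<lambda>h k. (\<xi> k)\<^sup>2 *\<^sub>R \<beta> h (S (\<beta> (- (h + k)) x))"
    \<comment> \<open>Majorant of the error under the means: \<open>\<epsilon> / 2\<close> for the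
      approximation by \<open>S\<close> on the orbit of \<open>x\<close>, the rest for the
      displacement.\<close>
    let ?v = "\<lambda>h k. (\<xi> k)\<^sup>2 * (\<epsilon> / 2 + norm (\<beta> (h + - k + - h) x - x))"
    have Tj: "continuous_on UNIV (\<lambda>(h, k). ?T h k)"
      unfolding case_prod_beta
      by (intro continuous_intros cont_compose2[OF \<xi>(1)] continuous_action bounded_linear.continuous_on[OF Sc])
    have Dj: "continuous_on UNIV (\<lambda>(h, k). ?T h k - (\<xi> k)\<^sup>2 *\<^sub>R x)"
      unfolding case_prod_beta
      by (intro continuous_intros cont_compose2[OF \<xi>(1)] continuous_action bounded_linear.continuous_on[OF Sc])
    have Vj: "continuous_on UNIV (\<lambda>(h, k). ?v h k)"
      unfolding case_prod_beta by (intro continuous_intros cont_compose2[OF \<xi>(1)] continuous_action)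
    have \<xi>2: "cont (\<lambda>k. (\<xi> k)\<^sup>2)" by (intro continuous_intros \<xi>)
    have \<xi>x: "group_mean (\<lambda>k. (\<xi> k)\<^sup>2 *\<^sub>R x) = x"
      using group_mean_bounded_linear[OF bounded_linear_scaleR_left \<xi>2, of x] \<xi>(2) by simp
    have "\<psi> (\<phi> x) - x = group_mean (\<lambda>h. group_mean (\<lambda>k. ?T h k - (\<xi> k)\<^sup>2 *\<^sub>R x))"
    proof -
      have "group_mean (\<lambda>k. ?T h k - (\<xi> k)\<^sup>2 *\<^sub>R x) = group_mean (\<lambda>k. ?T h k) - x" for h
        by (subst group_mean_diff) (auto simp: \<xi>x intro!: continuous_section(2)[OF Tj] continuous_intros \<xi>)
      moreover have "group_mean (\<lambda>h. group_mean (\<lambda>k. ?T h k) - x) = group_mean (\<lambda>h. group_mean (\<lambda>k. ?T h k)) - x"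
        by (subst group_mean_diff) (auto intro!: continuous_group_mean[OF Tj])
      ultimately show ?thesis by (simp add: comp)
    qed
    also have "norm \<dots> \<le> group_mean (\<lambda>h. group_mean (\<lambda>k. ?v h k))"
    proof (rule group_mean_norm_le_mean[OF continuous_group_mean[OF Dj] continuous_group_mean[OF Vj]])
      fix h
      show "norm (group_mean (\<lambda>k. ?T h k - (\<xi> k)\<^sup>2 *\<^sub>R x)) \<le> group_mean (\<lambda>k. ?v h k)"
      proof (rule group_mean_norm_le_mean[OF continuous_section(2)[OF Dj] continuous_section(2)[OF Vj]])
        fix k
        let ?y = "\<beta> (- (h + k)) x"
        have "?y \<in> K" using x by (auto simp: K_def)
        then have 1: "norm (S ?y - ?y) \<le> \<epsilon> / 2" using app[of ?y] by (simp add: S_def)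
        have "h + - k + - h = h + - (h + k)" by (simp only: minus_add add.assoc)
        then have yb: "\<beta> h ?y = \<beta> (h + - k + - h) x" by (simp only: action_add)
        have "norm (\<beta> h (S ?y) - x) \<le> norm (\<beta> h (S ?y - ?y)) + norm (\<beta> (h + - k + - h) x - x)"
          using norm_triangle_ineq[of "\<beta> h (S ?y - ?y)" "\<beta> h ?y - x"] by (simp add: action_diff yb)
        also have "\<dots> \<le> \<epsilon> / 2 + norm (\<beta> (h + - k + - h) x - x)"
          using action_norm_le[of h "S ?y - ?y"] 1 by linarith
        finally have "(\<xi> k)\<^sup>2 * norm (\<beta> h (S ?y) - x) \<le> ?v h k" by (intro mult_left_mono) auto
        then show "norm (?T h k - (\<xi> k)\<^sup>2 *\<^sub>R x) \<le> ?v h k" by (simp flip: scaleR_diff_right)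
      qed
    qed
    \<comment> \<open>After the interchange the mean over \<open>h\<close> acts on the displacement
      alone and produces \<open>v x k\<close>.\<close>
    also have "\<dots> = group_mean (\<lambda>k. group_mean (\<lambda>h. ?v h k))" by (rule group_mean_swap[OF Vj])
    also have "\<dots> = group_mean (\<lambda>k. (\<xi> k)\<^sup>2 * (\<epsilon> / 2) + (\<xi> k)\<^sup>2 * v x k)"
    proof -
      have "group_mean (\<lambda>h. ?v h k) = (\<xi> k)\<^sup>2 * (\<epsilon> / 2 + v x k)" for k
      proof -
        have c: "cont (\<lambda>h. norm (\<beta> (h + - k + - h) x - x))" by (rule continuous_section(2)[OF vj])
        have c': "cont (\<lambda>h. \<epsilon> / 2 + norm (\<beta> (h + - k + - h) x - x))" by (intro continuous_intros c)
        show ?thesis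
          using group_mean_scaleR[OF c', of "(\<xi> k)\<^sup>2"] group_mean_add[OF continuous_on_const c, of "\<epsilon> / 2"]
          by (simp add: v_def)
      qed
      then show ?thesis by (simp add: distrib_left)
    qed
    also have "\<dots> \<le> group_mean (\<lambda>k. (\<epsilon> / 2) *\<^sub>R (\<xi> k)\<^sup>2 + (\<xi> k)\<^sup>2 * w k)"
    proof (rule group_mean_mono)
      fix k
      \<comment> \<open>Since \<open>w\<close> sums over \<open>F\<close>, one \<open>\<xi>\<close>
        serves all elements of \<open>F\<close>.\<close>
      have "v x k \<le> w k" unfolding w_def by (rule member_le_sum) (use x F v0 in auto)
      then show "(\<xi> k)\<^sup>2 * (\<epsilon> / 2) + (\<xi> k)\<^sup>2 * v x k \<le> (\<epsilon> / 2) *\<^sub>R (\<xi> k)\<^sup>2 + (\<xi> k)\<^sup>2 * w k"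
        using mult_left_mono[of "v x k" "w k" "(\<xi> k)\<^sup>2"] by (simp add: mult.commute)
    qed (intro continuous_intros \<xi> vc w)+
    also have "\<dots> = \<epsilon> / 2 + group_mean (\<lambda>k. (\<xi> k)\<^sup>2 * w k)"
    proof -
      have c1: "cont (\<lambda>k. (\<epsilon> / 2) *\<^sub>R (\<xi> k)\<^sup>2)" and c2: "cont (\<lambda>k. (\<xi> k)\<^sup>2 * w k)"
        by (intro continuous_intros \<xi> w)+
      show ?thesis unfolding group_mean_add[OF c1 c2] group_mean_scaleR[OF \<xi>2] \<xi>(2) by simp
    qed
    also have "\<dots> < \<epsilon>" using \<xi>(3) \<epsilon> by linarith
    finally show ?thesis .
  qed
  then show ?thesis using ucp1 ucp2 rep eq1 eq2 by blast
qed

end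

theorem lemma5p5:
  fixes \<beta> :: "'g::{topological_group_add, t2_space, second_countable_topology} \<Rightarrow>
               'b \<Rightarrow> 'b::unital_cstar_algebra"
    and F :: "'b set" and \<epsilon> :: real
  assumes "compact (UNIV :: 'g set)"
    and "nuclear TYPE('b)"
    and "cstar_action \<beta>"
    and "finite F" and "\<epsilon> > 0"
  shows "\<exists>(n::nat) (\<phi> :: 'b \<Rightarrow> complex mat) (\<phi>' :: complex mat \<Rightarrow> 'b) (u :: 'g \<Rightarrow> complex mat).
           ucp_to_mat n \<phi> \<and> ucp_from_mat n \<phi>' \<and> unitary_rep_mat n u \<and>
           (\<forall>g. (\<forall>x. \<phi> (\<beta> g x) = Ad_mat (u g) (\<phi> x)) \<and>
                (\<forall>A \<in> carrier_mat n n. \<phi>' (Ad_mat (u g) A) = \<beta> g (\<phi>' A))) \<and>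
           (\<forall>x \<in> F. norm (\<phi>' (\<phi> x) - x) < \<epsilon>)"
proof -
  interpret compact_group_action "TYPE('g)" \<beta>
    by unfold_locales (rule assms(1), rule assms(3))
  show ?thesis by (rule equivariant_approximation[OF assms(2,4,5)])
qed

end
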